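(* Let $a>0$, $B_a=\{x\in\mathbb{R}^3:|x|<a\}$, and for real $\alpha$ let $\psi_\alpha(x)=\delta(x)^{-\alpha}$, $x\in B_a$, where $\delta(x)=a-|x|$ is the distance to $\partial B_a$. Let $Q_{\psi_\alpha,\psi_\beta}(t)=\iint_{B_a\times B_a}p(x,y;t)\psi_\alpha(x)\psi_\beta(y)\,dx\,dy$, where $p$ is the Dirichlet heat kernel of $B_a$. If $\alpha<2$, $\beta<2$, $\alpha+\beta>3$ and $J\in\mathbb{N}$, then there exist coefficients $b_0,b_1,\ldots$ depending on $\alpha$ and $\beta$ only such that for $t\to0^+$ $$\begin{aligned}Q_{\psi_\alpha,\psi_\beta}(t)=\;&4\pi c_{\alpha,\beta}\,a^2t^{(1-\alpha-\beta)/2}-4\pi\left(c_{\alpha-1,\beta}+c_{\alpha,\beta-1}\right)a\,t^{(2-\alpha-\beta)/2}\\&+4\pi c_{\alpha-1,\beta-1}\,t^{(3-\alpha-\beta)/2}+\sum_{j=0}^{J}b_j\,a^{3-j-\alpha-\beta}\,t^{j/2}+O\!\left(t^{(J+1)/2}\right),\end{aligned}$$ where $$c_{\alpha,\beta}=2^{-\alpha-\beta}\pi^{-1/2}\,\Gamma\!\left((2-\alpha-\beta)/2\right)\int_0^1\left(\rho^{-\alpha}+\rho^{-\beta}\right)\left((1-\rho)^{\alpha+\beta-2}-(1+\rho)^{\alpha+\beta-2}\right)d\rho,$$ and $$b_0=-\frac{8\pi}{(\alpha+\beta-1)(\alpha+\beta-2)(\alpha+\beta-3)},\qquad b_1=0,$$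 $$b_2=\frac{8\pi\alpha\beta}{(\alpha+\beta+1)(\alpha+\beta)(\alpha+\beta-1)},\qquad b_3=0.$$
   Context: The Dirichlet heat kernel $p(x,y;t)$ of $B_a$ is the minimal positive fundamental solution of the heat equation $\Delta u=\partial u/\partial t$ on $B_a$, where $\Delta=\sum_i\partial^2/\partial x_i^2$; equivalently, the heat kernel with Dirichlet (zero) boundary condition on $\partial B_a$. The quantities $c_{\alpha-1,\beta}$, $c_{\alpha,\beta-1}$, $c_{\alpha-1,\beta-1}$ are obtained from the formula for $c_{\alpha,\beta}$ by replacing the indices accordingly throughout (including in the sum $\alpha+\beta$). $\Gamma$ is the (meromorphically continued) Gamma function. *)

theory Defs
  imports "HOL-Analysis.Analysis" "HOL-Library.Landau_Symbols"
begin

definition partial_deriv :: "'a::euclidean_space \<Rightarrow> ('a \<Rightarrow> real) \<Rightarrow> 'a \<Rightarrow> real" where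
  "partial_deriv i f x = frechet_derivative f (at x) i"

definition laplacian :: "('a::euclidean_space \<Rightarrow> real) \<Rightarrow> 'a \<Rightarrow> real" where
  "laplacian f x = (\<Sum>i\<in>Basis. partial_deriv i (partial_deriv i f) x)"

text \<open>The class \<open>C\<^sup>2\<^sup>,\<^sup>1\<close> of functions on \<open>U \<times> (0, \<infinity>)\<close> (for open \<open>U\<close>): two continuous derivatives
  in the space variable and one in the time variable. Values outside \<open>U \<times> (0, \<infinity>)\<close> play no role,
  since \<open>U\<close> is open.\<close>

definition C21_on :: "'a::euclidean_space set \<Rightarrow> ('a \<Rightarrow> real \<Rightarrow> real) \<Rightarrow> bool" where
  "C21_on U u \<longleftrightarrow>
     (\<forall>x\<in>U. \<forall>t>0. u x differentiable at t \<and> (\<lambda>z. u z t) differentiable at x \<and>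
        (\<forall>i\<in>Basis. partial_deriv i (\<lambda>z. u z t) differentiable at x)) \<and>
     continuous_on (U \<times> {0<..}) (\<lambda>(x, t). u x t) \<and>
     continuous_on (U \<times> {0<..}) (\<lambda>(x, t). deriv (u x) t) \<and>
     (\<forall>i\<in>Basis. continuous_on (U \<times> {0<..}) (\<lambda>(x, t). partial_deriv i (\<lambda>z. u z t) x)) \<and>
     (\<forall>i\<in>Basis. \<forall>j\<in>Basis. continuous_on (U \<times> {0<..})
        (\<lambda>(x, t). partial_deriv j (partial_deriv i (\<lambda>z. u z t)) x))"

definition heat_solution :: "'a::euclidean_space set \<Rightarrow> ('a \<Rightarrow> real \<Rightarrow> real) \<Rightarrow> bool" where
  "heat_solution U u \<longleftrightarrow>
     C21_on U u \<and> (\<forall>x\<in>U. \<forall>t>0. laplacian (\<lambda>z. u z t) x = deriv (u x) t)"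

text \<open>A positive fundamental solution on the open set \<open>U\<close>: for each pole \<open>y\<close> in \<open>U\<close>, the function
  \<open>(x, t) \<mapsto> q x y t\<close> is a positive solution of the heat equation that converges to the Dirac measure
  at \<open>y\<close> as \<open>t \<rightarrow> 0+\<close>, tested against continuous functions with compact support in \<open>U\<close>.\<close>

definition positive_fundamental_solution ::
    "'a::euclidean_space set \<Rightarrow> ('a \<Rightarrow> 'a \<Rightarrow> real \<Rightarrow> real) \<Rightarrow> bool" where
  "positive_fundamental_solution U q \<longleftrightarrow>
     continuous_on (U \<times> U \<times> {0<..}) (\<lambda>(x, y, t). q x y t) \<and>
     (\<forall>x\<in>U. \<forall>y\<in>U. \<forall>t>0. 0 < q x y t) \<and>
     (\<forall>y\<in>U. heat_solution U (\<lambda>x t. q x y t)) \<and>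
     (\<forall>y\<in>U. \<forall>f K. continuous_on UNIV f \<longrightarrow> compact K \<longrightarrow> K \<subseteq> U \<longrightarrow> (\<forall>x. x \<notin> K \<longrightarrow> f x = 0) \<longrightarrow>
        ((\<lambda>t. LINT x:U|lborel. q x y t * f x) \<longlongrightarrow> f y) (at_right 0))"

definition dirichlet_heat_kernel ::
    "'a::euclidean_space set \<Rightarrow> ('a \<Rightarrow> 'a \<Rightarrow> real \<Rightarrow> real) \<Rightarrow> bool" where
  "dirichlet_heat_kernel U p \<longleftrightarrow>
     positive_fundamental_solution U p \<and>
     (\<forall>q. positive_fundamental_solution U q \<longrightarrow>
        (\<forall>x\<in>U. \<forall>y\<in>U. \<forall>t>0. p x y t \<le> q x y t))"

lemma dirichlet_heat_kernel_unique:
  assumes "dirichlet_heat_kernel U p" "dirichlet_heat_kernel U q" "x \<in> U" "y \<in> U" "t > 0"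
  shows "p x y t = q x y t"
  using assms unfolding dirichlet_heat_kernel_def by (meson order_antisym)

definition boundary_power :: "real \<Rightarrow> real \<Rightarrow> real^3 \<Rightarrow> real" where
  "boundary_power a \<alpha> x = (a - norm x) powr (- \<alpha>)"

definition heat_content ::
    "'a::euclidean_space set \<Rightarrow> ('a \<Rightarrow> 'a \<Rightarrow> real \<Rightarrow> real) \<Rightarrow> ('a \<Rightarrow> real) \<Rightarrow> ('a \<Rightarrow> real) \<Rightarrow> real \<Rightarrow> real" where
  "heat_content U p \<phi> \<psi> t =
     (LINT z:U \<times> U|lborel. (case z of (x, y) \<Rightarrow> p x y t * \<phi> x * \<psi> y))"

definition c_coeff :: "real \<Rightarrow> real \<Rightarrow> real" where
  "c_coeff \<alpha> \<beta> =
     2 powr (- \<alpha> - \<beta>) * pi powr (- 1 / 2) * Gamma ((2 - \<alpha> - \<beta>) / 2) *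
     (LBINT \<rho>=0..1. (\<rho> powr (- \<alpha>) + \<rho> powr (- \<beta>)) *
        ((1 - \<rho>) powr (\<alpha> + \<beta> - 2) - (1 + \<rho>) powr (\<alpha> + \<beta> - 2)))"

end

theory Submission
  imports Defs "HOL-Probability.Probability" "HOL-Real_Asymp.Real_Asymp"
begin

text \<open>By minimality, \<open>p\<close> is dominated by the kernels of the half spaces containing the ball, that is by
  a Gaussian minus its reflection; hence \<open>p\<close> is \<open>O(\<delta>)\<close> at the boundary. Green's identity with radial
  cut-offs therefore shows that \<open>p\<close> acts on each radial eigenfunction \<open>sin (n \<pi> |x| / a) / |x|\<close> as
  multiplication by \<open>exp (- (n \<pi> / a)\<^sup>2 t)\<close>. The image kernel of \<open>(0, 1)\<close> acts on sines in the same way,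
  and by density of sine polynomials \<open>Q(t)\<close> equals \<open>4 \<pi> a powr (3 - \<alpha> - \<beta>)\<close> times a heat content
  of the interval \<open>(0, 1)\<close> at time \<open>t / a\<^sup>2\<close>, with weights \<open>(1 - r) r powr (- \<alpha>)\<close> and
  \<open>(1 - r) r powr (- \<beta>)\<close>, where \<open>r = \<delta> / a\<close>.

  Near \<open>r = s = 0\<close> the kernel is that of the half line. Its content over the whole quadrant is homogeneous
  in \<open>t\<close> and gives exactly the terms with the constants \<open>c\<close>. Up to \<open>O(t\<^sup>N)\<close> the difference is a
  Gaussian average \<open>\<integral> gauss1 t z * \<Psi> z dz\<close> over \<open>z > 0\<close>, where \<open>z\<close> is the distance to the diagonal or to the
  image across \<open>r = 1\<close>, and \<open>\<Psi>\<close> is analytic at \<open>0\<close>. Watson's lemma yields the powers \<open>t powr (j / 2)\<close>,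
  and the first coefficients of \<open>\<Psi>\<close> yield \<open>b\<^sub>0, \<dots>, b\<^sub>3\<close>.\<close>

section \<open>Gaussian and half-space kernels\<close>

text \<open>About \<open>p\<close> only continuity, positivity, the heat equation, the initial Dirac
  mass and minimality are given, no boundary values. Half spaces are used for comparison because
  their kernels are explicit, and the one touching the sphere at the point nearest to x yields a
  factor a - |x|. Apart from positivity no lower bound for \<open>p\<close> is required:
  \<open>p\<close> is never identified with an image sum, only its integrals against radial
  functions are computed. In three dimensions the Laplacian of f(|x|) / |x| is f''(|x|) / |x|. Hence
  the sines, the reduction to an interval, and the factor 1 - r = |x| / a in each weight. This
  factor grows on the half line, so there the content contains an integral along the diagonal with
  integrand of order r powr (2 - \<alpha> - \<beta>), convergent exactly for \<alpha> + \<beta> > 3.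
  Expanding (1 - r)(1 - s) gives the c-terms with their signs. The discarded regions contribute
  exponentially little; an arbitrary power of t suffices as a bound and follows from exp (-x) \<le>
  n! / x^n.\<close>

lemma partial_deriv_eqI:
  assumes "(f has_derivative D) (at x)"
  shows "partial_deriv i f x = D i"
  using frechet_derivative_at[OF assms] by (simp add: partial_deriv_def)

text \<open>The generator is the Laplacian without a factor 1/2, hence variance 2 t in each
  coordinate.\<close>

definition gauss3 :: "real \<Rightarrow> real^3 \<Rightarrow> real" where
  "gauss3 t x = (4 * pi * t) powr (- 3 / 2) * exp (- (x \<bullet> x) / (4 * t))"

lemma gauss3_nonneg [simp]: "0 \<le> gauss3 t x"
  by (simp add: gauss3_def)

lemma gauss3_pos: "0 < t \<Longrightarrow> 0 < gauss3 t x"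
  by (simp add: gauss3_def)

lemma gauss3_has_derivative:
  "((\<lambda>x. gauss3 t (x - c)) has_derivative (\<lambda>h. - ((x - c) \<bullet> h) / (2 * t) * gauss3 t (x - c))) (at x)"
proof -
  have eq: "gauss3 t (x - c) = (4 * pi * t) powr (- 3 / 2) * exp ((x - c) \<bullet> (x - c) * (- 1 / (4 * t)))" for x
    by (simp add: gauss3_def)
  show ?thesis
    unfolding eq
    by (rule derivative_eq_intros refl)+
       (simp add: fun_eq_iff inner_commute field_simps)
qed

lemma gauss3_has_derivative2:
  "((\<lambda>x. - ((x - c) \<bullet> i) / (2 * t) * gauss3 t (x - c)) has_derivative
     (\<lambda>h. (((x - c) \<bullet> i) * ((x - c) \<bullet> h) / (4 * t\<^sup>2) - (h \<bullet> i) / (2 * t)) * gauss3 t (x - c))) (at x)"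
proof -
  have eq: "- ((x - c) \<bullet> i) / (2 * t) * gauss3 t (x - c) = ((x - c) \<bullet> i) * (- 1 / (2 * t)) * gauss3 t (x - c)" for x
    by simp
  show ?thesis
    unfolding eq
    by (rule derivative_eq_intros gauss3_has_derivative refl)+
       (simp add: fun_eq_iff inner_commute field_simps power2_eq_square)
qed

lemma gauss3_has_time_derivative:
  assumes "t > 0"
  shows "((\<lambda>t. gauss3 t x) has_real_derivative ((x \<bullet> x) / (4 * t\<^sup>2) - 3 / (2 * t)) * gauss3 t x) (at t)"
proof -
  have p: "(pi * (t * 4)) powr - (5 / 2) = (pi * (t * 4)) powr - (3 / 2) / (pi * (t * 4))"
    using assms powr_diff[of "pi * (t * 4)" "- (3/2)" 1] by simp
  show ?thesis
    unfolding gauss3_def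
    using assms
    by (auto intro!: derivative_eq_intros simp: field_simps power2_eq_square) (simp add: p)
qed

text \<open>\<open>y'\<close> is the mirror image of y in the plane x \<bullet> e = a. The squared
  distances from x to \<open>y'\<close> and to y differ by a product of the signed distances of x
  and y to the plane, so the image Gaussian is the original one times a factor that tends to 1 when
  either point approaches the plane.\<close>

lemma norm_diff_reflected:
  fixes a :: real and e x y :: "real^3"
  assumes e: "norm e = 1"
  defines "y' \<equiv> y + (2 * (a - y \<bullet> e)) *\<^sub>R e"
  shows "(x - y') \<bullet> (x - y') = (x - y) \<bullet> (x - y) + 4 * (a - y \<bullet> e) * (a - x \<bullet> e)"
proof -
  have "e \<bullet> e = 1" using e by (simp add: norm_eq_1)
  then show ?thesis
    unfolding y'_def
    by (simp add: algebra_simps inner_diff_left inner_diff_right inner_add_left inner_add_right inner_commute power2_eq_square)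
qed

text \<open>Polar coordinates for radial integrands. The image of Lebesgue measure under the norm
  and the density 4 \<pi> r^2 agree on half lines, whose preimages are balls of known volume, and
  half lines form an intersection-stable generator.\<close>

lemma nn_integral_norm_vec3:
  fixes f :: "real \<Rightarrow> ennreal"
  assumes [measurable]: "f \<in> borel_measurable borel"
  shows "(\<integral>\<^sup>+ x. f (norm (x :: real^3)) \<partial>lborel) =
         (\<integral>\<^sup>+ r. ennreal (4 * pi * r\<^sup>2) * indicator {0..} r * f r \<partial>lborel)"
proof -
  have meas: "emeasure (distr lborel borel (norm :: real^3 \<Rightarrow> real)) {..x} = ennreal (4 / 3 * pi * (max 0 x) ^ 3)" for x :: real
  proof -
    have "emeasure (distr lborel borel (norm :: real^3 \<Rightarrow> real)) {..x} = emeasure lborel (cball (0::real^3) x)"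
      by (subst emeasure_distr) (auto intro!: arg_cong[where f="emeasure lborel"])
    also have "\<dots> = ennreal (4 / 3 * pi * (max 0 x) ^ 3)"
    proof (cases "0 \<le> x")
      case True
      have "unit_ball_vol (real CARD(3)) = 4 / 3 * pi" 
        using unit_ball_vol_3 by simp
      then show ?thesis using True by (simp add: emeasure_cball)
    qed (simp add: cball_empty)
    finally show ?thesis .
  qed
  have dens: "emeasure (density lborel (\<lambda>r. ennreal (4 * pi * r\<^sup>2) * indicator {0..} r)) {..x} = ennreal (4 / 3 * pi * (max 0 x) ^ 3)" for x :: real
  proof -
    have "emeasure (density lborel (\<lambda>r. ennreal (4 * pi * r\<^sup>2) * indicator {0..} r)) {..x} =
      (\<integral>\<^sup>+ r. ennreal (4 * pi * r\<^sup>2) * indicator {0..x} r \<partial>lborel)"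
      by (subst emeasure_density) (auto intro!: nn_integral_cong split: split_indicator)
    also have "\<dots> = (\<integral>\<^sup>+ r. ennreal (4 * pi * r\<^sup>2) * indicator {0..max 0 x} r \<partial>lborel)"
      by (cases "x \<ge> 0") (auto intro!: nn_integral_cong_AE AE_I[where N="{0}"] simp: max_def split: split_indicator)
    also have "\<dots> = ennreal (4 / 3 * pi * (max 0 x) ^ 3 - 4/3 * pi * 0 ^ 3)"
      by (rule nn_integral_FTC_Icc[where F="\<lambda>x. 4/3 * pi * x^3"])
         (auto intro!: derivative_eq_intros)
    finally show ?thesis by simp
  qed
  have "distr lborel borel (norm :: real^3 \<Rightarrow> real) = density lborel (\<lambda>r. ennreal (4 * pi * r\<^sup>2) * indicator {0..} r)"
  proof (rule measure_eqI_generator_eq[where E="range atMost" and \<Omega>=UNIV and A="\<lambda>n. {..real n}"])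
    show "Int_stable (range (atMost :: real \<Rightarrow> _))"
      by (auto simp: Int_stable_def)
    show "sets (distr lborel borel (norm :: real^3 \<Rightarrow> real)) = sigma_sets UNIV (range atMost)"
      by (simp add: borel_eq_atMost)
    show "sets (density lborel (\<lambda>r. ennreal (4 * pi * r\<^sup>2) * indicator {0..} r)) = sigma_sets UNIV (range atMost)"
      by (simp add: borel_eq_atMost)
    show "(\<Union>i. {..real i}) = UNIV"
      using real_arch_simple by auto
  qed (auto simp: meas dens)
  then have "(\<integral>\<^sup>+ r. f r \<partial>distr lborel borel (norm :: real^3 \<Rightarrow> real)) = (\<integral>\<^sup>+ r. f r \<partial>density lborel (\<lambda>r. ennreal (4 * pi * r\<^sup>2) * indicator {0..} r))"
    by simp
  then show ?thesis
    by (subst (asm) nn_integral_distr; simp add: nn_integral_density)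
qed

definition gauss1 :: "real \<Rightarrow> real \<Rightarrow> real" where
  "gauss1 t z = exp (- z\<^sup>2 / (4 * t)) / sqrt (4 * pi * t)"

lemma gauss1_nonneg [simp]: "t > 0 \<Longrightarrow> 0 \<le> gauss1 t z"
  by (simp add: gauss1_def)

lemma gauss1_normal_density:
  "t > 0 \<Longrightarrow> gauss1 t z = normal_density 0 (sqrt (2 * t)) z"
  by (simp add: gauss1_def normal_density_def)

lemma gauss1_measurable [measurable]: "gauss1 t \<in> borel_measurable borel"
  unfolding gauss1_def[abs_def] by measurable

lemma gauss3_measurable [measurable]: "gauss3 t \<in> borel_measurable borel"
  unfolding gauss3_def[abs_def] by measurable

lemma gauss1_even_moment:
  assumes "t > 0"
  shows "has_bochner_integral lborel (\<lambda>z. gauss1 t z * z ^ (2 * k)) (fact (2 * k) / fact k * t ^ k)"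
proof -
  have "fact (2 * k) / ((2 / (sqrt (2*t))\<^sup>2)^k * fact k) = fact (2 * k) / fact k * t ^ k"
    using assms by (simp add: power_divide)
  then show ?thesis
    using normal_moment_even[of "sqrt (2 * t)" 0 k] assms
    by (simp only: gauss1_normal_density diff_0_right) simp
qed

text \<open>The radial density of the Gaussian in space is the Gaussian on the line times r^2 / t,
  so even moments in space are even moments on the line two degrees higher.\<close>

lemma gauss3_norm:
  assumes "t > 0"
  shows "4 * pi * (norm x)\<^sup>2 * gauss3 t x = (norm x)\<^sup>2 / t * gauss1 t (norm x)"
proof -
  have "(4 * pi * t) powr (- 3 / 2) = (4 * pi * t) powr (-1 - 1/2)" by simp
  also have "\<dots> = 1 / (4 * pi * t) / sqrt (4 * pi * t)"
    using assms by (subst powr_diff) (simp add: powr_half_sqrt powr_minus field_simps)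
  finally show ?thesis
    using assms by (simp add: gauss3_def gauss1_def power2_norm_eq_inner)
qed

lemma nn_integral_even_split:
  fixes f :: "real \<Rightarrow> ennreal"
  assumes [measurable]: "f \<in> borel_measurable borel" and even: "\<And>x. f (- x) = f x"
  shows "(\<integral>\<^sup>+ x. f x \<partial>lborel) = 2 * (\<integral>\<^sup>+ x. f x * indicator {0..} x \<partial>lborel)"
proof -
  have "(\<integral>\<^sup>+ x. f x \<partial>lborel) = (\<integral>\<^sup>+ x. f x * indicator {0..} x + f x * indicator {..<0} x \<partial>lborel)"
    by (auto intro!: nn_integral_cong split: split_indicator)
  also have "\<dots> = (\<integral>\<^sup>+ x. f x * indicator {0..} x \<partial>lborel) + (\<integral>\<^sup>+ x. f x * indicator {..<0} x \<partial>lborel)"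
    by (rule nn_integral_add) auto
  also have "(\<integral>\<^sup>+ x. f x * indicator {..<0} x \<partial>lborel) = (\<integral>\<^sup>+ x. f x * indicator {..<0} (- x) \<partial>lborel)"
    by (subst nn_integral_real_affine[where c="-1" and t=0]) (auto simp: even)
  also have "\<dots> = (\<integral>\<^sup>+ x. f x * indicator {0..} x \<partial>lborel)"
    by (rule nn_integral_cong_AE, rule AE_I[where N="{0}"]) (auto split: split_indicator)
  finally show ?thesis by (simp add: mult_2)
qed

lemma gauss3_even_moment:
  assumes "t > 0"
  shows "has_bochner_integral lborel (\<lambda>x. gauss3 t x * (norm x) ^ (2 * k)) 
     (fact (2 * (k + 1)) / fact (k + 1) * t ^ k / 2)"
proof -
  define f where "f r = ennreal ((4 * pi * t) powr (- 3 / 2) * exp (- r\<^sup>2 / (4 * t)) * r ^ (2 * k))" for r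
  define A where "A = fact (2 * (k + 1)) / fact (k + 1) * t ^ (k + 1)"
  have [measurable]: "f \<in> borel_measurable borel" unfolding f_def by measurable
  have fn: "f (norm x) = ennreal (gauss3 t x * (norm x) ^ (2 * k))" for x
    by (simp add: f_def gauss3_def power2_norm_eq_inner)
  have fr: "ennreal (4 * pi * r\<^sup>2) * indicator {0..} r * f r = ennreal (1 / t) * (ennreal (gauss1 t r * r ^ (2 * (k + 1))) * indicator {0..} r)" for r
  proof (cases "r \<ge> 0")
    case True
    define x :: "real^3" where "x = r *\<^sub>R axis 1 1"
    have nx: "norm x = r" using True by (simp add: x_def)
    have "4 * pi * r\<^sup>2 * (gauss3 t x * r ^ (2 * k)) = (4 * pi * r\<^sup>2 * gauss3 t x) * r ^ (2 * k)"
      by simp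
    also have "\<dots> = r\<^sup>2 / t * gauss1 t r * r ^ (2 * k)"
      using gauss3_norm[OF assms, of x] by (simp add: nx)
    finally have "4 * pi * r\<^sup>2 * (gauss3 t x * r ^ (2 * k)) = 1 / t * (gauss1 t r * r ^ (2 * (k + 1)))"
      by (simp add: power_add power2_eq_square)
    then show ?thesis
      using True fn[of x] assms by (simp add: nx ennreal_mult'[symmetric])
  qed simp
  have B: "(\<integral>\<^sup>+ r. ennreal (gauss1 t r * r ^ (2 * (k + 1))) \<partial>lborel) = ennreal A"
    using gauss1_even_moment[OF assms, of "k+1"] assms
    by (subst nn_integral_eq_integral)
       (auto simp: has_bochner_integral_iff A_def simp del: power_Suc mult_Suc_right fact_Suc intro!: mult_nonneg_nonneg zero_le_even_power)
  have "0 \<le> A" using assms by (simp add: A_def)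
  then have "2 * ennreal (A / 2) = ennreal A" by (simp add: ennreal_mult'[symmetric] flip: ennreal_numeral)
  also have "ennreal A = 2 * (\<integral>\<^sup>+ r. ennreal (gauss1 t r * r ^ (2 * (k + 1))) * indicator {0..} r \<partial>lborel)"
    unfolding B[symmetric] by (rule nn_integral_even_split) (auto simp: gauss1_def)
  finally have C: "(\<integral>\<^sup>+ r. ennreal (gauss1 t r * r ^ (2 * (k + 1))) * indicator {0..} r \<partial>lborel) = ennreal (A / 2)"
    by (subst (asm) ennreal_mult_cancel_left) auto
  have "(\<integral>\<^sup>+ x. ennreal (gauss3 t x * (norm x) ^ (2 * k)) \<partial>lborel) = ennreal (1 / t) * ennreal (A / 2)"
    unfolding fn[symmetric]
    by (subst nn_integral_norm_vec3) (simp, simp only: fr, subst nn_integral_cmult, simp, simp only: C)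
  also have "\<dots> = ennreal (fact (2 * (k + 1)) / fact (k + 1) * t ^ k / 2)"
    using assms by (subst ennreal_mult'[symmetric]) (auto simp: A_def)
  finally show ?thesis
    using assms by (intro has_bochner_integral_nn_integral) auto
qed

lemma has_bochner_integral_translation:
  fixes f :: "'a :: euclidean_space \<Rightarrow> real"
  assumes *: "has_bochner_integral lborel f I"
  shows "has_bochner_integral lborel (\<lambda>x. f (x - c)) I"
proof -
  from * have i: "integrable (distr lborel borel ((+) (- c))) f" "(LINT x|distr lborel borel ((+) (- c)). f x) = I"
    and [measurable]: "f \<in> borel_measurable borel"
    by (auto simp: lborel_distr_plus has_bochner_integral_iff)
  show ?thesis
    using i(1) i(2)[symmetric] by (simp add: has_bochner_integral_iff integrable_distr_eq integral_distr)
qed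

lemma gauss3_integral: "t > 0 \<Longrightarrow> has_bochner_integral lborel (\<lambda>x. gauss3 t (x - c)) 1"
  using has_bochner_integral_translation[OF gauss3_even_moment[of t 0]] by simp

lemma gauss3_second_moment:
  "t > 0 \<Longrightarrow> has_bochner_integral lborel (\<lambda>x. gauss3 t (x - c) * (norm (x - c))\<^sup>2) (6 * t)"
  using has_bochner_integral_translation[OF gauss3_even_moment[of t 1]] by (simp add: fact_numeral)

text \<open>Chebyshev's inequality replaces a dominated convergence argument in the next two proofs.\<close>

lemma gauss3_delta:
  fixes f :: "real^3 \<Rightarrow> real"
  assumes f[measurable]: "f \<in> borel_measurable borel" and M: "\<And>x. \<bar>f x\<bar> \<le> M" and "isCont f c"
  shows "((\<lambda>t. LINT x|lborel. gauss3 t (x - c) * f x) \<longlongrightarrow> f c) (at_right 0)"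
proof (rule tendstoI)
  fix e :: real assume "e > 0"
  from \<open>isCont f c\<close> obtain d where d: "d > 0" "\<And>x. dist x c < d \<Longrightarrow> dist (f x) (f c) < e / 2"
    unfolding continuous_at_eps_delta using \<open>e > 0\<close> by (meson half_gt_zero)
  have M0: "M \<ge> 0" using M[of c] by linarith
  have bnd: "\<bar>f x - f c\<bar> \<le> e / 2 + 2 * M / d\<^sup>2 * (norm (x - c))\<^sup>2" for x
  proof (cases "dist x c < d")
    case True
    have "0 \<le> 2 * M / d\<^sup>2 * (norm (x - c))\<^sup>2" using M0 by simp
    then show ?thesis using d(2)[OF True] by (simp add: dist_real_def)
  next
    case False
    then have "1 \<le> (norm (x - c))\<^sup>2 / d\<^sup>2" using d(1)
      by (simp add: dist_norm power_mono)
    then have "2 * M * 1 \<le> 2 * M * ((norm (x - c))\<^sup>2 / d\<^sup>2)" using M0 by (intro mult_left_mono) auto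
    then show ?thesis using M[of x] M[of c] \<open>e > 0\<close> by simp
  qed
  have lim: "((\<lambda>t. e / 2 + 2 * M / d\<^sup>2 * (6 * t)) \<longlongrightarrow> e / 2 + 2 * M / d\<^sup>2 * (6 * 0)) (at_right 0)"
    by (intro tendsto_intros)
  have "\<forall>\<^sub>F t in at_right 0. e / 2 + 2 * M / d\<^sup>2 * (6 * t) < e"
    using order_tendstoD(2)[OF lim, of e] \<open>e > 0\<close> by simp
  moreover have "\<forall>\<^sub>F t in at_right (0::real). t > 0"
    by (simp add: eventually_at_right_less)
  ultimately show "\<forall>\<^sub>F t in at_right 0. dist (LINT x|lborel. gauss3 t (x - c) * f x) (f c) < e"
  proof eventually_elim
    case (elim t)
    then have t: "t > 0" by simp
    note g1 = gauss3_integral[OF t, of c] and g2 = gauss3_second_moment[OF t, of c]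
    have i1: "integrable lborel (\<lambda>x. gauss3 t (x - c) * f x)"
      by (rule Bochner_Integration.integrable_bound[of _ "\<lambda>x. M * gauss3 t (x - c)"])
         (use g1 M M0 in \<open>auto simp: has_bochner_integral_iff abs_mult mult.commute[of M] intro!: mult_left_mono\<close>)
    have i2: "integrable lborel (\<lambda>x. gauss3 t (x - c) * (f x - f c))"
      using i1 g1 by (simp add: right_diff_distrib has_bochner_integral_iff)
    have "(LINT x|lborel. gauss3 t (x - c) * f x) - f c = (LINT x|lborel. gauss3 t (x - c) * (f x - f c))"
      using i1 g1 by (simp add: right_diff_distrib has_bochner_integral_iff)
    also have "\<bar>\<dots>\<bar> \<le> (LINT x|lborel. gauss3 t (x - c) * (e / 2) + 2 * M / d\<^sup>2 * (gauss3 t (x - c) * (norm (x - c))\<^sup>2))"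
    proof (rule order_trans[OF integral_abs_bound integral_mono])
      show "integrable lborel (\<lambda>x. \<bar>gauss3 t (x - c) * (f x - f c)\<bar>)" using i2 by simp
      show "integrable lborel (\<lambda>x. gauss3 t (x - c) * (e / 2) + 2 * M / d\<^sup>2 * (gauss3 t (x - c) * (norm (x - c))\<^sup>2))"
        using g1 g2 by (simp add: has_bochner_integral_iff)
      show "\<bar>gauss3 t (x - c) * (f x - f c)\<bar> \<le> gauss3 t (x - c) * (e / 2) + 2 * M / d\<^sup>2 * (gauss3 t (x - c) * (norm (x - c))\<^sup>2)" for x
        using mult_left_mono[OF bnd[of x], of "gauss3 t (x - c)"]
        by (simp only: abs_mult abs_of_nonneg[OF gauss3_nonneg] distrib_left gauss3_nonneg mult_ac simp_thms)
    qed
    also have "\<dots> = e / 2 + 2 * M / d\<^sup>2 * (6 * t)"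
      using g1 g2 by (simp add: has_bochner_integral_iff)
    also have "\<dots> < e" using elim by simp
    finally show ?case by (simp add: dist_real_def)
  qed
qed

lemma gauss3_off_support:
  fixes f :: "real^3 \<Rightarrow> real"
  assumes f[measurable]: "f \<in> borel_measurable borel" and M: "\<And>x. \<bar>f x\<bar> \<le> M" and "d > 0"
    and supp: "\<And>x. f x \<noteq> 0 \<Longrightarrow> d \<le> norm (x - c)"
  shows "((\<lambda>t. LINT x|lborel. gauss3 t (x - c) * f x) \<longlongrightarrow> 0) (at_right 0)"
proof (rule Lim_null_comparison)
  have M0: "M \<ge> 0" using M[of c] by linarith
  have bnd: "\<bar>f x\<bar> \<le> M / d\<^sup>2 * (norm (x - c))\<^sup>2" for x
  proof (cases "f x = 0")
    case False
    then have "1 \<le> (norm (x - c))\<^sup>2 / d\<^sup>2" using supp[of x] \<open>d > 0\<close> by (simp add: power_mono)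
    then have "M * 1 \<le> M * ((norm (x - c))\<^sup>2 / d\<^sup>2)" using M0 by (intro mult_left_mono) auto
    then show ?thesis using M[of x] by simp
  qed (use M0 in simp)
  have "\<forall>\<^sub>F t in at_right (0::real). t > 0"
    by (simp add: eventually_at_right_less)
  then show "\<forall>\<^sub>F t in at_right 0. norm (LINT x|lborel. gauss3 t (x - c) * f x) \<le> M / d\<^sup>2 * (6 * t)"
  proof eventually_elim
    case (elim t)
    note g2 = gauss3_second_moment[OF elim, of c]
    have bnd': "norm (gauss3 t (x - c) * f x) \<le> M / d\<^sup>2 * (gauss3 t (x - c) * (norm (x - c))\<^sup>2)" for x
      using mult_left_mono[OF bnd[of x], of "gauss3 t (x - c)"] by (simp add: abs_mult algebra_simps)
    have i1: "integrable lborel (\<lambda>x. M / d\<^sup>2 * (gauss3 t (x - c) * (norm (x - c))\<^sup>2))"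
      using g2 by (simp add: has_bochner_integral_iff)
    have i2: "integrable lborel (\<lambda>x. norm (gauss3 t (x - c) * f x))"
      by (rule Bochner_Integration.integrable_bound[OF i1]) 
         (auto intro!: AE_I2 order_trans[OF bnd'[unfolded real_norm_def]] abs_ge_self simp del: times_divide_eq_left)
    have "norm (LINT x|lborel. gauss3 t (x - c) * f x) \<le> (LINT x|lborel. M / d\<^sup>2 * (gauss3 t (x - c) * (norm (x - c))\<^sup>2))"
      by (rule order_trans[OF integral_norm_bound integral_mono[OF i2 i1 bnd']])
    then show ?case using g2 by (simp add: has_bochner_integral_iff)
  qed
  have "((\<lambda>t. M / d\<^sup>2 * (6 * t)) \<longlongrightarrow> M / d\<^sup>2 * (6 * 0)) (at_right 0)"
    by (intro tendsto_intros)
  then show "((\<lambda>t. M / d\<^sup>2 * (6 * t)) \<longlongrightarrow> 0) (at_right 0)" by simp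
qed

text \<open>Dirichlet kernel of the half space x \<bullet> e < a by the method of images. For a unit
  vector e this half space contains the ball of radius a and touches it at a e.\<close>

definition half_space_kernel :: "real \<Rightarrow> real^3 \<Rightarrow> real^3 \<Rightarrow> real^3 \<Rightarrow> real \<Rightarrow> real" where
  "half_space_kernel a e x y t = gauss3 t (x - y) - gauss3 t (x - (y + (2 * (a - y \<bullet> e)) *\<^sub>R e))"

text \<open>The factored form shows positivity and linear decay at the boundary plane; the
  difference form is the one that visibly solves the heat equation.\<close>

lemma half_space_kernel_eq:
  assumes "norm e = 1" "t > 0"
  shows "half_space_kernel a e x y t = gauss3 t (x - y) * (1 - exp (- ((a - y \<bullet> e) * (a - x \<bullet> e) / t)))"
proof -
  have "exp (- (N + 4 * A * B) / (4 * t)) = exp (- N / (4 * t)) * exp (- (A * B / t))" for N A B :: real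
    using assms(2) by (simp add: exp_add[symmetric] field_simps)
  moreover have "k * E - k * (E * F) = k * E * (1 - F)" for k E F :: real
    by (simp add: algebra_simps)
  ultimately show ?thesis
    unfolding half_space_kernel_def gauss3_def norm_diff_reflected[OF assms(1)]
    by (simp only:)
qed

text \<open>Reflection moves only the pole, which is a parameter of the equation, so two arbitrary
  centres cover the half space kernel.\<close>

lemma gauss3_diff_heat_solution:
  "heat_solution U (\<lambda>x t. gauss3 t (x - c) - gauss3 t (x - d))"
proof -
  define u where "u = (\<lambda>x t. gauss3 t (x - c) - gauss3 t (x - d))"
  define u1 where "u1 i t x = - ((x - c) \<bullet> i) / (2 * t) * gauss3 t (x - c) - - ((x - d) \<bullet> i) / (2 * t) * gauss3 t (x - d)" for i t x
  define u2 where "u2 i j t x = (((x - c) \<bullet> i) * ((x - c) \<bullet> j) / (4 * t\<^sup>2) - (j \<bullet> i) / (2 * t)) * gauss3 t (x - c)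
    - (((x - d) \<bullet> i) * ((x - d) \<bullet> j) / (4 * t\<^sup>2) - (j \<bullet> i) / (2 * t)) * gauss3 t (x - d)" for i j t x
  define ut where "ut t x = (((x - c) \<bullet> (x - c)) / (4 * t\<^sup>2) - 3 / (2 * t)) * gauss3 t (x - c)
    - (((x - d) \<bullet> (x - d)) / (4 * t\<^sup>2) - 3 / (2 * t)) * gauss3 t (x - d)" for t x
  have du: "((\<lambda>x. u x t) has_derivative (\<lambda>h. u1 h t x)) (at x)" for x t
    unfolding u_def u1_def by (intro has_derivative_diff gauss3_has_derivative)
  have p1: "partial_deriv i (\<lambda>x. u x t) = u1 i t" for i t
    using partial_deriv_eqI[OF du] by blast
  have du1: "(u1 i t has_derivative (\<lambda>h. u2 i h t x)) (at x)" for i x t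
    unfolding u1_def[abs_def] u2_def by (intro has_derivative_diff gauss3_has_derivative2)
  have p2: "partial_deriv j (partial_deriv i (\<lambda>x. u x t)) x = u2 i j t x" for i j t x
    unfolding p1 by (rule partial_deriv_eqI[OF du1])
  have dt: "(u x has_real_derivative ut t x) (at t)" if "t > 0" for x t
    unfolding u_def ut_def by (intro DERIV_diff gauss3_has_time_derivative that)
  have pt: "deriv (u x) t = ut t x" if "t > 0" for x t
    by (rule DERIV_imp_deriv[OF dt[OF that]])
  have cg: "continuous_on (U \<times> {0<..}) (\<lambda>z. gauss3 (snd z) (fst z - b))" for b
    unfolding gauss3_def by (intro continuous_intros) auto
  note cg' [continuous_intros] = cg[of c] cg[of d]
  have "continuous_on (U \<times> {0<..}) (\<lambda>(x, t). u x t)"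
    unfolding u_def split_beta by (intro continuous_intros)
  moreover have "continuous_on (U \<times> {0<..}) (\<lambda>(x, t). deriv (u x) t)"
  proof -
    have "continuous_on (U \<times> {0<..}) (\<lambda>(x, t). ut t x)"
      unfolding ut_def split_beta by (intro continuous_intros) auto
    then show ?thesis by (subst continuous_on_cong[OF refl, where g="\<lambda>(x, t). ut t x"]) (auto simp: pt)
  qed
  moreover have "continuous_on (U \<times> {0<..}) (\<lambda>(x, t). partial_deriv i (\<lambda>z. u z t) x)" for i
    unfolding p1 u1_def split_beta by (intro continuous_intros) auto
  moreover have "continuous_on (U \<times> {0<..}) (\<lambda>(x, t). partial_deriv j (partial_deriv i (\<lambda>z. u z t)) x)" for i j
    unfolding p2 u2_def split_beta by (intro continuous_intros) auto
  moreover have "u x differentiable at t" if "t > 0" for x t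
    using dt[OF that] real_differentiable_def by blast
  moreover have "(\<lambda>x. u x t) differentiable at x" "u1 i t differentiable at x" for i t x
    using du du1 unfolding differentiable_def by blast+
  ultimately have "C21_on U u"
    unfolding C21_on_def p1 by auto
  moreover have "laplacian (\<lambda>z. u z t) x = deriv (u x) t" if "t > 0" for x t
  proof -
    have *: "(\<Sum>i\<in>Basis. ((x - b) \<bullet> i) * ((x - b) \<bullet> i)) = (x - b) \<bullet> (x - b)" for b
      by (simp add: euclidean_inner[symmetric])
    have **: "(\<Sum>i\<in>(Basis :: (real^3) set). i \<bullet> i) = 3"
      by simp
    show ?thesis
      unfolding laplacian_def p2 pt[OF that] u2_def ut_def
      by (simp only: sum_subtractf sum_distrib_right[symmetric] sum_divide_distrib[symmetric] * **)
  qed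
  ultimately show ?thesis unfolding heat_solution_def u_def by blast
qed

text \<open>The kernel is an admissible competitor for minimality on the ball although it does not
  vanish on the sphere. As t tends to 0 the Gaussian at y produces the Dirac mass; the image point
  lies outside the ball, hence at positive distance from the compact support, and contributes
  nothing in the limit.\<close>

lemma half_space_kernel_fundamental:
  assumes e: "norm e = 1"
  shows "positive_fundamental_solution (ball 0 a) (half_space_kernel a e)"
  unfolding positive_fundamental_solution_def
proof (intro conjI ballI allI impI)
  show "continuous_on (ball 0 a \<times> ball 0 a \<times> {0<..}) (\<lambda>(x, y, t). half_space_kernel a e x y t)"
    unfolding half_space_kernel_def gauss3_def split_beta by (intro continuous_intros) auto
next
  have lt: "x \<bullet> e < a" if "x \<in> ball 0 a" for x
    using norm_cauchy_schwarz[of x e] e that by simp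
  fix x y :: "real^3" and t :: real assume "x \<in> ball 0 a" "y \<in> ball 0 a" "t > 0"
  then show "0 < half_space_kernel a e x y t"
    using lt[of x] lt[of y] e by (simp add: half_space_kernel_eq gauss3_pos)
next
  fix y :: "real^3"
  show "heat_solution (ball 0 a) (\<lambda>x t. half_space_kernel a e x y t)"
    unfolding half_space_kernel_def by (rule gauss3_diff_heat_solution)
next
  fix y :: "real^3" and f :: "real^3 \<Rightarrow> real" and K assume y: "y \<in> ball 0 a" and f: "continuous_on UNIV f" and K: "compact K" "K \<subseteq> ball 0 a"
    and supp: "\<forall>x. x \<notin> K \<longrightarrow> f x = 0"
  define y' where "y' = y + (2 * (a - y \<bullet> e)) *\<^sub>R e"
  have fm: "f \<in> borel_measurable borel" using f by (rule borel_measurable_continuous_onI)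
  obtain M where M: "\<And>x. x \<in> K \<Longrightarrow> \<bar>f x\<bar> \<le> M" and "M \<ge> 0"
    using compact_imp_bounded[OF compact_continuous_image[OF continuous_on_subset[OF f] K(1)]]
    unfolding bounded_pos by (auto intro: less_imp_le)
  then have M': "\<bar>f x\<bar> \<le> M" for x using supp by (cases "x \<in> K") auto
  have "y' \<notin> ball 0 a"
  proof -
    have "y' \<bullet> e = 2 * a - y \<bullet> e" using e by (simp add: y'_def inner_add_left norm_eq_1)
    moreover have "y \<bullet> e < a" using norm_cauchy_schwarz[of y e] e y by simp
    ultimately show ?thesis using norm_cauchy_schwarz[of y' e] e by simp
  qed
  then have "y' \<notin> K" using K by auto
  then obtain d where d: "d > 0" "\<And>x. x \<in> K \<Longrightarrow> d \<le> dist y' x"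
    using separate_point_closed[OF compact_imp_closed[OF K(1)]] by blast
  have supp': "d \<le> norm (x - y')" if "f x \<noteq> 0" for x
    using d(2)[of x] supp that by (auto simp: dist_norm norm_minus_commute)
  have "isCont f y" using f by (simp add: continuous_on_eq_continuous_at)
  from tendsto_diff[OF gauss3_delta[OF fm M' this] gauss3_off_support[OF fm M' d(1) supp']]
  have lim: "((\<lambda>t. (LINT x|lborel. gauss3 t (x - y) * f x) - (LINT x|lborel. gauss3 t (x - y') * f x)) \<longlongrightarrow> f y) (at_right 0)"
    by simp
  have "\<forall>\<^sub>F t in at_right (0::real). t > 0" by (simp add: eventually_at_right_less)
  then have ev: "\<forall>\<^sub>F t in at_right 0. (LINT x|lborel. gauss3 t (x - y) * f x) - (LINT x|lborel. gauss3 t (x - y') * f x) =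
      (LINT x:ball 0 a|lborel. half_space_kernel a e x y t * f x)"
  proof eventually_elim
    case (elim t)
    have i: "integrable lborel (\<lambda>x. gauss3 t (x - c) * f x)" for c
      by (rule Bochner_Integration.integrable_bound[of _ "\<lambda>x. M * gauss3 t (x - c)"])
         (use gauss3_integral[OF elim, of c] M' fm \<open>M \<ge> 0\<close> in \<open>auto simp: has_bochner_integral_iff abs_mult mult.commute[of M] intro!: mult_left_mono\<close>)
    have "(LINT x:ball 0 a|lborel. half_space_kernel a e x y t * f x) = (LINT x|lborel. half_space_kernel a e x y t * f x)"
      unfolding set_lebesgue_integral_def
      by (intro Bochner_Integration.integral_cong) (use K supp in \<open>auto simp: indicator_def\<close>)
    then show ?case
      using i by (simp add: half_space_kernel_def y'_def left_diff_distrib)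
  qed
  show "((\<lambda>t. LINT x:ball 0 a|lborel. half_space_kernel a e x y t * f x) \<longlongrightarrow> f y) (at_right 0)"
    using lim by (rule Lim_transform_eventually[OF _ ev])
qed

section \<open>Radial eigenfunctions and the Dirichlet heat kernel\<close>

lemma dirichlet_heat_kernel_le_half_space:
  assumes "dirichlet_heat_kernel (ball 0 a) p" "norm e = 1" "x \<in> ball 0 a" "y \<in> ball 0 a" "t > 0"
  shows "p x y t \<le> half_space_kernel a e x y t"
  using assms half_space_kernel_fundamental unfolding dirichlet_heat_kernel_def by blast

text \<open>The half space is adapted to x: its boundary plane touches the sphere at the boundary
  point nearest to x. The second bound is the Dirichlet condition in quantitative form, from 1 - exp
  (-z) \<le> z and a - y \<bullet> e \<le> 2 a.\<close>

lemma dirichlet_heat_kernel_bound: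
  fixes x y :: "real^3"
  assumes p: "dirichlet_heat_kernel (ball 0 a) p" and x: "x \<in> ball 0 a" and y: "y \<in> ball 0 a" and t: "t > 0"
  shows "p x y t \<le> gauss3 t (x - y)"
    and "p x y t \<le> gauss3 t (x - y) * (2 * a * (a - norm x) / t)"
proof -
  \<comment> \<open>At the origin every unit direction satisfies x \<bullet> e = norm x.\<close>
  define e :: "real^3" where "e = (if x = 0 then axis 1 1 else x /\<^sub>R norm x)"
  have e: "norm e = 1" by (simp add: e_def)
  have xe: "x \<bullet> e = norm x" by (simp add: e_def power2_norm_eq_inner[symmetric] power2_eq_square)
  have ye: "\<bar>y \<bullet> e\<bar> < a" using Cauchy_Schwarz_ineq2[of y e] e y by simp
  have nx: "norm x < a" using x by simp
  define z where "z = (a - y \<bullet> e) * (a - norm x) / t"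
  have le: "p x y t \<le> gauss3 t (x - y) * (1 - exp (- z))"
    using dirichlet_heat_kernel_le_half_space[OF p e x y t]
    by (simp add: half_space_kernel_eq[OF e t] xe z_def)
  have z: "z \<ge> 0" unfolding z_def using ye nx t by (intro divide_nonneg_pos mult_nonneg_nonneg) auto
  show "p x y t \<le> gauss3 t (x - y)"
    using le by (rule order_trans) (simp add: mult_left_le)
  have "1 - exp (- z) \<le> z" using exp_ge_add_one_self[of "- z"] by simp
  also have "z \<le> 2 * a * (a - norm x) / t"
    unfolding z_def using ye nx t by (intro divide_right_mono mult_right_mono) auto
  finally show "p x y t \<le> gauss3 t (x - y) * (2 * a * (a - norm x) / t)"
    using le by (meson gauss3_nonneg mult_left_mono order_trans)
qed

lemma exp_minus_le_power:
  fixes x :: real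
  assumes "x > 0"
  shows "exp (- x) \<le> fact n / x ^ n"
proof -
  have "x ^ n / fact n \<le> exp x"
  proof -
    have "(\<Sum>i\<in>{n}. inverse (fact i) *\<^sub>R x ^ i) \<le> exp x"
      unfolding exp_def by (rule sum_le_suminf[OF summable_exp_generic]) (use assms in auto)
    then show ?thesis by (simp add: divide_inverse mult.commute)
  qed
  then show ?thesis using assms by (simp add: exp_minus field_simps)
qed

text \<open>The boundary bound for the kernel contains 1 / t, which has to be absorbed when x stays
  away from y. Three powers from exp (- d^2 / (4 t)) beat t powr (- 5 / 2), and 384 = 3!
  4^3.\<close>

lemma gauss3_off_diagonal:
  assumes "t > 0" "t \<le> T" "d > 0" "d \<le> norm z"
  shows "gauss3 t z / t \<le> 384 * T powr (1 / 2) / d ^ 6"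
proof -
  have "gauss3 t z \<le> (4 * pi * t) powr (- 3 / 2) * exp (- (d\<^sup>2 / (4 * t)))"
    unfolding gauss3_def power2_norm_eq_inner[symmetric] using assms
    by (intro mult_left_mono) (auto simp: divide_right_mono power_mono)
  also have "\<dots> \<le> t powr (- 3 / 2) * (fact 3 / (d\<^sup>2 / (4 * t)) ^ 3)"
  proof (intro mult_mono exp_minus_le_power)
    have "1 \<le> 4 * pi" using pi_gt3 by simp
    then have "t \<le> 4 * pi * t" using assms(1) by (simp add: mult_left_le)
    then show "(4 * pi * t) powr (- 3 / 2) \<le> t powr (- 3 / 2)"
      using assms by (intro powr_mono2') auto
  qed (use assms in auto)
  also have "\<dots> = t powr (- 3 / 2) * t ^ 3 * (384 / d ^ 6)"
    by (simp add: power_divide power_mult_distrib fact_numeral power_mult[symmetric])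
  also have "t powr (- 3 / 2) * t ^ 3 = t powr (1 / 2) * t"
  proof -
    have "t powr (- 3 / 2) * t powr 3 = t powr (1 / 2) * t powr 1"
      unfolding powr_add[symmetric] by simp
    then show ?thesis using assms(1) by simp
  qed
  finally have "gauss3 t z / t \<le> t powr (1 / 2) * (384 / d ^ 6)"
    using assms(1) by (simp add: divide_le_eq mult_ac)
  also have "\<dots> \<le> T powr (1 / 2) * (384 / d ^ 6)"
    using assms by (intro mult_right_mono powr_mono2) auto
  finally show ?thesis by (simp add: mult_ac)
qed

section \<open>Green's identity with radial test functions\<close>

text \<open>The integral of F (x + h i) does not depend on h by translation invariance; its
  derivative at h = 0, taken under the integral over a fixed box, is the integral of the partial
  derivative. This takes the place of the divergence theorem.\<close>

lemma integral_partial_deriv_eq_0: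
  fixes F :: "'a::euclidean_space \<Rightarrow> real"
  assumes D: "\<And>x. F differentiable at x" and cont: "continuous_on UNIV (partial_deriv i F)"
    and "compact K" and supp: "\<And>x. x \<notin> K \<Longrightarrow> F x = 0"
  shows "(LINT x|lborel. partial_deriv i F x) = 0"
proof -
  obtain R where R: "\<And>x. x \<in> K \<Longrightarrow> norm x \<le> R"
    using compact_imp_bounded[OF \<open>compact K\<close>] unfolding bounded_iff by blast
  \<comment> \<open>The box has room for every translate of the support by h i with |h| < 1.\<close>
  obtain b :: 'a where b: "cball 0 (R + norm i) \<subseteq> cbox (- b) b"
    using bounded_subset_cbox_symmetric[OF bounded_cball] by blast
  have contF: "continuous_on UNIV F"
    using D by (auto simp: continuous_on_eq_continuous_at intro: differentiable_imp_continuous_within)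
  have i_eq: "integral (cbox (- b) b) f = (LINT x|lborel. f x)"
    if "continuous_on UNIV f" "\<And>x. norm x > R + norm i \<Longrightarrow> f x = 0" for f :: "'a \<Rightarrow> real"
  proof -
    have "set_integrable lborel (cbox (- b) b) f"
      unfolding set_integrable_def
      by (rule borel_integrable_compact[OF compact_cbox continuous_on_subset[OF that(1)]]) simp
    from set_borel_integral_eq_integral(2)[OF this]
    have "integral (cbox (- b) b) f = (LINT x:cbox (- b) b|lborel. f x)" by simp
    also have "\<dots> = (LINT x|lborel. f x)"
      unfolding set_lebesgue_integral_def
    proof (rule Bochner_Integration.integral_cong[OF refl])
      fix x
      have "x \<in> cbox (- b) b \<or> f x = 0"
        using that(2)[of x] subsetD[OF b, of x] by (metis dist_0_norm linorder_not_less mem_cball)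
      then show "indicat_real (cbox (- b) b) x *\<^sub>R f x = f x" by auto
    qed
    finally show ?thesis .
  qed
  have dF: "((\<lambda>h. F (x + h *\<^sub>R i)) has_field_derivative partial_deriv i F (x + h *\<^sub>R i)) (at h)" for x h
  proof -
    have "(F has_derivative frechet_derivative F (at (x + h *\<^sub>R i))) (at (x + h *\<^sub>R i))"
      using D frechet_derivative_works by blast
    moreover have "((\<lambda>h. x + h *\<^sub>R i) has_derivative (\<lambda>k. k *\<^sub>R i)) (at h)"
      by (auto intro!: derivative_eq_intros)
    ultimately have "((\<lambda>h. F (x + h *\<^sub>R i)) has_derivative (\<lambda>k. frechet_derivative F (at (x + h *\<^sub>R i)) (k *\<^sub>R i))) (at h)"
      using has_derivative_compose[of "\<lambda>h. x + h *\<^sub>R i"] by blast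
    moreover have "linear (frechet_derivative F (at (x + h *\<^sub>R i)))"
      using D by (rule linear_frechet_derivative)
    ultimately show ?thesis
      unfolding has_field_derivative_def
      by (elim has_derivative_eq_rhs) (simp add: fun_eq_iff partial_deriv_def linear_cmul)
  qed
  have shift: "norm x > R + norm i \<Longrightarrow> h \<in> {-1<..<1} \<Longrightarrow> F (x + h *\<^sub>R i) = 0" for x h
  proof (rule supp, rule notI)
    assume *: "norm x > R + norm i" "h \<in> {-1<..<1}" "x + h *\<^sub>R i \<in> K"
    then have "norm (h *\<^sub>R i) \<le> norm i" 
      unfolding norm_scaleR by (intro mult_left_le_one_le) auto
    moreover have "norm x \<le> norm (x + h *\<^sub>R i) + norm (h *\<^sub>R i)"
      using norm_triangle_ineq4[of "x + h *\<^sub>R i" "h *\<^sub>R i"] by (simp only: add_diff_cancel_right')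
    ultimately show False using R[OF *(3)] *(1) by linarith
  qed
  have const: "integral (cbox (- b) b) (\<lambda>x. F (x + h *\<^sub>R i)) = (LINT x|lborel. F x)" if "h \<in> {-1<..<1}" for h
  proof -
    have "integral (cbox (- b) b) (\<lambda>x. F (x + h *\<^sub>R i)) = (LINT x|lborel. F (x + h *\<^sub>R i))"
      using shift that by (intro i_eq continuous_on_compose2[OF contF] continuous_intros) auto
    also have "\<dots> = (LINT x|distr lborel borel ((+) (h *\<^sub>R i)). F x)"
      using contF by (subst integral_distr) (auto simp: add.commute borel_measurable_continuous_onI)
    finally show ?thesis by (simp add: lborel_distr_plus)
  qed
  have "((\<lambda>h. integral (cbox (- b) b) (\<lambda>x. F (x + h *\<^sub>R i))) has_field_derivative
     integral (cbox (- b) b) (\<lambda>x. partial_deriv i F (x + 0 *\<^sub>R i))) (at 0 within {-1<..<1})"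
  proof (rule leibniz_rule_field_derivative)
    show "((\<lambda>h. F (x + h *\<^sub>R i)) has_field_derivative partial_deriv i F (x + h *\<^sub>R i)) (at h within {-1<..<1})" for h x
      using dF by (rule has_field_derivative_at_within)
    show "(\<lambda>x. F (x + h *\<^sub>R i)) integrable_on cbox (- b) b" for h
      by (intro integrable_continuous continuous_on_compose2[OF contF] continuous_intros) auto
    show "continuous_on ({-1<..<1} \<times> cbox (- b) b) (\<lambda>(h, x). partial_deriv i F (x + h *\<^sub>R i))"
      unfolding split_beta by (intro continuous_on_compose2[OF cont] continuous_intros) auto
  qed auto
  then have "((\<lambda>h. integral (cbox (- b) b) (\<lambda>x. F (x + h *\<^sub>R i))) has_field_derivative
     integral (cbox (- b) b) (partial_deriv i F)) (at 0)"
    by (simp add: at_within_open[of 0 "{-1<..<1::real}"])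
  then have "((\<lambda>h. LINT x|lborel. F x) has_field_derivative integral (cbox (- b) b) (partial_deriv i F)) (at 0)"
    by (rule has_field_derivative_transform_within_open[of _ _ _ "{-1<..<1}"]) (auto simp: const)
  then have int0: "integral (cbox (- b) b) (partial_deriv i F) = 0"
    by (rule DERIV_unique[OF _ DERIV_const])
  have pd0: "partial_deriv i F x = 0" if "norm x > R + norm i" for x
  proof -
    have "(F has_derivative (\<lambda>_. 0)) (at x)"
    proof (rule has_derivative_transform_within_open)
      show "((\<lambda>_. 0) has_derivative (\<lambda>_. 0)) (at x)" by simp
      show "open (- K)" using \<open>compact K\<close> by (simp add: compact_imp_closed open_Compl)
      show "x \<in> - K" using R[of x] that norm_ge_zero[of i] by fastforce
      show "\<And>x. x \<in> - K \<Longrightarrow> 0 = F x" using supp by simp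
    qed
    then show ?thesis by (rule partial_deriv_eqI)
  qed
  show ?thesis using i_eq[OF cont pd0] int0 by (rule trans[OF sym])
qed

text \<open>Radial functions are written as functions of x \<bullet> x, which is smooth at the
  origin, where the norm is not.\<close>

lemma radial_has_derivative:
  fixes x :: "'a::real_inner"
  assumes "\<And>s. (E has_real_derivative E' s) (at s)"
  shows "((\<lambda>x. E (x \<bullet> x)) has_derivative (\<lambda>h. 2 * E' (x \<bullet> x) * (x \<bullet> h))) (at x)"
proof -
  have "((\<lambda>x. x \<bullet> x) has_derivative (\<lambda>h. 2 * (x \<bullet> h))) (at x)"
    by (auto intro!: derivative_eq_intros simp: inner_commute)
  moreover have "(E has_derivative (*) (E' (x \<bullet> x))) (at (x \<bullet> x))"
    using assms by (simp add: has_field_derivative_def)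
  ultimately have "((\<lambda>x. E (x \<bullet> x)) has_derivative (\<lambda>h. E' (x \<bullet> x) * (2 * (x \<bullet> h)))) (at x)"
    by (rule has_derivative_compose)
  then show ?thesis by (simp add: mult_ac)
qed

lemma radial_has_derivative2:
  fixes x :: "'a::real_inner"
  assumes "\<And>s. (E' has_real_derivative E'' s) (at s)"
  shows "((\<lambda>x. 2 * E' (x \<bullet> x) * (x \<bullet> i)) has_derivative
    (\<lambda>h. 4 * E'' (x \<bullet> x) * (x \<bullet> h) * (x \<bullet> i) + 2 * E' (x \<bullet> x) * (h \<bullet> i))) (at x)"
  by (rule derivative_eq_intros radial_has_derivative[OF assms] refl)+ (simp add: fun_eq_iff algebra_simps)

lemma integrable_compact_support:
  fixes f :: "'a::euclidean_space \<Rightarrow> real"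
  assumes "continuous_on UNIV f" "compact K" "\<And>x. x \<notin> K \<Longrightarrow> f x = 0"
  shows "integrable lborel f"
proof -
  have "integrable lborel (\<lambda>x. indicator K x *\<^sub>R f x)"
    by (rule borel_integrable_compact[OF assms(2) continuous_on_subset[OF assms(1)]]) simp
  moreover have "(\<lambda>x. indicator K x *\<^sub>R f x) = f"
    using assms(3) by (auto simp: fun_eq_iff indicator_def)
  ultimately show ?thesis by simp
qed

text \<open>Differentiation under the integral followed by Green's second identity. With s = |x|^2
  the Laplacian of E(s) in dimension three is 4 s E'' + 6 E'. The test function vanishes for s > b
  with b < a^2, so there is no boundary term and all integrands extend by zero to continuous
  functions on the whole space.\<close>

lemma heat_radial_test:
  fixes u :: "real^3 \<Rightarrow> real \<Rightarrow> real"
  assumes u: "heat_solution (ball 0 a) u" and a: "0 < a" and b: "0 \<le> b" "b < a\<^sup>2"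
    and dE: "\<And>s. (E has_real_derivative E' s) (at s)"
    and dE': "\<And>s. (E' has_real_derivative E'' s) (at s)"
    and cE: "continuous_on UNIV E''"
    and z: "\<And>s. b < s \<Longrightarrow> E s = 0" "\<And>s. b < s \<Longrightarrow> E' s = 0" "\<And>s. b < s \<Longrightarrow> E'' s = 0"
    and t: "t > 0"
  shows "((\<lambda>t. LINT x:ball 0 a|lborel. u x t * E (x \<bullet> x)) has_real_derivative
     (LINT x:ball 0 a|lborel. u x t * (4 * (x \<bullet> x) * E'' (x \<bullet> x) + 6 * E' (x \<bullet> x)))) (at t)"
proof -
  define B :: "(real^3) set" where "B = ball 0 a"
  \<comment> \<open>\<open>B\<close> and \<open>V\<close> are open and cover the space, and on
    \<open>V\<close> the test function and its derivatives vanish. Regularity of an extension by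
    zero can thus be checked on the two sets separately.\<close>
  define V :: "(real^3) set" where "V = {x. b < x \<bullet> x}"
  define K :: "(real^3) set" where "K = cball 0 (sqrt b)"
  have oB: "open B" by (simp add: B_def)
  have oV: "open V" unfolding V_def by (intro open_Collect_less continuous_intros)
  have BV: "x \<in> B \<or> x \<in> V" for x
  proof -
    have "x \<in> V" if "a \<le> norm x"
    proof -
      have "a\<^sup>2 \<le> (norm x)\<^sup>2" using that a by (intro power_mono) auto
      then show ?thesis using b by (simp add: V_def power2_norm_eq_inner)
    qed
    then show ?thesis by (cases "a \<le> norm x") (auto simp: B_def)
  qed
  have KV: "x \<notin> K \<Longrightarrow> x \<in> V" for x
    using real_sqrt_less_iff[of b "x \<bullet> x"] by (simp add: K_def V_def norm_eq_sqrt_inner not_le)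
  have compK: "compact K" by (simp add: K_def)
  have ext: "continuous_on ({0<..} \<times> UNIV) (\<lambda>(t, x). if x \<in> B then g t x else 0)"
    if g: "continuous_on (B \<times> {0<..}) (\<lambda>(x, t). g t x)" and g0: "\<And>t x. x \<in> V \<Longrightarrow> g t x = 0" for g :: "real \<Rightarrow> real^3 \<Rightarrow> real"
  proof -
    have "continuous_on ({0<..} \<times> B \<union> {0<..} \<times> V) (\<lambda>(t, x). if x \<in> B then g t x else 0)"
    proof (rule continuous_on_open_Un)
      have "continuous_on ({0<..} \<times> B) (\<lambda>z. (\<lambda>(x, t). g t x) (snd z, fst z))"
        by (rule continuous_on_compose2[OF g]) (auto intro!: continuous_intros)
      then show "continuous_on ({0<..} \<times> B) (\<lambda>(t, x). if x \<in> B then g t x else 0)"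
        by (rule continuous_on_cong[THEN iffD1, rotated -1]) auto
      have "continuous_on ({0<..} \<times> V) (\<lambda>z. 0 :: real)" by simp
      then show "continuous_on ({0<..} \<times> V) (\<lambda>(t, x). if x \<in> B then g t x else 0)"
        by (rule continuous_on_cong[THEN iffD1, rotated -1]) (auto simp: g0)
    qed (auto intro!: open_Times oB oV)
    moreover have "{0<..} \<times> B \<union> {0<..} \<times> V = ({0<..} :: real set) \<times> UNIV" using BV by auto
    ultimately show ?thesis by simp
  qed
  have slice: "continuous_on UNIV (\<lambda>x. h t x)" if "continuous_on ({0<..} \<times> UNIV) (\<lambda>(t, x). h t x)" "t > 0"
    for h :: "real \<Rightarrow> real^3 \<Rightarrow> real" and t
    using continuous_on_compose2[OF that(1), of UNIV "\<lambda>x. (t, x)"] that(2) by (simp add: continuous_intros image_subset_iff)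
  have C: "C21_on B u" and heat: "\<And>x t. x \<in> B \<Longrightarrow> t > 0 \<Longrightarrow> laplacian (\<lambda>z. u z t) x = deriv (u x) t"
    using u by (auto simp: heat_solution_def B_def)
  note C' = C[unfolded C21_on_def]
  have cu: "continuous_on (B \<times> {0<..}) (\<lambda>(x, t). u x t)"
    and cut: "continuous_on (B \<times> {0<..}) (\<lambda>(x, t). deriv (u x) t)"
    and cu2: "i \<in> Basis \<Longrightarrow> continuous_on (B \<times> {0<..}) (\<lambda>(x, t). partial_deriv i (partial_deriv i (\<lambda>z. u z t)) x)" for i
    using C' by blast+
  have "continuous_on UNIV E" "continuous_on UNIV E'"
    using dE dE' by (auto intro!: DERIV_continuous simp: continuous_on_eq_continuous_at)
  then have cc: "continuous_on S (\<lambda>x. E (f x))" "continuous_on S (\<lambda>x. E' (f x))" "continuous_on S (\<lambda>x. E'' (f x))"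
    if "continuous_on S f" for f :: "'c::topological_space \<Rightarrow> real" and S
    using continuous_on_compose2[OF _ that subset_UNIV] cE by blast+
  define eta where "eta x = E (x \<bullet> x)" for x :: "real^3"
  define eta1 where "eta1 i x = 2 * E' (x \<bullet> x) * (x \<bullet> i)" for i x :: "real^3"
  define eta2 where "eta2 i x = 4 * E'' (x \<bullet> x) * (x \<bullet> i) * (x \<bullet> i) + 2 * E' (x \<bullet> x) * (i \<bullet> i)" for i x :: "real^3"
  define L where "L x = 4 * (x \<bullet> x) * E'' (x \<bullet> x) + 6 * E' (x \<bullet> x)" for x :: "real^3"
  have ce: "continuous_on S (\<lambda>z. eta (fst z))" "continuous_on S (\<lambda>z. eta1 i (fst z))"
    "continuous_on S (\<lambda>z. eta2 i (fst z))" "continuous_on S (\<lambda>z. L (fst z))" for i and S :: "((real^3) \<times> real) set"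
    unfolding eta_def eta1_def eta2_def L_def by (intro continuous_intros cc)+
  have eta0: "eta x = 0" "eta1 i x = 0" "eta2 i x = 0" "L x = 0" if "x \<in> V" for i x
    using that z by (auto simp: eta_def eta1_def eta2_def L_def V_def)
  have L_sum: "(\<Sum>i\<in>Basis. eta2 i x) = L x" for x
  proof -
    have *: "(\<Sum>i\<in>Basis. (x \<bullet> i) * (x \<bullet> i)) = x \<bullet> x"
      by (simp add: euclidean_inner[symmetric])
    have "(\<Sum>i\<in>Basis. eta2 i x) = 4 * E'' (x \<bullet> x) * (\<Sum>i\<in>Basis. (x \<bullet> i) * (x \<bullet> i)) + 2 * E' (x \<bullet> x) * (\<Sum>i\<in>(Basis::(real^3) set). i \<bullet> i)"
      unfolding eta2_def by (simp add: sum.distrib sum_distrib_left mult_ac)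
    then show ?thesis unfolding * by (simp add: L_def)
  qed
  \<comment> \<open>The i-th partial derivative of the i-th component of the field eta grad u - u
    grad eta; the mixed first-order terms cancel.\<close>
  define W where "W i x = (if x \<in> B then eta x * partial_deriv i (partial_deriv i (\<lambda>z. u z t)) x - u x t * eta2 i x else 0)" for i x
  have cW: "continuous_on UNIV (W i)" if "i \<in> Basis" for i
  proof -
    have "continuous_on (B \<times> {0<..}) (\<lambda>(x, t). eta x * partial_deriv i (partial_deriv i (\<lambda>z. u z t)) x - u x t * eta2 i x)"
      using cu cu2[OF that] ce unfolding split_beta by (intro continuous_intros) auto
    from slice[OF ext[OF this] t] show ?thesis
      unfolding W_def[abs_def] using eta0 by simp
  qed
  have intW: "(LINT x|lborel. W i x) = 0" if i: "i \<in> Basis" for i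
  proof -
    define F where "F x = (if x \<in> B then eta x * partial_deriv i (\<lambda>z. u z t) x - u x t * eta1 i x else 0)" for x
    have F: "(F has_derivative (\<lambda>h. 0)) (at x)" if "x \<in> V" for x
      by (rule has_derivative_transform_within_open[OF has_derivative_const[of 0] oV that]) (auto simp: F_def eta0)
    have F': "\<exists>D. (F has_derivative D) (at x) \<and> D i = W i x" if x: "x \<in> B" for x
    proof -
      have d1: "((\<lambda>z. u z t) has_derivative frechet_derivative (\<lambda>z. u z t) (at x)) (at x)"
        and d2: "(partial_deriv i (\<lambda>z. u z t) has_derivative frechet_derivative (partial_deriv i (\<lambda>z. u z t)) (at x)) (at x)"
        using C' x t i frechet_derivative_works by blast+
      have d3: "(eta has_derivative (\<lambda>h. eta1 h x)) (at x)"
        unfolding eta_def eta1_def using radial_has_derivative[of E E', OF dE] by blast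
      have d4: "(eta1 i has_derivative (\<lambda>h. 4 * E'' (x \<bullet> x) * (x \<bullet> h) * (x \<bullet> i) + 2 * E' (x \<bullet> x) * (h \<bullet> i))) (at x)"
        unfolding eta1_def[abs_def] by (rule radial_has_derivative2[OF dE'])
      note D = has_derivative_diff[OF has_derivative_mult[OF d3 d2] has_derivative_mult[OF d1 d4]]
      have FD: "(F has_derivative (\<lambda>h. eta x * frechet_derivative (partial_deriv i (\<lambda>z. u z t)) (at x) h + eta1 h x * partial_deriv i (\<lambda>z. u z t) x
        - (u x t * (4 * E'' (x \<bullet> x) * (x \<bullet> h) * (x \<bullet> i) + 2 * E' (x \<bullet> x) * (h \<bullet> i)) + frechet_derivative (\<lambda>z. u z t) (at x) h * eta1 i x))) (at x)"
        by (rule has_derivative_transform_within_open[OF D oB x]) (simp add: F_def)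
      show ?thesis
        by (rule exI, rule conjI, rule FD) (simp add: W_def x eta2_def partial_deriv_def)
    qed
    have dF: "F differentiable at x" for x
      using F F' BV unfolding differentiable_def by blast
    have pF: "partial_deriv i F = W i"
    proof
      fix x
      show "partial_deriv i F x = W i x"
      proof (cases "x \<in> B")
        case True
        then show ?thesis using F' partial_deriv_eqI by metis
      next
        case False
        then show ?thesis using BV F[THEN partial_deriv_eqI, of x i] by (auto simp: W_def)
      qed
    qed
    have "(LINT x|lborel. partial_deriv i F x) = 0"
      by (rule integral_partial_deriv_eq_0[OF dF _ compK]) (use KV eta0 in \<open>auto simp: pF cW[OF i] F_def\<close>)
    then show ?thesis by (simp add: pF)
  qed
  define P where "P t x = (if x \<in> B then u x t * eta x else 0)" for t x
  define P' where "P' t x = (if x \<in> B then deriv (u x) t * eta x else 0)" for t x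
  define Q where "Q x = (if x \<in> B then u x t * L x else 0)" for x
  have cP: "continuous_on ({0<..} \<times> UNIV) (\<lambda>(t, x). P t x)"
    unfolding P_def using cu ce eta0 by (intro ext) (auto intro!: continuous_intros simp: split_beta)
  have cP': "continuous_on ({0<..} \<times> UNIV) (\<lambda>(t, x). P' t x)"
    unfolding P'_def using cut ce eta0 by (intro ext) (auto intro!: continuous_intros simp: split_beta)
  have cQ: "continuous_on UNIV Q"
  proof -
    have "continuous_on (B \<times> {0<..}) (\<lambda>(x, t). u x t * L x)"
      using cu ce unfolding split_beta by (intro continuous_intros) auto
    from slice[OF ext[OF this] t] show ?thesis unfolding Q_def[abs_def] using eta0 by simp
  qed
  have int: "integrable lborel (P s)" "integrable lborel (P' s)" if "s > 0" for s
    using slice[OF cP that] slice[OF cP' that] compK KV eta0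
    by (auto intro!: integrable_compact_support[of _ K] simp: P_def P'_def)
  have intQ: "integrable lborel Q"
    using cQ compK KV eta0 by (auto intro!: integrable_compact_support[of _ K] simp: Q_def)
  have iW: "integrable lborel (W i)" if "i \<in> Basis" for i
    using cW[OF that] compK KV eta0 by (auto intro!: integrable_compact_support[of _ K] simp: W_def)
  have "P' t x - Q x = (\<Sum>i\<in>Basis. W i x)" for x
  proof (cases "x \<in> B")
    case True
    then have "(\<Sum>i\<in>Basis. W i x) = eta x * laplacian (\<lambda>z. u z t) x - u x t * L x"
      by (simp add: W_def sum_subtractf sum_distrib_left[symmetric] L_sum laplacian_def)
    then show ?thesis using True heat[OF True t] by (simp add: P'_def Q_def mult.commute)
  qed (simp add: P'_def Q_def W_def)
  then have "(LINT x|lborel. P' t x) - (LINT x|lborel. Q x) = (LINT x|lborel. (\<Sum>i\<in>Basis. W i x))"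
    using int(2)[OF t] intQ by (simp flip: Bochner_Integration.integral_diff)
  also have "\<dots> = 0" using iW intW by simp
  finally have PQ: "(LINT x|lborel. P' t x) = (LINT x|lborel. Q x)" by simp
  obtain c :: "real^3" where c: "K \<subseteq> cbox (- c) c"
    using bounded_subset_cbox_symmetric[OF compact_imp_bounded[OF compK]] by blast
  have toint: "integral (cbox (- c) c) f = (LINT x|lborel. f x)"
    if "integrable lborel f" "\<And>x. x \<notin> K \<Longrightarrow> f x = 0" for f :: "real^3 \<Rightarrow> real"
  proof -
    have eq: "indicat_real (cbox (- c) c) x *\<^sub>R f x = f x" for x
      using that(2)[of x] c by (auto simp: indicator_def)
    have "set_integrable lborel (cbox (- c) c) f"
      unfolding set_integrable_def eq by (rule that(1))
    from set_borel_integral_eq_integral(2)[OF this] show ?thesis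
      unfolding set_lebesgue_integral_def eq by simp
  qed
  have "((\<lambda>s. integral (cbox (- c) c) (P s)) has_field_derivative integral (cbox (- c) c) (P' t)) (at t within {0<..})"
  proof (rule leibniz_rule_field_derivative)
    fix s :: real and x assume "s \<in> {0<..}"
    have "((\<lambda>s. P s x) has_field_derivative P' s x) (at s)"
    proof (cases "x \<in> B")
      case True
      then have "u x differentiable at s" using C' \<open>s \<in> {0<..}\<close> by auto
      then have "(u x has_real_derivative deriv (u x) s) (at s)"
        using DERIV_deriv_iff_real_differentiable by blast
      from DERIV_cmult_right[OF this, of "eta x"] show ?thesis using True by (simp add: P_def P'_def)
    qed (simp add: P_def P'_def)
    then show "((\<lambda>s. P s x) has_field_derivative P' s x) (at s within {0<..})"
      by (rule has_field_derivative_at_within)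
  next
    fix s :: real assume "s \<in> {0<..}"
    then show "P s integrable_on cbox (- c) c"
      using slice[OF cP, of s] by (intro integrable_continuous) (auto intro: continuous_on_subset)
  next
    show "continuous_on ({0<..} \<times> cbox (- c) c) (\<lambda>(t, x). P' t x)"
      using cP' by (rule continuous_on_subset) auto
  qed (use t in auto)
  then have "((\<lambda>s. integral (cbox (- c) c) (P s)) has_field_derivative integral (cbox (- c) c) (P' t)) (at t)"
    using t by (simp add: at_within_open[of t "{0<..}"])
  moreover have "integral (cbox (- c) c) (P' t) = (LINT x:ball 0 a|lborel. u x t * L x)"
  proof -
    have "integral (cbox (- c) c) (P' t) = (LINT x|lborel. P' t x)"
      using int(2)[OF t] KV eta0 by (intro toint) (auto simp: P'_def)
    then show ?thesis
      unfolding PQ by (auto simp: Q_def B_def set_lebesgue_integral_def intro!: Bochner_Integration.integral_cong)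
  qed
  moreover have "integral (cbox (- c) c) (P s) = (LINT x:ball 0 a|lborel. u x s * eta x)" if "s \<in> {0<..}" for s
    using int(1)[of s] KV eta0 that
    by (subst toint) (auto simp: P_def B_def set_lebesgue_integral_def intro!: Bochner_Integration.integral_cong)
  ultimately have "((\<lambda>s. LINT x:ball 0 a|lborel. u x s * eta x) has_real_derivative
      (LINT x:ball 0 a|lborel. u x t * L x)) (at t)"
    using t by (auto intro: has_field_derivative_transform_within_open[of _ _ _ "{0<..}"])
  then show ?thesis by (simp add: eta_def L_def)
qed

section \<open>Radial eigenfunctions as power series in the squared radius\<close>

definition rsinc_coeff :: "real \<Rightarrow> nat \<Rightarrow> real" where
  "rsinc_coeff k n = (- 1) ^ n * k ^ (2 * n + 1) / fact (2 * n + 1)"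

text \<open>The value at \<open>r\<^sup>2\<close> is \<open>sin (k r) / r\<close>, the radial Dirichlet eigenfunction of the ball.\<close>

definition rsinc :: "real \<Rightarrow> real \<Rightarrow> real" where
  "rsinc k s = (\<Sum>n. rsinc_coeff k n * s ^ n)"

lemma rsinc_summable: "summable (\<lambda>n. rsinc_coeff k n * s ^ n)"
proof (rule summable_comparison_test')
  show "summable (\<lambda>n. \<bar>k\<bar> * (inverse (fact n) * (k\<^sup>2 * \<bar>s\<bar>) ^ n))"
    by (intro summable_mult summable_exp)
  fix n :: nat
  have "norm (rsinc_coeff k n * s ^ n) = \<bar>k\<bar> * (inverse (fact (2 * n + 1)) * (k\<^sup>2 * \<bar>s\<bar>) ^ n)"
    by (simp add: rsinc_coeff_def abs_mult power_abs power_mult_distrib power_mult divide_inverse del: fact_Suc)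
  also have "\<dots> \<le> \<bar>k\<bar> * (inverse (fact n) * (k\<^sup>2 * \<bar>s\<bar>) ^ n)"
    by (intro mult_left_mono mult_right_mono le_imp_inverse_le fact_mono) auto
  finally show "norm (rsinc_coeff k n * s ^ n) \<le> \<bar>k\<bar> * (inverse (fact n) * (k\<^sup>2 * \<bar>s\<bar>) ^ n)" .
qed

lemma rsinc_square: "r * rsinc k (r\<^sup>2) = sin (k * r)"
proof -
  have "(\<lambda>n. r * (rsinc_coeff k n * (r\<^sup>2) ^ n)) sums (r * rsinc k (r\<^sup>2))"
    unfolding rsinc_def by (intro sums_mult summable_sums rsinc_summable)
  moreover have "(\<lambda>n. r * (rsinc_coeff k n * (r\<^sup>2) ^ n)) = (\<lambda>n. (- 1) ^ n / fact (2 * n + 1) * (k * r) ^ (2 * n + 1))"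
    by (simp add: fun_eq_iff rsinc_coeff_def power_mult_distrib power_mult del: fact_Suc)
  ultimately show ?thesis using sin_paired[of "k * r"] sums_unique2 by (metis (no_types, lifting))
qed

definition rsinc' :: "real \<Rightarrow> real \<Rightarrow> real" where
  "rsinc' k s = (\<Sum>n. diffs (rsinc_coeff k) n * s ^ n)"

definition rsinc'' :: "real \<Rightarrow> real \<Rightarrow> real" where
  "rsinc'' k s = (\<Sum>n. diffs (diffs (rsinc_coeff k)) n * s ^ n)"

lemma rsinc'_summable: "summable (\<lambda>n. diffs (rsinc_coeff k) n * s ^ n)"
  by (rule termdiff_converges_all) (rule rsinc_summable)

lemma rsinc''_summable: "summable (\<lambda>n. diffs (diffs (rsinc_coeff k)) n * s ^ n)"
  by (rule termdiff_converges_all) (rule rsinc'_summable)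

lemma rsinc_deriv: "(rsinc k has_real_derivative rsinc' k s) (at s)"
  unfolding rsinc_def[abs_def] rsinc'_def
  by (rule termdiffs_strong_converges_everywhere) (rule rsinc_summable)

lemma rsinc'_deriv: "(rsinc' k has_real_derivative rsinc'' k s) (at s)"
  unfolding rsinc'_def[abs_def] rsinc''_def
  by (rule termdiffs_strong_converges_everywhere) (rule rsinc'_summable)

lemma rsinc''_continuous: "isCont (rsinc'' k) s"
  unfolding rsinc''_def[abs_def]
  by (rule DERIV_isCont[OF termdiffs_strong_converges_everywhere]) (rule rsinc''_summable)

text \<open>With s = |x|^2 the left side is the Laplacian of the radial function, so this is its
  eigenvalue equation. In coefficients it is the recursion (4 n + 6) (n + 1) c (n + 1) = - k^2 c
  n.\<close>

lemma rsinc_ode: "4 * s * rsinc'' k s + 6 * rsinc' k s = - k\<^sup>2 * rsinc k s"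
proof -
  have "(\<lambda>n. diffs (diffs (rsinc_coeff k)) n * s ^ n) sums rsinc'' k s"
    unfolding rsinc''_def by (intro summable_sums rsinc''_summable)
  from sums_mult[OF this, of s]
  have "(\<lambda>n. s * (diffs (diffs (rsinc_coeff k)) n * s ^ n)) sums (s * rsinc'' k s)" .
  then have "(\<lambda>n. real (Suc n) * diffs (rsinc_coeff k) (Suc n) * s ^ Suc n) sums (s * rsinc'' k s)"
    by (simp add: diffs_def mult_ac)
  \<comment> \<open>The factor s shifts the index by one; the new zeroth term is zero, so the two
    series can be added termwise.\<close>
  then have "(\<lambda>n. real n * diffs (rsinc_coeff k) n * s ^ n) sums (s * rsinc'' k s)"
    by (subst (asm) sums_Suc_iff) simp
  moreover have "(\<lambda>n. diffs (rsinc_coeff k) n * s ^ n) sums rsinc' k s"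
    unfolding rsinc'_def by (intro summable_sums rsinc'_summable)
  ultimately have "(\<lambda>n. 4 * (real n * diffs (rsinc_coeff k) n * s ^ n) + 6 * (diffs (rsinc_coeff k) n * s ^ n)) sums
     (4 * (s * rsinc'' k s) + 6 * rsinc' k s)"
    by (intro sums_add sums_mult)
  moreover have "4 * (real n * diffs (rsinc_coeff k) n * s ^ n) + 6 * (diffs (rsinc_coeff k) n * s ^ n) = - k\<^sup>2 * (rsinc_coeff k n * s ^ n)" for n
  proof -
    have f1: "fact (2 * Suc n + 1) = (2 * real n + 3) * ((2 * real n + 2) * fact (2 * n + 1))"
      by (simp add: algebra_simps)
    have f2: "k ^ (2 * Suc n + 1) = k\<^sup>2 * k ^ (2 * n + 1)" by (simp add: power2_eq_square)
    have gen: "(- 1 * A) * (k2 * K) / (x * (y * F)) * (y * x) = - k2 * (A * K / F)"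
      if "x \<noteq> 0" "y \<noteq> 0" "F \<noteq> 0" for A k2 K x y F :: real
      using that by simp
    have "2 * real n + 2 \<noteq> 0" "2 * real n + 3 \<noteq> 0" using of_nat_0_le_iff[of n] by linarith+
    then have "rsinc_coeff k (Suc n) * ((2 * real n + 2) * (2 * real n + 3)) = - k\<^sup>2 * rsinc_coeff k n"
      unfolding rsinc_coeff_def power_Suc[of "- 1"] f1 f2 by (intro gen) (auto simp del: fact_Suc)
    moreover have "diffs (rsinc_coeff k) n = (real n + 1) * rsinc_coeff k (Suc n)"
      by (simp add: diffs_def)
    ultimately have *: "(4 * real n + 6) * diffs (rsinc_coeff k) n = - k\<^sup>2 * rsinc_coeff k n"
      by (simp add: algebra_simps)
    have "4 * (real n * diffs (rsinc_coeff k) n * s ^ n) + 6 * (diffs (rsinc_coeff k) n * s ^ n) =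
      ((4 * real n + 6) * diffs (rsinc_coeff k) n) * s ^ n" by (simp add: algebra_simps)
    then show ?thesis unfolding * by (simp add: mult.assoc)
  qed
  moreover have "(\<lambda>n. - k\<^sup>2 * (rsinc_coeff k n * s ^ n)) sums (- k\<^sup>2 * rsinc k s)"
    unfolding rsinc_def by (intro sums_mult summable_sums rsinc_summable)
  ultimately show ?thesis using sums_unique2 by (simp add: mult.assoc)
qed

section \<open>A cut-off near the sphere\<close>

text \<open>Here w stands for a^2 - |x|^2. The cube makes the function twice continuously
  differentiable at w = e. The form 1 - e / w, rather than a rescaled bump, has derivatives of size
  e / w^2 and e / w^3, so that the resulting error terms have a majorant independent of e and vanish
  by dominated convergence.\<close>

definition cutoff :: "real \<Rightarrow> real \<Rightarrow> real" where
  "cutoff e w = (if e < w then (1 - e / w) ^ 3 else 0)"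

definition cutoff' :: "real \<Rightarrow> real \<Rightarrow> real" where
  "cutoff' e w = (if e < w then 3 * (1 - e / w)\<^sup>2 * (e / w\<^sup>2) else 0)"

definition cutoff'' :: "real \<Rightarrow> real \<Rightarrow> real" where
  "cutoff'' e w = (if e < w then 6 * (1 - e / w) * (e\<^sup>2 / w ^ 4) - 6 * (1 - e / w)\<^sup>2 * (e / w ^ 3) else 0)"

text \<open>Handles the gluing point w = e, where the cut-off and its first derivative are O((w -
  e)^2).\<close>

lemma DERIV_zero_quadratic:
  fixes f :: "real \<Rightarrow> real"
  assumes "\<And>y. \<bar>f y\<bar> \<le> C * (y - x)\<^sup>2"
  shows "(f has_real_derivative 0) (at x)"
proof -
  have fx: "f x = 0" using assms[of x] by simp
  have "((\<lambda>h. (f (x + h) - f x) / h) \<longlongrightarrow> 0) (at 0)"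
  proof (rule Lim_null_comparison)
    show "\<forall>\<^sub>F h in at 0. norm ((f (x + h) - f x) / h) \<le> C * \<bar>h\<bar>"
    proof (rule eventually_at_filter[THEN iffD2], rule always_eventually, intro allI impI)
      fix h :: real assume "h \<noteq> 0"
      then show "norm ((f (x + h) - f x) / h) \<le> C * \<bar>h\<bar>"
        using assms[of "x + h"] by (simp add: fx divide_le_eq power2_eq_square mult.assoc flip: abs_mult)
    qed
    have "((\<lambda>h. C * \<bar>h\<bar>) \<longlongrightarrow> C * \<bar>0\<bar>) (at (0::real))"
      by (intro tendsto_intros)
    then show "((\<lambda>h. C * \<bar>h\<bar>) \<longlongrightarrow> 0) (at (0::real))" by simp
  qed
  then show ?thesis by (simp add: DERIV_def)
qed

lemma cutoff_ratio_bound: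
  fixes e w :: real
  assumes "0 < e" "e < w"
  shows "0 \<le> 1 - e / w" "1 - e / w \<le> 1" "1 - e / w \<le> (w - e) / e"
proof -
  have w: "0 < w" using assms by linarith
  show "0 \<le> 1 - e / w" using w assms by simp
  show "1 - e / w \<le> 1" using w assms by simp
  have "(w - e) / w \<le> (w - e) / e" using assms by (intro divide_left_mono) auto
  then show "1 - e / w \<le> (w - e) / e" using w by (simp add: diff_divide_distrib)
qed

lemma cutoff_deriv:
  assumes "0 < e"
  shows "(cutoff e has_real_derivative cutoff' e w) (at w)"
proof -
  consider "w < e" | "w = e" | "e < w" by linarith
  then show ?thesis
  proof cases
    case 1
    then show ?thesis
      by (auto intro: has_field_derivative_transform_within_open[of "\<lambda>_. 0" _ _ "{..<e}"] simp: cutoff_def cutoff'_def)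
  next
    case 2
    have "\<bar>cutoff e y\<bar> \<le> 1 / e\<^sup>2 * (y - e)\<^sup>2" for y
    proof (cases "e < y")
      case True
      note r = cutoff_ratio_bound[OF assms True]
      have "(1 - e / y) ^ 3 \<le> (1 - e / y)\<^sup>2" using r by (intro power_decreasing) auto
      also have "\<dots> \<le> ((y - e) / e)\<^sup>2" using r by (intro power_mono) auto
      finally show ?thesis using r by (simp add: cutoff_def power_divide True)
    qed (simp add: cutoff_def)
    from DERIV_zero_quadratic[of "cutoff e", OF this] show ?thesis using 2 by (simp add: cutoff'_def)
  next
    case 3
    have "((\<lambda>w. (1 - e / w) ^ 3) has_real_derivative 3 * (1 - e / w)\<^sup>2 * (e / w\<^sup>2)) (at w)"
      using 3 assms by (auto intro!: derivative_eq_intros simp: power2_eq_square)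
    then show ?thesis using 3
      by (auto intro: has_field_derivative_transform_within_open[of _ _ _ "{e<..}"] simp: cutoff_def cutoff'_def)
  qed
qed

lemma cutoff'_deriv:
  assumes "0 < e"
  shows "(cutoff' e has_real_derivative cutoff'' e w) (at w)"
proof -
  consider "w < e" | "w = e" | "e < w" by linarith
  then show ?thesis
  proof cases
    case 1
    then show ?thesis
      by (auto intro: has_field_derivative_transform_within_open[of "\<lambda>_. 0" _ _ "{..<e}"] simp: cutoff'_def cutoff''_def)
  next
    case 2
    have "\<bar>cutoff' e y\<bar> \<le> 3 / e ^ 3 * (y - e)\<^sup>2" for y
    proof (cases "e < y")
      case True
      note r = cutoff_ratio_bound[OF assms True]
      have "3 * (1 - e / y)\<^sup>2 * (e / y\<^sup>2) \<le> 3 * ((y - e) / e)\<^sup>2 * (e / e\<^sup>2)"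
        using r True assms by (intro mult_mono power_mono divide_left_mono) auto
      also have "\<dots> = 3 / e ^ 3 * (y - e)\<^sup>2"
        using assms by (simp add: power2_eq_square power3_eq_cube)
      finally show ?thesis using r True assms by (simp add: cutoff'_def)
    qed (use assms in \<open>simp add: cutoff'_def\<close>)
    from DERIV_zero_quadratic[of "cutoff' e", OF this] show ?thesis using 2 by (simp add: cutoff''_def)
  next
    case 3
    have "((\<lambda>w. 3 * (1 - e / w)\<^sup>2 * (e / w\<^sup>2)) has_real_derivative 6 * (1 - e / w) * (e\<^sup>2 / w ^ 4) - 6 * (1 - e / w)\<^sup>2 * (e / w ^ 3)) (at w)"
      using 3 assms by (auto intro!: derivative_eq_intros simp: power2_eq_square eval_nat_numeral field_simps)
    then show ?thesis using 3
      by (auto intro: has_field_derivative_transform_within_open[of _ _ _ "{e<..}"] simp: cutoff'_def cutoff''_def)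
  qed
qed

lemma cutoff''_continuous:
  assumes "0 < e"
  shows "isCont (cutoff'' e) w"
proof -
  \<comment> \<open>Freezing w at max e w reproduces the zero branch, since both terms contain the
    factor 1 - e / w, which is 0 at w = e.\<close>
  have eq: "cutoff'' e = (\<lambda>w. 6 * (1 - e / max e w) * (e\<^sup>2 / max e w ^ 4) - 6 * (1 - e / max e w)\<^sup>2 * (e / max e w ^ 3))"
    using assms by (auto simp: fun_eq_iff cutoff''_def max_def)
  have "max e w \<noteq> 0" using assms by auto
  then show ?thesis unfolding eq by (intro continuous_intros) auto
qed

lemma cutoff_bounds:
  assumes "0 < e"
  shows "0 \<le> cutoff e w" "cutoff e w \<le> 1"
    and "e < w \<Longrightarrow> \<bar>cutoff' e w\<bar> \<le> 3 * (e / w\<^sup>2)"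
    and "e < w \<Longrightarrow> \<bar>cutoff'' e w\<bar> \<le> 12 * (e / w ^ 3)"
proof -
  show "0 \<le> cutoff e w" "cutoff e w \<le> 1"
    using cutoff_ratio_bound[OF assms, of w] by (auto simp: cutoff_def power_le_one)
  assume w: "e < w"
  note r = cutoff_ratio_bound[OF assms w]
  have q: "0 \<le> (1 - e / w)\<^sup>2" "(1 - e / w)\<^sup>2 \<le> 1" using r by (auto simp: power_le_one)
  have "3 * (1 - e / w)\<^sup>2 * (e / w\<^sup>2) \<le> 3 * 1 * (e / w\<^sup>2)"
    using q w assms by (intro mult_right_mono mult_left_mono) auto
  then show "\<bar>cutoff' e w\<bar> \<le> 3 * (e / w\<^sup>2)" using w assms by (simp add: cutoff'_def)
  have 1: "\<bar>6 * (1 - e / w) * (e\<^sup>2 / w ^ 4)\<bar> \<le> 6 * 1 * (e / w ^ 3)"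
  proof -
    have "e\<^sup>2 / w ^ 4 \<le> e / w ^ 3"
      using w assms by (simp add: field_simps eval_nat_numeral)
    then show ?thesis using r unfolding abs_mult by (intro mult_mono) auto
  qed
  have 2: "\<bar>6 * (1 - e / w)\<^sup>2 * (e / w ^ 3)\<bar> \<le> 6 * 1 * (e / w ^ 3)"
    using q w assms unfolding abs_mult by (intro mult_mono) auto
  show "\<bar>cutoff'' e w\<bar> \<le> 12 * (e / w ^ 3)"
    unfolding cutoff''_def if_P[OF w] using 1 2 by linarith
qed

text \<open>The hypothesis sin (k a) = 0 makes the eigenfunction vanish on the sphere; a bound for
  its derivative on the compact interval then gives linear decay in a^2 - s.\<close>

lemma rsinc_boundary_bound:
  assumes "0 < a" "sin (k * a) = 0"
  obtains C where "C \<ge> 0" "\<And>s. 0 \<le> s \<Longrightarrow> s \<le> a\<^sup>2 \<Longrightarrow> \<bar>rsinc k s\<bar> \<le> C * (a\<^sup>2 - s)"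
    "\<And>s. 0 \<le> s \<Longrightarrow> s \<le> a\<^sup>2 \<Longrightarrow> \<bar>rsinc' k s\<bar> \<le> C"
proof -
  have "continuous_on {0..a\<^sup>2} (rsinc' k)"
    using DERIV_isCont[OF rsinc'_deriv] by (intro continuous_at_imp_continuous_on) auto
  then obtain C where C: "C > 0" "\<And>s. s \<in> {0..a\<^sup>2} \<Longrightarrow> \<bar>rsinc' k s\<bar> \<le> C"
    using compact_imp_bounded[OF compact_continuous_image[of "{0..a\<^sup>2}" "rsinc' k"]] 
    unfolding bounded_pos by auto
  have 0: "rsinc k (a\<^sup>2) = 0" using rsinc_square[of a k] assms by simp
  have "\<bar>rsinc k s\<bar> \<le> C * (a\<^sup>2 - s)" if "0 \<le> s" "s \<le> a\<^sup>2" for s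
  proof -
    have "norm (rsinc k s - rsinc k (a\<^sup>2)) \<le> C * norm (s - a\<^sup>2)"
      by (rule field_differentiable_bound[of "{0..a\<^sup>2}" _ "rsinc' k"])
         (use that C in \<open>auto intro: has_field_derivative_at_within[OF rsinc_deriv]\<close>)
    then show ?thesis using that 0 by simp
  qed
  then show thesis using that[of C] C by auto
qed

section \<open>Action of the Dirichlet kernel on the eigenfunctions\<close>

text \<open>The indicator belongs to the statement because nothing is known about \<open>p\<close>
  outside U.\<close>

lemma dirichlet_heat_kernel_slice_measurable:
  assumes p: "dirichlet_heat_kernel U p" and U: "open U" and y: "y \<in> U" and t: "t > 0"
  shows "(\<lambda>x. indicator U x * p x y t) \<in> borel_measurable borel"
proof -
  have c: "continuous_on (U \<times> U \<times> {0<..}) (\<lambda>(x, y, t). p x y t)"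
    using p by (auto simp: dirichlet_heat_kernel_def positive_fundamental_solution_def)
  have "continuous_on U (\<lambda>x. p x y t)"
    using continuous_on_compose2[OF c, of U "\<lambda>x. (x, y, t)"] y t by (auto simp: continuous_intros)
  from borel_measurable_continuous_on_indicator[OF _ this] U show ?thesis
    by (simp add: borel_open)
qed

lemma dirichlet_heat_kernel_integrable:
  fixes y :: "real^3"
  assumes p: "dirichlet_heat_kernel (ball 0 a) p" and y: "y \<in> ball 0 a" and t: "t > 0"
    and g[measurable]: "g \<in> borel_measurable borel" and M: "\<And>x. x \<in> ball 0 a \<Longrightarrow> \<bar>g x\<bar> \<le> M"
  shows "set_integrable lborel (ball 0 a) (\<lambda>x. p x y t * g x)"
    and "(LINT x:ball 0 a|lborel. p x y t) \<le> 1"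
proof -
  have pos: "0 < p x y t" if "x \<in> ball 0 a" for x
    using p y t that by (auto simp: dirichlet_heat_kernel_def positive_fundamental_solution_def)
  have M0: "0 \<le> M" using M[OF y] by linarith
  note [measurable] = dirichlet_heat_kernel_slice_measurable[OF p open_ball y t]
  note g1 = gauss3_integral[OF t, of y]
  have "integrable lborel (\<lambda>x. indicator (ball 0 a) x * p x y t * g x)"
  proof (rule Bochner_Integration.integrable_bound)
    show "integrable lborel (\<lambda>x. M * gauss3 t (x - y))" using g1 by (simp add: has_bochner_integral_iff)
    show "AE x in lborel. norm (indicator (ball 0 a) x * p x y t * g x) \<le> norm (M * gauss3 t (x - y))"
    proof (rule AE_I2)
      fix x
      have "\<bar>g x\<bar> * p x y t \<le> M * gauss3 t (x - y)" if "x \<in> ball 0 a"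
        using dirichlet_heat_kernel_bound(1)[OF p that y t] M[OF that] pos[OF that] M0 by (intro mult_mono) auto
      then show "norm (indicator (ball 0 a) x * p x y t * g x) \<le> norm (M * gauss3 t (x - y))"
        using pos[of x] M0 by (cases "x \<in> ball 0 a") (auto simp: abs_mult mult.commute)
    qed
  qed measurable
  then show "set_integrable lborel (ball 0 a) (\<lambda>x. p x y t * g x)"
    by (simp add: set_integrable_def mult.assoc)
  have "(LINT x:ball 0 a|lborel. p x y t) \<le> (LINT x|lborel. gauss3 t (x - y))"
    unfolding set_lebesgue_integral_def
  proof (rule integral_mono')
    show "integrable lborel (\<lambda>x. gauss3 t (x - y))" using g1 by (simp add: has_bochner_integral_iff)
  qed (use dirichlet_heat_kernel_bound(1)[OF p _ y t] in \<open>auto simp: indicator_def\<close>)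
  then show "(LINT x:ball 0 a|lborel. p x y t) \<le> 1" using g1 by (simp add: has_bochner_integral_iff)
qed

lemma cutoff_tendsto:
  assumes "0 < w" "e \<longlonglongrightarrow> 0"
  shows "(\<lambda>n. cutoff (e n) w) \<longlonglongrightarrow> 1"
proof -
  have "(\<lambda>n. (1 - e n / w) ^ 3) \<longlonglongrightarrow> (1 - 0 / w) ^ 3"
    using assms by (intro tendsto_intros) auto
  moreover have "\<forall>\<^sub>F n in sequentially. (1 - e n / w) ^ 3 = cutoff (e n) w"
    using order_tendstoD(2)[OF assms(2) assms(1)] by eventually_elim (simp add: cutoff_def)
  ultimately show ?thesis using Lim_transform_eventually by fastforce
qed

text \<open>Commutator term: what the radial Laplacian 4 s E'' + 6 E' of \<open>rsinc\<close> times
  the cut-off leaves over once the eigenvalue term is removed. The signs come from the argument a^2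
  - s of the cut-off.\<close>

definition cutoff_error :: "real \<Rightarrow> real \<Rightarrow> real \<Rightarrow> real \<Rightarrow> real" where
  "cutoff_error k a e s = - 8 * s * rsinc' k s * cutoff' e (a\<^sup>2 - s) + 4 * s * rsinc k s * cutoff'' e (a\<^sup>2 - s)
     - 6 * rsinc k s * cutoff' e (a\<^sup>2 - s)"

text \<open>The linear decay of the eigenfunction turns the e / w^3 of \<open>cutoff''\<close> into
  e / w^2, the size of the other two terms. The constant is 90 = 24 + 48 + 18.\<close>

lemma cutoff_error_bound:
  assumes "0 < e" and C: "C \<ge> 0" "\<bar>rsinc k s\<bar> \<le> C * (a\<^sup>2 - s)" "\<bar>rsinc' k s\<bar> \<le> C" and s: "0 \<le> s" "s \<le> a\<^sup>2"
  shows "\<bar>cutoff_error k a e s\<bar> \<le> (if e < a\<^sup>2 - s then 90 * a\<^sup>2 * C * (e / (a\<^sup>2 - s)\<^sup>2) else 0)"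
proof (cases "e < a\<^sup>2 - s")
  case True
  define w where "w = a\<^sup>2 - s"
  have w: "e < w" "0 < w" "w \<le> a\<^sup>2" using True s assms(1) by (auto simp: w_def)
  note b = cutoff_bounds(3)[OF assms(1) w(1)] cutoff_bounds(4)[OF assms(1) w(1)]
  have S: "\<bar>rsinc k s\<bar> \<le> C * w" using C by (simp add: w_def)
  define q where "q = e / w\<^sup>2"
  have q: "q \<ge> 0" using assms w by (simp add: q_def)
  have 1: "\<bar>8 * s * rsinc' k s * cutoff' e w\<bar> \<le> 8 * a\<^sup>2 * C * (3 * q)"
    unfolding abs_mult using C b s by (intro mult_mono) (auto simp: q_def)
  have 2: "\<bar>4 * s * rsinc k s * cutoff'' e w\<bar> \<le> 4 * a\<^sup>2 * C * (12 * q)"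
  proof -
    have "\<bar>4 * s * rsinc k s * cutoff'' e w\<bar> \<le> 4 * a\<^sup>2 * (C * w) * (12 * (e / w ^ 3))"
      unfolding abs_mult using S b s C w by (intro mult_mono) auto
    also have "\<dots> = 4 * a\<^sup>2 * C * (12 * q)"
      using w by (simp add: q_def power2_eq_square power3_eq_cube)
    finally show ?thesis .
  qed
  have 3: "\<bar>6 * rsinc k s * cutoff' e w\<bar> \<le> 6 * (C * a\<^sup>2) * (3 * q)"
  proof -
    have "C * w \<le> C * a\<^sup>2" using C w by (intro mult_left_mono) auto
    then show ?thesis
      unfolding abs_mult using S b C w by (intro mult_mono) (auto simp: q_def)
  qed
  have "\<bar>cutoff_error k a e s\<bar> \<le> \<bar>8 * s * rsinc' k s * cutoff' e w\<bar> + \<bar>4 * s * rsinc k s * cutoff'' e w\<bar> + \<bar>6 * rsinc k s * cutoff' e w\<bar>"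
    unfolding cutoff_error_def w_def[symmetric] by linarith
  also have "\<dots> \<le> 8 * a\<^sup>2 * C * (3 * q) + 4 * a\<^sup>2 * C * (12 * q) + 6 * (C * a\<^sup>2) * (3 * q)"
    by (intro add_mono 1 2 3)
  also have "\<dots> = 90 * a\<^sup>2 * C * q" by (simp add: algebra_simps)
  finally show ?thesis using True by (simp add: q_def w_def)
qed (simp add: cutoff_error_def cutoff'_def cutoff''_def)

text \<open>This weight remains when the error of order e / w^2 meets the kernel bound of order w.
  It is at most 1 and tends to 0 at each point, so dominated convergence on the ball
  applies.\<close>

lemma set_integral_cutoff_weight_tendsto:
  assumes e: "e \<longlonglongrightarrow> 0" "\<And>n. 0 < e n" and "0 < a"
  shows "(\<lambda>n. LINT x:ball (0::real^3) a|lborel. (if e n < a\<^sup>2 - x \<bullet> x then e n / (a\<^sup>2 - x \<bullet> x) else 0)) \<longlonglongrightarrow> 0"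
proof -
  define f where "f n x = indicat_real (ball (0::real^3) a) x *\<^sub>R (if e n < a\<^sup>2 - x \<bullet> x then e n / (a\<^sup>2 - x \<bullet> x) else 0)" for n x
  have "(\<lambda>n. LINT x|lborel. f n x) \<longlonglongrightarrow> (LINT x::real^3|lborel. (0::real))"
  proof (rule integral_dominated_convergence)
    show "f n \<in> borel_measurable lborel" for n
      unfolding f_def indicator_def mem_ball_0 by measurable
    show "integrable lborel (indicat_real (ball (0::real^3) a))"
      by (intro integrable_real_indicator emeasure_lborel_ball_finite) simp
    show "AE x in lborel. norm (f n x) \<le> indicat_real (ball 0 a) x" for n
      using e(2)[of n] by (intro AE_I2) (auto simp: f_def indicator_def divide_le_eq)
    show "AE x in lborel. (\<lambda>n. f n x) \<longlonglongrightarrow> 0"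
    proof (rule AE_I2, rule Lim_null_comparison)
      fix x :: "real^3"
      define c where "c = (if a\<^sup>2 - x \<bullet> x > 0 then 1 / (a\<^sup>2 - x \<bullet> x) else 0)"
      have "0 \<le> c" by (simp add: c_def)
      have "norm (f n x) \<le> c * e n" for n
      proof (cases "e n < a\<^sup>2 - x \<bullet> x \<and> x \<in> ball 0 a")
        case True
        then have "0 < a\<^sup>2 - x \<bullet> x" using e(2)[of n] by linarith
        then show ?thesis using e(2)[of n] by (simp add: f_def c_def indicator_def)
      next
        case False
        then show ?thesis using e(2)[of n] \<open>0 \<le> c\<close> by (auto simp: f_def)
      qed
      then show "\<forall>\<^sub>F n in sequentially. norm (f n x) \<le> c * e n" by simp
      show "(\<lambda>n. c * e n) \<longlonglongrightarrow> 0" using e(1) by (rule tendsto_mult_right_zero)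
    qed
  qed simp
  then show ?thesis by (simp add: f_def set_lebesgue_integral_def)
qed

text \<open>For the eigenfunction times a cut-off, the integral M against the kernel satisfies M' =
  - k^2 M + R. Multiplying by exp (k^2 s) and comparing with time 0, where the Dirac property
  supplies the value, leaves an error of the size of R. It vanishes with the cut-off parameter
  because the kernel is O(a^2 - |x|^2) near the sphere, uniformly for 0 < s \<le> t.\<close>

lemma dirichlet_heat_kernel_eigen:
  fixes y :: "real^3"
  assumes p: "dirichlet_heat_kernel (ball 0 a) p" and a: "0 < a" and y: "y \<in> ball 0 a" and t: "t > 0"
    and k: "sin (k * a) = 0"
  shows "(LINT x:ball 0 a|lborel. p x y t * rsinc k (x \<bullet> x)) = exp (- k\<^sup>2 * t) * rsinc k (y \<bullet> y)"
proof -
  define B :: "(real^3) set" where "B = ball 0 a"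
  have fund: "positive_fundamental_solution B p"
    using p by (simp add: dirichlet_heat_kernel_def B_def)
  have heat: "heat_solution (ball 0 a) (\<lambda>x t. p x y t)"
    and delta: "\<And>f K. continuous_on UNIV f \<Longrightarrow> compact K \<Longrightarrow> K \<subseteq> B \<Longrightarrow> (\<And>x. x \<notin> K \<Longrightarrow> f x = 0) \<Longrightarrow>
        ((\<lambda>t. LINT x:B|lborel. p x y t * f x) \<longlongrightarrow> f y) (at_right 0)"
    and pos: "\<And>x s. x \<in> B \<Longrightarrow> s > 0 \<Longrightarrow> 0 < p x y s"
    using fund y unfolding positive_fundamental_solution_def B_def by blast+
  note int = dirichlet_heat_kernel_integrable[OF p y, folded B_def]
  obtain C where C: "C \<ge> 0" "\<And>s. 0 \<le> s \<Longrightarrow> s \<le> a\<^sup>2 \<Longrightarrow> \<bar>rsinc k s\<bar> \<le> C * (a\<^sup>2 - s)"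
    "\<And>s. 0 \<le> s \<Longrightarrow> s \<le> a\<^sup>2 \<Longrightarrow> \<bar>rsinc' k s\<bar> \<le> C"
    using rsinc_boundary_bound[OF a k] by blast
  have sB: "0 \<le> x \<bullet> x" "x \<bullet> x < a\<^sup>2" if "x \<in> B" for x
  proof -
    have "(norm x)\<^sup>2 < a\<^sup>2" using that by (intro power_strict_mono) (auto simp: B_def)
    then show "0 \<le> x \<bullet> x" "x \<bullet> x < a\<^sup>2" by (simp_all add: power2_norm_eq_inner)
  qed
  have rsincB: "\<bar>rsinc k (x \<bullet> x)\<bar> \<le> C * a\<^sup>2" if "x \<in> B" for x
  proof -
    have "C * (a\<^sup>2 - x \<bullet> x) \<le> C * a\<^sup>2" using sB[OF that] C(1) by (intro mult_left_mono) auto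
    then show ?thesis using C(2)[of "x \<bullet> x"] sB[OF that] by linarith
  qed
  \<comment> \<open>Midway between |y| and a: outside radius \<open>r0\<close> the distance to y is
    at least \<open>d\<close>, so the boundary bound is uniform in time; inside, a^2 - |x|^2 is at
    least \<open>w0\<close>.\<close>
  define r0 where "r0 = (a + norm y) / 2"
  define d where "d = (a - norm y) / 2"
  have r0: "0 \<le> r0" "r0 < a" and d: "0 < d" using y a by (auto simp: r0_def d_def intro: add_nonneg_nonneg)
  define w0 where "w0 = a\<^sup>2 - r0\<^sup>2"
  have w0: "0 < w0" using r0 by (simp add: w0_def power_strict_mono)
  define D where "D = 384 * t powr (1 / 2) / d ^ 6"
  have D: "0 \<le> D" using d by (simp add: D_def)
  have near: "p x y s \<le> 2 * D * (a\<^sup>2 - x \<bullet> x)" if x: "x \<in> B" "r0 \<le> norm x" and s: "0 < s" "s \<le> t" for x s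
  proof -
    have "d \<le> norm (x - y)" using norm_triangle_ineq2[of x y] x(2) by (simp add: r0_def d_def)
    then have g: "gauss3 s (x - y) / s \<le> D" unfolding D_def using s d by (intro gauss3_off_diagonal) auto
    have nx: "norm x < a" using x(1) by (simp add: B_def)
    have "p x y s \<le> gauss3 s (x - y) / s * (2 * (a * (a - norm x)))"
      using dirichlet_heat_kernel_bound(2)[OF p _ y s(1), of x] x(1) by (simp add: B_def mult_ac)
    also have "\<dots> \<le> D * (2 * (a\<^sup>2 - x \<bullet> x))"
    proof (rule mult_mono[OF g])
      have "a * (a - norm x) \<le> (a + norm x) * (a - norm x)" using nx by (intro mult_right_mono) auto
      then show "2 * (a * (a - norm x)) \<le> 2 * (a\<^sup>2 - x \<bullet> x)"
        by (simp add: power2_norm_eq_inner[symmetric] power2_eq_square algebra_simps)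
    qed (use D nx a in auto)
    finally show ?thesis by (simp add: mult_ac)
  qed
  define J where "J e = (LINT x:B|lborel. (if e < a\<^sup>2 - x \<bullet> x then e / (a\<^sup>2 - x \<bullet> x) else 0))" for e
  \<comment> \<open>The first summand bounds the error on the outer shell, the second on the inner
    ball, where the total mass of the kernel is at most 1.\<close>
  define \<kappa> where "\<kappa> e = 90 * a\<^sup>2 * C * (2 * D * J e + e / w0\<^sup>2)" for e
  have rsincm [measurable]: "rsinc k \<in> borel_measurable borel" "rsinc' k \<in> borel_measurable borel" "rsinc'' k \<in> borel_measurable borel"
    using DERIV_isCont[OF rsinc_deriv] DERIV_isCont[OF rsinc'_deriv] rsinc''_continuous
    by (auto intro!: borel_measurable_continuous_onI continuous_at_imp_continuous_on)
  have cutm: "cutoff e \<in> borel_measurable borel" "cutoff' e \<in> borel_measurable borel" "cutoff'' e \<in> borel_measurable borel" for e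
    unfolding cutoff_def[abs_def] cutoff'_def[abs_def] cutoff''_def[abs_def] by measurable
  note [measurable] = cutm
  have key: "\<bar>exp (k\<^sup>2 * t) * (LINT x:B|lborel. p x y t * (rsinc k (x \<bullet> x) * cutoff e (a\<^sup>2 - x \<bullet> x))) - rsinc k (y \<bullet> y) * cutoff e (a\<^sup>2 - y \<bullet> y)\<bar>
     \<le> exp (k\<^sup>2 * t) * \<kappa> e * t" if e: "0 < e" "e < a\<^sup>2" for e
  proof -
    define E where "E s = rsinc k s * cutoff e (a\<^sup>2 - s)" for s
    define E' where "E' s = rsinc' k s * cutoff e (a\<^sup>2 - s) - rsinc k s * cutoff' e (a\<^sup>2 - s)" for s
    define E'' where "E'' s = rsinc'' k s * cutoff e (a\<^sup>2 - s) - 2 * rsinc' k s * cutoff' e (a\<^sup>2 - s) + rsinc k s * cutoff'' e (a\<^sup>2 - s)" for s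
    define M where "M s = (LINT x:B|lborel. p x y s * E (x \<bullet> x))" for s
    have dm: "((\<lambda>s. a\<^sup>2 - s) has_real_derivative - 1) (at s)" for s
      by (auto intro!: derivative_eq_intros)
    have dc: "((\<lambda>s. cutoff e (a\<^sup>2 - s)) has_real_derivative - cutoff' e (a\<^sup>2 - s)) (at s)"
      "((\<lambda>s. cutoff' e (a\<^sup>2 - s)) has_real_derivative - cutoff'' e (a\<^sup>2 - s)) (at s)" for s
      using DERIV_chain2[where f="cutoff e" and g="\<lambda>s. a\<^sup>2 - s", OF cutoff_deriv[OF e(1)] dm]
        DERIV_chain2[where f="cutoff' e" and g="\<lambda>s. a\<^sup>2 - s", OF cutoff'_deriv[OF e(1)] dm] by simp_all
    have dE: "(E has_real_derivative E' s) (at s)" for s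
      unfolding E_def[abs_def] E'_def
      by (rule DERIV_cong[OF DERIV_mult[OF rsinc_deriv dc(1)]]) simp
    have dE': "(E' has_real_derivative E'' s) (at s)" for s
      unfolding E'_def[abs_def] E''_def
      by (rule DERIV_cong[OF DERIV_diff[OF DERIV_mult[OF rsinc'_deriv dc(1)] DERIV_mult[OF rsinc_deriv dc(2)]]]) simp
    have "isCont E'' s" for s
      unfolding E''_def[abs_def]
      by (intro continuous_intros isCont_o2[OF _ cutoff''_continuous[OF e(1)]] rsinc''_continuous
          DERIV_isCont[OF rsinc_deriv] DERIV_isCont[OF rsinc'_deriv] DERIV_isCont[OF dc(1)] DERIV_isCont[OF dc(2)])
    then have cE: "continuous_on UNIV E''" by (simp add: continuous_at_imp_continuous_on)
    have z: "E s = 0" "E' s = 0" "E'' s = 0" if "a\<^sup>2 - e < s" for s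
      using that by (auto simp: E_def E'_def E''_def cutoff_def cutoff'_def cutoff''_def)
    have L: "4 * s * E'' s + 6 * E' s = - k\<^sup>2 * E s + cutoff_error k a e s" for s
    proof -
      have "4 * s * E'' s + 6 * E' s = (4 * s * rsinc'' k s + 6 * rsinc' k s) * cutoff e (a\<^sup>2 - s) + cutoff_error k a e s"
        by (simp add: E'_def E''_def cutoff_error_def algebra_simps)
      then show ?thesis unfolding rsinc_ode by (simp add: E_def)
    qed
    have err: "\<bar>cutoff_error k a e (x \<bullet> x)\<bar> \<le> (if e < a\<^sup>2 - x \<bullet> x then 90 * a\<^sup>2 * C * (e / (a\<^sup>2 - x \<bullet> x)\<^sup>2) else 0)" if "x \<in> B" for x
      using sB[OF that] C by (intro cutoff_error_bound e) auto
    have err': "\<bar>cutoff_error k a e (x \<bullet> x)\<bar> \<le> 90 * a\<^sup>2 * C * (1 / e)" if "x \<in> B" for x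
    proof (cases "e < a\<^sup>2 - x \<bullet> x")
      case True
      have "e / (a\<^sup>2 - x \<bullet> x)\<^sup>2 \<le> e / e\<^sup>2"
        using True e by (intro divide_left_mono power_mono) auto
      then have "90 * a\<^sup>2 * C * (e / (a\<^sup>2 - x \<bullet> x)\<^sup>2) \<le> 90 * a\<^sup>2 * C * (e / e\<^sup>2)"
        using C by (intro mult_left_mono) auto
      then show ?thesis using err[OF that] True e by (simp add: power2_eq_square)
    qed (use err[OF that] C e in auto)
    have EB: "\<bar>E (x \<bullet> x)\<bar> \<le> C * a\<^sup>2" if "x \<in> B" for x
    proof -
      have "\<bar>E (x \<bullet> x)\<bar> \<le> \<bar>rsinc k (x \<bullet> x)\<bar> * 1"
        unfolding E_def abs_mult using cutoff_bounds(1,2)[OF e(1)] by (intro mult_left_mono) auto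
      then show ?thesis using rsincB[OF that] by simp
    qed
    have Em: "(\<lambda>x :: real^3. E (x \<bullet> x)) \<in> borel_measurable borel" "(\<lambda>x :: real^3. cutoff_error k a e (x \<bullet> x)) \<in> borel_measurable borel"
      unfolding E_def cutoff_error_def by measurable
    define R where "R s = (LINT x:B|lborel. p x y s * cutoff_error k a e (x \<bullet> x))" for s
    have iE: "set_integrable lborel B (\<lambda>x. p x y s * E (x \<bullet> x))" and iR: "set_integrable lborel B (\<lambda>x. p x y s * cutoff_error k a e (x \<bullet> x))"
      if "s > 0" for s
      using int(1)[OF that Em(1) EB] int(1)[OF that Em(2) err'] by auto
    have dM: "(M has_real_derivative (- k\<^sup>2 * M s + R s)) (at s)" if s: "s > 0" for s
    proof -
      have "(M has_real_derivative (LINT x:ball 0 a|lborel. p x y s * (4 * (x \<bullet> x) * E'' (x \<bullet> x) + 6 * E' (x \<bullet> x)))) (at s)"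
        unfolding M_def[abs_def] B_def
        by (rule heat_radial_test[OF heat a, where b="a\<^sup>2 - e"]) (use e dE dE' cE z s in auto)
      also have "(LINT x:ball 0 a|lborel. p x y s * (4 * (x \<bullet> x) * E'' (x \<bullet> x) + 6 * E' (x \<bullet> x))) =
         (LINT x:B|lborel. - k\<^sup>2 * (p x y s * E (x \<bullet> x)) + p x y s * cutoff_error k a e (x \<bullet> x))"
        unfolding L B_def by (simp add: algebra_simps)
      also have "(LINT x:B|lborel. c * (p x y s * E (x \<bullet> x)) + p x y s * cutoff_error k a e (x \<bullet> x)) = c * M s + R s" for c
        unfolding M_def R_def using iE[OF s] iR[OF s] by (subst set_integral_add) auto
      finally show ?thesis .
    qed
    have Rb: "\<bar>R s\<bar> \<le> \<kappa> e" if s: "0 < s" "s \<le> t" for s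
    proof -
      define W where "W x = (if e < a\<^sup>2 - x \<bullet> x then e / (a\<^sup>2 - x \<bullet> x) else 0)" for x :: "real^3"
      have Wm: "W \<in> borel_measurable borel" unfolding W_def[abs_def] by measurable
      have W1: "0 \<le> W x" "W x \<le> 1" for x using e by (auto simp: W_def)
      have iW: "set_integrable lborel B W"
      proof (rule set_integrable_bound[of _ _ "\<lambda>_. 1 :: real"])
        show "set_integrable lborel B (\<lambda>_. 1 :: real)" 
          unfolding set_integrable_def B_def using integrable_real_indicator[OF _ emeasure_lborel_ball_finite, of "0 :: real^3" a] by simp
        show "set_borel_measurable lborel B W"
          unfolding set_borel_measurable_def B_def using Wm by (auto intro!: borel_measurable_times borel_measurable_indicator)
      qed (use W1 in auto)
      have ip: "set_integrable lborel B (\<lambda>x. p x y s)" using int(1)[OF s(1), of "\<lambda>_. 1" 1] by simp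
      have iS: "set_integrable lborel B (\<lambda>x. 90 * a\<^sup>2 * C * (2 * D * W x + e / w0\<^sup>2 * p x y s))"
        using iW ip by auto
      have "\<bar>R s\<bar> \<le> (LINT x:B|lborel. \<bar>p x y s * cutoff_error k a e (x \<bullet> x)\<bar>)"
        unfolding R_def using iR[OF s(1)] set_integral_norm_bound[of lborel B "\<lambda>x. p x y s * cutoff_error k a e (x \<bullet> x)"] by simp
      also have "\<dots> \<le> (LINT x:B|lborel. 90 * a\<^sup>2 * C * (2 * D * W x + e / w0\<^sup>2 * p x y s))"
      proof (rule set_integral_mono)
        show "set_integrable lborel B (\<lambda>x. \<bar>p x y s * cutoff_error k a e (x \<bullet> x)\<bar>)" using iR[OF s(1)] by (rule set_integrable_abs)
        fix x assume x: "x \<in> B"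
        note pp = pos[OF x s(1)]
        define w where "w = a\<^sup>2 - x \<bullet> x"
        show "\<bar>p x y s * cutoff_error k a e (x \<bullet> x)\<bar> \<le> 90 * a\<^sup>2 * C * (2 * D * W x + e / w0\<^sup>2 * p x y s)"
        proof (cases "e < w")
          case True
          then have w: "0 < w" using e by simp
          have "\<bar>p x y s * cutoff_error k a e (x \<bullet> x)\<bar> \<le> p x y s * (90 * a\<^sup>2 * C * (e / w\<^sup>2))"
            unfolding abs_mult abs_of_pos[OF pp] using err[OF x] True pp by (intro mult_left_mono) (auto simp: w_def)
          also have "\<dots> = 90 * a\<^sup>2 * C * (p x y s * (e / w\<^sup>2))" by simp
          also have "\<dots> \<le> 90 * a\<^sup>2 * C * (2 * D * W x + e / w0\<^sup>2 * p x y s)"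
          proof (rule mult_left_mono)
            show "p x y s * (e / w\<^sup>2) \<le> 2 * D * W x + e / w0\<^sup>2 * p x y s"
            proof (cases "r0 \<le> norm x")
              case r: True
              have "p x y s * (e / w\<^sup>2) \<le> 2 * D * w * (e / w\<^sup>2)"
                using near[OF x r s] e by (intro mult_right_mono) (auto simp: w_def)
              also have "\<dots> = 2 * D * W x" using w True by (simp add: W_def w_def power2_eq_square)
              finally show ?thesis using e pp by (simp add: add_increasing2)
            next
              case False
              then have "(norm x)\<^sup>2 \<le> r0\<^sup>2" by (intro power_mono) auto
              then have "w0 \<le> w" by (simp add: w_def w0_def power2_norm_eq_inner)
              then have "e / w\<^sup>2 \<le> e / w0\<^sup>2" using w0 w e by (intro divide_left_mono power_mono) auto
              then have "p x y s * (e / w\<^sup>2) \<le> p x y s * (e / w0\<^sup>2)" using pp by (intro mult_left_mono) auto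
              moreover have "0 \<le> 2 * D * W x" using D W1[of x] by simp
              ultimately show ?thesis by (metis add.commute add_increasing2 mult.commute)
            qed
          qed (use C in auto)
          finally show ?thesis .
        next
          case False
          then have "cutoff_error k a e (x \<bullet> x) = 0" using err[OF x] by (simp add: w_def)
          then show ?thesis using C D W1[of x] e pp by simp
        qed
      qed (rule iS)
      also have "\<dots> = 90 * a\<^sup>2 * C * (2 * D * J e + e / w0\<^sup>2 * (LINT x:B|lborel. p x y s))"
      proof -
        have "(LINT x:B|lborel. c * (c1 * W x + c2 * p x y s)) = c * (c1 * (LINT x:B|lborel. W x) + c2 * (LINT x:B|lborel. p x y s))" for c c1 c2
          unfolding set_integral_mult_right using iW ip by (subst set_integral_add) auto
        then show ?thesis by (simp only: J_def W_def)
      qed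
      also have "\<dots> \<le> \<kappa> e"
      proof -
        have "(LINT x:B|lborel. p x y s) \<le> 1" using int(2)[OF s(1), of "\<lambda>_. 0" 0] by simp
        then have "e / w0\<^sup>2 * (LINT x:B|lborel. p x y s) \<le> e / w0\<^sup>2 * 1"
          using e by (intro mult_left_mono) auto
        then show ?thesis unfolding \<kappa>_def using C by (intro mult_left_mono) auto
      qed
      finally show ?thesis .
    qed
    define N where "N s = exp (k\<^sup>2 * s) * M s" for s
    have dN: "(N has_real_derivative exp (k\<^sup>2 * s) * R s) (at s)" if s: "s > 0" for s
      unfolding N_def[abs_def]
      by (rule derivative_eq_intros dM[OF s] refl)+ (simp add: algebra_simps)
    have \<kappa>0: "0 \<le> \<kappa> e" using Rb[of t] t by linarith
    have diff: "\<bar>N t - N s\<bar> \<le> exp (k\<^sup>2 * t) * \<kappa> e * t" if s: "0 < s" "s < t" for s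
    proof -
      have "norm (N t - N s) \<le> exp (k\<^sup>2 * t) * \<kappa> e * norm (t - s)"
      proof (rule field_differentiable_bound[of "{s..t}" N "\<lambda>s. exp (k\<^sup>2 * s) * R s"])
        fix z assume z: "z \<in> {s..t}"
        show "(N has_field_derivative exp (k\<^sup>2 * z) * R z) (at z within {s..t})"
          by (rule has_field_derivative_at_within[OF dN]) (use z s in auto)
        have "\<bar>R z\<bar> \<le> \<kappa> e" using Rb z s by auto
        moreover have "\<bar>exp (k\<^sup>2 * z)\<bar> \<le> exp (k\<^sup>2 * t)"
          using z by (simp add: mult_left_mono)
        ultimately show "norm (exp (k\<^sup>2 * z) * R z) \<le> exp (k\<^sup>2 * t) * \<kappa> e"
          unfolding real_norm_def abs_mult by (intro mult_mono) auto
      qed (use s in auto)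
      also have "\<dots> \<le> exp (k\<^sup>2 * t) * \<kappa> e * t" using s \<kappa>0 by (intro mult_left_mono) auto
      finally show ?thesis by simp
    qed
    have lim: "(M \<longlongrightarrow> E (y \<bullet> y)) (at_right 0)"
      unfolding M_def[abs_def]
    proof (rule delta[where K="cball 0 (sqrt (a\<^sup>2 - e))"])
      have "continuous_on UNIV E" using DERIV_isCont[OF dE] by (simp add: continuous_at_imp_continuous_on)
      then show "continuous_on UNIV (\<lambda>x::real^3. E (x \<bullet> x))"
        by (rule continuous_on_compose2) (auto intro!: continuous_intros)
      have "sqrt (a\<^sup>2 - e) < sqrt (a\<^sup>2)" using e by (intro real_sqrt_less_mono) auto
      then show "cball 0 (sqrt (a\<^sup>2 - e)) \<subseteq> B" using a by (auto simp: B_def)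
      fix x :: "real^3" assume "x \<notin> cball 0 (sqrt (a\<^sup>2 - e))"
      then have "sqrt (a\<^sup>2 - e) < sqrt (x \<bullet> x)" by (simp add: norm_eq_sqrt_inner)
      then show "E (x \<bullet> x) = 0" using z(1) by simp
    qed simp
    have "((\<lambda>s. exp (k\<^sup>2 * s)) \<longlongrightarrow> exp (k\<^sup>2 * 0)) (at_right 0)" by (intro tendsto_intros)
    from tendsto_mult[OF this lim] have "(N \<longlongrightarrow> E (y \<bullet> y)) (at_right 0)" by (simp add: N_def[abs_def])
    then have "((\<lambda>s. \<bar>N t - N s\<bar>) \<longlongrightarrow> \<bar>N t - E (y \<bullet> y)\<bar>) (at_right 0)" by (intro tendsto_intros)
    then have "\<bar>N t - E (y \<bullet> y)\<bar> \<le> exp (k\<^sup>2 * t) * \<kappa> e * t"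
    proof (rule tendsto_upperbound)
      have "\<forall>\<^sub>F s in at_right 0. s \<in> {0<..<t}" using t by (rule eventually_at_right_real)
      then show "\<forall>\<^sub>F s in at_right 0. \<bar>N t - N s\<bar> \<le> exp (k\<^sup>2 * t) * \<kappa> e * t"
        by eventually_elim (use diff in auto)
    qed simp
    then show ?thesis by (simp add: N_def M_def E_def)
  qed
  \<comment> \<open>The shift by 2 keeps the parameter strictly below a^2 already for n = 0.\<close>
  define e where "e n = a\<^sup>2 / (real n + 2)" for n
  have e: "0 < e n" "e n < a\<^sup>2" for n
    using a by (auto simp: e_def divide_less_eq)
  have e0: "e \<longlonglongrightarrow> 0" unfolding e_def[abs_def] by real_asymp
  have J0: "(\<lambda>n. J (e n)) \<longlonglongrightarrow> 0"
    unfolding J_def B_def by (rule set_integral_cutoff_weight_tendsto[OF e0 e(1) a])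
  have "(\<lambda>n. exp (k\<^sup>2 * t) * \<kappa> (e n) * t) \<longlonglongrightarrow> exp (k\<^sup>2 * t) * (90 * a\<^sup>2 * C * (2 * D * 0 + 0 / w0\<^sup>2)) * t"
    unfolding \<kappa>_def using w0 by (intro tendsto_intros J0 e0) auto
  then have k0: "(\<lambda>n. exp (k\<^sup>2 * t) * \<kappa> (e n) * t) \<longlonglongrightarrow> 0" by simp
  have M0: "(\<lambda>n. LINT x:B|lborel. p x y t * (rsinc k (x \<bullet> x) * cutoff (e n) (a\<^sup>2 - x \<bullet> x))) \<longlonglongrightarrow> (LINT x:B|lborel. p x y t * rsinc k (x \<bullet> x))"
    unfolding set_lebesgue_integral_def
  proof (rule integral_dominated_convergence)
    have i: "set_integrable lborel B (\<lambda>x. p x y t * (rsinc k (x \<bullet> x) * 1))"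
      using rsincB by (intro int(1)[OF t, of _ "C * a\<^sup>2"]) auto
    show "(\<lambda>x. indicat_real B x *\<^sub>R (p x y t * rsinc k (x \<bullet> x))) \<in> borel_measurable lborel"
      using i by (auto simp: set_integrable_def)
    show "integrable lborel (\<lambda>x. \<bar>indicat_real B x *\<^sub>R (p x y t * (rsinc k (x \<bullet> x) * 1))\<bar>)"
      using i by (simp add: set_integrable_def del: mult_1_right real_scaleR_def)
    have "\<bar>rsinc k (x \<bullet> x) * cutoff (e n) (a\<^sup>2 - x \<bullet> x)\<bar> \<le> C * a\<^sup>2" if "x \<in> B" for x n
      using mult_mono[OF rsincB[OF that] cutoff_bounds(2)[OF e(1)[of n], of "a\<^sup>2 - x \<bullet> x"]] C(1) cutoff_bounds(1)[OF e(1)[of n], of "a\<^sup>2 - x \<bullet> x"]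
      by (simp add: abs_mult)
    then show "(\<lambda>x. indicat_real B x *\<^sub>R (p x y t * (rsinc k (x \<bullet> x) * cutoff (e n) (a\<^sup>2 - x \<bullet> x)))) \<in> borel_measurable lborel" for n
      using int(1)[OF t, of "\<lambda>x. rsinc k (x \<bullet> x) * cutoff (e n) (a\<^sup>2 - x \<bullet> x)" "C * a\<^sup>2"]
      by (auto simp: set_integrable_def)
    show "AE x in lborel. norm (indicat_real B x *\<^sub>R (p x y t * (rsinc k (x \<bullet> x) * cutoff (e n) (a\<^sup>2 - x \<bullet> x)))) \<le> \<bar>indicat_real B x *\<^sub>R (p x y t * (rsinc k (x \<bullet> x) * 1))\<bar>" for n
      using cutoff_bounds(1,2)[OF e(1)[of n]] by (intro AE_I2) (auto simp: abs_mult intro!: mult_left_mono mult_left_le)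
    show "AE x in lborel. (\<lambda>n. indicat_real B x *\<^sub>R (p x y t * (rsinc k (x \<bullet> x) * cutoff (e n) (a\<^sup>2 - x \<bullet> x)))) \<longlonglongrightarrow> indicat_real B x *\<^sub>R (p x y t * rsinc k (x \<bullet> x))"
    proof (rule AE_I2)
      fix x
      show "(\<lambda>n. indicat_real B x *\<^sub>R (p x y t * (rsinc k (x \<bullet> x) * cutoff (e n) (a\<^sup>2 - x \<bullet> x)))) \<longlonglongrightarrow> indicat_real B x *\<^sub>R (p x y t * rsinc k (x \<bullet> x))"
      proof (cases "x \<in> B")
        case True
        have "(\<lambda>n. indicat_real B x *\<^sub>R (p x y t * (rsinc k (x \<bullet> x) * cutoff (e n) (a\<^sup>2 - x \<bullet> x)))) \<longlonglongrightarrow> indicat_real B x *\<^sub>R (p x y t * (rsinc k (x \<bullet> x) * 1))"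
          using sB[OF True] by (intro tendsto_intros cutoff_tendsto e0) auto
        then show ?thesis by simp
      qed simp
    qed
  qed
  have y0: "(\<lambda>n. rsinc k (y \<bullet> y) * cutoff (e n) (a\<^sup>2 - y \<bullet> y)) \<longlonglongrightarrow> rsinc k (y \<bullet> y) * 1"
    using sB[of y] y by (intro tendsto_intros cutoff_tendsto e0) (auto simp: B_def)
  from tendsto_rabs[OF tendsto_diff[OF tendsto_mult_left[OF M0, of "exp (k\<^sup>2 * t)"] y0]]
  have "\<bar>exp (k\<^sup>2 * t) * (LINT x:B|lborel. p x y t * rsinc k (x \<bullet> x)) - rsinc k (y \<bullet> y) * 1\<bar> \<le> 0"
    by (rule LIMSEQ_le[OF _ k0]) (use key e in blast)
  then have "exp (k\<^sup>2 * t) * (LINT x:B|lborel. p x y t * rsinc k (x \<bullet> x)) = rsinc k (y \<bullet> y)" by simp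
  then have "exp (- k\<^sup>2 * t) * (exp (k\<^sup>2 * t) * (LINT x:B|lborel. p x y t * rsinc k (x \<bullet> x))) = exp (- k\<^sup>2 * t) * rsinc k (y \<bullet> y)" by simp
  then show ?thesis by (simp add: B_def mult.assoc[symmetric] exp_add[symmetric])
qed

section \<open>The image kernel of an interval\<close>

definition gauss1' :: "real \<Rightarrow> real \<Rightarrow> real" where
  "gauss1' t z = - z / (2 * t) * gauss1 t z"

definition gauss1'' :: "real \<Rightarrow> real \<Rightarrow> real" where
  "gauss1'' t z = (z\<^sup>2 / (4 * t\<^sup>2) - 1 / (2 * t)) * gauss1 t z"

lemma gauss1_deriv: "t > 0 \<Longrightarrow> (gauss1 t has_real_derivative gauss1' t z) (at z)"
  unfolding gauss1_def[abs_def] gauss1'_def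
  by (auto intro!: derivative_eq_intros simp: field_simps)

lemma gauss1'_deriv: "t > 0 \<Longrightarrow> (gauss1' t has_real_derivative gauss1'' t z) (at z)"
  unfolding gauss1'_def[abs_def] gauss1''_def
  by (rule derivative_eq_intros gauss1_deriv refl | simp)+ (simp add: gauss1'_def field_simps power2_eq_square)

lemma gauss1_minus [simp]: "gauss1 t (- z) = gauss1 t z"
  by (simp add: gauss1_def)

lemma gauss1_continuous [continuous_intros]:
  "t > 0 \<Longrightarrow> continuous_on S f \<Longrightarrow> continuous_on S (\<lambda>x. gauss1 t (f x))"
  unfolding gauss1_def by (intro continuous_intros) auto

lemma gauss1''_bounded:
  assumes "t > 0"
  shows "\<bar>gauss1'' t z\<bar> \<le> 2 / t / sqrt (4 * pi * t)"
proof -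
  define x where "x = z\<^sup>2 / (4 * t)"
  have x: "0 \<le> x" using assms by (simp add: x_def)
  have eq: "gauss1'' t z = (x * exp (- x) / t - exp (- x) / (2 * t)) / sqrt (4 * pi * t)"
    using assms by (simp add: gauss1''_def gauss1_def x_def field_simps power2_eq_square)
  have "x * exp (- x) \<le> 1"
  proof -
    have "x \<le> exp x" using exp_ge_add_one_self[of x] by linarith
    then show ?thesis by (simp add: exp_minus field_simps)
  qed
  then have "x * exp (- x) / t \<le> 1 / t" using assms by (intro divide_right_mono) auto
  moreover have "0 \<le> x * exp (- x) / t" using x assms by simp
  moreover have "exp (- x) / (2 * t) \<le> 1 / t"
    using x assms by (intro frac_le) auto
  moreover have "0 \<le> exp (- x) / (2 * t)" using assms by simp
  moreover have "\<bar>A - B\<bar> \<le> C + C" if "A \<le> C" "0 \<le> A" "B \<le> C" "0 \<le> B" for A B C :: real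
    using that by linarith
  ultimately have "\<bar>x * exp (- x) / t - exp (- x) / (2 * t)\<bar> \<le> 1 / t + 1 / t" by blast
  then show ?thesis
    unfolding eq abs_divide using assms divide_right_mono[of _ "2 / t" "sqrt (4 * pi * t)"] by simp
qed

text \<open>For w \<ge> 1/2 and t \<le> 1 the factor 4 w^2 / t^2 dominates 1 and the prefactors of
  both derivatives, so one estimate serves all three. In the exponential bound of order N + 3, one
  power of t absorbs 1 / sqrt (4 pi t) \<le> 1 / t and two absorb 1 / t^2; of the 2 N + 6 powers of
  w, two are spent on the prefactor, four are kept for summing over images, and the rest is bounded
  by 4^N.\<close>

lemma gauss1_decay:
  obtains C where "C \<ge> 0"
    "\<And>t w. 0 < t \<Longrightarrow> t \<le> 1 \<Longrightarrow> 1 / 2 \<le> w \<Longrightarrow> gauss1 t w \<le> C * t ^ N / w ^ 4"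
    "\<And>t w. 0 < t \<Longrightarrow> t \<le> 1 \<Longrightarrow> 1 / 2 \<le> w \<Longrightarrow> \<bar>gauss1' t w\<bar> \<le> C * t ^ N / w ^ 4"
    "\<And>t w. 0 < t \<Longrightarrow> t \<le> 1 \<Longrightarrow> 1 / 2 \<le> w \<Longrightarrow> \<bar>gauss1'' t w\<bar> \<le> C * t ^ N / w ^ 4"
proof -
  define C :: real where "C = 4 * (fact (N + 3) * 4 ^ (N + 3)) * 4 ^ N"
  have main: "4 * w\<^sup>2 / t\<^sup>2 * gauss1 t w \<le> C * t ^ N / w ^ 4" if t: "0 < t" "t \<le> 1" and w: "1 / 2 \<le> w" for t w
  proof -
    have w0: "0 < w" using w by simp
    have "t\<^sup>2 \<le> 4 * pi * t"
    proof -
      have "t * t \<le> (4 * pi) * t" using t pi_gt3 by (intro mult_right_mono) auto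
      then show ?thesis by (simp add: power2_eq_square)
    qed
    then have s: "t \<le> sqrt (4 * pi * t)" using t by (intro real_le_rsqrt) auto
    have "gauss1 t w \<le> exp (- (w\<^sup>2 / (4 * t))) / t"
      unfolding gauss1_def using s t by (simp add: frac_le)
    also have "\<dots> \<le> fact (N + 3) / (w\<^sup>2 / (4 * t)) ^ (N + 3) / t"
      using t w0 by (intro divide_right_mono exp_minus_le_power) auto
    also have "\<dots> = fact (N + 3) * 4 ^ (N + 3) * t ^ (N + 2) / (w\<^sup>2) ^ (N + 3)"
      using t w0 by (simp add: power_divide power_mult_distrib field_simps eval_nat_numeral)
    finally have "4 * w\<^sup>2 / t\<^sup>2 * gauss1 t w \<le> 4 * w\<^sup>2 / t\<^sup>2 * (fact (N + 3) * 4 ^ (N + 3) * t ^ (N + 2) / (w\<^sup>2) ^ (N + 3))"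
      by (intro mult_left_mono) auto
    also have "\<dots> = 4 * (fact (N + 3) * 4 ^ (N + 3)) * t ^ N / w ^ 4 * (1 / (w\<^sup>2) ^ N)"
    proof -
      have e: "t ^ (N + 2) = t ^ N * t\<^sup>2" "(w\<^sup>2) ^ (N + 3) = (w\<^sup>2) ^ N * w ^ 4 * w\<^sup>2"
        by (simp_all add: power_add eval_nat_numeral)
      have gen: "4 * W / T * (F * (P * T) / (R * V * W)) = 4 * F * P / V * (1 / R)" if "T \<noteq> 0" "W \<noteq> 0" "V \<noteq> 0" "R \<noteq> 0" for W T F P R V :: real
        using that by (simp add: field_simps)
      show ?thesis unfolding e by (rule gen) (use t w0 in auto)
    qed
    also have "\<dots> \<le> 4 * (fact (N + 3) * 4 ^ (N + 3)) * t ^ N / w ^ 4 * 4 ^ N"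
    proof (rule mult_left_mono)
      have "(1 / 2)\<^sup>2 \<le> w\<^sup>2" using w by (intro power_mono) auto
      then have "1 / w\<^sup>2 \<le> 4" using w0 by (simp add: field_simps power2_eq_square)
      then have "(1 / w\<^sup>2) ^ N \<le> 4 ^ N" by (intro power_mono) auto
      then show "1 / (w\<^sup>2) ^ N \<le> 4 ^ N" by (simp add: power_divide)
    qed (use t in auto)
    finally show ?thesis by (simp add: C_def mult_ac)
  qed
  have small: "1 \<le> 4 * w\<^sup>2 / t\<^sup>2" "\<bar>- w / (2 * t)\<bar> \<le> 4 * w\<^sup>2 / t\<^sup>2" "\<bar>w\<^sup>2 / (4 * t\<^sup>2) - 1 / (2 * t)\<bar> \<le> 4 * w\<^sup>2 / t\<^sup>2"
    if t: "0 < t" "t \<le> 1" and w: "1 / 2 \<le> w" for t w :: real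
  proof -
    have w4: "1 \<le> 4 * w\<^sup>2" using power_mono[of "1/2" w 2] w by (simp add: power2_eq_square)
    have tt: "t\<^sup>2 \<le> t" using t by (simp add: power2_eq_square mult_left_le)
    then have t1: "t\<^sup>2 \<le> 1" using t by simp
    have "1 * t\<^sup>2 \<le> 4 * w\<^sup>2" using w4 t1 by simp
    then show "1 \<le> 4 * w\<^sup>2 / t\<^sup>2" using t by (simp add: le_divide_eq)
    have a: "1 / t \<le> 1 / t\<^sup>2" using t tt by (intro divide_left_mono) auto
    have "w / 2 \<le> 4 * w\<^sup>2" using w by (simp add: power2_eq_square)
    then have "w / 2 * (1 / t) \<le> 4 * w\<^sup>2 * (1 / t\<^sup>2)" using a t w by (intro mult_mono) auto
    then show "\<bar>- w / (2 * t)\<bar> \<le> 4 * w\<^sup>2 / t\<^sup>2" using t w by simp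
    have "1 / (2 * t) \<le> 2 * w\<^sup>2 / t\<^sup>2"
    proof -
      have "1 / 2 * (1 / t) \<le> 2 * w\<^sup>2 * (1 / t\<^sup>2)" using a w4 t by (intro mult_mono) auto
      then show ?thesis by simp
    qed
    moreover have "w\<^sup>2 / (4 * t\<^sup>2) \<le> 2 * w\<^sup>2 / t\<^sup>2" using t by (simp add: divide_le_eq)
    moreover have "0 \<le> w\<^sup>2 / (4 * t\<^sup>2)" "0 \<le> 1 / (2 * t)" using t by auto
    moreover have "4 * w\<^sup>2 / t\<^sup>2 = 2 * w\<^sup>2 / t\<^sup>2 + 2 * w\<^sup>2 / t\<^sup>2" by simp
    ultimately show "\<bar>w\<^sup>2 / (4 * t\<^sup>2) - 1 / (2 * t)\<bar> \<le> 4 * w\<^sup>2 / t\<^sup>2" by linarith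
  qed
  have "C \<ge> 0" by (simp add: C_def)
  moreover have "gauss1 t w \<le> C * t ^ N / w ^ 4" "\<bar>gauss1' t w\<bar> \<le> C * t ^ N / w ^ 4" "\<bar>gauss1'' t w\<bar> \<le> C * t ^ N / w ^ 4"
    if "0 < t" "t \<le> 1" "1 / 2 \<le> w" for t w
  proof -
    have g: "0 \<le> gauss1 t w" using that by simp
    show "gauss1 t w \<le> C * t ^ N / w ^ 4"
      using mult_right_mono[OF small(1)[OF that] g] main[OF that] by simp
    show "\<bar>gauss1' t w\<bar> \<le> C * t ^ N / w ^ 4"
      unfolding gauss1'_def abs_mult abs_of_nonneg[OF g]
      using mult_right_mono[OF small(2)[OF that] g] main[OF that] by linarith
    show "\<bar>gauss1'' t w\<bar> \<le> C * t ^ N / w ^ 4"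
      unfolding gauss1''_def abs_mult abs_of_nonneg[OF g]
      using mult_right_mono[OF small(3)[OF that] g] main[OF that] by linarith
  qed
  ultimately show thesis using that by blast
qed

text \<open>The images of the pole at distance \<open>z\<close>, grouped so that the sum is odd in both variables.\<close>

definition image_quad :: "real \<Rightarrow> real \<Rightarrow> real \<Rightarrow> real \<Rightarrow> real" where
  "image_quad t z r s = gauss1 t (z + r - s) + gauss1 t (z - r + s) - gauss1 t (z + r + s) - gauss1 t (z - r - s)"

definition half_line_kernel :: "real \<Rightarrow> real \<Rightarrow> real \<Rightarrow> real" where
  "half_line_kernel t r s = gauss1 t (r - s) - gauss1 t (r + s)"

text \<open>At z = 0 the four images coincide in pairs, so bounds for \<open>image_quad\<close> pass
  to the half line kernel with half the constant.\<close>

lemma half_line_kernel_image_quad: "image_quad t 0 r s = 2 * half_line_kernel t r s"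
  using gauss1_minus[of t "r - s"] gauss1_minus[of t "r + s"]
  by (simp add: image_quad_def half_line_kernel_def minus_diff_eq del: gauss1_minus)

text \<open>A mixed second difference of \<open>gauss1\<close>: it vanishes at r = 0 and at s = 0,
  hence is of order r s. This factor makes the products with the weights r powr (-p) and s powr (-q)
  integrable at 0 for p, q < 2.\<close>

lemma image_quad_bound:
  assumes t: "t > 0" and rs: "0 \<le> r" "0 \<le> s"
    and B: "\<And>w. z - r - s \<le> w \<Longrightarrow> w \<le> z + r + s \<Longrightarrow> \<bar>gauss1'' t w\<bar> \<le> B"
  shows "\<bar>image_quad t z r s\<bar> \<le> 4 * B * (r * s)"
proof -
  have G: "\<bar>gauss1' t u - gauss1' t v\<bar> \<le> B * \<bar>u - v\<bar>" if "u \<in> {z - r - s..z + r + s}" "v \<in> {z - r - s..z + r + s}" for u v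
    using field_differentiable_bound[of "{z - r - s..z + r + s}" "gauss1' t" "gauss1'' t" B u v] that B
    by (auto intro: has_field_derivative_at_within gauss1'_deriv[OF t])
  \<comment> \<open>Mean value theorem in r; the r-derivative is a sum of two differences of
    \<open>gauss1'\<close> over a distance 2 s, to which \<open>G\<close> applies.\<close>
  have "norm (image_quad t z r s - image_quad t z 0 s) \<le> 4 * B * s * norm (r - 0)"
  proof (rule field_differentiable_bound[of "{0..r}"])
    fix q assume q: "q \<in> {0..r}"
    show "((\<lambda>r. image_quad t z r s) has_field_derivative
        (gauss1' t (z + q - s) - gauss1' t (z - q + s) - gauss1' t (z + q + s) + gauss1' t (z - q - s))) (at q within {0..r})"
      unfolding image_quad_def
      by (rule has_field_derivative_at_within)
         (auto intro!: derivative_eq_intros DERIV_chain2[OF gauss1_deriv[OF t]])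
    have "\<bar>gauss1' t (z + q - s) - gauss1' t (z + q + s)\<bar> \<le> B * (2 * s)"
      using G[of "z + q - s" "z + q + s"] q rs by simp
    moreover have "\<bar>gauss1' t (z - q + s) - gauss1' t (z - q - s)\<bar> \<le> B * (2 * s)"
      using G[of "z - q + s" "z - q - s"] q rs by simp
    ultimately show "norm (gauss1' t (z + q - s) - gauss1' t (z - q + s) - gauss1' t (z + q + s) + gauss1' t (z - q - s)) \<le> 4 * B * s"
      by simp
  qed (use rs in auto)
  moreover have "image_quad t z 0 s = 0" by (simp add: image_quad_def)
  ultimately show ?thesis using rs by (simp add: mult_ac)
qed

text \<open>The images for (0,1) have period 2. The m-th group holds those shifted by 2 m + 2 and by
  - (2 m + 2); the unshifted pair is the half line kernel.\<close>

definition interval_kernel :: "real \<Rightarrow> real \<Rightarrow> real \<Rightarrow> real" where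
  "interval_kernel t r s = half_line_kernel t r s + (\<Sum>m. image_quad t (2 * real m + 2) r s)"

lemma inverse_fourth_summable: "summable (\<lambda>m. 1 / (2 * real m + 2) ^ 4)"
proof (rule summable_comparison_test')
  show "summable (\<lambda>m. 1 / real (Suc m) ^ 2)"
    using inverse_power_summable[of 2] by (subst summable_Suc_iff) (simp add: divide_inverse)
  show "norm (1 / (2 * real m + 2) ^ 4) \<le> 1 / real (Suc m) ^ 2" if "0 \<le> m" for m
  proof -
    have "real (Suc m) ^ 2 \<le> (2 * real m + 2) ^ 2" by (intro power_mono) auto
    also have "\<dots> \<le> (2 * real m + 2) ^ 4" by (intro power_increasing) auto
    finally show ?thesis by (simp add: frac_le)
  qed
qed

lemma image_quad_far_bound:
  obtains C where "C \<ge> 0"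
    "\<And>t r s z. 0 < t \<Longrightarrow> t \<le> 1 \<Longrightarrow> 0 \<le> r \<Longrightarrow> 0 \<le> s \<Longrightarrow> 1 / 2 \<le> z - r - s \<Longrightarrow>
      \<bar>image_quad t z r s\<bar> \<le> C * t ^ N / (z - r - s) ^ 4 * (r * s)"
proof -
  obtain C where C: "C \<ge> 0" "\<And>t w. 0 < t \<Longrightarrow> t \<le> 1 \<Longrightarrow> 1 / 2 \<le> w \<Longrightarrow> \<bar>gauss1'' t w\<bar> \<le> C * t ^ N / w ^ 4"
    using gauss1_decay[of N] by metis
  have "\<bar>image_quad t z r s\<bar> \<le> 4 * C * t ^ N / (z - r - s) ^ 4 * (r * s)"
    if a: "0 < t" "t \<le> 1" "0 \<le> r" "0 \<le> s" "1 / 2 \<le> z - r - s" for t r s z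
  proof -
    have "\<bar>image_quad t z r s\<bar> \<le> 4 * (C * t ^ N / (z - r - s) ^ 4) * (r * s)"
    proof (rule image_quad_bound[OF a(1,3,4)])
      fix w assume w: "z - r - s \<le> w"
      have "\<bar>gauss1'' t w\<bar> \<le> C * t ^ N / w ^ 4" using C(2)[of t w] a w by simp
      also have "\<dots> \<le> C * t ^ N / (z - r - s) ^ 4"
        using C a w by (intro divide_left_mono power_mono) auto
      finally show "\<bar>gauss1'' t w\<bar> \<le> C * t ^ N / (z - r - s) ^ 4" .
    qed
    then show ?thesis by simp
  qed
  then show thesis using that[of "4 * C"] C by simp
qed

text \<open>The group z = 2 is left out, since 2 - r - s reaches 0 at the corner r = s = 1. From z =
  4 on, r + s \<le> 2 gives z - r - s \<ge> 2 m + 2.\<close>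

lemma image_quad_sum_bound:
  obtains C where "C \<ge> 0"
    "\<And>t r s m. 0 < t \<Longrightarrow> t \<le> 1 \<Longrightarrow> 0 \<le> r \<Longrightarrow> r \<le> 1 \<Longrightarrow> 0 \<le> s \<Longrightarrow> s \<le> 1 \<Longrightarrow>
      \<bar>image_quad t (2 * real (Suc m) + 2) r s\<bar> \<le> C * t ^ N * (r * s) * (1 / (2 * real m + 2) ^ 4)"
proof -
  obtain C where C: "C \<ge> 0" "\<And>t r s z. 0 < t \<Longrightarrow> t \<le> 1 \<Longrightarrow> 0 \<le> r \<Longrightarrow> 0 \<le> s \<Longrightarrow> 1 / 2 \<le> z - r - s \<Longrightarrow>
      \<bar>image_quad t z r s\<bar> \<le> C * t ^ N / (z - r - s) ^ 4 * (r * s)"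
    using image_quad_far_bound[of N] by metis
  have "\<bar>image_quad t (2 * real (Suc m) + 2) r s\<bar> \<le> C * t ^ N * (r * s) * (1 / (2 * real m + 2) ^ 4)"
    if a: "0 < t" "t \<le> 1" "0 \<le> r" "r \<le> 1" "0 \<le> s" "s \<le> 1" for t r s m
  proof -
    have "\<bar>image_quad t (2 * real (Suc m) + 2) r s\<bar> \<le> C * t ^ N / (2 * real (Suc m) + 2 - r - s) ^ 4 * (r * s)"
      using a by (intro C(2)) auto
    also have "\<dots> \<le> C * t ^ N / (2 * real m + 2) ^ 4 * (r * s)"
      using C(1) a by (intro mult_right_mono divide_left_mono power_mono) auto
    finally show ?thesis by simp
  qed
  then show thesis using that[of C] C by blast
qed

lemma interval_kernel_summable:
  assumes "0 < t" "t \<le> 1" "0 \<le> r" "r \<le> 1" "0 \<le> s" "s \<le> 1"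
  shows "summable (\<lambda>m. \<bar>image_quad t (2 * real m + 2) r s\<bar>)"
proof -
  obtain C where C: "\<And>m. \<bar>image_quad t (2 * real (Suc m) + 2) r s\<bar> \<le> C * t ^ 0 * (r * s) * (1 / (2 * real m + 2) ^ 4)"
    using image_quad_sum_bound[of 0] assms by metis
  have "summable (\<lambda>m. \<bar>image_quad t (2 * real (Suc m) + 2) r s\<bar>)"
    by (rule summable_comparison_test'[OF summable_mult[OF inverse_fourth_summable, of "C * t ^ 0 * (r * s)"]])
       (use C in auto)
  then show ?thesis by (subst (asm) summable_Suc_iff[of "\<lambda>m. \<bar>image_quad t (2 * real m + 2) r s\<bar>"])
qed

text \<open>On the unit square only the half line kernel and the group z = 2 matter up to an
  arbitrary power of t. The bound on partial sums is for dominated convergence of the image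
  series.\<close>

lemma interval_kernel_tail:
  obtains C where "C \<ge> 0"
    "\<And>t r s. 0 < t \<Longrightarrow> t \<le> 1 \<Longrightarrow> 0 \<le> r \<Longrightarrow> r \<le> 1 \<Longrightarrow> 0 \<le> s \<Longrightarrow> s \<le> 1 \<Longrightarrow>
      \<bar>interval_kernel t r s - half_line_kernel t r s - image_quad t 2 r s\<bar> \<le> C * t ^ N * (r * s)"
    "\<And>t r s n. 0 < t \<Longrightarrow> t \<le> 1 \<Longrightarrow> 0 \<le> r \<Longrightarrow> r \<le> 1 \<Longrightarrow> 0 \<le> s \<Longrightarrow> s \<le> 1 \<Longrightarrow>
      (\<Sum>m<n. \<bar>image_quad t (2 * real (Suc m) + 2) r s\<bar>) \<le> C * t ^ N * (r * s)"
proof -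
  obtain C where C: "C \<ge> 0" "\<And>t r s m. 0 < t \<Longrightarrow> t \<le> 1 \<Longrightarrow> 0 \<le> r \<Longrightarrow> r \<le> 1 \<Longrightarrow> 0 \<le> s \<Longrightarrow> s \<le> 1 \<Longrightarrow>
      \<bar>image_quad t (2 * real (Suc m) + 2) r s\<bar> \<le> C * t ^ N * (r * s) * (1 / (2 * real m + 2) ^ 4)"
    using image_quad_sum_bound[of N] by metis
  define D where "D = C * (\<Sum>m. 1 / (2 * real m + 2) ^ 4)"
  have D0: "0 \<le> D" unfolding D_def using C(1) by (intro mult_nonneg_nonneg suminf_nonneg inverse_fourth_summable) auto
  have "\<bar>interval_kernel t r s - half_line_kernel t r s - image_quad t 2 r s\<bar> \<le> D * t ^ N * (r * s) \<and>
    (\<Sum>m<n. \<bar>image_quad t (2 * real (Suc m) + 2) r s\<bar>) \<le> D * t ^ N * (r * s)"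
    if a: "0 < t" "t \<le> 1" "0 \<le> r" "r \<le> 1" "0 \<le> s" "s \<le> 1" for t r s n
  proof -
    note S = interval_kernel_summable[OF a]
    have S': "summable (\<lambda>m. \<bar>image_quad t (2 * real (Suc m) + 2) r s\<bar>)"
      using S by (subst summable_Suc_iff[of "\<lambda>m. \<bar>image_quad t (2 * real m + 2) r s\<bar>"])
    have b: "(\<Sum>m. \<bar>image_quad t (2 * real (Suc m) + 2) r s\<bar>) \<le> D * t ^ N * (r * s)"
    proof -
      have "(\<Sum>m. \<bar>image_quad t (2 * real (Suc m) + 2) r s\<bar>) \<le> (\<Sum>m. C * t ^ N * (r * s) * (1 / (2 * real m + 2) ^ 4))"
        using C(2)[OF a] by (intro suminf_le S' summable_mult inverse_fourth_summable)
      also have "\<dots> = D * t ^ N * (r * s)"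
        by (subst suminf_mult[OF inverse_fourth_summable]) (simp add: D_def mult_ac)
      finally show ?thesis .
    qed
    have "interval_kernel t r s - half_line_kernel t r s - image_quad t 2 r s = (\<Sum>m. image_quad t (2 * real (Suc m) + 2) r s)"
      using suminf_split_head[OF summable_rabs_cancel[OF S]] by (simp add: interval_kernel_def)
    also have "\<bar>\<dots>\<bar> \<le> (\<Sum>m. \<bar>image_quad t (2 * real (Suc m) + 2) r s\<bar>)"
      by (rule summable_rabs[OF S'])
    finally have 1: "\<bar>interval_kernel t r s - half_line_kernel t r s - image_quad t 2 r s\<bar> \<le> D * t ^ N * (r * s)"
      using b by linarith
    have "(\<Sum>m<n. \<bar>image_quad t (2 * real (Suc m) + 2) r s\<bar>) \<le> (\<Sum>m. \<bar>image_quad t (2 * real (Suc m) + 2) r s\<bar>)"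
      by (rule sum_le_suminf[OF S']) auto
    then show ?thesis using 1 b by linarith
  qed
  then show thesis using that[of D] D0 by blast
qed

section \<open>Action of the image kernel on sines\<close>

text \<open>Convolution with a Gaussian multiplies a sine by a constant. After scaling by c = sqrt
  (2 t) that constant is the characteristic function of the standard normal law; the odd part
  integrates to zero.\<close>

lemma gauss1_sine:
  assumes t: "t > 0"
  shows "has_bochner_integral lborel (\<lambda>x. gauss1 t (r - x) * sin (k * x)) (exp (- k\<^sup>2 * t) * sin (k * r))"
proof -
  define c where "c = sqrt (2 * t)"
  define q where "q = k * c"
  have c: "0 < c" "c\<^sup>2 = 2 * t" using t by (auto simp: c_def)
  have den: "integrable lborel std_normal_density" by simp
  have ic: "integrable lborel (\<lambda>x. std_normal_density x * cos (q * x))" "integrable lborel (\<lambda>x. std_normal_density x * sin (q * x))"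
    by (rule Bochner_Integration.integrable_bound[OF den]; auto simp: abs_mult mult_left_le)+
  have "(LINT x|lborel. std_normal_density x * cos (q * x)) = Re (char std_normal_distribution q)"
  proof -
    have i: "integrable std_normal_distribution (\<lambda>x. iexp (q * x))"
      by (subst integrable_density) (auto intro!: Bochner_Integration.integrable_bound[OF den])
    have "Re (char std_normal_distribution q) = (LINT x|std_normal_distribution. Re (iexp (q * x)))"
      unfolding char_def by (rule integral_Re[OF i, symmetric])
    also have "\<dots> = (LINT x|lborel. std_normal_density x * cos (q * x))"
      by (subst integral_real_density) (auto simp: Re_exp)
    finally show ?thesis by simp
  qed
  then have cosI: "(LINT x|lborel. std_normal_density x * cos (q * x)) = exp (- q\<^sup>2 / 2)"
    by (simp add: char_std_normal_distribution)
  have "(LINT x|lborel. std_normal_density x * sin (q * x)) = (LINT x|lborel. - (std_normal_density x * sin (q * x)))"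
    by (subst lborel_integral_real_affine[of "-1" _ 0]) (auto simp: normal_density_def)
  then have sinI: "(LINT x|lborel. std_normal_density x * sin (q * x)) = 0" by simp
  have eq: "gauss1 t (r - (r + c * x)) * sin (k * (r + c * x)) =
     sin (k * r) / c * (std_normal_density x * cos (q * x)) + cos (k * r) / c * (std_normal_density x * sin (q * x))" for x
  proof -
    have A: "gauss1 t (r - (r + c * x)) = std_normal_density x / c"
      using t c by (simp add: gauss1_def normal_density_def power_mult_distrib real_sqrt_mult c_def)
    have B: "sin (k * (r + c * x)) = sin (k * r) * cos (q * x) + cos (k * r) * sin (q * x)"
      by (simp add: q_def distrib_left sin_add mult_ac)
    show ?thesis unfolding A B by (simp add: algebra_simps add_divide_distrib)
  qed
  have "has_bochner_integral lborel (\<lambda>x. gauss1 t (r - (r + c * x)) * sin (k * (r + c * x))) (sin (k * r) / c * exp (- q\<^sup>2 / 2) + cos (k * r) / c * 0)"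
    unfolding eq using ic cosI sinI
    by (intro has_bochner_integral_add has_bochner_integral_mult_right) (auto simp: has_bochner_integral_iff)
  also have "sin (k * r) / c * exp (- q\<^sup>2 / 2) + cos (k * r) / c * 0 = (exp (- k\<^sup>2 * t) * sin (k * r)) /\<^sub>R \<bar>c\<bar>"
    using c by (simp add: q_def power_mult_distrib field_simps)
  finally show ?thesis
    using lborel_has_bochner_integral_real_affine_iff[of c "\<lambda>x. gauss1 t (r - x) * sin (k * x)" _ r] c by simp
qed

lemma sin_period:
  fixes j m :: nat
  shows "sin (real j * pi * (x + 2 * real m)) = sin (real j * pi * x)"
    and "sin (real j * pi * (x - 2 * real m)) = sin (real j * pi * x)"
proof -
  have "sin (2 * real (j * m) * pi) = 0" "cos (2 * real (j * m) * pi) = 1"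
    using sin_npi[of "2 * (j * m)"] cos_npi[of "2 * (j * m)"] by (simp_all add: mult.assoc)
  moreover have "real j * pi * (x + 2 * real m) = real j * pi * x + 2 * real (j * m) * pi"
    "real j * pi * (x - 2 * real m) = real j * pi * x - 2 * real (j * m) * pi" by (simp_all add: algebra_simps)
  ultimately show "sin (real j * pi * (x + 2 * real m)) = sin (real j * pi * x)"
    "sin (real j * pi * (x - 2 * real m)) = sin (real j * pi * x)"
    by (simp_all only: sin_add sin_diff)
qed

text \<open>Unfolding: oddness and period 2 of the sine turn the integral of an image pair over
  (0,1) into the integral of a single Gaussian over the interval of length 2 centred at - c.\<close>

lemma image_pair_sine:
  fixes j :: nat and r :: real
  assumes t: "t > 0" and k: "k = real j * pi" and c: "c = 2 * real m \<or> c = - (2 * real m)"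
  defines "g \<equiv> \<lambda>x. gauss1 t (r - x) * sin (k * x)"
  shows "integral {0..1} (\<lambda>s. (gauss1 t (c + r - s) - gauss1 t (c + r + s)) * sin (k * s)) = integral {- 1 - c..1 - c} g"
proof -
  have cg: "continuous_on S g" for S
    unfolding g_def by (intro continuous_intros t)
  have per: "sin (k * (x - c)) = sin (k * x)" "sin (k * (- x - c)) = - sin (k * x)" for x
    using sin_period[of j x m] sin_period[of j "- x" m] c by (auto simp: k)
  have 1: "integral {0..1} (\<lambda>s. gauss1 t (c + r - s) * sin (k * s)) = integral {- c..1 - c} g"
  proof -
    have "integral {0..1} (g \<circ> (+) (- c)) = integral {0 + (- c)..1 + (- c)} g"
      by (rule integral_shift_Icc_real)
    moreover have "(g \<circ> (+) (- c)) = (\<lambda>s. gauss1 t (c + r - s) * sin (k * s))"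
      using per by (auto simp: g_def fun_eq_iff algebra_simps)
    ultimately show ?thesis by simp
  qed
  have 2: "integral {0..1} (\<lambda>s. gauss1 t (c + r + s) * sin (k * s)) = - integral {- 1 - c..- c} g"
  proof -
    have "integral {-1..0} (g \<circ> (+) (- c)) = integral {-1 + (- c)..0 + (- c)} g"
      by (rule integral_shift_Icc_real)
    moreover have "integral {-1..-0} (\<lambda>x. (g \<circ> (+) (- c)) (- (- x))) = integral {0..1} (\<lambda>x. (g \<circ> (+) (- c)) (- x))"
      by (rule Henstock_Kurzweil_Integration.integral_reflect_real)
    moreover have "(\<lambda>x. (g \<circ> (+) (- c)) (- x)) = (\<lambda>s. - (gauss1 t (c + r + s) * sin (k * s)))"
      using per by (auto simp: g_def fun_eq_iff algebra_simps)
    ultimately show ?thesis by (simp add: o_def)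
  qed
  have "integral {0..1} (\<lambda>s. gauss1 t (c + r - s) * sin (k * s) - gauss1 t (c + r + s) * sin (k * s)) =
     integral {0..1} (\<lambda>s. gauss1 t (c + r - s) * sin (k * s)) - integral {0..1} (\<lambda>s. gauss1 t (c + r + s) * sin (k * s))"
    by (intro Henstock_Kurzweil_Integration.integral_diff integrable_continuous_interval continuous_intros t)
  also have "\<dots> = integral {- 1 - c..- c} g + integral {- c..1 - c} g" using 1 2 by simp
  also have "\<dots> = integral {- 1 - c..1 - c} g"
    by (rule Henstock_Kurzweil_Integration.integral_combine) (auto intro!: integrable_continuous_interval cg)
  finally show ?thesis by (simp add: left_diff_distrib)
qed

text \<open>The unfolded intervals are adjacent, so the first n groups together with the half line
  kernel tile a symmetric interval that grows to the whole line.\<close>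

lemma interval_kernel_partial_sine:
  fixes j :: nat and r :: real
  assumes t: "t > 0" and k: "k = real j * pi"
  defines "g \<equiv> \<lambda>x. gauss1 t (r - x) * sin (k * x)"
  shows "integral {0..1} (\<lambda>s. (half_line_kernel t r s + (\<Sum>m<n. image_quad t (2 * real m + 2) r s)) * sin (k * s))
    = integral {- (2 * real n + 1)..2 * real n + 1} g"
proof (induction n)
  case 0
  show ?case
    using image_pair_sine[OF t k, of 0 0 r] by (simp add: half_line_kernel_def g_def)
next
  case (Suc n)
  have cg: "continuous_on S g" for S
    unfolding g_def by (intro continuous_intros t)
  define c where "c = 2 * real (Suc n)"
  have q: "image_quad t c r s * sin (k * s) = (gauss1 t (c + r - s) - gauss1 t (c + r + s)) * sin (k * s) + (gauss1 t (- c + r - s) - gauss1 t (- c + r + s)) * sin (k * s)" for s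
    using gauss1_minus[of t "- c + r - s"] gauss1_minus[of t "- c + r + s"]
    by (simp add: image_quad_def algebra_simps del: gauss1_minus)
  have "integral {0..1} (\<lambda>s. image_quad t c r s * sin (k * s)) = integral {- 1 - c..1 - c} g + integral {- 1 - (- c)..1 - (- c)} g"
    unfolding q image_pair_sine[OF t k disjI1[OF c_def], of r, folded g_def, symmetric]
      image_pair_sine[OF t k disjI2[OF arg_cong[OF c_def, of uminus]], of r, folded g_def, symmetric]
    by (rule Henstock_Kurzweil_Integration.integral_add) (intro integrable_continuous_interval continuous_intros t)+
  note 1 = this
  have "integral {0..1} (\<lambda>s. (half_line_kernel t r s + (\<Sum>m<n. image_quad t (2 * real m + 2) r s)) * sin (k * s) + image_quad t c r s * sin (k * s)) =
     integral {0..1} (\<lambda>s. (half_line_kernel t r s + (\<Sum>m<n. image_quad t (2 * real m + 2) r s)) * sin (k * s)) + integral {0..1} (\<lambda>s. image_quad t c r s * sin (k * s))"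
    unfolding half_line_kernel_def image_quad_def
    by (rule Henstock_Kurzweil_Integration.integral_add) (intro integrable_continuous_interval continuous_intros t)+
  also have "\<dots> = integral {- 1 - c..1 - c} g + integral {1 - c..c - 1} g + integral {c - 1..c + 1} g"
    unfolding 1 Suc by (simp add: c_def algebra_simps)
  also have "integral {- 1 - c..1 - c} g + integral {1 - c..c - 1} g = integral {- 1 - c..c - 1} g"
    by (rule Henstock_Kurzweil_Integration.integral_combine) (auto intro!: integrable_continuous_interval cg simp: c_def)
  also have "\<dots> + integral {c - 1..c + 1} g = integral {- 1 - c..c + 1} g"
    by (rule Henstock_Kurzweil_Integration.integral_combine) (auto intro!: integrable_continuous_interval cg simp: c_def)
  finally show ?case by (simp add: c_def algebra_simps)
qed

lemma interval_kernel_measurable [measurable]: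
  "(\<lambda>z. interval_kernel t (fst z) (snd z)) \<in> borel_measurable (borel \<Otimes>\<^sub>M borel)"
  unfolding interval_kernel_def half_line_kernel_def image_quad_def gauss1_def by measurable

lemma interval_kernel_measurable2 [measurable]: "interval_kernel t r \<in> borel_measurable borel"
  unfolding interval_kernel_def[abs_def] half_line_kernel_def image_quad_def gauss1_def by measurable

text \<open>The constant depends on t, which is enough for integrability and dominated convergence
  at a fixed time; bounds uniform in t come from \<open>interval_kernel_tail\<close>.\<close>

lemma interval_kernel_bound:
  assumes t: "0 < t" "t \<le> 1"
  obtains C where "C \<ge> 0" "\<And>r s. 0 \<le> r \<Longrightarrow> r \<le> 1 \<Longrightarrow> 0 \<le> s \<Longrightarrow> s \<le> 1 \<Longrightarrow> \<bar>interval_kernel t r s\<bar> \<le> C * (r * s)"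
    "\<And>r s n. 0 \<le> r \<Longrightarrow> r \<le> 1 \<Longrightarrow> 0 \<le> s \<Longrightarrow> s \<le> 1 \<Longrightarrow>
      \<bar>half_line_kernel t r s + (\<Sum>m<n. image_quad t (2 * real m + 2) r s)\<bar> \<le> C * (r * s)"
proof -
  define B where "B = 2 / t / sqrt (4 * pi * t)"
  have B0: "0 \<le> B" using t by (simp add: B_def)
  have Q: "\<bar>image_quad t z r s\<bar> \<le> 4 * B * (r * s)" if "0 \<le> r" "0 \<le> s" for z r s
    using that t gauss1''_bounded[OF t(1)] by (intro image_quad_bound) (auto simp: B_def)
  have H: "\<bar>half_line_kernel t r s\<bar> \<le> 2 * B * (r * s)" if "0 \<le> r" "0 \<le> s" for r s
    using Q[OF that, of 0] by (simp add: half_line_kernel_image_quad)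
  obtain C where C: "C \<ge> 0" "\<And>r s. 0 \<le> r \<Longrightarrow> r \<le> 1 \<Longrightarrow> 0 \<le> s \<Longrightarrow> s \<le> 1 \<Longrightarrow>
      \<bar>interval_kernel t r s - half_line_kernel t r s - image_quad t 2 r s\<bar> \<le> C * t ^ 0 * (r * s)"
    "\<And>r s n. 0 \<le> r \<Longrightarrow> r \<le> 1 \<Longrightarrow> 0 \<le> s \<Longrightarrow> s \<le> 1 \<Longrightarrow>
      (\<Sum>m<n. \<bar>image_quad t (2 * real (Suc m) + 2) r s\<bar>) \<le> C * t ^ 0 * (r * s)"
    using interval_kernel_tail[of 0] t by metis
  define D where "D = 6 * B + C"
  have D0: "D \<ge> 0" using B0 C by (simp add: D_def)
  show thesis
  proof (rule that[OF D0])
    fix r s :: real assume a: "0 \<le> r" "r \<le> 1" "0 \<le> s" "s \<le> 1"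
    have d: "D * (r * s) = 2 * B * (r * s) + 4 * B * (r * s) + C * (r * s)" by (simp add: D_def algebra_simps)
    show "\<bar>interval_kernel t r s\<bar> \<le> D * (r * s)"
      using C(2)[OF a] H[OF a(1,3)] Q[OF a(1,3), of 2] unfolding d by simp
    fix n
    have "\<bar>\<Sum>m<n. image_quad t (2 * real m + 2) r s\<bar> \<le> 4 * B * (r * s) + C * (r * s)"
    proof (cases n)
      case 0
      then show ?thesis using a B0 C by simp
    next
      case (Suc l)
      have "\<bar>\<Sum>m<l. image_quad t (2 * real (Suc m) + 2) r s\<bar> \<le> C * (r * s)"
        using order_trans[OF sum_abs C(3)[OF a]] by simp
      then show ?thesis
        unfolding Suc sum.lessThan_Suc_shift using Q[OF a(1,3), of 2] by simp
    qed
    then show "\<bar>half_line_kernel t r s + (\<Sum>m<n. image_quad t (2 * real m + 2) r s)\<bar> \<le> D * (r * s)"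
      using H[OF a(1,3)] unfolding d by linarith
  qed
qed

lemma set_integrable_bounded_interval:
  fixes f :: "real \<Rightarrow> real"
  assumes "f \<in> borel_measurable borel" "\<And>x. x \<in> {a..b} \<Longrightarrow> \<bar>f x\<bar> \<le> M"
  shows "set_integrable lborel {a..b} f"
proof (rule set_integrable_bound[of _ _ "\<lambda>_. M"])
  show "set_integrable lborel {a..b} (\<lambda>_. M)"
    unfolding set_integrable_def by (intro integrable_scaleR_left integrable_real_indicator) (auto simp: emeasure_lborel_Icc_eq)
  show "set_borel_measurable lborel {a..b} f" using assms(1) by (simp add: set_borel_measurable_def)
qed (use assms in \<open>auto intro: order_trans[OF _ abs_ge_self]\<close>)

text \<open>Letting the tiled interval grow yields the Gaussian multiplier, which is the one that
  the Dirichlet kernel of the unit ball has on the corresponding radial eigenfunction.\<close>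

lemma interval_kernel_sine:
  fixes j :: nat
  assumes t: "0 < t" "t \<le> 1" and r: "0 \<le> r" "r \<le> 1"
  shows "(LINT s:{0..1}|lborel. interval_kernel t r s * sin (real j * pi * s)) = exp (- (real j * pi)\<^sup>2 * t) * sin (real j * pi * r)"
proof -
  define k where "k = real j * pi"
  define g where "g x = gauss1 t (r - x) * sin (k * x)" for x
  define S where "S n s = half_line_kernel t r s + (\<Sum>m<n. image_quad t (2 * real m + 2) r s)" for n s
  obtain C where C: "C \<ge> 0" 
    "\<And>s n. 0 \<le> s \<Longrightarrow> s \<le> 1 \<Longrightarrow> \<bar>S n s\<bar> \<le> C * (r * s)"
    using interval_kernel_bound[OF t] r unfolding S_def by metis
  have cg: "continuous_on A g" for A unfolding g_def by (intro continuous_intros t)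
  have cS: "continuous_on A (S n)" for A n
    unfolding S_def half_line_kernel_def image_quad_def by (intro continuous_intros t)
  have Sb: "\<bar>S n s\<bar> \<le> C" if "s \<in> {0..1}" for n s
  proof -
    have "r * s \<le> 1" using r that mult_mono[of r 1 s 1] by simp
    then have "C * (r * s) \<le> C * 1" using C(1) by (intro mult_left_mono)
    then show ?thesis using C(2)[of s n] that by simp
  qed
  have conv: "(\<lambda>n. LINT s:{0..1}|lborel. S n s * sin (k * s)) \<longlonglongrightarrow> (LINT s:{0..1}|lborel. interval_kernel t r s * sin (k * s))"
    unfolding set_lebesgue_integral_def
  proof (rule integral_dominated_convergence[where w="\<lambda>s. indicator {0..1} s * C"])
    have [measurable]: "S n \<in> borel_measurable borel" for n
      using cS by (rule borel_measurable_continuous_onI)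
    show "(\<lambda>s. indicat_real {0..1} s *\<^sub>R (interval_kernel t r s * sin (k * s))) \<in> borel_measurable lborel" by measurable
    show "(\<lambda>s. indicat_real {0..1} s *\<^sub>R (S n s * sin (k * s))) \<in> borel_measurable lborel" for n by measurable
    show "integrable lborel (\<lambda>s. indicator {0..1::real} s * C)"
      by (intro integrable_mult_left integrable_real_indicator) (auto simp: emeasure_lborel_Icc_eq)
    show "AE s in lborel. (\<lambda>n. indicat_real {0..1} s *\<^sub>R (S n s * sin (k * s))) \<longlonglongrightarrow> indicat_real {0..1} s *\<^sub>R (interval_kernel t r s * sin (k * s))"
    proof (rule AE_I2)
      fix s :: real
      show "(\<lambda>n. indicat_real {0..1} s *\<^sub>R (S n s * sin (k * s))) \<longlonglongrightarrow> indicat_real {0..1} s *\<^sub>R (interval_kernel t r s * sin (k * s))"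
      proof (cases "s \<in> {0..1}")
        case True
        then have "summable (\<lambda>m. image_quad t (2 * real m + 2) r s)"
          using interval_kernel_summable[OF t r, of s] by (auto intro: summable_rabs_cancel)
        then have "(\<lambda>n. \<Sum>m<n. image_quad t (2 * real m + 2) r s) \<longlonglongrightarrow> (\<Sum>m. image_quad t (2 * real m + 2) r s)"
          by (rule summable_LIMSEQ)
        then show ?thesis unfolding S_def interval_kernel_def by (intro tendsto_intros)
      qed simp
    qed
    show "AE s in lborel. norm (indicat_real {0..1} s *\<^sub>R (S n s * sin (k * s))) \<le> indicator {0..1} s * C" for n
    proof (rule AE_I2)
      fix s :: real
      have "\<bar>S n s\<bar> * \<bar>sin (k * s)\<bar> \<le> C * 1" if "s \<in> {0..1}"
        using Sb[OF that] C by (intro mult_mono) auto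
      then show "norm (indicat_real {0..1} s *\<^sub>R (S n s * sin (k * s))) \<le> indicator {0..1} s * C"
        by (auto simp: abs_mult indicator_def)
    qed
  qed
  have gi: "integrable lborel g" "(LINT x|lborel. g x) = exp (- k\<^sup>2 * t) * sin (k * r)"
    using gauss1_sine[OF t(1), of r k] unfolding g_def[abs_def] by (auto simp: has_bochner_integral_iff)
  have eq: "(LINT s:{0..1}|lborel. S n s * sin (k * s)) = (LINT s:{- (2 * real n + 1)..2 * real n + 1}|lborel. g s)" for n
  proof -
    have "set_integrable lborel {0..1} (\<lambda>s. S n s * sin (k * s))"
      unfolding set_integrable_def by (rule borel_integrable_compact) (auto intro!: continuous_intros cS)
    from set_borel_integral_eq_integral(2)[OF this]
    have "(LINT s:{0..1}|lborel. S n s * sin (k * s)) = integral {0..1} (\<lambda>s. S n s * sin (k * s))" .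
    also have "\<dots> = integral {- (2 * real n + 1)..2 * real n + 1} g"
      unfolding S_def g_def by (rule interval_kernel_partial_sine[OF t(1) k_def])
    also have "\<dots> = (LINT s:{- (2 * real n + 1)..2 * real n + 1}|lborel. g s)"
      by (rule set_borel_integral_eq_integral(2)[symmetric], unfold set_integrable_def, rule borel_integrable_compact)
         (auto intro!: cg)
    finally show ?thesis .
  qed
  have "(\<lambda>n. LINT s:{- (2 * real n + 1)..2 * real n + 1}|lborel. g s) \<longlonglongrightarrow> (LINT x|lborel. g x)"
    unfolding set_lebesgue_integral_def
  proof (rule integral_dominated_convergence[where w="\<lambda>x. \<bar>g x\<bar>"])
    show "AE x in lborel. (\<lambda>n. indicat_real {- (2 * real n + 1)..2 * real n + 1} x *\<^sub>R g x) \<longlonglongrightarrow> g x"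
    proof (rule AE_I2)
      fix x
      obtain N :: nat where N: "\<bar>x\<bar> \<le> real N" using real_arch_simple by blast
      have "\<forall>\<^sub>F n in sequentially. g x = indicat_real {- (2 * real n + 1)..2 * real n + 1} x *\<^sub>R g x"
        using eventually_ge_at_top[of N] by eventually_elim (use N in \<open>auto simp: indicator_def\<close>)
      then show "(\<lambda>n. indicat_real {- (2 * real n + 1)..2 * real n + 1} x *\<^sub>R g x) \<longlonglongrightarrow> g x"
        by (rule Lim_transform_eventually[OF tendsto_const])
    qed
  qed (use gi(1) in \<open>auto simp: indicator_def\<close>)
  then have "(\<lambda>n. LINT s:{0..1}|lborel. S n s * sin (k * s)) \<longlonglongrightarrow> exp (- k\<^sup>2 * t) * sin (k * r)"
    unfolding eq gi(2) .
  with conv have "(LINT s:{0..1}|lborel. interval_kernel t r s * sin (k * s)) = exp (- k\<^sup>2 * t) * sin (k * r)"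
    using LIMSEQ_unique by blast
  then show ?thesis unfolding k_def .
qed

section \<open>Reduction to one dimension\<close>

text \<open>Both kernels act on each sine with the same multiplier, so the identity extends by
  linearity to sine polynomials and by uniform approximation to sin (pi s) h(s). The factor sin (pi
  s) stays outside the approximation: it compensates the division by the norm at the centre and
  gives the approximation error an integrable majorant.\<close>

lemma dirichlet_heat_kernel_radial:
  fixes y :: "real^3" and h :: "real \<Rightarrow> real"
  assumes p: "dirichlet_heat_kernel (ball 0 a) p" and a: "0 < a" and y: "y \<in> ball 0 a" "y \<noteq> 0"
    and t: "0 < t" "t \<le> a\<^sup>2" and h: "continuous_on {0..1} h"
  shows "set_integrable lborel (ball 0 a) (\<lambda>x. p x y t * (sin (pi * (1 - norm x / a)) * h (1 - norm x / a) / norm x))"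
    and "(LINT x:ball 0 a|lborel. p x y t * (sin (pi * (1 - norm x / a)) * h (1 - norm x / a) / norm x)) =
      (LINT s:{0..1}|lborel. interval_kernel (t / a\<^sup>2) (1 - norm y / a) s * (sin (pi * s) * h s)) / norm y"
proof -
  define B :: "(real^3) set" where "B = ball 0 a"
  define \<tau> where "\<tau> = t / a\<^sup>2"
  have \<tau>: "0 < \<tau>" "\<tau> \<le> 1" using a t by (auto simp: \<tau>_def)
  define \<sigma> where "\<sigma> x = 1 - norm x / a" for x :: "real^3"
  have \<sigma>m [measurable]: "\<sigma> \<in> borel_measurable borel" unfolding \<sigma>_def[abs_def] by measurable
  have \<sigma>B: "\<sigma> x \<in> {0..1}" if "x \<in> B" for x
    using that a by (auto simp: \<sigma>_def B_def divide_le_eq)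
  have yB: "\<sigma> y \<in> {0..1}" using \<sigma>B y by (simp add: B_def)
  have ny: "0 < norm y" using y by simp
  note int = dirichlet_heat_kernel_integrable(1)[OF p y(1) t(1), folded B_def]
  note [measurable] = dirichlet_heat_kernel_slice_measurable[OF p open_ball y(1) t(1), folded B_def]
  define K where "K = interval_kernel \<tau> (\<sigma> y)"
  have [measurable]: "K \<in> borel_measurable borel" unfolding K_def by measurable
  obtain C where C: "C \<ge> 0" "\<And>s. s \<in> {0..1} \<Longrightarrow> \<bar>K s\<bar> \<le> C"
  proof -
    obtain C where C: "C \<ge> 0" "\<And>r s. 0 \<le> r \<Longrightarrow> r \<le> 1 \<Longrightarrow> 0 \<le> s \<Longrightarrow> s \<le> 1 \<Longrightarrow> \<bar>interval_kernel \<tau> r s\<bar> \<le> C * (r * s)"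
      using interval_kernel_bound[OF \<tau>] by metis
    have "\<bar>K s\<bar> \<le> C" if s: "s \<in> {0..1}" for s
    proof -
      have "\<sigma> y * s \<le> 1 * 1" using yB s by (intro mult_mono) auto
      then have "C * (\<sigma> y * s) \<le> C * 1" using C(1) by (intro mult_left_mono) auto
      then show ?thesis using C(2)[of "\<sigma> y" s] yB s by (simp add: K_def)
    qed
    then show thesis using that C(1) by blast
  qed
  have iK: "set_integrable lborel {0..1} (\<lambda>s. K s * \<phi> s)"
    if "\<phi> \<in> borel_measurable borel" "\<And>s. s \<in> {0..1} \<Longrightarrow> \<bar>\<phi> s\<bar> \<le> M" for \<phi> :: "real \<Rightarrow> real" and M
    using that C by (intro set_integrable_bounded_interval[where M="C * M"]) (auto simp: abs_mult intro!: mult_mono)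
  \<comment> \<open>The functions for which both sides agree. Measurability, boundedness and
    integrability are carried along so that the class is closed under linear combinations.\<close>
  define good where "good \<phi> \<longleftrightarrow> \<phi> \<in> borel_measurable borel \<and> (\<exists>M. \<forall>s\<in>{0..1}. \<bar>\<phi> s\<bar> \<le> M) \<and>
     set_integrable lborel B (\<lambda>x. p x y t * (\<phi> (\<sigma> x) / norm x)) \<and>
     (LINT x:B|lborel. p x y t * (\<phi> (\<sigma> x) / norm x)) = (LINT s:{0..1}|lborel. K s * \<phi> s) / norm y" for \<phi> :: "real \<Rightarrow> real"
  have good_add: "good (\<lambda>s. \<phi> s + \<psi> s)" if gd: "good \<phi>" "good \<psi>" for \<phi> \<psi>
  proof -
    obtain M where M1: "\<forall>s\<in>{0..1}. \<bar>\<phi> s\<bar> \<le> M" using gd(1) unfolding good_def by blast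
    obtain M' where M2: "\<forall>s\<in>{0..1}. \<bar>\<psi> s\<bar> \<le> M'" using gd(2) unfolding good_def by blast
    note M = M1 M2
    have "\<forall>s\<in>{0..1}. \<bar>\<phi> s + \<psi> s\<bar> \<le> M + M'"
      using M by (auto intro!: order_trans[OF abs_triangle_ineq] add_mono)
    moreover have "set_integrable lborel {0..1} (\<lambda>s. K s * \<phi> s)" "set_integrable lborel {0..1} (\<lambda>s. K s * \<psi> s)"
      using iK that M unfolding good_def by blast+
    ultimately show ?thesis
      using that unfolding good_def by (auto simp: add_divide_distrib distrib_left)
  qed
  have good_cmult: "good (\<lambda>s. c * \<phi> s)" if gd: "good \<phi>" for c \<phi>
  proof -
    obtain M where M: "\<forall>s\<in>{0..1}. \<bar>\<phi> s\<bar> \<le> M" using gd unfolding good_def by blast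
    have "\<forall>s\<in>{0..1}. \<bar>c * \<phi> s\<bar> \<le> \<bar>c\<bar> * M"
      using M by (auto simp: abs_mult intro!: mult_left_mono)
    moreover have "(\<lambda>s. c * \<phi> s) \<in> borel_measurable borel" using gd by (intro borel_measurable_times) (auto simp: good_def)
    moreover have e1: "p x y t * (c * \<phi> (\<sigma> x) / norm x) = c * (p x y t * (\<phi> (\<sigma> x) / norm x))" for x by simp
    have e2: "K s * (c * \<phi> s) = c * (K s * \<phi> s)" for s by simp
    moreover have "set_integrable lborel B (\<lambda>x. p x y t * (c * \<phi> (\<sigma> x) / norm x))"
      unfolding e1 using gd by (intro set_integrable_mult_right) (simp add: good_def)
    moreover have "(LINT x:B|lborel. p x y t * (c * \<phi> (\<sigma> x) / norm x)) = (LINT s:{0..1}|lborel. K s * (c * \<phi> s)) / norm y"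
      unfolding e1 e2 set_integral_mult_right using gd by (simp add: good_def)
    ultimately show ?thesis
      using gd unfolding good_def by blast
  qed
  have good_sum: "finite I \<Longrightarrow> (\<And>i. i \<in> I \<Longrightarrow> good (\<phi> i)) \<Longrightarrow> good (\<lambda>s. \<Sum>i\<in>I. \<phi> i s)" for I :: "nat set" and \<phi>
  proof (induction I rule: finite_induct)
    case empty
    show ?case by (auto simp: good_def set_integrable_def set_lebesgue_integral_def intro!: exI[of _ 0])
  qed (simp add: good_add)
  have good_sin: "good (\<lambda>s. sin (real n * pi * s))" for n :: nat
  proof -
    define k where "k = real n * pi / a"
    have "k * a = real n * pi" using a by (simp add: k_def)
    then have k0: "sin (k * a) = 0" by simp
    \<comment> \<open>In the variable 1 - |x| / a the sine runs backwards; the resulting sign is the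
      same at x and at y and cancels.\<close>
    have eq: "sin (real n * pi * \<sigma> x) / norm x = - cos (real n * pi) * rsinc k (x \<bullet> x)" if "x \<noteq> 0" for x
    proof -
      have "norm x * rsinc k (x \<bullet> x) = sin (k * norm x)"
        using rsinc_square[of "norm x" k] by (simp add: power2_norm_eq_inner)
      then have r: "rsinc k (x \<bullet> x) = sin (k * norm x) / norm x" using that by (simp add: field_simps)
      have "real n * pi * \<sigma> x = real n * pi - k * norm x"
        using a by (simp add: \<sigma>_def k_def field_simps)
      then have "sin (real n * pi * \<sigma> x) = - cos (real n * pi) * sin (k * norm x)"
        by (simp add: sin_diff)
      then show ?thesis by (simp add: r)
    qed
    have ae: "AE x in lborel. x \<noteq> (0 :: real^3)" by (rule AE_lborel_singleton)
    obtain D where D: "D \<ge> 0" "\<And>s. 0 \<le> s \<Longrightarrow> s \<le> a\<^sup>2 \<Longrightarrow> \<bar>rsinc k s\<bar> \<le> D * (a\<^sup>2 - s)"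
      using rsinc_boundary_bound[OF a k0] by metis
    have Db: "\<bar>rsinc k (x \<bullet> x)\<bar> \<le> D * a\<^sup>2" if "x \<in> B" for x
    proof -
      have "(norm x)\<^sup>2 \<le> a\<^sup>2" using that by (intro power_mono) (auto simp: B_def)
      then have x: "0 \<le> x \<bullet> x" "x \<bullet> x \<le> a\<^sup>2" by (auto simp: power2_norm_eq_inner)
      have "D * (a\<^sup>2 - x \<bullet> x) \<le> D * a\<^sup>2" using D(1) x by (intro mult_left_mono) auto
      then show ?thesis using D(2)[OF x] by linarith
    qed
    have [measurable]: "rsinc k \<in> borel_measurable borel"
      using DERIV_isCont[OF rsinc_deriv] by (intro borel_measurable_continuous_onI continuous_at_imp_continuous_on) auto
    define c where "c = - cos (real n * pi)"
    have i: "set_integrable lborel B (\<lambda>x. p x y t * rsinc k (x \<bullet> x))"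
      by (rule int[OF _ Db]) measurable
    have e: "indicat_real B x *\<^sub>R (p x y t * (sin (real n * pi * \<sigma> x) / norm x)) = c * (indicat_real B x *\<^sub>R (p x y t * rsinc k (x \<bullet> x)))" if "x \<noteq> 0" for x
      by (simp only: eq[OF that] c_def) simp
    have aee: "AE x in lborel. indicat_real B x *\<^sub>R (p x y t * (sin (real n * pi * \<sigma> x) / norm x)) = c * (indicat_real B x *\<^sub>R (p x y t * rsinc k (x \<bullet> x)))"
      using ae by eventually_elim (rule e)
    have m: "(\<lambda>x. indicat_real B x *\<^sub>R (p x y t * (sin (real n * pi * \<sigma> x) / norm x))) \<in> borel_measurable lborel"
    proof -
      have "(\<lambda>x. (indicat_real B x * p x y t) * (sin (real n * pi * \<sigma> x) / norm x)) \<in> borel_measurable lborel" by measurable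
      then show ?thesis by (simp add: mult.assoc)
    qed
    have m2: "(\<lambda>x. c * (indicat_real B x *\<^sub>R (p x y t * rsinc k (x \<bullet> x)))) \<in> borel_measurable lborel"
      using i unfolding set_integrable_def by (intro borel_measurable_times) auto
    have "set_integrable lborel B (\<lambda>x. p x y t * (sin (real n * pi * \<sigma> x) / norm x))"
      unfolding set_integrable_def integrable_cong_AE[OF m m2 aee] using i by (simp add: set_integrable_def)
    moreover have "(LINT x:B|lborel. p x y t * (sin (real n * pi * \<sigma> x) / norm x)) = c * (LINT x:B|lborel. p x y t * rsinc k (x \<bullet> x))"
      unfolding set_lebesgue_integral_def integral_cong_AE[OF m m2 aee] by simp
    moreover have "(LINT x:B|lborel. p x y t * rsinc k (x \<bullet> x)) = exp (- k\<^sup>2 * t) * rsinc k (y \<bullet> y)"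
      unfolding B_def by (rule dirichlet_heat_kernel_eigen[OF p a y(1) t(1) k0])
    moreover have "c * (exp (- k\<^sup>2 * t) * rsinc k (y \<bullet> y)) = exp (- k\<^sup>2 * t) * (sin (real n * pi * \<sigma> y) / norm y)"
      unfolding eq[OF y(2)] by (simp add: c_def)
    moreover have "k\<^sup>2 * t = (real n * pi)\<^sup>2 * \<tau>"
      by (simp add: k_def \<tau>_def power_divide)
    moreover have "(LINT s:{0..1}|lborel. K s * sin (real n * pi * s)) = exp (- (real n * pi)\<^sup>2 * \<tau>) * sin (real n * pi * \<sigma> y)"
      unfolding K_def using yB by (intro interval_kernel_sine \<tau>) auto
    ultimately show ?thesis unfolding good_def by (auto intro!: exI[of _ 1])
  qed
  \<comment> \<open>The product formula sin (n x) cos x = (sin ((n + 1) x) + sin ((n - 1) x)) / 2,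
    iterated, reaches sin x times every polynomial in cos x.\<close>
  have good_sin_cos: "good (\<lambda>s. sin (real n * pi * s) * cos (pi * s) ^ j)" for n j :: nat
  proof (induction j arbitrary: n)
    case 0
    then show ?case using good_sin by simp
  next
    case (Suc j)
    show ?case
    proof (cases n)
      case 0
      then show ?thesis using good_sin[of 0] by simp
    next
      case (Suc m)
      have e: "sin (real n * pi * s) * cos (pi * s) ^ Suc j =
        1 / 2 * (sin (real (Suc n) * pi * s) * cos (pi * s) ^ j) + 1 / 2 * (sin (real m * pi * s) * cos (pi * s) ^ j)" for s
      proof -
        have "real (Suc n) * pi * s = real n * pi * s + pi * s" "real m * pi * s = real n * pi * s - pi * s"
          by (simp_all add: Suc algebra_simps)
        then have "1 / 2 * sin (real (Suc n) * pi * s) + 1 / 2 * sin (real m * pi * s) = sin (real n * pi * s) * cos (pi * s)"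
          by (simp only: sin_add sin_diff) (simp add: add_divide_distrib diff_divide_distrib)
        note eq = this
        have "sin (real n * pi * s) * cos (pi * s) ^ Suc j =
          (1 / 2 * sin (real (Suc n) * pi * s) + 1 / 2 * sin (real m * pi * s)) * cos (pi * s) ^ j"
          unfolding eq by simp
        then show ?thesis by (simp only: distrib_right mult.assoc)
      qed
      show ?thesis unfolding e by (intro good_add good_cmult Suc.IH)
    qed
  qed
  have good_poly: "good (\<lambda>s. sin (pi * s) * g (cos (pi * s)))" if "real_polynomial_function g" for g
  proof -
    obtain b n where g: "g = (\<lambda>x. \<Sum>i\<le>n. b i * x ^ i)" using \<open>real_polynomial_function g\<close>
      unfolding real_polynomial_function_iff_sum by blast
    have "good (\<lambda>s. \<Sum>i\<le>n. b i * (sin (real 1 * pi * s) * cos (pi * s) ^ i))"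
      by (intro good_sum good_cmult good_sin_cos) auto
    then show ?thesis by (simp add: g sum_distrib_left mult_ac)
  qed
  \<comment> \<open>Since cos (pi s) maps [0,1] homeomorphically onto [-1,1], polynomials in it
    approximate h uniformly.\<close>
  define H where "H c = h (arccos c / pi)" for c
  have cH: "continuous_on {-1..1} H"
    unfolding H_def
    by (rule continuous_on_compose2[OF h])
       (auto intro!: continuous_intros divide_nonneg_pos simp: arccos_lbound arccos_ubound divide_le_eq)
  have hH: "h s = H (cos (pi * s))" if "s \<in> {0..1}" for s
    using that by (simp add: H_def arccos_cos mult_left_le)
  have "\<exists>g. real_polynomial_function g \<and> (\<forall>x\<in>{-1..1}. \<bar>H x - g x\<bar> < 1 / real (Suc n))" for n
    by (rule Stone_Weierstrass_real_polynomial_function[OF _ cH, of "1 / real (Suc n)"]) auto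
  then obtain g where g: "\<And>n. real_polynomial_function (g n)" "\<And>n x. x \<in> {-1..1} \<Longrightarrow> \<bar>H x - g n x\<bar> < 1 / real (Suc n)"
    by metis
  define \<Phi> where "\<Phi> n s = sin (pi * s) * g n (cos (pi * s))" for n s
  define \<Psi> where "\<Psi> s = sin (pi * s) * H (cos (pi * s))" for s
  have gd: "good (\<Phi> n)" for n using good_poly[OF g(1)] by (simp add: \<Phi>_def[abs_def])
  have gH: "\<bar>\<Psi> s - \<Phi> n s\<bar> \<le> 1 / real (Suc n) * \<bar>sin (pi * s)\<bar>" for n s
  proof -
    have "\<bar>\<Psi> s - \<Phi> n s\<bar> = \<bar>H (cos (pi * s)) - g n (cos (pi * s))\<bar> * \<bar>sin (pi * s)\<bar>"
      unfolding \<Psi>_def \<Phi>_def by (simp add: right_diff_distrib[symmetric] abs_mult mult.commute)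
    also have "\<dots> \<le> 1 / real (Suc n) * \<bar>sin (pi * s)\<bar>"
      using g(2)[of "cos (pi * s)" n] by (intro mult_right_mono) auto
    finally show ?thesis .
  qed
  have inv0: "(\<lambda>n. 1 / real (Suc n) * c) \<longlonglongrightarrow> 0" for c :: real
    using tendsto_mult_left_zero[OF LIMSEQ_inverse_real_of_nat, of c] by (simp add: divide_inverse)
  have lim\<Phi>: "(\<lambda>n. \<Phi> n s) \<longlonglongrightarrow> \<Psi> s" for s
  proof -
    have "(\<lambda>n. \<Psi> s - \<Phi> n s) \<longlonglongrightarrow> 0"
      by (rule Lim_null_comparison[OF always_eventually inv0]) (use gH in auto)
    from tendsto_diff[OF tendsto_const this, of "\<Psi> s"] show ?thesis by simp
  qed
  have [measurable]: "\<Phi> n \<in> borel_measurable borel" for n using gd by (simp add: good_def)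
  have \<Psi>m [measurable]: "\<Psi> \<in> borel_measurable borel"
    by (rule borel_measurable_LIMSEQ_real[where u=\<Phi>]) (use lim\<Phi> in auto)
  \<comment> \<open>Majorant for all n: every approximant differs from the first by at most 2 |sin
    (pi \<sigma>)|, whose quotient by the norm is integrable by \<open>good_sin\<close> with n =
    1.\<close>
  define w where "w x = indicat_real B x *\<^sub>R \<bar>p x y t * (\<Phi> 0 (\<sigma> x) / norm x)\<bar> + 2 * (indicat_real B x *\<^sub>R \<bar>p x y t * (sin (real 1 * pi * \<sigma> x) / norm x)\<bar>)" for x
  have iw: "integrable lborel w"
  proof -
    have "set_integrable lborel B (\<lambda>x. p x y t * (\<Phi> 0 (\<sigma> x) / norm x))" "set_integrable lborel B (\<lambda>x. p x y t * (sin (real 1 * pi * \<sigma> x) / norm x))"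
      using gd[of 0] good_sin[of 1] unfolding good_def by auto
    from this[THEN set_integrable_abs] show ?thesis
      unfolding w_def set_integrable_def by (intro Bochner_Integration.integrable_add integrable_mult_right)
  qed
  have m\<Phi>: "(\<lambda>x. indicat_real B x *\<^sub>R (p x y t * (\<phi> (\<sigma> x) / norm x))) \<in> borel_measurable lborel"
    if [measurable]: "\<phi> \<in> borel_measurable borel" for \<phi>
  proof -
    have "(\<lambda>x. (indicat_real B x * p x y t) * (\<phi> (\<sigma> x) / norm x)) \<in> borel_measurable lborel" by measurable
    then show ?thesis by (simp add: mult.assoc)
  qed
  have bnd: "norm (indicat_real B x *\<^sub>R (p x y t * (\<Phi> n (\<sigma> x) / norm x))) \<le> w x" for n x
  proof -
    have "1 / real (Suc n) \<le> 1" by simp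
    then have "1 / real (Suc n) * \<bar>sin (pi * \<sigma> x)\<bar> \<le> 1 * \<bar>sin (pi * \<sigma> x)\<bar>" by (intro mult_right_mono) auto
    then have "\<bar>\<Phi> n (\<sigma> x)\<bar> \<le> \<bar>\<Phi> 0 (\<sigma> x)\<bar> + 2 * \<bar>sin (pi * \<sigma> x)\<bar>"
      using gH[of "\<sigma> x" n] gH[of "\<sigma> x" 0] by simp
    then have "\<bar>p x y t\<bar> / norm x * \<bar>\<Phi> n (\<sigma> x)\<bar> \<le> \<bar>p x y t\<bar> / norm x * (\<bar>\<Phi> 0 (\<sigma> x)\<bar> + 2 * \<bar>sin (pi * \<sigma> x)\<bar>)"
      by (intro mult_left_mono) auto
    then show ?thesis
      by (cases "x \<in> B") (auto simp: w_def abs_mult abs_divide algebra_simps add_divide_distrib)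
  qed
  have pw: "(\<lambda>n. indicat_real B x *\<^sub>R (p x y t * (\<Phi> n (\<sigma> x) / norm x))) \<longlonglongrightarrow> indicat_real B x *\<^sub>R (p x y t * (\<Psi> (\<sigma> x) / norm x))" for x
    unfolding divide_inverse by (intro tendsto_intros lim\<Phi>)
  note DC = integrable_dominated_convergence[where w=w, OF m\<Phi>[OF \<Psi>m] m\<Phi> iw AE_I2[OF pw] AE_I2[OF bnd]]
    integral_dominated_convergence[where w=w, OF m\<Phi>[OF \<Psi>m] m\<Phi> iw AE_I2[OF pw] AE_I2[OF bnd]]
  have i\<Psi>: "set_integrable lborel B (\<lambda>x. p x y t * (\<Psi> (\<sigma> x) / norm x))"
    unfolding set_integrable_def by (rule DC(1)) measurable
  have L1: "(\<lambda>n. LINT x:B|lborel. p x y t * (\<Phi> n (\<sigma> x) / norm x)) \<longlonglongrightarrow> (LINT x:B|lborel. p x y t * (\<Psi> (\<sigma> x) / norm x))"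
    unfolding set_lebesgue_integral_def by (rule DC(2)) measurable
  obtain M where M: "\<And>s. s \<in> {0..1} \<Longrightarrow> \<bar>\<Phi> 0 s\<bar> \<le> M" using gd[of 0] unfolding good_def by blast
  have Mb: "\<bar>\<Phi> n s\<bar> \<le> M + 2" if "s \<in> {0..1}" for n s
  proof -
    have "\<bar>\<Psi> s - \<Phi> m s\<bar> \<le> 1" for m
    proof -
      have "1 / real (Suc m) * \<bar>sin (pi * s)\<bar> \<le> 1 * 1" by (intro mult_mono) auto
      then show ?thesis using gH[of s m] by linarith
    qed
    from this[of n] this[of 0] M[OF that] show ?thesis by linarith
  qed
  have L2: "(\<lambda>n. LINT s:{0..1}|lborel. K s * \<Phi> n s) \<longlonglongrightarrow> (LINT s:{0..1}|lborel. K s * \<Psi> s)"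
    unfolding set_lebesgue_integral_def
  proof (rule integral_dominated_convergence[where w="\<lambda>s. indicator {0..1} s * (C * (M + 2))"])
    show "integrable lborel (\<lambda>s. indicator {0..1::real} s * (C * (M + 2)))"
      by (intro integrable_mult_left integrable_real_indicator) (auto simp: emeasure_lborel_Icc_eq)
    show "AE s in lborel. (\<lambda>n. indicat_real {0..1} s *\<^sub>R (K s * \<Phi> n s)) \<longlonglongrightarrow> indicat_real {0..1} s *\<^sub>R (K s * \<Psi> s)"
      by (intro AE_I2 tendsto_intros lim\<Phi>)
    show "AE s in lborel. norm (indicat_real {0..1} s *\<^sub>R (K s * \<Phi> n s)) \<le> indicator {0..1} s * (C * (M + 2))" for n
      using C Mb by (intro AE_I2) (auto simp: indicator_def abs_mult intro!: mult_mono)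
  qed measurable
  have "(\<lambda>n. LINT x:B|lborel. p x y t * (\<Phi> n (\<sigma> x) / norm x)) \<longlonglongrightarrow> (LINT s:{0..1}|lborel. K s * \<Psi> s) / norm y"
    using tendsto_divide[OF L2 tendsto_const, of "norm y"] ny gd by (simp add: good_def)
  from LIMSEQ_unique[OF L1 this]
  have main: "(LINT x:B|lborel. p x y t * (\<Psi> (\<sigma> x) / norm x)) = (LINT s:{0..1}|lborel. K s * \<Psi> s) / norm y" .
  have \<Psi>h: "\<Psi> s = sin (pi * s) * h s" if "s \<in> {0..1}" for s using hH[OF that] by (simp add: \<Psi>_def)
  have e1: "indicat_real B x *\<^sub>R (p x y t * (\<Psi> (\<sigma> x) / norm x)) = indicat_real (ball 0 a) x *\<^sub>R (p x y t * (sin (pi * (1 - norm x / a)) * h (1 - norm x / a) / norm x))" for x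
    using \<Psi>h[OF \<sigma>B, of x] by (cases "x \<in> B") (auto simp: B_def \<sigma>_def)
  have e2: "indicat_real {0..1} s *\<^sub>R (K s * \<Psi> s) = indicat_real {0..1} s *\<^sub>R (interval_kernel (t / a\<^sup>2) (1 - norm y / a) s * (sin (pi * s) * h s))" for s
    using \<Psi>h[of s] by (cases "s \<in> {0..1}") (auto simp: K_def \<tau>_def \<sigma>_def)
  show "set_integrable lborel (ball 0 a) (\<lambda>x. p x y t * (sin (pi * (1 - norm x / a)) * h (1 - norm x / a) / norm x))"
    using i\<Psi> unfolding set_integrable_def e1 .
  show "(LINT x:ball 0 a|lborel. p x y t * (sin (pi * (1 - norm x / a)) * h (1 - norm x / a) / norm x)) =
      (LINT s:{0..1}|lborel. interval_kernel (t / a\<^sup>2) (1 - norm y / a) s * (sin (pi * s) * h s)) / norm y"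
    using main unfolding set_lebesgue_integral_def e1 e2 .
qed

section \<open>Boundary powers as limits of truncated weights\<close>

text \<open>The factor 1 - r stands for |x| / a on (0,1). For r > 1 the profile is negative; those
  values enter when the content is extended to the half line.\<close>

definition profile :: "real \<Rightarrow> real \<Rightarrow> real" where
  "profile p r = (1 - r) * r powr (- p)"

definition interval_content :: "real \<Rightarrow> real \<Rightarrow> real \<Rightarrow> real" where
  "interval_content t p q =
     (LINT r:{0<..<1}|lborel. profile p r * (LINT s:{0<..<1}|lborel. interval_kernel t r s * profile q s))"

lemma profile_measurable [measurable]: "profile p \<in> borel_measurable borel"
  unfolding profile_def[abs_def] by measurable

lemma set_integrable_powr_01:
  fixes q :: real
  assumes "q > - 1"
  shows "set_integrable lborel {0<..<1} (\<lambda>s. s powr q)"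
proof -
  have "set_integrable lborel {0..1} (\<lambda>t. t powr ((q + 1) - 1) * (1 - t) powr (1 - 1))"
    by (rule Gamma_Function.integrable_Beta) (use assms in auto)
  then have "set_integrable lborel {0<..<1} (\<lambda>t. t powr q * (1 - t) powr 0)"
    by (auto elim: set_integrable_subset)
  then show ?thesis
    unfolding set_integrable_def
    by (rule Bochner_Integration.integrable_cong[THEN iffD1, rotated -1]) (auto simp: indicator_def)
qed

text \<open>Continuous, increasing to 1 on (0,1), and zero near both end points: near 0, where the
  profile may be unbounded, and near 1, where the quotient by sin (pi s) has to be formed as
  well.\<close>

definition bump :: "nat \<Rightarrow> real \<Rightarrow> real" where
  "bump n s = min 1 (max 0 (real n * (s * (1 - s)) - 1))"

lemma bump_range: "0 \<le> bump n s" "bump n s \<le> 1"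
  by (auto simp: bump_def)

lemma bump_mono: "s \<in> {0..1} \<Longrightarrow> n \<le> m \<Longrightarrow> bump n s \<le> bump m s"
  unfolding bump_def by (intro min.mono max.mono diff_right_mono mult_right_mono) auto

lemma bump_outside: "s \<notin> {0<..<1} \<Longrightarrow> bump n s = 0"
proof -
  assume "s \<notin> {0<..<1}"
  then have "s * (1 - s) \<le> 0" by (auto simp: mult_le_0_iff)
  then have "real n * (s * (1 - s)) \<le> 0" by (simp add: mult_le_0_iff)
  then show ?thesis by (simp add: bump_def)
qed

lemma bump_tendsto:
  assumes "s \<in> {0<..<1}"
  shows "(\<lambda>n. bump n s) \<longlonglongrightarrow> 1"
proof -
  have s: "0 < s * (1 - s)" using assms by simp
  obtain N :: nat where N: "2 / (s * (1 - s)) \<le> real N" using real_arch_simple by blast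
  have "\<forall>\<^sub>F n in sequentially. bump n s = 1"
    using eventually_ge_at_top[of N]
  proof eventually_elim
    case (elim n)
    then have "2 / (s * (1 - s)) \<le> real n" using N by linarith
    then have "2 \<le> real n * (s * (1 - s))" using s by (simp add: divide_le_eq)
    then show ?case by (simp add: bump_def)
  qed
  then show ?thesis by (rule tendsto_eventually)
qed


lemma sin_pi_pos: "s \<in> {0<..<1} \<Longrightarrow> 0 < sin (pi * s)"
  by (intro sin_gt_zero) (auto simp: mult_less_cancel_left1)

text \<open>This quotient, up to a constant, is the h to which
  \<open>dirichlet_heat_kernel_radial\<close> is applied. It is locally zero around the zeros of the
  sine, hence continuous across them.\<close>

lemma bump_quotient_continuous: "continuous_on UNIV (\<lambda>s. bump n s * (profile p s / sin (pi * s)))"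
proof -
  define U where "U = {s::real. real n * (s * (1 - s)) < 1}"
  have oU: "open U" unfolding U_def by (intro open_Collect_less continuous_intros)
  have "continuous_on (U \<union> {0<..<1}) (\<lambda>s. bump n s * (profile p s / sin (pi * s)))"
  proof (rule continuous_on_open_Un[OF oU open_greaterThanLessThan])
    have "continuous_on U (\<lambda>s. 0 :: real)" by simp
    then show "continuous_on U (\<lambda>s. bump n s * (profile p s / sin (pi * s)))"
      by (rule continuous_on_cong[THEN iffD1, rotated -1]) (auto simp: U_def bump_def)
    show "continuous_on {0<..<1} (\<lambda>s. bump n s * (profile p s / sin (pi * s)))"
      unfolding bump_def profile_def using sin_pi_pos
      by (intro continuous_intros) (auto simp: less_imp_neq[symmetric])
  qed
  moreover have "U \<union> {0<..<1} = UNIV"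
  proof -
    have "s \<in> U" if "s \<notin> {0<..<1}" for s
    proof -
      have "s * (1 - s) \<le> 0" using that by (auto simp: mult_le_0_iff)
      then have "real n * (s * (1 - s)) \<le> 0" by (simp add: mult_le_0_iff)
      then show ?thesis by (simp add: U_def)
    qed
    then show ?thesis by auto
  qed
  ultimately show ?thesis by simp
qed

text \<open>The factor r s in the kernel bound lowers the singularity of the profile to s powr (1 -
  q), which is integrable for q < 2.\<close>

lemma interval_kernel_profile_integrable:
  assumes t: "0 < t" "t \<le> 1" and q: "q < 2"
  obtains C where "C \<ge> 0" "\<And>r. 0 \<le> r \<Longrightarrow> r \<le> 1 \<Longrightarrow> set_integrable lborel {0<..<1} (\<lambda>s. \<bar>interval_kernel t r s\<bar> * profile q s)"
    "\<And>r. 0 \<le> r \<Longrightarrow> r \<le> 1 \<Longrightarrow> (LINT s:{0<..<1}|lborel. \<bar>interval_kernel t r s\<bar> * profile q s) \<le> C * r"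
proof -
  obtain C where C: "C \<ge> 0" "\<And>r s. 0 \<le> r \<Longrightarrow> r \<le> 1 \<Longrightarrow> 0 \<le> s \<Longrightarrow> s \<le> 1 \<Longrightarrow> \<bar>interval_kernel t r s\<bar> \<le> C * (r * s)"
    using interval_kernel_bound[OF t] by metis
  define I where "I = (LINT s:{0<..<1}|lborel. s powr (1 - q))"
  have iI: "set_integrable lborel {0<..<1} (\<lambda>s. s powr (1 - q))" using q by (intro set_integrable_powr_01) simp
  have I0: "0 \<le> I" unfolding I_def set_lebesgue_integral_def by (intro integral_nonneg_AE) (auto simp: indicator_def)
  have b: "\<bar>interval_kernel t r s\<bar> * profile q s \<le> C * r * s powr (1 - q)" "0 \<le> \<bar>interval_kernel t r s\<bar> * profile q s"
    if r: "0 \<le> r" "r \<le> 1" and s: "s \<in> {0<..<1}" for r s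
  proof -
    have "profile q s \<le> 1 * s powr (- q)" "0 \<le> profile q s" unfolding profile_def using s by (auto intro: mult_right_mono)
    then have "\<bar>interval_kernel t r s\<bar> * profile q s \<le> C * (r * s) * (s powr (- q))"
      using C r s by (intro mult_mono) auto
    also have "\<dots> = C * r * (s powr 1 * s powr (- q))" using s by simp
    also have "s powr 1 * s powr (- q) = s powr (1 - q)" using powr_add[of s 1 "- q"] by simp
    finally show "\<bar>interval_kernel t r s\<bar> * profile q s \<le> C * r * s powr (1 - q)" .
    show "0 \<le> \<bar>interval_kernel t r s\<bar> * profile q s" using \<open>0 \<le> profile q s\<close> by simp
  qed
  have i: "set_integrable lborel {0<..<1} (\<lambda>s. \<bar>interval_kernel t r s\<bar> * profile q s)" if r: "0 \<le> r" "r \<le> 1" for r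
  proof (rule set_integrable_bound)
    show "set_integrable lborel {0<..<1} (\<lambda>s. C * r * s powr (1 - q))" using iI by (intro set_integrable_mult_right)
    show "set_borel_measurable lborel {0<..<1} (\<lambda>s. \<bar>interval_kernel t r s\<bar> * profile q s)"
      unfolding set_borel_measurable_def by measurable
    show "AE s in lborel. s \<in> {0<..<1} \<longrightarrow> norm (\<bar>interval_kernel t r s\<bar> * profile q s) \<le> norm (C * r * s powr (1 - q))"
    proof (intro AE_I2 impI)
      fix s :: real assume "s \<in> {0<..<1}"
      from b[OF r this] show "norm (\<bar>interval_kernel t r s\<bar> * profile q s) \<le> norm (C * r * s powr (1 - q))"
        unfolding real_norm_def by linarith
    qed
  qed
  have "(LINT s:{0<..<1}|lborel. \<bar>interval_kernel t r s\<bar> * profile q s) \<le> C * I * r" if r: "0 \<le> r" "r \<le> 1" for r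
  proof -
    have "(LINT s:{0<..<1}|lborel. \<bar>interval_kernel t r s\<bar> * profile q s) \<le> (LINT s:{0<..<1}|lborel. C * r * s powr (1 - q))"
      using b[OF r] i[OF r] iI by (intro set_integral_mono) auto
    also have "\<dots> = C * I * r" by (simp add: I_def)
    finally show ?thesis .
  qed
  then show thesis using that[of "C * I"] i C I0 by simp
qed

lemma interval_kernel_profile_integrable':
  assumes t: "0 < t" "t \<le> 1" and q: "q < 2" and r: "0 \<le> r" "r \<le> 1"
  shows "set_integrable lborel {0<..<1} (\<lambda>s. interval_kernel t r s * profile q s)"
proof -
  have "set_integrable lborel {0<..<1} (\<lambda>s. \<bar>interval_kernel t r s\<bar> * profile q s)"
    using interval_kernel_profile_integrable[OF t q] r by metis
  then show ?thesis
    by (rule set_integrable_bound)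
       (auto simp: abs_mult set_borel_measurable_def)
qed

text \<open>Truncation with \<open>bump\<close> brings the weight into the range of
  \<open>dirichlet_heat_kernel_radial\<close>. The limit is taken by monotone convergence on the
  ball, where the integrand is nonnegative, and by dominated convergence on the interval, where no
  sign of the image kernel has been established.\<close>

lemma dirichlet_heat_kernel_boundary_power:
  fixes y :: "real^3"
  assumes p: "dirichlet_heat_kernel (ball 0 a) p" and a: "0 < a" and y: "y \<in> ball 0 a" "y \<noteq> 0"
    and t: "0 < t" "t \<le> a\<^sup>2" and \<alpha>: "\<alpha> < 2"
  defines "W \<equiv> LINT s:{0<..<1}|lborel. interval_kernel (t / a\<^sup>2) (1 - norm y / a) s * profile \<alpha> s"
  shows "(\<integral>\<^sup>+ x. ennreal (indicator (ball 0 a) x * p x y t * boundary_power a \<alpha> x) \<partial>lborel) = ennreal (a powr (1 - \<alpha>) / norm y * W)"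
    and "0 \<le> W"
proof -
  define B :: "(real^3) set" where "B = ball 0 a"
  define \<tau> where "\<tau> = t / a\<^sup>2"
  have \<tau>: "0 < \<tau>" "\<tau> \<le> 1" using a t by (auto simp: \<tau>_def)
  define \<sigma> where "\<sigma> x = 1 - norm x / a" for x :: "real^3"
  have \<sigma>m [measurable]: "\<sigma> \<in> borel_measurable borel" unfolding \<sigma>_def[abs_def] by measurable
  have \<sigma>B: "\<sigma> x \<in> {0<..1}" if "x \<in> B" for x
    using that a by (auto simp: \<sigma>_def B_def divide_less_eq)
  have \<sigma>B': "\<sigma> x \<in> {0<..<1}" if "x \<in> B" "x \<noteq> 0" for x
    using that a by (auto simp: \<sigma>_def B_def divide_less_eq)
  have pos: "0 < p x y t" if "x \<in> B" for x
    using p y t that by (auto simp: dirichlet_heat_kernel_def positive_fundamental_solution_def B_def)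
  have ny: "0 < norm y" using y by simp
  \<comment> \<open>A factor a powr (- \<alpha>) from scaling the weight and a factor a from |x| = a
    (1 - \<sigma>).\<close>
  define A where "A = a powr (1 - \<alpha>)"
  have A: "0 < A" using a by (simp add: A_def)
  define h where "h n s = A * (bump n s * (profile \<alpha> s / sin (pi * s)))" for n s
  have ch: "continuous_on {0..1} (h n)" for n
    unfolding h_def[abs_def]
    by (rule continuous_on_subset[OF continuous_on_mult[OF continuous_on_const bump_quotient_continuous] subset_UNIV])
  have sh: "sin (pi * s) * h n s = A * (bump n s * profile \<alpha> s)" for n s
  proof (cases "s \<in> {0<..<1}")
    case True
    then show ?thesis using sin_pi_pos[OF True] by (simp add: h_def)
  qed (simp add: h_def bump_outside)
  have bp: "A * (bump n (\<sigma> x) * profile \<alpha> (\<sigma> x)) / norm x = bump n (\<sigma> x) * boundary_power a \<alpha> x" if x: "x \<in> B" for x n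
  proof (cases "x = 0")
    case True
    then show ?thesis by (simp add: \<sigma>_def bump_outside)
  next
    case False
    have "boundary_power a \<alpha> x = (a * \<sigma> x) powr (- \<alpha>)"
      using a by (simp add: boundary_power_def \<sigma>_def right_diff_distrib)
    also have "\<dots> = a powr (- \<alpha>) * \<sigma> x powr (- \<alpha>)"
      by (rule powr_mult)
    also have "a powr (- \<alpha>) = A / a" using a by (simp add: A_def powr_diff powr_minus divide_inverse)
    finally have "boundary_power a \<alpha> x = A / a * \<sigma> x powr (- \<alpha>)" .
    moreover have "profile \<alpha> (\<sigma> x) = norm x / a * \<sigma> x powr (- \<alpha>)"
      by (simp add: profile_def \<sigma>_def)
    ultimately show ?thesis using False by simp
  qed
  have bpp: "0 \<le> boundary_power a \<alpha> x" for x by (simp add: boundary_power_def)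
  have bpm [measurable]: "boundary_power a \<alpha> \<in> borel_measurable borel" unfolding boundary_power_def[abs_def] by measurable
  note [measurable] = dirichlet_heat_kernel_slice_measurable[OF p open_ball y(1) t(1), folded B_def]
  define V where "V n = (LINT s:{0..1}|lborel. interval_kernel \<tau> (\<sigma> y) s * (A * (bump n s * profile \<alpha> s)))" for n
  have eqb: "indicat_real B x *\<^sub>R (p x y t * (A * (bump n (\<sigma> x) * profile \<alpha> (\<sigma> x)) / norm x)) = indicat_real B x * p x y t * (bump n (\<sigma> x) * boundary_power a \<alpha> x)" for n x
    using bp[of x n] by (cases "x \<in> B") auto
  note R = dirichlet_heat_kernel_radial[OF p a y t ch, folded B_def \<tau>_def, folded \<sigma>_def, unfolded sh, folded V_def, unfolded set_integrable_def set_lebesgue_integral_def eqb]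
  have nn: "(\<integral>\<^sup>+ x. ennreal (indicat_real B x * p x y t * (bump n (\<sigma> x) * boundary_power a \<alpha> x)) \<partial>lborel) = ennreal (V n / norm y)" for n
  proof -
    have "AE x in lborel. 0 \<le> indicat_real B x * p x y t * (bump n (\<sigma> x) * boundary_power a \<alpha> x)"
      using less_imp_le[OF pos] bump_range(1) bpp by (intro AE_I2) (auto simp: indicator_def intro!: mult_nonneg_nonneg)
    from nn_integral_eq_integral[OF R(1) this] show ?thesis unfolding R(2) V_def set_lebesgue_integral_def .
  qed
  have Vpos: "0 \<le> V n" for n
  proof -
    have "0 \<le> (LINT x|lborel. indicat_real B x * p x y t * (bump n (\<sigma> x) * boundary_power a \<alpha> x))"
      using less_imp_le[OF pos] bump_range(1) bpp by (intro integral_nonneg_AE AE_I2) (auto simp: indicator_def intro!: mult_nonneg_nonneg)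
    then show ?thesis unfolding R(2) using ny by (simp add: V_def set_lebesgue_integral_def zero_le_divide_iff)
  qed
  have yr: "0 \<le> \<sigma> y" "\<sigma> y \<le> 1" using \<sigma>B[of y] y by (auto simp: B_def)
  have V: "V \<longlonglongrightarrow> A * W"
  proof -
    have iW: "set_integrable lborel {0<..<1} (\<lambda>s. \<bar>interval_kernel \<tau> (\<sigma> y) s * profile \<alpha> s\<bar>)"
      using interval_kernel_profile_integrable'[OF \<tau> \<alpha> yr] by (rule set_integrable_abs)
    have "(\<lambda>n. LINT s|lborel. indicat_real {0..1} s *\<^sub>R (interval_kernel \<tau> (\<sigma> y) s * (A * (bump n s * profile \<alpha> s)))) \<longlonglongrightarrow>
        (LINT s|lborel. A * (indicat_real {0<..<1} s *\<^sub>R (interval_kernel \<tau> (\<sigma> y) s * profile \<alpha> s)))"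
    proof (rule integral_dominated_convergence)
      show "integrable lborel (\<lambda>s. A * (indicat_real {0<..<1} s *\<^sub>R \<bar>interval_kernel \<tau> (\<sigma> y) s * profile \<alpha> s\<bar>))"
        using iW unfolding set_integrable_def by (rule integrable_mult_right)
      show "AE s in lborel. (\<lambda>n. indicat_real {0..1} s *\<^sub>R (interval_kernel \<tau> (\<sigma> y) s * (A * (bump n s * profile \<alpha> s)))) \<longlonglongrightarrow>
         A * (indicat_real {0<..<1} s *\<^sub>R (interval_kernel \<tau> (\<sigma> y) s * profile \<alpha> s))"
      proof (rule AE_I2)
        fix s :: real
        show "(\<lambda>n. indicat_real {0..1} s *\<^sub>R (interval_kernel \<tau> (\<sigma> y) s * (A * (bump n s * profile \<alpha> s)))) \<longlonglongrightarrow>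
           A * (indicat_real {0<..<1} s *\<^sub>R (interval_kernel \<tau> (\<sigma> y) s * profile \<alpha> s))"
        proof (cases "s \<in> {0<..<1}")
          case True
          have "(\<lambda>n. indicat_real {0..1} s *\<^sub>R (interval_kernel \<tau> (\<sigma> y) s * (A * (bump n s * profile \<alpha> s)))) \<longlonglongrightarrow>
             indicat_real {0..1} s *\<^sub>R (interval_kernel \<tau> (\<sigma> y) s * (A * (1 * profile \<alpha> s)))"
            by (intro tendsto_intros bump_tendsto True)
          then show ?thesis using True by (simp add: mult_ac)
        qed (simp add: bump_outside)
      qed
      show "AE s in lborel. norm (indicat_real {0..1} s *\<^sub>R (interval_kernel \<tau> (\<sigma> y) s * (A * (bump n s * profile \<alpha> s)))) \<le>
         A * (indicat_real {0<..<1} s *\<^sub>R \<bar>interval_kernel \<tau> (\<sigma> y) s * profile \<alpha> s\<bar>)" for n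
      proof (rule AE_I2)
        fix s :: real
        show "norm (indicat_real {0..1} s *\<^sub>R (interval_kernel \<tau> (\<sigma> y) s * (A * (bump n s * profile \<alpha> s)))) \<le>
           A * (indicat_real {0<..<1} s *\<^sub>R \<bar>interval_kernel \<tau> (\<sigma> y) s * profile \<alpha> s\<bar>)"
        proof (cases "s \<in> {0<..<1}")
          case True
          have "bump n s * (A * \<bar>interval_kernel \<tau> (\<sigma> y) s * profile \<alpha> s\<bar>) \<le> 1 * (A * \<bar>interval_kernel \<tau> (\<sigma> y) s * profile \<alpha> s\<bar>)"
            using bump_range[of n s] A by (intro mult_right_mono) auto
          then show ?thesis using True A bump_range(1)[of n s] by (simp add: abs_mult mult_ac)
        qed (simp add: bump_outside)
      qed
    qed (auto simp: bump_def[abs_def])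
    then show ?thesis unfolding V_def[abs_def] set_lebesgue_integral_def W_def \<tau>_def[symmetric] \<sigma>_def[symmetric] by simp
  qed
  have "0 \<le> A * W" using V by (rule LIMSEQ_le_const) (use Vpos in auto)
  then show "0 \<le> W" using A by (simp add: zero_le_mult_iff)
  \<comment> \<open>At the centre \<sigma> x = 1, so every truncation vanishes there; the centre is
    removed from the limit, which changes it on a null set only.\<close>
  define u where "u x = ennreal (indicator (B - {0}) x * p x y t * boundary_power a \<alpha> x)" for x
  have "(\<lambda>n. \<integral>\<^sup>+ x. ennreal (indicat_real B x * p x y t * (bump n (\<sigma> x) * boundary_power a \<alpha> x)) \<partial>lborel) \<longlonglongrightarrow> (\<integral>\<^sup>+ x. u x \<partial>lborel)"
  proof (rule nn_integral_LIMSEQ)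
    show "incseq (\<lambda>n x. ennreal (indicat_real B x * p x y t * (bump n (\<sigma> x) * boundary_power a \<alpha> x)))"
    proof (rule incseq_SucI, rule le_funI)
      fix n x
      have "bump n (\<sigma> x) \<le> bump (Suc n) (\<sigma> x)" if "x \<in> B"
        using \<sigma>B[OF that] by (intro bump_mono) auto
      then show "ennreal (indicat_real B x * p x y t * (bump n (\<sigma> x) * boundary_power a \<alpha> x)) \<le>
          ennreal (indicat_real B x * p x y t * (bump (Suc n) (\<sigma> x) * boundary_power a \<alpha> x))"
        using pos[of x] bpp[of x] by (cases "x \<in> B") (auto intro!: ennreal_leI mult_left_mono mult_right_mono)
    qed
    show "(\<lambda>n. ennreal (indicat_real B x * p x y t * (bump n (\<sigma> x) * boundary_power a \<alpha> x))) \<longlonglongrightarrow> u x" for x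
    proof (cases "x \<in> B - {0}")
      case True
      have "(\<lambda>n. ennreal (indicat_real B x * p x y t * (bump n (\<sigma> x) * boundary_power a \<alpha> x))) \<longlonglongrightarrow> ennreal (indicat_real B x * p x y t * (1 * boundary_power a \<alpha> x))"
        using True by (intro tendsto_ennrealI tendsto_intros bump_tendsto \<sigma>B') auto
      then show ?thesis using True by (simp add: u_def)
    next
      case False
      then have "x \<notin> B \<or> x = 0" by auto
      then show ?thesis by (auto simp: u_def \<sigma>_def bump_outside)
    qed
  qed (auto simp: bump_def[abs_def])
  moreover have "(\<lambda>n. ennreal (V n / norm y)) \<longlonglongrightarrow> ennreal (A * W / norm y)"
    by (intro tendsto_ennrealI tendsto_intros V) (use ny in auto)
  ultimately have "(\<integral>\<^sup>+ x. u x \<partial>lborel) = ennreal (A * W / norm y)"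
    unfolding nn using LIMSEQ_unique by blast
  moreover have "(\<integral>\<^sup>+ x. u x \<partial>lborel) = (\<integral>\<^sup>+ x. ennreal (indicator (ball 0 a) x * p x y t * boundary_power a \<alpha> x) \<partial>lborel)"
    by (rule nn_integral_cong_AE, rule AE_mp[OF AE_lborel_singleton[of 0]], rule AE_I2)
       (auto simp: u_def B_def indicator_def)
  ultimately show "(\<integral>\<^sup>+ x. ennreal (indicator (ball 0 a) x * p x y t * boundary_power a \<alpha> x) \<partial>lborel) = ennreal (a powr (1 - \<alpha>) / norm y * W)"
    by (simp add: A_def)
qed

lemma interval_inner_measurable [measurable]:
  "(\<lambda>r. LINT s:{0<..<1}|lborel. interval_kernel t r s * profile q s) \<in> borel_measurable borel"
proof -
  have "(\<lambda>z. indicat_real {0<..<1} (snd z) *\<^sub>R (interval_kernel t (fst z) (snd z) * profile q (snd z))) \<in> borel_measurable (borel \<Otimes>\<^sub>M borel)"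
    by measurable
  then have "(\<lambda>z. indicat_real {0<..<1} (snd z) *\<^sub>R (interval_kernel t (fst z) (snd z) * profile q (snd z))) \<in> borel_measurable (borel \<Otimes>\<^sub>M lborel)"
    by (simp cong: measurable_cong_sets sets_pair_measure_cong)
  then have "(\<lambda>r. LINT s|lborel. indicat_real {0<..<1} s *\<^sub>R (interval_kernel t r s * profile q s)) \<in> borel_measurable borel"
    by (intro lborel.borel_measurable_lebesgue_integral) (simp add: split_beta')
  then show ?thesis by (simp add: set_lebesgue_integral_def)
qed

text \<open>Tonelli with the pole outside; the inner integral is radial in the pole, so polar
  coordinates and a reflection of the radius finish. The exponent of a collects 1 - \<alpha> from
  the inner integral, - \<beta> from the weight, and 2 from the radial factor and the line element.
  The inner weight is the one with \<alpha>, whence the swapped arguments of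
  \<open>interval_content\<close>.\<close>

lemma heat_content_eq_interval_content:
  fixes p :: "real^3 \<Rightarrow> real^3 \<Rightarrow> real \<Rightarrow> real"
  assumes p: "dirichlet_heat_kernel (ball 0 a) p" and a: "0 < a"
    and t: "0 < t" "t \<le> a\<^sup>2" and \<alpha>: "\<alpha> < 2"
  shows "heat_content (ball 0 a) p (boundary_power a \<alpha>) (boundary_power a \<beta>) t =
    4 * pi * a powr (3 - \<alpha> - \<beta>) * interval_content (t / a\<^sup>2) \<beta> \<alpha>"
proof -
  define B :: "(real^3) set" where "B = ball 0 a"
  define W where "W r = (LINT s:{0<..<1}|lborel. interval_kernel (t / a\<^sup>2) r s * profile \<alpha> s)" for r
  have Wm [measurable]: "W \<in> borel_measurable borel" unfolding W_def[abs_def] by (rule interval_inner_measurable)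
  have bpm [measurable]: "boundary_power a c \<in> borel_measurable borel" for c unfolding boundary_power_def[abs_def] by measurable
  have bpp: "0 \<le> boundary_power a c x" for c x by (simp add: boundary_power_def)
  have fund: "positive_fundamental_solution B p" using p by (simp add: dirichlet_heat_kernel_def B_def)
  have pos: "0 \<le> p x y t" if "x \<in> B" "y \<in> B" for x y
    using fund t that by (auto simp: positive_fundamental_solution_def intro: less_imp_le)
  define F where "F z = indicat_real (B \<times> B) z * p (fst z) (snd z) t" for z
  have Fm [measurable]: "F \<in> borel_measurable (borel \<Otimes>\<^sub>M borel)"
  proof -
    have c: "continuous_on (B \<times> B \<times> {0<..}) (\<lambda>(x, y, t). p x y t)"
      using fund by (simp add: positive_fundamental_solution_def)
    have "continuous_on (B \<times> B) (\<lambda>z. (\<lambda>(x, y, t). p x y t) (fst z, snd z, t))"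
      by (rule continuous_on_compose2[OF c]) (use t in \<open>auto intro!: continuous_intros\<close>)
    from borel_measurable_continuous_on_indicator[OF _ this] show ?thesis
      by (simp add: F_def[abs_def] B_def borel_open open_Times borel_prod)
  qed
  define G where "G z = F z * boundary_power a \<alpha> (fst z) * boundary_power a \<beta> (snd z)" for z
  have Gm [measurable]: "G \<in> borel_measurable (borel \<Otimes>\<^sub>M borel)" unfolding G_def by measurable
  have G0: "0 \<le> G z" for z
    using pos bpp by (auto simp: G_def F_def indicator_def intro!: mult_nonneg_nonneg)
  have "heat_content (ball 0 a) p (boundary_power a \<alpha>) (boundary_power a \<beta>) t = (LINT z|lborel. G z)"
    unfolding heat_content_def set_lebesgue_integral_def
    by (rule Bochner_Integration.integral_cong) (auto simp: G_def F_def B_def indicator_def)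
  \<comment> \<open>For a nonnegative function this also covers an infinite integral, where both
    sides are 0 by convention.\<close>
  also have "\<dots> = enn2real (\<integral>\<^sup>+ z. ennreal (G z) \<partial>lborel)"
    using G0 Gm by (intro integral_eq_nn_integral) (auto simp: borel_prod)
  also have "(\<integral>\<^sup>+ z. ennreal (G z) \<partial>lborel) = (\<integral>\<^sup>+ y. (\<integral>\<^sup>+ x. ennreal (G (x, y)) \<partial>lborel) \<partial>lborel)"
    unfolding lborel_prod[symmetric] by (rule lborel_pair.nn_integral_snd[symmetric]) measurable
  also have "\<dots> = (\<integral>\<^sup>+ y. ennreal (indicator {0<..<a} (norm y) * boundary_power a \<beta> y * (a powr (1 - \<alpha>) / norm y * W (1 - norm y / a))) \<partial>lborel)"
  proof (rule nn_integral_cong_AE, rule AE_mp[OF AE_lborel_singleton[of 0]], rule AE_I2, rule impI)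
    fix y :: "real^3" assume y0: "y \<noteq> 0"
    show "(\<integral>\<^sup>+ x. ennreal (G (x, y)) \<partial>lborel) = ennreal (indicator {0<..<a} (norm y) * boundary_power a \<beta> y * (a powr (1 - \<alpha>) / norm y * W (1 - norm y / a)))"
    proof (cases "y \<in> B")
      case False
      then have "G (x, y) = 0" for x by (simp add: G_def F_def)
      then show ?thesis using False by (simp add: B_def)
    next
      case True
      then have y: "y \<in> ball 0 a" by (simp add: B_def)
      note dk = dirichlet_heat_kernel_boundary_power[OF p a y y0 t \<alpha>, folded W_def]
      have [measurable]: "(\<lambda>x. indicator B x * p x y t) \<in> borel_measurable borel"
        using dirichlet_heat_kernel_slice_measurable[OF p open_ball y t(1)] by (simp add: B_def)
      have "G (x, y) = boundary_power a \<beta> y * (indicator B x * p x y t * boundary_power a \<alpha> x)" for x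
        using True by (simp add: G_def F_def indicator_def)
      then have "(\<integral>\<^sup>+ x. ennreal (G (x, y)) \<partial>lborel) = (\<integral>\<^sup>+ x. ennreal (boundary_power a \<beta> y) * ennreal (indicator B x * p x y t * boundary_power a \<alpha> x) \<partial>lborel)"
        using bpp by (simp add: ennreal_mult')
      also have "\<dots> = ennreal (boundary_power a \<beta> y) * ennreal (a powr (1 - \<alpha>) / norm y * W (1 - norm y / a))"
        by (subst nn_integral_cmult) (use dk(1) in \<open>auto simp: B_def[symmetric]\<close>)
      also have "\<dots> = ennreal (boundary_power a \<beta> y * (a powr (1 - \<alpha>) / norm y * W (1 - norm y / a)))"
        by (rule ennreal_mult'[symmetric, OF bpp])
      finally show ?thesis using y y0 by simp
    qed
  qed
  also have "\<dots> = (\<integral>\<^sup>+ r. ennreal (4 * pi * r\<^sup>2) * indicator {0..} r *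
      ennreal (indicator {0<..<a} r * (a - r) powr (- \<beta>) * (a powr (1 - \<alpha>) / r * W (1 - r / a))) \<partial>lborel)"
    unfolding boundary_power_def by (rule nn_integral_norm_vec3) measurable
  also have "\<dots> = (\<integral>\<^sup>+ r. ennreal (indicator {0<..<a} r * (4 * pi * a powr (1 - \<alpha>)) * (r * (a - r) powr (- \<beta>) * W (1 - r / a))) \<partial>lborel)"
  proof (rule nn_integral_cong)
    fix r :: real
    have "4 * pi * r\<^sup>2 * ((a - r) powr (- \<beta>) * (a powr (1 - \<alpha>) / r * X)) = 4 * pi * a powr (1 - \<alpha>) * (r * (a - r) powr (- \<beta>) * X)" if "0 < r" for X
      using that by (simp add: power2_eq_square)
    then show "ennreal (4 * pi * r\<^sup>2) * indicator {0..} r * ennreal (indicator {0<..<a} r * (a - r) powr (- \<beta>) * (a powr (1 - \<alpha>) / r * W (1 - r / a))) =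
       ennreal (indicator {0<..<a} r * (4 * pi * a powr (1 - \<alpha>)) * (r * (a - r) powr (- \<beta>) * W (1 - r / a)))"
      by (cases "r \<in> {0<..<a}") (auto simp: ennreal_mult'[symmetric])
  qed
  also have "\<dots> = ennreal \<bar>- a\<bar> * (\<integral>\<^sup>+ r. ennreal (indicator {0<..<a} (a + (- a) * r) * (4 * pi * a powr (1 - \<alpha>)) *
       ((a + (- a) * r) * (a - (a + (- a) * r)) powr (- \<beta>) * W (1 - (a + (- a) * r) / a))) \<partial>lborel)"
    by (rule nn_integral_real_affine) (use a in auto)
  also have "\<dots> = (\<integral>\<^sup>+ r. ennreal (4 * pi * a powr (3 - \<alpha> - \<beta>)) * ennreal (indicator {0<..<1} r * (profile \<beta> r * W r)) \<partial>lborel)"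
  proof (subst nn_integral_cmult[symmetric], measurable, rule nn_integral_cong)
    fix r :: real
    have i: "indicat_real {0<..<a} (a + (- a) * r) = indicat_real {0<..<1} r"
      using a by (auto simp: indicator_def zero_less_mult_iff)
    have W: "1 - (a + (- a) * r) / a = r" using a by (simp add: field_simps)
    have pw: "(a * r) powr (- \<beta>) = a powr (- \<beta>) * r powr (- \<beta>)" by (rule powr_mult)
    have "a powr (3 - \<alpha> - \<beta>) = a powr (1 - \<alpha>) * a powr 2 * a powr (- \<beta>)"
      unfolding powr_add[symmetric] by simp
    then have aa: "a powr (3 - \<alpha> - \<beta>) = a powr (1 - \<alpha>) * a\<^sup>2 * a powr (- \<beta>)" using a by simp
    have "a * (4 * pi * a powr (1 - \<alpha>) * ((a + (- a) * r) * (a - (a + (- a) * r)) powr (- \<beta>) * W r)) =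
        4 * pi * a powr (3 - \<alpha> - \<beta>) * (profile \<beta> r * W r)"
      unfolding aa by (simp add: pw profile_def power2_eq_square algebra_simps)
    then have "\<bar>- a\<bar> * (indicat_real {0<..<a} (a + (- a) * r) * (4 * pi * a powr (1 - \<alpha>)) * ((a + (- a) * r) * (a - (a + (- a) * r)) powr (- \<beta>) * W r)) =
        4 * pi * a powr (3 - \<alpha> - \<beta>) * (indicat_real {0<..<1} r * (profile \<beta> r * W r))"
      unfolding i using a by (simp add: indicator_def)
    then show "ennreal \<bar>- a\<bar> * ennreal (indicator {0<..<a} (a + (- a) * r) * (4 * pi * a powr (1 - \<alpha>)) * ((a + (- a) * r) * (a - (a + (- a) * r)) powr (- \<beta>) * W (1 - (a + (- a) * r) / a))) =
        ennreal (4 * pi * a powr (3 - \<alpha> - \<beta>)) * ennreal (indicator {0<..<1} r * (profile \<beta> r * W r))"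
      unfolding W by (simp only: ennreal_mult'[symmetric] abs_ge_zero zero_le_mult_iff pi_ge_zero powr_ge_zero zero_le_numeral simp_thms)
  qed
  also have "\<dots> = ennreal (4 * pi * a powr (3 - \<alpha> - \<beta>)) * (\<integral>\<^sup>+ r. ennreal (indicator {0<..<1} r * (profile \<beta> r * W r)) \<partial>lborel)"
    by (rule nn_integral_cmult) measurable
  also have "enn2real \<dots> = 4 * pi * a powr (3 - \<alpha> - \<beta>) * enn2real (\<integral>\<^sup>+ r. ennreal (indicator {0<..<1} r * (profile \<beta> r * W r)) \<partial>lborel)"
    by (simp add: enn2real_mult)
  also have "enn2real (\<integral>\<^sup>+ r. ennreal (indicator {0<..<1} r * (profile \<beta> r * W r)) \<partial>lborel) = (LINT r|lborel. indicator {0<..<1} r * (profile \<beta> r * W r))"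
  proof (rule integral_eq_nn_integral[symmetric])
    have W0: "0 \<le> W r" if r: "r \<in> {0<..<1}" for r
    proof -
      define y :: "real^3" where "y = (a * (1 - r)) *\<^sub>R axis 1 1"
      have "norm y = a * (1 - r)" using a r by (simp add: y_def)
      moreover from this have "y \<in> ball 0 a" "y \<noteq> 0" "1 - norm y / a = r" using a r by (auto simp: mult_less_cancel_left2)
      ultimately show ?thesis using dirichlet_heat_kernel_boundary_power(2)[OF p a _ _ t \<alpha>, of y] by (simp add: W_def)
    qed
    show "AE r in lborel. 0 \<le> indicator {0<..<1} r * (profile \<beta> r * W r)"
      using W0 by (intro AE_I2) (auto simp: indicator_def profile_def)
  qed measurable
  finally show ?thesis
    by (simp add: interval_content_def set_lebesgue_integral_def W_def)
qed

section \<open>The half line\<close>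

text \<open>The image of 2 s ds under squaring agrees with Lebesgue measure on the positive axis on
  all half lines, hence on all Borel sets.\<close>

lemma nn_integral_square_subst:
  fixes f :: "real \<Rightarrow> ennreal"
  assumes [measurable]: "f \<in> borel_measurable borel"
  shows "(\<integral>\<^sup>+ s. ennreal (2 * s) * indicator {0<..} s * f (s\<^sup>2) \<partial>lborel) = (\<integral>\<^sup>+ x. indicator {0<..} x * f x \<partial>lborel)"
proof -
  define M where "M = distr (density lborel (\<lambda>s::real. ennreal (2 * s) * indicator {0<..} s)) borel (\<lambda>s. s\<^sup>2)"
  define N where "N = density lborel (\<lambda>x::real. indicator {0<..} x :: ennreal)"
  have M: "emeasure M {..x} = ennreal (max 0 x)" for x
  proof -
    have "emeasure M {..x} = emeasure (density lborel (\<lambda>s::real. ennreal (2 * s) * indicator {0<..} s)) {s. s\<^sup>2 \<le> x}"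
      unfolding M_def by (subst emeasure_distr) (auto intro!: arg_cong2[where f=emeasure])
    also have "\<dots> = (\<integral>\<^sup>+ s. ennreal (2 * s) * indicator {0<..} s * indicator {s. s\<^sup>2 \<le> x} s \<partial>lborel)"
      by (rule emeasure_density) auto
    also have "\<dots> = (\<integral>\<^sup>+ s. ennreal (2 * s) * indicator {0..sqrt (max 0 x)} s \<partial>lborel)"
    proof (rule nn_integral_cong)
      fix s :: real
      have "s\<^sup>2 \<le> x \<longleftrightarrow> s \<le> sqrt (max 0 x)" if "0 < s"
      proof -
        have "s\<^sup>2 \<le> x \<longleftrightarrow> s\<^sup>2 \<le> max 0 x" using that by (auto simp: max_def)
          (metis less_le_not_le order_trans zero_less_power)
        also have "\<dots> \<longleftrightarrow> s \<le> sqrt (max 0 x)"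
          using that real_sqrt_le_iff[of "s\<^sup>2" "max 0 x"] by simp
        finally show ?thesis .
      qed
      then show "ennreal (2 * s) * indicator {0<..} s * indicator {s. s\<^sup>2 \<le> x} s = ennreal (2 * s) * indicator {0..sqrt (max 0 x)} s"
        by (cases "0 < s") (auto simp: indicator_def ennreal_neg)
    qed
    also have "\<dots> = ennreal ((sqrt (max 0 x))\<^sup>2 - 0\<^sup>2)"
      by (rule nn_integral_FTC_Icc[where F="\<lambda>s. s\<^sup>2"]) (auto intro!: derivative_eq_intros)
    finally show ?thesis by simp
  qed
  have N: "emeasure N {..x} = ennreal (max 0 x)" for x
  proof -
    have "emeasure N {..x} = (\<integral>\<^sup>+ s. indicator {0<..} s * indicator {..x} s \<partial>lborel)"
      unfolding N_def by (rule emeasure_density) auto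
    also have "\<dots> = (\<integral>\<^sup>+ s. indicator {0<..x} s \<partial>lborel)"
      by (rule nn_integral_cong) (auto simp: indicator_def)
    also have "\<dots> = ennreal (max 0 x)" by (cases "0 \<le> x") (auto simp: max_def)
    finally show ?thesis .
  qed
  have "M = N"
  proof (rule measure_eqI_generator_eq[where E="range atMost" and \<Omega>=UNIV and A="\<lambda>n. {..real n}"])
    show "Int_stable (range (atMost :: real \<Rightarrow> _))" by (auto simp: Int_stable_def)
    show "sets M = sigma_sets UNIV (range atMost)" "sets N = sigma_sets UNIV (range atMost)"
      by (simp_all add: M_def N_def borel_eq_atMost)
    show "(\<Union>i. {..real i}) = UNIV" using real_arch_simple by auto
  qed (auto simp: M N)
  then have "(\<integral>\<^sup>+ x. f x \<partial>M) = (\<integral>\<^sup>+ x. f x \<partial>N)" by simp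
  then show ?thesis
    unfolding M_def N_def by (subst (asm) nn_integral_distr) (simp_all add: nn_integral_density)
qed

lemma nn_integral_gamma_scale:
  fixes c P :: real
  assumes c: "0 < c" and P: "0 < P"
  shows "(\<integral>\<^sup>+ x. ennreal (indicator {0<..} x * (x powr (P - 1) * exp (- c * x))) \<partial>lborel) = ennreal (Gamma P * c powr (- P))"
proof -
  have "ennreal (Gamma P) = (\<integral>\<^sup>+ x. ennreal (indicator {0..} x * x powr (P - 1) / exp x) \<partial>lborel)"
    by (rule Gamma_conv_nn_integral_real[OF P])
  also have "\<dots> = ennreal \<bar>c\<bar> * (\<integral>\<^sup>+ x. ennreal (indicator {0..} (0 + c * x) * (0 + c * x) powr (P - 1) / exp (0 + c * x)) \<partial>lborel)"
    by (rule nn_integral_real_affine) (use c in auto)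
  also have "\<dots> = (\<integral>\<^sup>+ x. ennreal (c powr P) * ennreal (indicator {0<..} x * (x powr (P - 1) * exp (- c * x))) \<partial>lborel)"
  proof (subst nn_integral_cmult[symmetric], measurable, rule nn_integral_cong)
    fix x :: real
    have "c * (c * x) powr (P - 1) = c powr P * x powr (P - 1)"
      using c by (simp add: powr_mult powr_diff abs_mult)
    then have "c * (indicator {0..} (c * x) * (c * x) powr (P - 1) / exp (c * x)) = c powr P * (indicator {0<..} x * (x powr (P - 1) * exp (- c * x)))"
      using c by (cases "x = 0") (auto simp: indicator_def zero_le_mult_iff exp_minus divide_inverse)
    then show "ennreal \<bar>c\<bar> * ennreal (indicator {0..} (0 + c * x) * (0 + c * x) powr (P - 1) / exp (0 + c * x)) = ennreal (c powr P) * ennreal (indicator {0<..} x * (x powr (P - 1) * exp (- c * x)))"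
      using c by (simp add: ennreal_mult'[symmetric])
  qed
  also have "\<dots> = ennreal (c powr P) * (\<integral>\<^sup>+ x. ennreal (indicator {0<..} x * (x powr (P - 1) * exp (- c * x))) \<partial>lborel)"
    by (rule nn_integral_cmult) measurable
  finally have *: "ennreal (Gamma P) = ennreal (c powr P) * (\<integral>\<^sup>+ x. ennreal (indicator {0<..} x * (x powr (P - 1) * exp (- c * x))) \<partial>lborel)" .
  have "ennreal (Gamma P * c powr (- P)) = ennreal (c powr (- P)) * ennreal (Gamma P)"
    by (simp add: ennreal_mult'' mult.commute Gamma_real_nonneg P less_imp_le ennreal_mult')
  also have "\<dots> = ennreal (c powr (- P) * c powr P) * (\<integral>\<^sup>+ x. ennreal (indicator {0<..} x * (x powr (P - 1) * exp (- c * x))) \<partial>lborel)"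
    unfolding * by (simp add: ennreal_mult' mult.assoc)
  also have "c powr (- P) * c powr P = 1" using c by (simp add: powr_add[symmetric])
  finally show ?thesis by simp
qed

text \<open>Writing the difference of exponentials as an integral over the rate gives a proof that is
  uniform in the sign of \<open>P\<close>.\<close>

lemma nn_integral_exp_diff:
  fixes a b P :: real
  assumes a: "0 < a" "a \<le> b" and P: "- 1 < P" "P \<noteq> 0"
  shows "(\<integral>\<^sup>+ x. ennreal (indicator {0<..} x * (x powr (P - 1) * (exp (- a * x) - exp (- b * x)))) \<partial>lborel)
     = ennreal (Gamma P * (a powr (- P) - b powr (- P)))"
proof -
  define F where "F c x = ennreal (indicator {0<..} x * (x powr P * exp (- c * x)) * indicator {a..b} c)" for c x :: real
  have [measurable]: "(\<lambda>z. F (fst z) (snd z)) \<in> borel_measurable (borel \<Otimes>\<^sub>M borel)"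
    unfolding F_def by measurable
  have 1: "(\<integral>\<^sup>+ c. F c x \<partial>lborel) = ennreal (indicator {0<..} x * (x powr (P - 1) * (exp (- a * x) - exp (- b * x))))" for x
  proof (cases "0 < x")
    case True
    have "(\<integral>\<^sup>+ c. F c x \<partial>lborel) = (\<integral>\<^sup>+ c. ennreal (x powr P * exp (- c * x)) * indicator {a..b} c \<partial>lborel)"
      using True by (intro nn_integral_cong) (auto simp: F_def indicator_def)
    also have "\<dots> = ennreal (- (x powr (P - 1)) * exp (- b * x) - - (x powr (P - 1)) * exp (- a * x))"
    proof (rule nn_integral_FTC_Icc[where F="\<lambda>c. - (x powr (P - 1)) * exp (- c * x)"])
      have "x powr P = x powr (P - 1) * x" using True by (simp add: powr_diff)
      then show "((\<lambda>c. - (x powr (P - 1)) * exp (- c * x)) has_real_derivative x powr P * exp (- c * x)) (at c)" for c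
        by (auto intro!: derivative_eq_intros)
    qed (use a in auto)
    finally show ?thesis using True by (simp add: algebra_simps)
  qed (simp add: F_def)
  have 2: "(\<integral>\<^sup>+ x. F c x \<partial>lborel) = ennreal (Gamma (P + 1) * c powr (- (P + 1))) * indicator {a..b} c" for c
  proof (cases "c \<in> {a..b}")
    case True
    then have c: "0 < c" using a by auto
    have "(\<integral>\<^sup>+ x. F c x \<partial>lborel) = (\<integral>\<^sup>+ x. ennreal (indicator {0<..} x * (x powr (P + 1 - 1) * exp (- c * x))) \<partial>lborel)"
      using True by (intro nn_integral_cong) (auto simp: F_def)
    then show ?thesis using nn_integral_gamma_scale[OF c, of "P + 1"] P True by simp
  qed (simp add: F_def)
  have "(\<integral>\<^sup>+ x. (\<integral>\<^sup>+ c. F c x \<partial>lborel) \<partial>lborel) = (\<integral>\<^sup>+ c. (\<integral>\<^sup>+ x. F c x \<partial>lborel) \<partial>lborel)"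
    by (rule lborel_pair.Fubini') (simp add: split_beta')
  also have "\<dots> = ennreal (Gamma (P + 1) * (- 1 / P) * b powr (- P) - Gamma (P + 1) * (- 1 / P) * a powr (- P))"
    unfolding 2
  proof (rule nn_integral_FTC_Icc[where F="\<lambda>c. Gamma (P + 1) * (- 1 / P) * c powr (- P)"])
    show "((\<lambda>c. Gamma (P + 1) * (- 1 / P) * c powr (- P)) has_real_derivative Gamma (P + 1) * c powr (- (P + 1))) (at c)"
      if "c \<in> {a..b}" for c
      using a P that by (auto intro!: derivative_eq_intros simp: powr_diff)
    show "0 \<le> Gamma (P + 1) * c powr (- (P + 1))" for c
      using P by (intro mult_nonneg_nonneg Gamma_real_nonneg) auto
  qed (use a in auto)
  \<comment> \<open>Only \<open>Gamma (P + 1)\<close> arises as an integral; for - 1 < P < 0 the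
    functional equation brings in the continued value \<open>Gamma P\<close>.\<close>
  also have "Gamma (P + 1) = P * Gamma P"
  proof (rule Gamma_plus1)
    show "P \<notin> \<int>\<^sub>\<le>\<^sub>0"
    proof
      assume "P \<in> \<int>\<^sub>\<le>\<^sub>0"
      then obtain n :: nat where "P = - real n" by (elim nonpos_Ints_cases')
      then show False using P by (cases n) auto
    qed
  qed
  also have "P * Gamma P * (- 1 / P) * b powr (- P) - P * Gamma P * (- 1 / P) * a powr (- P) = Gamma P * (a powr (- P) - b powr (- P))"
    using P by (simp add: algebra_simps)
  finally show ?thesis unfolding 1 .
qed

text \<open>Along a ray the difference of Gaussians is a difference of exponentials in s^2, and x =
  s^2 leads to the exponent P = (2 - S) / 2. The condition S < 4 is P > - 1, and S = 2 is the pole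
  of Gamma at 0.\<close>

lemma gauss1_scale_diff:
  assumes t: "0 < t" and A: "0 < A" "A \<le> B" and S: "S < 4" "S \<noteq> 2"
  shows "(\<integral>\<^sup>+ s. ennreal (indicator {0<..} s * (s powr (1 - S) * (gauss1 t (s * A) - gauss1 t (s * B)))) \<partial>lborel) =
    ennreal (2 powr (- S) * pi powr (- 1 / 2) * Gamma ((2 - S) / 2) * t powr ((1 - S) / 2) * (A powr (S - 2) - B powr (S - 2)))"
proof -
  define P where "P = (2 - S) / 2"
  have P: "- 1 < P" "P \<noteq> 0" using S by (auto simp: P_def)
  define a where "a = A\<^sup>2 / (4 * t)"
  define b where "b = B\<^sup>2 / (4 * t)"
  have ab: "0 < a" "a \<le> b" using A t by (auto simp: a_def b_def divide_right_mono power_mono)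
  \<comment> \<open>The additional factor 1/2 compensates dx = 2 s ds.\<close>
  define k where "k = 1 / (2 * sqrt (4 * pi * t))"
  have k: "0 \<le> k" using t by (simp add: k_def)
  define f where "f x = ennreal (k * (x powr (P - 1) * (exp (- a * x) - exp (- b * x))))" for x
  have fm: "f \<in> borel_measurable borel" unfolding f_def by measurable
  have "(\<integral>\<^sup>+ s. ennreal (indicator {0<..} s * (s powr (1 - S) * (gauss1 t (s * A) - gauss1 t (s * B)))) \<partial>lborel) =
    (\<integral>\<^sup>+ s. ennreal (2 * s) * indicator {0<..} s * f (s\<^sup>2) \<partial>lborel)"
  proof (rule nn_integral_cong)
    fix s :: real
    show "ennreal (indicator {0<..} s * (s powr (1 - S) * (gauss1 t (s * A) - gauss1 t (s * B)))) = ennreal (2 * s) * indicator {0<..} s * f (s\<^sup>2)"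
    proof (cases "0 < s")
      case True
      have "s\<^sup>2 powr (P - 1) = s powr (2 * (P - 1))"
        using True powr_powr[of s 2 "P - 1"] by simp
      also have "2 * (P - 1) = - S" by (simp add: P_def field_simps)
      finally have e: "s * (s\<^sup>2) powr (P - 1) = s powr (1 - S)" using True by (simp add: powr_diff powr_minus divide_inverse)
      have g: "gauss1 t (s * A) - gauss1 t (s * B) = 2 * k * (exp (- a * s\<^sup>2) - exp (- b * s\<^sup>2))"
        by (simp add: gauss1_def k_def a_def b_def power_mult_distrib mult.commute diff_divide_distrib)
      have "s powr (1 - S) * (gauss1 t (s * A) - gauss1 t (s * B)) = 2 * s * (k * ((s\<^sup>2) powr (P - 1) * (exp (- a * s\<^sup>2) - exp (- b * s\<^sup>2))))"
        unfolding g e[symmetric] by simp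
      then show ?thesis using True by (simp add: f_def ennreal_mult'[symmetric])
    qed simp
  qed
  also have "\<dots> = (\<integral>\<^sup>+ x. indicator {0<..} x * f x \<partial>lborel)"
    by (rule nn_integral_square_subst[OF fm])
  also have "\<dots> = (\<integral>\<^sup>+ x. ennreal k * ennreal (indicator {0<..} x * (x powr (P - 1) * (exp (- a * x) - exp (- b * x)))) \<partial>lborel)"
    using k by (intro nn_integral_cong) (auto simp: f_def ennreal_mult' indicator_def)
  also have "\<dots> = ennreal k * ennreal (Gamma P * (a powr (- P) - b powr (- P)))"
    by (subst nn_integral_cmult) (auto simp: nn_integral_exp_diff[OF ab P, simplified])
  also have "\<dots> = ennreal (k * (Gamma P * (a powr (- P) - b powr (- P))))"
    using k by (simp add: ennreal_mult')
  also have "k * (Gamma P * (a powr (- P) - b powr (- P))) =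
     2 powr (- S) * pi powr (- 1 / 2) * Gamma ((2 - S) / 2) * t powr ((1 - S) / 2) * (A powr (S - 2) - B powr (S - 2))"
  proof -
    have pw: "(X\<^sup>2 / (4 * t)) powr (- P) = (4 * t) powr P * X powr (S - 2)" if X: "0 < X" for X
    proof -
      have "(X\<^sup>2) powr (- P) = X powr (S - 2)"
      proof -
        have e: "2 * (- P) = S - 2" by (simp add: P_def field_simps)
        show ?thesis using X powr_powr[of X 2 "- P", unfolded e] by simp
      qed
      then show ?thesis using t X by (simp add: powr_divide powr_minus field_simps)
    qed
    have "k * (4 * t) powr P = 1 / 2 * pi powr (- 1 / 2) * ((4 * t) powr (- 1 / 2) * (4 * t) powr P)"
    proof -
      have "sqrt (4 * pi * t) = sqrt pi * sqrt (4 * t)" by (simp only: real_sqrt_mult[symmetric] mult_ac)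
      moreover have "x powr (- 1 / 2) = 1 / sqrt x" if "0 < x" for x :: real
        using that powr_minus_divide[of x "1 / 2"] by (simp add: powr_half_sqrt)
      ultimately show ?thesis using t by (simp add: k_def)
    qed
    also have "(4 * t) powr (- 1 / 2) * (4 * t) powr P = 4 powr ((1 - S) / 2) * t powr ((1 - S) / 2)"
    proof -
      have e: "- 1 / 2 + P = (1 - S) / 2" by (simp add: P_def field_simps)
      show ?thesis unfolding powr_add[symmetric] e by (rule powr_mult)
    qed
    also have "4 powr ((1 - S) / 2) = 2 powr (1 - S)"
      using powr_powr[of 2 2 "(1 - S) / 2"] by simp
    also have "2 powr (1 - S) = 2 * 2 powr (- S)" by (simp add: powr_diff powr_minus divide_inverse)
    finally have k4: "k * (4 * t) powr P = 2 powr (- S) * pi powr (- 1 / 2) * t powr ((1 - S) / 2)" by simp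
    have "k * (Gamma P * (a powr (- P) - b powr (- P))) = (k * (4 * t) powr P) * Gamma P * (A powr (S - 2) - B powr (S - 2))"
      unfolding a_def b_def using A pw[of A] pw[of B] by (simp add: algebra_simps)
    then show ?thesis unfolding k4 by (simp add: P_def)
  qed
  finally show ?thesis .
qed

lemma half_line_kernel_nonneg:
  assumes "0 < t" "0 \<le> r" "0 \<le> s"
  shows "0 \<le> half_line_kernel t r s"
proof -
  have "(r - s)\<^sup>2 \<le> (r + s)\<^sup>2" using assms by (simp add: power2_eq_square algebra_simps)
  then show ?thesis
    unfolding half_line_kernel_def gauss1_def using assms by (simp add: divide_right_mono)
qed

lemma half_line_kernel_commute: "half_line_kernel t r s = half_line_kernel t s r"
  using gauss1_minus[of t "r - s"] by (simp add: half_line_kernel_def add.commute del: gauss1_minus)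

lemma half_line_kernel_measurable [measurable]:
  "(\<lambda>z. half_line_kernel t (fst z) (snd z)) \<in> borel_measurable (borel \<Otimes>\<^sub>M borel)"
  unfolding half_line_kernel_def gauss1_def by measurable

section \<open>The constants c as moments of the half line kernel\<close>

definition c_weight :: "real \<Rightarrow> real \<Rightarrow> real" where
  "c_weight S v = (1 - v) powr (S - 2) - (1 + v) powr (S - 2)"

text \<open>Scaling r = s v maps the triangle r < s to v in (0,1). For fixed v the integral over s
  is that of \<open>gauss1_scale_diff\<close> and produces the power of t; the remaining variable v
  is the one in \<open>c_coeff\<close>.\<close>

lemma half_line_triangle:
  fixes p q t :: real
  assumes t: "0 < t" and S: "p + q < 4" "p + q \<noteq> 2"
  shows "(\<integral>\<^sup>+ s. (\<integral>\<^sup>+ r. ennreal (indicator {0<..} s * indicator {0<..<s} r * (half_line_kernel t r s * r powr (- p) * s powr (- q))) \<partial>lborel) \<partial>lborel) =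
    (\<integral>\<^sup>+ v. ennreal (2 powr (- p - q) * pi powr (- 1 / 2) * Gamma ((2 - p - q) / 2) * t powr ((1 - p - q) / 2) *
       (indicator {0<..<1} v * (v powr (- p) * c_weight (p + q) v))) \<partial>lborel)"
proof -
  define F where "F s v = indicator {0<..} s * (s powr (1 - (p + q)) * (gauss1 t (s * (1 - v)) - gauss1 t (s * (1 + v)))) * (indicator {0<..<1} v * v powr (- p))" for s v :: real
  have Fm [measurable]: "(\<lambda>z. F (fst z) (snd z)) \<in> borel_measurable (borel \<Otimes>\<^sub>M borel)"
    unfolding F_def gauss1_def by measurable
  have inner: "(\<integral>\<^sup>+ r. ennreal (indicator {0<..} s * indicator {0<..<s} r * (half_line_kernel t r s * r powr (- p) * s powr (- q))) \<partial>lborel) =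
    (\<integral>\<^sup>+ v. ennreal (F s v) \<partial>lborel)" for s
  proof (cases "0 < s")
    case True
    have "(\<integral>\<^sup>+ r. ennreal (indicator {0<..} s * indicator {0<..<s} r * (half_line_kernel t r s * r powr (- p) * s powr (- q))) \<partial>lborel) =
      ennreal \<bar>s\<bar> * (\<integral>\<^sup>+ v. ennreal (indicator {0<..} s * indicator {0<..<s} (0 + s * v) * (half_line_kernel t (0 + s * v) s * (0 + s * v) powr (- p) * s powr (- q))) \<partial>lborel)"
      by (rule nn_integral_real_affine) (use True in \<open>auto simp: half_line_kernel_def\<close>)
    also have "\<dots> = (\<integral>\<^sup>+ v. ennreal (F s v) \<partial>lborel)"
    proof (subst nn_integral_cmult[symmetric])
      show "(\<lambda>v. ennreal (indicator {0<..} s * indicator {0<..<s} (0 + s * v) * (half_line_kernel t (0 + s * v) s * (0 + s * v) powr (- p) * s powr (- q)))) \<in> borel_measurable lborel"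
        unfolding half_line_kernel_def gauss1_def by measurable
      show "(\<integral>\<^sup>+ v. ennreal \<bar>s\<bar> * ennreal (indicator {0<..} s * indicator {0<..<s} (0 + s * v) * (half_line_kernel t (0 + s * v) s * (0 + s * v) powr (- p) * s powr (- q))) \<partial>lborel) = (\<integral>\<^sup>+ v. ennreal (F s v) \<partial>lborel)"
      proof (rule nn_integral_cong)
        fix v :: real
        have i: "indicat_real {0<..<s} (0 + s * v) = indicat_real {0<..<1} v"
          using True by (auto simp: indicator_def zero_less_mult_iff)
        have h: "half_line_kernel t (0 + s * v) s = gauss1 t (s * (1 - v)) - gauss1 t (s * (1 + v))"
          using gauss1_minus[of t "s * (1 - v)"] by (simp add: half_line_kernel_def algebra_simps del: gauss1_minus)
        have pw: "s * ((0 + s * v) powr (- p) * s powr (- q)) = s powr (1 - (p + q)) * v powr (- p)" if "0 < v"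
        proof -
          have "s powr (1 - (p + q)) = s powr 1 * s powr (- p) * s powr (- q)"
            unfolding powr_add[symmetric] by (simp add: diff_diff_eq)
          then show ?thesis using True that by (simp add: powr_mult)
        qed
        have "s * (indicator {0<..} s * indicator {0<..<s} (0 + s * v) * (half_line_kernel t (0 + s * v) s * (0 + s * v) powr (- p) * s powr (- q))) = F s v"
        proof (cases "0 < v")
          case v: True
          have "s * (X * (Y * (Z * A * B))) = X * (Z * (s * (A * B)) * Y)" for X Y Z A B by simp
          then show ?thesis
            unfolding i h F_def using pw[OF v] True by (simp add: mult_ac)
        qed (unfold i F_def, simp)
        then show "ennreal \<bar>s\<bar> * ennreal (indicator {0<..} s * indicator {0<..<s} (0 + s * v) * (half_line_kernel t (0 + s * v) s * (0 + s * v) powr (- p) * s powr (- q))) = ennreal (F s v)"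
          using True by (simp add: ennreal_mult'[symmetric] del: add_0)
      qed
    qed
    finally show ?thesis .
  qed (simp add: F_def)
  have outer: "(\<integral>\<^sup>+ s. ennreal (F s v) \<partial>lborel) = ennreal (2 powr (- p - q) * pi powr (- 1 / 2) * Gamma ((2 - p - q) / 2) * t powr ((1 - p - q) / 2) *
       (indicator {0<..<1} v * (v powr (- p) * c_weight (p + q) v)))" for v
  proof (cases "v \<in> {0<..<1}")
    case True
    have "(\<integral>\<^sup>+ s. ennreal (F s v) \<partial>lborel) = (\<integral>\<^sup>+ s. ennreal (v powr (- p)) * ennreal (indicator {0<..} s * (s powr (1 - (p + q)) * (gauss1 t (s * (1 - v)) - gauss1 t (s * (1 + v))))) \<partial>lborel)"
      using True by (intro nn_integral_cong) (simp add: F_def ennreal_mult'[symmetric] mult.commute)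
    also have "\<dots> = ennreal (v powr (- p)) * ennreal (2 powr (- (p + q)) * pi powr (- 1 / 2) * Gamma ((2 - (p + q)) / 2) * t powr ((1 - (p + q)) / 2) * ((1 - v) powr (p + q - 2) - (1 + v) powr (p + q - 2)))"
      by (subst nn_integral_cmult) (use True t S in \<open>auto simp: gauss1_scale_diff\<close>)
    also have "\<dots> = ennreal (v powr (- p) * (2 powr (- (p + q)) * pi powr (- 1 / 2) * Gamma ((2 - (p + q)) / 2) * t powr ((1 - (p + q)) / 2) * ((1 - v) powr (p + q - 2) - (1 + v) powr (p + q - 2))))"
      by (simp add: ennreal_mult')
    finally show ?thesis using True by (simp add: c_weight_def mult_ac diff_diff_eq)
  qed (simp add: F_def)
  have "(\<integral>\<^sup>+ s. (\<integral>\<^sup>+ v. ennreal (F s v) \<partial>lborel) \<partial>lborel) = (\<integral>\<^sup>+ v. (\<integral>\<^sup>+ s. ennreal (F s v) \<partial>lborel) \<partial>lborel)"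
    by (rule lborel_pair.Fubini'[symmetric]) (simp add: split_beta')
  then show ?thesis unfolding inner outer .
qed

text \<open>Near v = 0 the two powers cancel to first order, which tames v powr (-p); near v = 1 the
  only possible singularity is (1 - v) powr (S - 2).\<close>

lemma c_weight_bound:
  obtains C where "C \<ge> 0" "\<And>v. v \<in> {0<..<1} \<Longrightarrow> \<bar>v powr (- p) * c_weight S v\<bar> \<le> C * (v powr (1 - p) + (1 - v) powr (S - 2) + 1)"
proof -
  define g where "g = S - 2"
  define D where "D = max ((1 / 2) powr (g - 1)) ((3 / 2) powr (g - 1))"
  define E where "E = max 1 (2 powr g)"
  define P where "P = max 1 ((1 / 2) powr (- p))"
  define C where "C = max (2 * (\<bar>g\<bar> * D)) (P * max 1 E)"
  have D0: "0 \<le> D" by (simp add: D_def le_max_iff_disj)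
  have C0: "0 \<le> C"
  proof -
    have "0 \<le> P * max 1 E" by (intro mult_nonneg_nonneg) (auto simp: P_def le_max_iff_disj)
    then show ?thesis by (simp add: C_def le_max_iff_disj)
  qed
  have CP: "P * max 1 E \<le> C" by (simp add: C_def)
  \<comment> \<open>A power is monotone on the positive axis, so on an interval it is bounded by its
    values at the end points, whatever the sign of the exponent.\<close>
  have mono_max: "w powr e \<le> max (l powr e) (u powr e)" if "0 < l" "l \<le> w" "w \<le> u" for l w u e :: real
  proof (cases "0 \<le> e")
    case True
    then have "w powr e \<le> u powr e" using that by (intro powr_mono2) auto
    then show ?thesis by simp
  next
    case False
    then have "w powr e \<le> l powr e" using that by (intro powr_mono2') auto
    then show ?thesis by simp
  qed
  have "\<bar>v powr (- p) * c_weight S v\<bar> \<le> C * (v powr (1 - p) + (1 - v) powr (S - 2) + 1)" if v: "v \<in> {0<..<1}" for v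
  proof (cases "v \<le> 1 / 2")
    case True
    have "norm ((1 - v) powr g - (1 + v) powr g) \<le> \<bar>g\<bar> * D * norm ((1 - v) - (1 + v))"
    proof (rule field_differentiable_bound[of "{1 / 2..3 / 2}"])
      fix w :: real assume w: "w \<in> {1 / 2..3 / 2}"
      then show "((\<lambda>w. w powr g) has_field_derivative g * w powr (g - 1)) (at w within {1 / 2..3 / 2})"
        by (intro has_field_derivative_at_within[OF has_real_derivative_powr]) auto
      have "w powr (g - 1) \<le> D" unfolding D_def using w by (intro mono_max) auto
      then show "norm (g * w powr (g - 1)) \<le> \<bar>g\<bar> * D"
        unfolding real_norm_def abs_mult by (intro mult_left_mono) auto
    qed (use v True in auto)
    then have "\<bar>c_weight S v\<bar> \<le> 2 * (\<bar>g\<bar> * D) * v" using v by (simp add: c_weight_def g_def)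
    then have "v powr (- p) * \<bar>c_weight S v\<bar> \<le> v powr (- p) * (2 * (\<bar>g\<bar> * D) * v)" by (intro mult_left_mono) auto
    also have "\<dots> = 2 * (\<bar>g\<bar> * D) * v powr (1 - p)" using v by (simp add: powr_diff powr_minus divide_inverse)
    also have "\<dots> \<le> C * (v powr (1 - p) + (1 - v) powr (S - 2) + 1)"
      using D0 by (intro mult_mono) (auto simp: C_def le_max_iff_disj)
    finally show ?thesis by (simp add: abs_mult)
  next
    case False
    have 1: "v powr (- p) \<le> P"
      using mono_max[of "1/2" v 1 "- p"] False v by (simp add: P_def max.commute)
    have 2: "(1 + v) powr g \<le> E"
      using mono_max[of 1 "1 + v" 2 g] v by (simp add: E_def)
    have "\<bar>c_weight S v\<bar> \<le> (1 - v) powr g + (1 + v) powr g"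
      unfolding c_weight_def g_def[symmetric] using powr_ge_zero[of "1 - v" g] powr_ge_zero[of "1 + v" g] by linarith
    also have "\<dots> \<le> max 1 E * ((1 - v) powr g + 1)"
    proof -
      have "(1 - v) powr g \<le> max 1 E * (1 - v) powr g" using mult_right_mono[of 1 "max 1 E" "(1 - v) powr g"] by simp
      then show ?thesis using 2 by (simp add: distrib_left)
    qed
    finally have "v powr (- p) * \<bar>c_weight S v\<bar> \<le> P * (max 1 E * ((1 - v) powr g + 1))"
      using 1 by (intro mult_mono) (auto simp: P_def)
    also have "\<dots> = P * max 1 E * ((1 - v) powr g + 1)" by simp
    also have "\<dots> \<le> C * (v powr (1 - p) + (1 - v) powr (S - 2) + 1)"
      unfolding g_def using CP C0 by (intro mult_mono) auto
    finally show ?thesis by (simp add: abs_mult)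
  qed
  then show thesis using that C0 by blast
qed

lemma c_weight_integrable:
  assumes "p < 2" "1 < S"
  shows "set_integrable lborel {0<..<1} (\<lambda>v. v powr (- p) * c_weight S v)"
proof -
  obtain C where C: "C \<ge> 0" "\<And>v. v \<in> {0<..<1} \<Longrightarrow> \<bar>v powr (- p) * c_weight S v\<bar> \<le> C * (v powr (1 - p) + (1 - v) powr (S - 2) + 1)"
    using c_weight_bound by metis
  show ?thesis
  proof (rule set_integrable_bound)
    have 1: "set_integrable lborel {0<..<1} (\<lambda>v. v powr (1 - p))" using assms by (intro set_integrable_powr_01) auto
    have "set_integrable lborel {0<..<1} (\<lambda>v. v powr (S - 2))" using assms by (intro set_integrable_powr_01) auto
    then have "integrable lborel (\<lambda>v. indicat_real {0<..<1} (1 + (-1) * v) *\<^sub>R (1 + (-1) * v) powr (S - 2))"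
      unfolding set_integrable_def by (rule lborel_integrable_real_affine) simp
    then have 2: "set_integrable lborel {0<..<1} (\<lambda>v. (1 - v) powr (S - 2))"
      unfolding set_integrable_def
      by (rule Bochner_Integration.integrable_cong[THEN iffD1, rotated -1]) (auto simp: indicator_def)
    have 3: "set_integrable lborel {0<..<1} (\<lambda>v :: real. 1 :: real)"
      unfolding set_integrable_def by (intro integrable_scaleR_left integrable_real_indicator) auto
    show "set_integrable lborel {0<..<1} (\<lambda>v. C * (v powr (1 - p) + (1 - v) powr (S - 2) + 1))"
      using 1 2 3 by (intro set_integrable_mult_right set_integral_add)
    show "set_borel_measurable lborel {0<..<1} (\<lambda>v. v powr (- p) * c_weight S v)"
      unfolding set_borel_measurable_def c_weight_def by measurable
    show "AE v in lborel. v \<in> {0<..<1} \<longrightarrow> norm (v powr (- p) * c_weight S v) \<le> norm (C * (v powr (1 - p) + (1 - v) powr (S - 2) + 1))"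
      using C by (intro AE_I2) (auto intro: order_trans[OF _ abs_ge_self])
  qed
qed

lemma c_coeff_eq:
  assumes "p < 2" "q < 2" "1 < p + q"
  shows "c_coeff p q = 2 powr (- p - q) * pi powr (- 1 / 2) * Gamma ((2 - p - q) / 2) *
    ((LINT v:{0<..<1}|lborel. v powr (- p) * c_weight (p + q) v) + (LINT v:{0<..<1}|lborel. v powr (- q) * c_weight (p + q) v))"
proof -
  have "(LBINT v=0..1. (v powr (- p) + v powr (- q)) * ((1 - v) powr (p + q - 2) - (1 + v) powr (p + q - 2))) =
    (LINT v:{0<..<1}|lborel. v powr (- p) * c_weight (p + q) v + v powr (- q) * c_weight (p + q) v)"
    by (subst interval_integral_Ioo) (auto simp: c_weight_def distrib_right)
  also have "\<dots> = (LINT v:{0<..<1}|lborel. v powr (- p) * c_weight (p + q) v) + (LINT v:{0<..<1}|lborel. v powr (- q) * c_weight (p + q) v)"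
    using assms by (intro set_integral_add c_weight_integrable)
  finally show ?thesis unfolding c_coeff_def by simp
qed

text \<open>The diagonal cuts the quadrant into two triangles; they contribute the summands with v
  powr (-p) and v powr (-q) of \<open>c_coeff\<close>.\<close>

lemma half_line_moment:
  fixes p q t :: real
  assumes t: "0 < t" and pq: "p < 2" "q < 2" "1 < p + q" and S: "p + q < 4" "p + q \<noteq> 2"
  shows "has_bochner_integral (lborel \<Otimes>\<^sub>M lborel)
    (\<lambda>z. indicator ({0<..} \<times> {0<..}) z * (half_line_kernel t (fst z) (snd z) * fst z powr (- p) * snd z powr (- q)))
    (c_coeff p q * t powr ((1 - p - q) / 2))"
proof -
  define H where "H z = indicat_real ({0<..} \<times> {0<..}) z * (half_line_kernel t (fst z) (snd z) * fst z powr (- p) * snd z powr (- q))" for z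
  define k where "k = 2 powr (- p - q) * pi powr (- 1 / 2) * Gamma ((2 - p - q) / 2) * t powr ((1 - p - q) / 2)"
  define w where "w e v = indicator {0<..<1} v * (v powr (- e) * c_weight (p + q) v)" for e v :: real
  have w_sym: "c_weight (q + p) = c_weight (p + q)" by (simp add: add.commute)
  have wm [measurable]: "w e \<in> borel_measurable borel" for e unfolding w_def c_weight_def by measurable
  have wi: "integrable lborel (w e)" if "e < 2" for e
    using c_weight_integrable[OF that pq(3)] by (simp add: w_def[abs_def] set_integrable_def)
  \<comment> \<open>Gamma ((2 - p - q) / 2) and \<open>c_weight\<close> change sign together at p +
    q = 2. This permits the computation with nonnegative integrals on both sides of that
    value.\<close>
  have kw: "0 \<le> k * w e v" for e v
  proof (cases "v \<in> {0<..<1}")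
    case True
    have "0 \<le> Gamma ((2 - p - q) / 2) * c_weight (p + q) v"
    proof (cases "p + q < 2")
      case True
      then have "(1 - v) powr (p + q - 2) \<ge> (1 + v) powr (p + q - 2)"
        using \<open>v \<in> {0<..<1}\<close> by (intro powr_mono2') auto
      moreover have "0 \<le> Gamma ((2 - p - q) / 2)" using True by (intro Gamma_real_nonneg) auto
      ultimately show ?thesis by (simp add: c_weight_def)
    next
      case False
      then have "(1 - v) powr (p + q - 2) \<le> (1 + v) powr (p + q - 2)"
        using \<open>v \<in> {0<..<1}\<close> by (intro powr_mono2) auto
      moreover have "Gamma ((2 - p - q) / 2) \<le> 0"
      proof -
        define P where "P = (2 - p - q) / 2"
        have P: "- 1 < P" "P < 0" using False S by (auto simp: P_def)
        have "P \<notin> \<int>\<^sub>\<le>\<^sub>0"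
        proof
          assume "P \<in> \<int>\<^sub>\<le>\<^sub>0"
          then obtain n :: nat where "P = - real n" by (elim nonpos_Ints_cases')
          then show False using P by (cases n) auto
        qed
        then have "Gamma (P + 1) = P * Gamma P" by (rule Gamma_plus1)
        moreover have "0 \<le> Gamma (P + 1)" using P by (intro Gamma_real_nonneg) auto
        ultimately show ?thesis unfolding P_def[symmetric] using P by (simp add: zero_le_mult_iff)
      qed
      ultimately show ?thesis unfolding c_weight_def by (intro mult_nonpos_nonpos) auto
    qed
    from mult_nonneg_nonneg[OF _ this, of "2 powr (- p - q) * pi powr (- 1 / 2) * t powr ((1 - p - q) / 2) * v powr (- e)"]
    have "0 \<le> 2 powr (- p - q) * pi powr (- 1 / 2) * t powr ((1 - p - q) / 2) * v powr (- e) * (Gamma ((2 - p - q) / 2) * c_weight (p + q) v)"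
      by simp
    then show ?thesis using True by (simp add: k_def w_def mult_ac)
  qed (simp add: w_def)
  define H1 where "H1 s r = ennreal (indicator {0<..} s * indicator {0<..<s} r * (half_line_kernel t r s * r powr (- p) * s powr (- q)))" for s r :: real
  define H2 where "H2 r s = ennreal (indicator {0<..} r * indicator {0<..<r} s * (half_line_kernel t s r * s powr (- q) * r powr (- p)))" for s r :: real
  have m1: "(\<lambda>z. H1 (snd z) (fst z)) \<in> borel_measurable (borel \<Otimes>\<^sub>M borel)"
    and m2: "(\<lambda>z. H2 (fst z) (snd z)) \<in> borel_measurable (borel \<Otimes>\<^sub>M borel)"
  proof -
    have i: "indicat_real {0<..<s} r = indicator {0<..} r * indicator {0<..} (s - r)" for r s :: real by (auto simp: indicator_def)
    show "(\<lambda>z. H1 (snd z) (fst z)) \<in> borel_measurable (borel \<Otimes>\<^sub>M borel)" "(\<lambda>z. H2 (fst z) (snd z)) \<in> borel_measurable (borel \<Otimes>\<^sub>M borel)"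
      unfolding H1_def H2_def i half_line_kernel_def gauss1_def by measurable
  qed
  have T1: "(\<integral>\<^sup>+ s. (\<integral>\<^sup>+ r. H1 s r \<partial>lborel) \<partial>lborel) = (\<integral>\<^sup>+ v. ennreal (k * w p v) \<partial>lborel)"
    unfolding H1_def k_def w_def using half_line_triangle[OF t S] .
  have "(\<integral>\<^sup>+ r. (\<integral>\<^sup>+ s. H2 r s \<partial>lborel) \<partial>lborel) = (\<integral>\<^sup>+ v. ennreal (k * w q v) \<partial>lborel)"
  proof -
    have e: "- q - p = - p - q" "2 - q - p = 2 - p - q" "1 - q - p = 1 - p - q" by (simp_all add: algebra_simps)
    show ?thesis
      unfolding H2_def k_def w_def using half_line_triangle[OF t, of q p] S unfolding w_sym e by (simp add: add.commute)
  qed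
  also have "(\<integral>\<^sup>+ r. (\<integral>\<^sup>+ s. H2 r s \<partial>lborel) \<partial>lborel) = (\<integral>\<^sup>+ s. (\<integral>\<^sup>+ r. H2 r s \<partial>lborel) \<partial>lborel)"
    by (rule lborel_pair.Fubini'[symmetric]) (use m2 in \<open>simp add: split_beta'\<close>)
  finally have T2: "(\<integral>\<^sup>+ s. (\<integral>\<^sup>+ r. H2 r s \<partial>lborel) \<partial>lborel) = (\<integral>\<^sup>+ v. ennreal (k * w q v) \<partial>lborel)" .
  have split: "ennreal (H (r, s)) = H1 s r + H2 r s" if "r \<noteq> s" for r s
  proof -
    have "half_line_kernel t s r = half_line_kernel t r s" by (rule half_line_kernel_commute)
    then show ?thesis using that by (cases "r < s") (auto simp: H_def H1_def H2_def indicator_def mult_ac)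
  qed
  have Hm: "H \<in> borel_measurable (borel \<Otimes>\<^sub>M borel)" unfolding H_def by measurable
  have "(\<integral>\<^sup>+ z. ennreal (H z) \<partial>(lborel \<Otimes>\<^sub>M lborel)) = (\<integral>\<^sup>+ s. (\<integral>\<^sup>+ r. ennreal (H (r, s)) \<partial>lborel) \<partial>lborel)"
    by (rule lborel_pair.nn_integral_snd[symmetric]) (use Hm in simp)
  also have "\<dots> = (\<integral>\<^sup>+ s. (\<integral>\<^sup>+ r. H1 s r + H2 r s \<partial>lborel) \<partial>lborel)"
  proof (rule nn_integral_cong, rule nn_integral_cong_AE)
    fix s :: real
    show "AE r in lborel. ennreal (H (r, s)) = H1 s r + H2 r s"
      by (rule AE_mp[OF AE_lborel_singleton[of s]]) (use split in auto)
  qed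
  also have "\<dots> = (\<integral>\<^sup>+ s. (\<integral>\<^sup>+ r. H1 s r \<partial>lborel) + (\<integral>\<^sup>+ r. H2 r s \<partial>lborel) \<partial>lborel)"
  proof (rule nn_integral_cong, rule nn_integral_add)
    fix s :: real
    have sec: "(\<lambda>r. (r, s)) \<in> borel \<rightarrow>\<^sub>M borel \<Otimes>\<^sub>M borel" by measurable
    show "H1 s \<in> borel_measurable lborel" using measurable_compose[OF sec m1] by simp
    show "(\<lambda>r. H2 r s) \<in> borel_measurable lborel" using measurable_compose[OF sec m2] by simp
  qed
  also have "\<dots> = (\<integral>\<^sup>+ s. (\<integral>\<^sup>+ r. H1 s r \<partial>lborel) \<partial>lborel) + (\<integral>\<^sup>+ s. (\<integral>\<^sup>+ r. H2 r s \<partial>lborel) \<partial>lborel)"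
  proof (rule nn_integral_add)
    have "(\<lambda>z. H1 (fst z) (snd z)) \<in> borel_measurable (borel \<Otimes>\<^sub>M borel)"
      using measurable_compose[OF measurable_pair_swap' m1] by (simp add: split_beta')
    then show "(\<lambda>s. \<integral>\<^sup>+ r. H1 s r \<partial>lborel) \<in> borel_measurable lborel"
      by (intro lborel.borel_measurable_nn_integral) (simp add: split_beta')
    have "(\<lambda>z. H2 (snd z) (fst z)) \<in> borel_measurable (borel \<Otimes>\<^sub>M borel)"
      using measurable_compose[OF measurable_pair_swap' m2] by (simp add: split_beta')
    then show "(\<lambda>s. \<integral>\<^sup>+ r. H2 r s \<partial>lborel) \<in> borel_measurable lborel"
      by (intro lborel.borel_measurable_nn_integral) (simp add: split_beta')
  qed
  also have "\<dots> = (\<integral>\<^sup>+ v. ennreal (k * w p v) + ennreal (k * w q v) \<partial>lborel)"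
    unfolding T1 T2 by (rule nn_integral_add[symmetric]) auto
  also have "\<dots> = (\<integral>\<^sup>+ v. ennreal (k * w p v + k * w q v) \<partial>lborel)"
    using kw by (simp add: ennreal_plus)
  also have "\<dots> = ennreal (LINT v|lborel. k * w p v + k * w q v)"
    using wi pq kw by (intro nn_integral_eq_integral) auto
  also have "(LINT v|lborel. k * w p v + k * w q v) = k * ((LINT v|lborel. w p v) + (LINT v|lborel. w q v))"
    using wi pq by (simp add: distrib_left)
  also have "\<dots> = c_coeff p q * t powr ((1 - p - q) / 2)"
    using c_coeff_eq[OF pq] by (simp add: k_def w_def[abs_def] set_lebesgue_integral_def)
  finally have I: "(\<integral>\<^sup>+ z. ennreal (H z) \<partial>(lborel \<Otimes>\<^sub>M lborel)) = ennreal (c_coeff p q * t powr ((1 - p - q) / 2))" .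
  have "0 \<le> (LINT v|lborel. k * w p v + k * w q v)" using kw by (intro integral_nonneg_AE) auto
  also have "(LINT v|lborel. k * w p v + k * w q v) = k * ((LINT v|lborel. w p v) + (LINT v|lborel. w q v))"
    using wi pq by (simp add: distrib_left)
  also have "\<dots> = c_coeff p q * t powr ((1 - p - q) / 2)"
    using c_coeff_eq[OF pq] by (simp add: k_def w_def[abs_def] set_lebesgue_integral_def)
  finally have c0: "0 \<le> c_coeff p q * t powr ((1 - p - q) / 2)" .
  have "has_bochner_integral (lborel \<Otimes>\<^sub>M lborel) H (c_coeff p q * t powr ((1 - p - q) / 2))"
  proof (rule has_bochner_integral_nn_integral[OF _ _ c0 I])
    show "H \<in> borel_measurable (lborel \<Otimes>\<^sub>M lborel)" using Hm by simp
    show "AE z in lborel \<Otimes>\<^sub>M lborel. 0 \<le> H z"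
      using half_line_kernel_nonneg[OF t] by (intro AE_I2) (auto simp: H_def indicator_def intro!: mult_nonneg_nonneg)
  qed
  then show ?thesis unfolding H_def[abs_def] .
qed

section \<open>Boundary layer and asymptotic expansion\<close>

abbreviation lborel2 :: "(real \<times> real) measure" where
  "lborel2 \<equiv> lborel \<Otimes>\<^sub>M lborel"

text \<open>Integrable majorant in one variable. Near 0 the vanishing of the kernel has paid one
  power of r; at infinity r powr (- 2) is what is retained of the Gaussian decay.\<close>

definition decay_weight :: "real \<Rightarrow> real \<Rightarrow> real" where
  "decay_weight p r = indicator {0<..<1} r * r powr (1 - p) + indicator {1..} r * r powr (- 2)"

text \<open>Majorant off the diagonal when both coordinates are at least 1/2: the two profiles
  together are of order s powr (2 - S), and the Gaussian gives four powers of the distance.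
  Integrating over r - s first leaves s powr (2 - S), integrable at infinity for S > 3.\<close>

definition strip_weight :: "real \<Rightarrow> real \<Rightarrow> real \<Rightarrow> real" where
  "strip_weight S s r = indicator {1 / 2..} s * indicator {1 / 2..} (r - s) * (s powr (2 - S) * (r - s) powr (- 4))"

lemma decay_weight_measurable [measurable]: "decay_weight p \<in> borel_measurable borel"
  unfolding decay_weight_def[abs_def] by measurable

lemma decay_weight_nonneg: "0 \<le> decay_weight p r"
  by (simp add: decay_weight_def)

lemma strip_weight_nonneg: "0 \<le> strip_weight S s r"
  by (simp add: strip_weight_def)

lemma nn_integral_powr_to_inf:
  fixes e a :: real
  assumes "e < - 1" "0 < a"
  shows "(\<integral>\<^sup>+ x. ennreal (indicator {a..} x * x powr e) \<partial>lborel) < \<infinity>"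
proof -
  have "((\<lambda>x. x powr e) has_integral - (a powr (e + 1)) / (e + 1)) {a..}"
    using has_integral_powr_to_inf[OF assms] .
  then have "(\<integral>\<^sup>+ x. ennreal (indicator {a..} x * x powr e) \<partial>lborel) = ennreal (- (a powr (e + 1)) / (e + 1))"
    by (intro nn_integral_has_integral_lebesgue) auto
  then show ?thesis by simp
qed

lemma decay_weight_nn_integral:
  assumes "p < 2"
  shows "(\<integral>\<^sup>+ r. ennreal (decay_weight p r) \<partial>lborel) < \<infinity>"
proof -
  have 1: "(\<integral>\<^sup>+ r. ennreal (indicator {0<..<1} r * r powr (1 - p)) \<partial>lborel) < \<infinity>"
    using set_integrable_powr_01[of "1 - p"] assms
    by (simp add: set_integrable_def integrable_iff_bounded)
  have 2: "(\<integral>\<^sup>+ r. ennreal (indicator {1..} r * r powr (- 2)) \<partial>lborel) < \<infinity>"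
    by (rule nn_integral_powr_to_inf) auto
  have "(\<integral>\<^sup>+ r. ennreal (decay_weight p r) \<partial>lborel) = (\<integral>\<^sup>+ r. ennreal (indicator {0<..<1} r * r powr (1 - p)) + ennreal (indicator {1..} r * r powr (- 2)) \<partial>lborel)"
    unfolding decay_weight_def by (simp add: ennreal_plus)
  also have "\<dots> = (\<integral>\<^sup>+ r. ennreal (indicator {0<..<1} r * r powr (1 - p)) \<partial>lborel) + (\<integral>\<^sup>+ r. ennreal (indicator {1..} r * r powr (- 2)) \<partial>lborel)"
    by (rule nn_integral_add) auto
  finally show ?thesis using 1 2 by simp
qed

lemma decay_weight_integrable2:
  assumes "p < 2" "q < 2"
  shows "integrable lborel2 (\<lambda>z. decay_weight p (fst z) * decay_weight q (snd z))"
proof (rule integrableI_nonneg)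
  show "(\<lambda>z. decay_weight p (fst z) * decay_weight q (snd z)) \<in> borel_measurable lborel2" by measurable
  show "AE z in lborel2. 0 \<le> decay_weight p (fst z) * decay_weight q (snd z)"
    by (intro AE_I2 mult_nonneg_nonneg decay_weight_nonneg)
  have "(\<integral>\<^sup>+ z. ennreal (decay_weight p (fst z) * decay_weight q (snd z)) \<partial>lborel2) =
    (\<integral>\<^sup>+ r. (\<integral>\<^sup>+ s. ennreal (decay_weight p (fst (r, s)) * decay_weight q (snd (r, s))) \<partial>lborel) \<partial>lborel)"
    by (rule lborel.nn_integral_fst[symmetric]) measurable
  also have "\<dots> = (\<integral>\<^sup>+ r. ennreal (decay_weight p r) * (\<integral>\<^sup>+ s. ennreal (decay_weight q s) \<partial>lborel) \<partial>lborel)"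
    by (simp add: ennreal_mult' decay_weight_nonneg nn_integral_cmult)
  also have "\<dots> = (\<integral>\<^sup>+ r. ennreal (decay_weight p r) \<partial>lborel) * (\<integral>\<^sup>+ s. ennreal (decay_weight q s) \<partial>lborel)"
    by (rule nn_integral_multc) measurable
  also have "\<dots> < \<infinity>"
    using decay_weight_nn_integral[OF assms(1)] decay_weight_nn_integral[OF assms(2)] by (simp add: ennreal_mult_less_top)
  finally show "(\<integral>\<^sup>+ z. ennreal (decay_weight p (fst z) * decay_weight q (snd z)) \<partial>lborel2) < \<infinity>" .
qed

lemma strip_weight_integrable2:
  assumes "3 < S"
  shows "integrable lborel2 (\<lambda>z. strip_weight S (fst z) (snd z))"
    and "integrable lborel2 (\<lambda>z. strip_weight S (snd z) (fst z))"
proof -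
  have m: "(\<lambda>z. strip_weight S (fst z) (snd z)) \<in> borel_measurable lborel2" unfolding strip_weight_def by measurable
  show 1: "integrable lborel2 (\<lambda>z. strip_weight S (fst z) (snd z))"
  proof (rule integrableI_nonneg[OF m])
    show "AE z in lborel2. 0 \<le> strip_weight S (fst z) (snd z)"
      by (intro AE_I2 strip_weight_nonneg)
    define I where "I = (\<integral>\<^sup>+ x. ennreal (indicator {1 / 2..} x * x powr (- 4 :: real)) \<partial>lborel)"
    have "(\<integral>\<^sup>+ z. ennreal (strip_weight S (fst z) (snd z)) \<partial>lborel2) = (\<integral>\<^sup>+ s. (\<integral>\<^sup>+ r. ennreal (strip_weight S (fst (s, r)) (snd (s, r))) \<partial>lborel) \<partial>lborel)"
      by (rule lborel.nn_integral_fst[symmetric]) (use m in measurable)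
    also have "\<dots> = (\<integral>\<^sup>+ s. ennreal (indicator {1 / 2..} s * s powr (2 - S)) * I \<partial>lborel)"
    proof (rule nn_integral_cong)
      fix s :: real
      have "(\<integral>\<^sup>+ r. ennreal (strip_weight S (fst (s, r)) (snd (s, r))) \<partial>lborel) =
        (\<integral>\<^sup>+ r. ennreal (indicator {1 / 2..} s * s powr (2 - S)) * ennreal (indicator {1 / 2..} (r - s) * (r - s) powr (- 4)) \<partial>lborel)"
        by (intro nn_integral_cong) (simp add: strip_weight_def ennreal_mult'[symmetric] mult_ac)
      also have "\<dots> = ennreal (indicator {1 / 2..} s * s powr (2 - S)) * (\<integral>\<^sup>+ r. ennreal (indicator {1 / 2..} (r - s) * (r - s) powr (- 4)) \<partial>lborel)"
        by (rule nn_integral_cmult) measurable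
      also have "(\<integral>\<^sup>+ r. ennreal (indicator {1 / 2..} (r - s) * (r - s) powr (- 4)) \<partial>lborel) = I"
        by (subst nn_integral_real_affine[where c=1 and t=s]) (auto simp: I_def)
      finally show "(\<integral>\<^sup>+ r. ennreal (strip_weight S (fst (s, r)) (snd (s, r))) \<partial>lborel) = ennreal (indicator {1 / 2..} s * s powr (2 - S)) * I" .
    qed
    also have "\<dots> = (\<integral>\<^sup>+ s. ennreal (indicator {1 / 2..} s * s powr (2 - S)) \<partial>lborel) * I"
      by (rule nn_integral_multc) measurable
    also have "\<dots> < \<infinity>"
      using nn_integral_powr_to_inf[of "2 - S" "1/2"] nn_integral_powr_to_inf[of "- 4" "1/2"] assms
      by (simp add: I_def ennreal_mult_less_top)
    finally show "(\<integral>\<^sup>+ z. ennreal (strip_weight S (fst z) (snd z)) \<partial>lborel2) < \<infinity>" .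
  qed
  show "integrable lborel2 (\<lambda>z. strip_weight S (snd z) (fst z))"
    using lborel_pair.integrable_product_swap[OF 1] by (simp add: split_beta')
qed

section \<open>Splitting off the corner and the diagonal\<close>

text \<open>The one image in the group z = 2 that is not negligible on the unit square: its distance
  2 - r - s tends to 0 at r = s = 1. The cut at 3/2 keeps the distances below 1/2.\<close>

definition corner_term :: "real \<Rightarrow> real \<Rightarrow> real \<Rightarrow> real \<times> real \<Rightarrow> real" where
  "corner_term t p q z = (case z of (r, s) \<Rightarrow>
     indicator {z. 0 < fst z \<and> fst z < 1 \<and> 0 < snd z \<and> snd z < 1 \<and> 3 / 2 < fst z + snd z} (r, s) *
       (gauss1 t (2 - r - s) * profile p r * profile q s))"

text \<open>The part that the quadrant adds to the square near the diagonal, again at distance below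
  1/2. It appears with the same sign as \<open>corner_term\<close>: that image carries a minus sign
  in \<open>image_quad\<close>, and this part is subtracted with the quadrant.\<close>

definition diagonal_term :: "real \<Rightarrow> real \<Rightarrow> real \<Rightarrow> real \<times> real \<Rightarrow> real" where
  "diagonal_term t p q z = (case z of (r, s) \<Rightarrow>
     indicator {z. (1 \<le> fst z \<or> 1 \<le> snd z) \<and> \<bar>fst z - snd z\<bar> < 1 / 2} (r, s) *
       (gauss1 t (r - s) * profile p r * profile q s))"

definition square_term :: "real \<Rightarrow> real \<Rightarrow> real \<Rightarrow> real \<times> real \<Rightarrow> real" where
  "square_term t p q z = (case z of (r, s) \<Rightarrow>
     indicator ({0<..<1} \<times> {0<..<1}) (r, s) * (interval_kernel t r s * profile p r * profile q s))"

definition quadrant_term :: "real \<Rightarrow> real \<Rightarrow> real \<Rightarrow> real \<times> real \<Rightarrow> real" where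
  "quadrant_term t p q z = (case z of (r, s) \<Rightarrow>
     indicator ({0<..} \<times> {0<..}) (r, s) * (half_line_kernel t r s * profile p r * profile q s))"

lemma profile_bounds:
  assumes "1 < p" "0 < r"
  shows "r < 1 \<Longrightarrow> \<bar>profile p r\<bar> \<le> r powr (- p)"
    and "1 / 2 \<le> r \<Longrightarrow> \<bar>profile p r\<bar> \<le> 2 * r powr (1 - p)"
    and "1 \<le> r \<Longrightarrow> \<bar>profile p r\<bar> \<le> 1"
proof -
  show "r < 1 \<Longrightarrow> \<bar>profile p r\<bar> \<le> r powr (- p)"
    using assms by (simp add: profile_def abs_mult mult_left_le_one_le)
  have e: "r powr (1 - p) = r * r powr (- p)" using assms by (simp add: powr_diff powr_minus divide_inverse)
  have m: "\<bar>profile p r\<bar> \<le> c * r powr (1 - p)" if "\<bar>1 - r\<bar> \<le> c * r" for c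
    using mult_right_mono[OF that, of "r powr (- p)"] by (simp add: profile_def abs_mult e mult.assoc)
  show "1 / 2 \<le> r \<Longrightarrow> \<bar>profile p r\<bar> \<le> 2 * r powr (1 - p)"
    by (rule m) auto
  assume r: "1 \<le> r"
  have "\<bar>profile p r\<bar> \<le> 1 * r powr (1 - p)"
    by (rule m) (use r in auto)
  also have "\<dots> \<le> 1" using r assms powr_mono[of "1 - p" 0 r] by simp
  finally show "\<bar>profile p r\<bar> \<le> 1" .
qed

lemma half_line_kernel_far:
  assumes t: "0 < t" and rs: "0 \<le> s" and B: "\<And>w. r - s \<le> w \<Longrightarrow> w \<le> r + s \<Longrightarrow> \<bar>gauss1' t w\<bar> \<le> B"
  shows "\<bar>half_line_kernel t r s\<bar> \<le> 2 * B * s"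
proof -
  have "norm (gauss1 t (r - s) - gauss1 t (r + s)) \<le> B * norm ((r - s) - (r + s))"
    by (rule field_differentiable_bound[of "{r - s..r + s}" _ "gauss1' t"])
       (use rs B in \<open>auto intro: has_field_derivative_at_within gauss1_deriv[OF t]\<close>)
  then show ?thesis using rs by (simp add: half_line_kernel_def)
qed

text \<open>For s < 1/2 the vanishing of the kernel at s = 0 is essential, and r - s \<ge> r / 2
  turns the decay into one in r. For s \<ge> 1/2 a single Gaussian dominates the kernel and the
  profiles supply the decay along the strip.\<close>

lemma half_line_off_diagonal_bound:
  assumes pq: "1 < p" "1 < q"
  obtains C where "C \<ge> 0" "\<And>t r s. 0 < t \<Longrightarrow> t \<le> 1 \<Longrightarrow> 0 < s \<Longrightarrow> 1 \<le> r \<Longrightarrow> 1 / 2 \<le> r - s \<Longrightarrow>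
    \<bar>half_line_kernel t r s * profile p r * profile q s\<bar> \<le>
      C * t ^ N * (decay_weight p r * decay_weight q s + strip_weight (p + q) s r)"
proof -
  obtain C where C: "C \<ge> 0"
    "\<And>t w. 0 < t \<Longrightarrow> t \<le> 1 \<Longrightarrow> 1 / 2 \<le> w \<Longrightarrow> gauss1 t w \<le> C * t ^ N / w ^ 4"
    "\<And>t w. 0 < t \<Longrightarrow> t \<le> 1 \<Longrightarrow> 1 / 2 \<le> w \<Longrightarrow> \<bar>gauss1' t w\<bar> \<le> C * t ^ N / w ^ 4"
    using gauss1_decay[of N] by metis
  have "\<bar>half_line_kernel t r s * profile p r * profile q s\<bar> \<le>
      32 * C * t ^ N * (decay_weight p r * decay_weight q s + strip_weight (p + q) s r)"
    if a: "0 < t" "t \<le> 1" "0 < s" "1 \<le> r" "1 / 2 \<le> r - s" for t r s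
  proof (cases "s < 1 / 2")
    case True
    have "\<bar>half_line_kernel t r s\<bar> \<le> 2 * (C * t ^ N * 16 / r ^ 4) * s"
    proof (rule half_line_kernel_far[OF a(1)])
      fix w assume w: "r - s \<le> w"
      have "r / 2 \<le> w" using w True a by simp
      have "\<bar>gauss1' t w\<bar> \<le> C * t ^ N / w ^ 4" using C(3)[OF a(1,2)] w a by simp
      also have "\<dots> \<le> C * t ^ N / (r / 2) ^ 4"
        using C(1) a \<open>r / 2 \<le> w\<close> by (intro divide_left_mono power_mono) auto
      finally show "\<bar>gauss1' t w\<bar> \<le> C * t ^ N * 16 / r ^ 4" by (simp add: power_divide)
    qed (use a in auto)
    also have "\<dots> = 32 * C * t ^ N * (s / r ^ 4)" by simp
    finally have h: "\<bar>half_line_kernel t r s\<bar> \<le> 32 * C * t ^ N * (s / r ^ 4)" .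
    have r4: "1 / r ^ 4 \<le> decay_weight p r"
    proof -
      have "1 / r ^ 4 \<le> 1 / r ^ 2" using a by (intro divide_left_mono power_increasing) auto
      moreover have "r powr (- 2) = 1 / r ^ 2" using a powr_minus_divide[of r 2] by simp
      ultimately show ?thesis using a by (simp add: decay_weight_def)
    qed
    have "\<bar>half_line_kernel t r s * profile p r * profile q s\<bar> \<le> (32 * C * t ^ N * (s / r ^ 4)) * 1 * s powr (- q)"
      unfolding abs_mult using C(1) a True
      by (intro mult_mono h profile_bounds(3)[OF pq(1)] profile_bounds(1)[OF pq(2)]) auto
    also have "\<dots> = 32 * C * t ^ N * (1 / r ^ 4 * s powr (1 - q))"
    proof -
      have "s powr 1 * s powr (- q) = s powr (1 - q)" unfolding powr_add[symmetric] by simp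
      then have "s powr (1 - q) = s * s powr (- q)" using a by simp
      then show ?thesis by simp
    qed
    also have "\<dots> \<le> 32 * C * t ^ N * (decay_weight p r * decay_weight q s)"
      using C(1) a True r4 by (intro mult_left_mono mult_mono) (auto simp: decay_weight_def)
    also have "\<dots> \<le> 32 * C * t ^ N * (decay_weight p r * decay_weight q s + strip_weight (p + q) s r)"
      using C(1) a strip_weight_nonneg by (intro mult_left_mono) auto
    finally show ?thesis .
  next
    case False
    have "0 \<le> half_line_kernel t r s" using a by (intro half_line_kernel_nonneg) auto
    then have "\<bar>half_line_kernel t r s\<bar> \<le> gauss1 t (r - s)"
      unfolding half_line_kernel_def using a by simp
    also have "\<dots> \<le> C * t ^ N / (r - s) ^ 4" using C(2) a by auto
    finally have h: "\<bar>half_line_kernel t r s\<bar> \<le> C * t ^ N / (r - s) ^ 4" .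
    have f: "\<bar>profile p r\<bar> \<le> 2 * s powr (1 - p)"
    proof -
      have "r powr (1 - p) \<le> s powr (1 - p)" using a pq by (intro powr_mono2') auto
      then show ?thesis using profile_bounds(2)[OF pq(1), of r] a by simp
    qed
    have g: "\<bar>profile q s\<bar> \<le> 2 * s powr (1 - q)" using profile_bounds(2)[OF pq(2), of s] a False by simp
    have "\<bar>half_line_kernel t r s * profile p r * profile q s\<bar> \<le> (C * t ^ N / (r - s) ^ 4) * (2 * s powr (1 - p)) * (2 * s powr (1 - q))"
      unfolding abs_mult using C(1) a by (intro mult_mono h f g) auto
    also have "\<dots> = 4 * C * t ^ N * ((s powr (1 - p) * s powr (1 - q)) * (1 / (r - s) ^ 4))" by simp
    also have "s powr (1 - p) * s powr (1 - q) = s powr (2 - (p + q))"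
      unfolding powr_add[symmetric] by (rule arg_cong[where f="(powr) s"]) simp
    also have "s powr (2 - (p + q)) * (1 / (r - s) ^ 4) = strip_weight (p + q) s r"
    proof -
      have "(r - s) powr (- 4) = 1 / (r - s) ^ 4"
        using a powr_minus_divide[of "r - s" 4] by simp
      then show ?thesis using a False by (simp add: strip_weight_def)
    qed
    also have "4 * C * t ^ N * strip_weight (p + q) s r \<le> 32 * C * t ^ N * (decay_weight p r * decay_weight q s + strip_weight (p + q) s r)"
      using C(1) a strip_weight_nonneg decay_weight_nonneg by (intro mult_mono) (auto intro: mult_right_mono)
    finally show ?thesis .
  qed
  then show thesis using that[of "32 * C"] C(1) by simp
qed

definition error_weight :: "real \<Rightarrow> real \<Rightarrow> real \<times> real \<Rightarrow> real" where
  "error_weight p q z = decay_weight p (fst z) * decay_weight q (snd z)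
     + strip_weight (p + q) (snd z) (fst z) + strip_weight (p + q) (fst z) (snd z)"

text \<open>Serves to distribute the decay (r + s)^(-4) \<le> r^(-2) s^(-2) over the two
  variables.\<close>

lemma profile_decay:
  assumes "1 < p" "1 / 2 \<le> r"
  shows "\<bar>profile p r\<bar> / r\<^sup>2 \<le> 8 * decay_weight p r"
proof (cases "1 \<le> r")
  case True
  have "\<bar>profile p r\<bar> / r\<^sup>2 \<le> 1 / r\<^sup>2"
    using profile_bounds(3)[OF assms(1)] True by (intro divide_right_mono) auto
  also have "1 / r\<^sup>2 = decay_weight p r"
    using True powr_minus_divide[of r 2] by (simp add: decay_weight_def)
  finally show ?thesis using decay_weight_nonneg[of p r] by simp
next
  case False
  have "(1 / 2)\<^sup>2 \<le> r\<^sup>2" using assms by (intro power_mono) auto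
  then have "1 / r\<^sup>2 \<le> 4" using assms by (simp add: field_simps power2_eq_square)
  moreover have "\<bar>profile p r\<bar> \<le> 2 * r powr (1 - p)" using profile_bounds(2)[of p r] assms by simp
  ultimately have "\<bar>profile p r\<bar> * (1 / r\<^sup>2) \<le> 2 * r powr (1 - p) * 4" by (intro mult_mono) auto
  then show ?thesis using False assms by (simp add: decay_weight_def)
qed

text \<open>Inside the square the image kernel exceeds the half line kernel essentially by minus the
  corner image. Outside it only the quadrant is present, and near the diagonal the half line kernel
  is essentially its direct Gaussian. All that remains is smaller than any power of t, with an
  integrable weight.\<close>

lemma pointwise_remainder:
  assumes pq: "1 < p" "1 < q"
  obtains C where "C \<ge> 0" "\<And>t z. 0 < t \<Longrightarrow> t \<le> 1 \<Longrightarrow>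
    \<bar>square_term t p q z - quadrant_term t p q z + (corner_term t p q z + diagonal_term t p q z)\<bar> \<le> C * t ^ N * error_weight p q z"
proof -
  obtain Cg where Cg: "Cg \<ge> 0" "\<And>t w. 0 < t \<Longrightarrow> t \<le> 1 \<Longrightarrow> 1 / 2 \<le> w \<Longrightarrow> gauss1 t w \<le> Cg * t ^ N / w ^ 4"
    using gauss1_decay[of N] by metis
  obtain Ct where Ct: "Ct \<ge> 0" "\<And>t r s. 0 < t \<Longrightarrow> t \<le> 1 \<Longrightarrow> 0 \<le> r \<Longrightarrow> r \<le> 1 \<Longrightarrow> 0 \<le> s \<Longrightarrow> s \<le> 1 \<Longrightarrow>
      \<bar>interval_kernel t r s - half_line_kernel t r s - image_quad t 2 r s\<bar> \<le> Ct * t ^ N * (r * s)"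
    using interval_kernel_tail[of N] by metis
  obtain Cq where Cq: "Cq \<ge> 0" "\<And>t r s z. 0 < t \<Longrightarrow> t \<le> 1 \<Longrightarrow> 0 \<le> r \<Longrightarrow> 0 \<le> s \<Longrightarrow> 1 / 2 \<le> z - r - s \<Longrightarrow>
      \<bar>image_quad t z r s\<bar> \<le> Cq * t ^ N / (z - r - s) ^ 4 * (r * s)"
    using image_quad_far_bound[of N] by metis
  obtain C1 where C1: "C1 \<ge> 0" "\<And>t r s. 0 < t \<Longrightarrow> t \<le> 1 \<Longrightarrow> 0 < s \<Longrightarrow> 1 \<le> r \<Longrightarrow> 1 / 2 \<le> r - s \<Longrightarrow>
    \<bar>half_line_kernel t r s * profile p r * profile q s\<bar> \<le> C1 * t ^ N * (decay_weight p r * decay_weight q s + strip_weight (p + q) s r)"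
    using half_line_off_diagonal_bound[OF pq, of N] by metis
  obtain C2 where C2: "C2 \<ge> 0" "\<And>t r s. 0 < t \<Longrightarrow> t \<le> 1 \<Longrightarrow> 0 < r \<Longrightarrow> 1 \<le> s \<Longrightarrow> 1 / 2 \<le> s - r \<Longrightarrow>
    \<bar>half_line_kernel t s r * profile q s * profile p r\<bar> \<le> C2 * t ^ N * (decay_weight q s * decay_weight p r + strip_weight (q + p) r s)"
    using half_line_off_diagonal_bound[OF pq(2,1), of N] by metis
  \<comment> \<open>One summand per region: 4 comes from two profile bounds with constant 2, 3
    counts the other images in the group z = 2, 16 is the fourth power of 1 / (1/2), and 64 comes
    from using \<open>profile_decay\<close> twice.\<close>
  define D where "D = 4 * (Ct + 3 * Cg) + (16 * Cq + Ct) + 64 * Cg + C1 + C2"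
  note C0 = Cg(1) Ct(1) Cq(1) C1(1) C2(1)
  have D: "0 \<le> D" "4 * (Ct + 3 * Cg) \<le> D" "16 * Cq + Ct \<le> D" "64 * Cg \<le> D" "C1 \<le> D" "C2 \<le> D"
    using C0 by (auto simp: D_def)
  have E: "0 \<le> decay_weight p r * decay_weight q s" "0 \<le> error_weight p q (r, s)"
    "decay_weight p r * decay_weight q s \<le> error_weight p q (r, s)"
    "decay_weight p r * decay_weight q s + strip_weight (p + q) s r \<le> error_weight p q (r, s)"
    "decay_weight q s * decay_weight p r + strip_weight (q + p) r s \<le> error_weight p q (r, s)" for r s
    using decay_weight_nonneg[of p r] decay_weight_nonneg[of q s] strip_weight_nonneg[of "p + q" s r] strip_weight_nonneg[of "p + q" r s]
    by (auto simp: error_weight_def add.commute[of q p] mult.commute)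
  have up: "X \<le> D * t ^ N * error_weight p q (r, s)" if "X \<le> c * t ^ N * w" "c \<le> D" "w \<le> error_weight p q (r, s)" "0 \<le> c" "0 < t" for X c t w r s
  proof -
    have "c * t ^ N * w \<le> c * t ^ N * error_weight p q (r, s)" using that by (intro mult_left_mono) auto
    also have "\<dots> \<le> D * t ^ N * error_weight p q (r, s)" using that E(2) by (intro mult_right_mono) auto
    finally show ?thesis using that by linarith
  qed
  have "\<bar>square_term t p q (r, s) - quadrant_term t p q (r, s) + (corner_term t p q (r, s) + diagonal_term t p q (r, s))\<bar> \<le> D * t ^ N * error_weight p q (r, s)"
    (is "\<bar>?e\<bar> \<le> _") if t: "0 < t" "t \<le> 1" for t r s
  proof (cases "0 < r \<and> 0 < s")
    case False
    then have "?e = 0"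
      by (auto simp: square_term_def quadrant_term_def corner_term_def diagonal_term_def indicator_def)
    then show ?thesis using D E(2) t by simp
  next
    case rs: True
    show ?thesis
    proof (cases "r < 1 \<and> s < 1")
      case lt: True
      then have dd: "diagonal_term t p q (r, s) = 0" by (simp add: diagonal_term_def)
      have vv: "decay_weight p r * decay_weight q s = r powr (1 - p) * s powr (1 - q)"
        using lt rs by (simp add: decay_weight_def)
      note tail = Ct(2)[OF t, of r s]
      show ?thesis
      proof (cases "3 / 2 < r + s")
        case True
        have e: "?e = (interval_kernel t r s - half_line_kernel t r s + gauss1 t (2 - r - s)) * (profile p r * profile q s)"
          using lt rs True by (simp add: square_term_def quadrant_term_def corner_term_def dd algebra_simps)
        \<comment> \<open>Near the corner the three other images of the group z = 2 are at distance
          at least 1.\<close>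
        have g1: "gauss1 t w \<le> Cg * t ^ N" "0 \<le> gauss1 t w" if "1 \<le> w" for w
        proof -
          have "gauss1 t w \<le> Cg * t ^ N / w ^ 4" using Cg(2)[OF t, of w] that by simp
          also have "\<dots> \<le> Cg * t ^ N / 1" using that Cg(1) t by (intro divide_left_mono) auto
          finally show "gauss1 t w \<le> Cg * t ^ N" by simp
        qed (use t in auto)
        have "r * s \<le> 1 * 1" using lt rs by (intro mult_mono) auto
        then have "Ct * t ^ N * (r * s) \<le> Ct * t ^ N * 1" using Ct(1) t by (intro mult_left_mono) auto
        then have "\<bar>interval_kernel t r s - half_line_kernel t r s - image_quad t 2 r s\<bar> \<le> Ct * t ^ N"
          using tail lt rs by simp
        moreover have "image_quad t 2 r s + gauss1 t (2 - r - s) = gauss1 t (2 + r - s) + gauss1 t (2 - r + s) - gauss1 t (2 + r + s)"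
          by (simp add: image_quad_def)
        ultimately have k: "\<bar>interval_kernel t r s - half_line_kernel t r s + gauss1 t (2 - r - s)\<bar> \<le> Ct * t ^ N + (Cg * t ^ N + Cg * t ^ N + Cg * t ^ N)"
          using g1[of "2 + r - s"] g1[of "2 - r + s"] g1[of "2 + r + s"] lt rs by linarith
        have f: "\<bar>profile p r\<bar> \<le> 2 * r powr (1 - p)" "\<bar>profile q s\<bar> \<le> 2 * s powr (1 - q)"
          using profile_bounds(2)[OF pq(1), of r] profile_bounds(2)[OF pq(2), of s] lt rs True by auto
        have "\<bar>?e\<bar> \<le> (Ct * t ^ N + (Cg * t ^ N + Cg * t ^ N + Cg * t ^ N)) * ((2 * r powr (1 - p)) * (2 * s powr (1 - q)))"
          unfolding e abs_mult using Ct(1) Cg(1) t by (intro mult_mono k f) auto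
        also have "\<dots> = 4 * (Ct + 3 * Cg) * t ^ N * (decay_weight p r * decay_weight q s)"
          unfolding vv by (simp add: algebra_simps)
        finally show ?thesis by (rule up) (use D E C0 t in auto)
      next
        case False
        have e: "?e = (interval_kernel t r s - half_line_kernel t r s) * (profile p r * profile q s)"
          using lt rs False by (simp add: square_term_def quadrant_term_def corner_term_def dd algebra_simps)
        have "\<bar>image_quad t 2 r s\<bar> \<le> Cq * t ^ N / (2 - r - s) ^ 4 * (r * s)"
          using Cq(2)[OF t, of r s 2] rs False by simp
        also have "\<dots> \<le> Cq * t ^ N / (1 / 2) ^ 4 * (r * s)"
          using Cq(1) t rs False by (intro mult_right_mono divide_left_mono power_mono) auto
        finally have "\<bar>image_quad t 2 r s\<bar> \<le> 16 * Cq * t ^ N * (r * s)" by (simp add: power_divide)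
        then have "\<bar>interval_kernel t r s - half_line_kernel t r s\<bar> \<le> 16 * Cq * t ^ N * (r * s) + Ct * t ^ N * (r * s)"
          using tail lt rs by simp
        then have k: "\<bar>interval_kernel t r s - half_line_kernel t r s\<bar> \<le> (16 * Cq + Ct) * t ^ N * (r * s)"
          by (simp add: algebra_simps)
        have f: "\<bar>profile p r\<bar> \<le> r powr (- p)" "\<bar>profile q s\<bar> \<le> s powr (- q)"
          using profile_bounds(1)[OF pq(1), of r] profile_bounds(1)[OF pq(2), of s] lt rs by auto
        have "\<bar>?e\<bar> \<le> ((16 * Cq + Ct) * t ^ N * (r * s)) * (r powr (- p) * s powr (- q))"
          unfolding e abs_mult using Ct(1) Cq(1) t rs by (intro mult_mono k f) auto
        also have "\<dots> = (16 * Cq + Ct) * t ^ N * (decay_weight p r * decay_weight q s)"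
        proof -
          have "x powr 1 * x powr (- c) = x powr (1 - c)" for x c :: real unfolding powr_add[symmetric] by simp
          then have "r powr (1 - p) = r * r powr (- p)" "s powr (1 - q) = s * s powr (- q)" using rs by (metis powr_one less_imp_le)+
          then show ?thesis unfolding vv by simp
        qed
        finally show ?thesis by (rule up) (use D E C0 t in auto)
      qed
    next
      case ge: False
      have sq: "square_term t p q (r, s) = 0" "corner_term t p q (r, s) = 0"
        using ge by (auto simp: square_term_def corner_term_def indicator_def)
      have qd: "quadrant_term t p q (r, s) = half_line_kernel t r s * profile p r * profile q s"
        using rs by (simp add: quadrant_term_def)
      show ?thesis
      proof (cases "\<bar>r - s\<bar> < 1 / 2")
        case True
        have "1 \<le> r \<or> 1 \<le> s" using ge by auto
        moreover have "r - s < 1 / 2" "s - r < 1 / 2" using True by (simp_all only: abs_less_iff minus_diff_eq)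
        ultimately have h: "1 / 2 \<le> r" "1 / 2 \<le> s" by linarith+
        have dt: "diagonal_term t p q (r, s) = gauss1 t (r - s) * profile p r * profile q s"
          using True ge by (auto simp: diagonal_term_def indicator_def not_less)
        \<comment> \<open>The direct Gaussian cancels against \<open>diagonal_term\<close>, leaving
          the reflected one, whose distance r + s is bounded below.\<close>
        have e: "?e = gauss1 t (r + s) * (profile p r * profile q s)"
          unfolding sq qd dt half_line_kernel_def by (simp add: algebra_simps)
        have "r\<^sup>2 * s\<^sup>2 \<le> (r + s)\<^sup>2 * (r + s)\<^sup>2" using rs by (intro mult_mono power_mono) auto
        then have "r\<^sup>2 * s\<^sup>2 \<le> (r + s) ^ 4" by (simp add: power2_eq_square eval_nat_numeral mult.assoc)
        then have "Cg * t ^ N / (r + s) ^ 4 \<le> Cg * t ^ N / (r\<^sup>2 * s\<^sup>2)"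
          using Cg(1) t rs by (intro divide_left_mono) auto
        moreover have "gauss1 t (r + s) \<le> Cg * t ^ N / (r + s) ^ 4" using Cg(2)[OF t, of "r + s"] h by simp
        ultimately have g: "\<bar>gauss1 t (r + s)\<bar> \<le> Cg * t ^ N / (r\<^sup>2 * s\<^sup>2)" using t by simp
        have "\<bar>?e\<bar> \<le> Cg * t ^ N / (r\<^sup>2 * s\<^sup>2) * (\<bar>profile p r\<bar> * \<bar>profile q s\<bar>)"
          unfolding e abs_mult[of _ "profile p r * _"] abs_mult[of "profile p r"] by (intro mult_right_mono g) auto
        also have "\<dots> = Cg * t ^ N * ((\<bar>profile p r\<bar> / r\<^sup>2) * (\<bar>profile q s\<bar> / s\<^sup>2))" by simp
        also have "\<dots> \<le> Cg * t ^ N * ((8 * decay_weight p r) * (8 * decay_weight q s))"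
          using Cg(1) t decay_weight_nonneg by (intro mult_left_mono mult_mono profile_decay pq h) auto
        also have "\<dots> = 64 * Cg * t ^ N * (decay_weight p r * decay_weight q s)" by simp
        finally show ?thesis by (rule up) (use D E C0 t in auto)
      next
        case False
        have dt: "diagonal_term t p q (r, s) = 0" using False by (simp add: diagonal_term_def)
        have e: "\<bar>?e\<bar> = \<bar>half_line_kernel t r s * profile p r * profile q s\<bar>" unfolding sq qd dt by simp
        show ?thesis
        proof (cases "s \<le> r")
          case True
          have "\<bar>?e\<bar> \<le> C1 * t ^ N * (decay_weight p r * decay_weight q s + strip_weight (p + q) s r)"
            unfolding e using C1(2)[OF t] rs True False ge by auto
          then show ?thesis by (rule up) (use D E C0 t in auto)
        next
          case sr: False
          have c: "half_line_kernel t r s * profile p r * profile q s = half_line_kernel t s r * profile q s * profile p r"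
            using half_line_kernel_commute[of t r s] by simp
          have "\<bar>?e\<bar> \<le> C2 * t ^ N * (decay_weight q s * decay_weight p r + strip_weight (q + p) r s)"
            unfolding e c by (rule C2(2)[OF t]) (use rs sr False ge in auto)
          then show ?thesis by (rule up) (use D E C0 t in auto)
        qed
      qed
    qed
  qed
  then have "\<bar>square_term t p q z - quadrant_term t p q z + (corner_term t p q z + diagonal_term t p q z)\<bar> \<le> D * t ^ N * error_weight p q z"
    if "0 < t" "t \<le> 1" for t z using that by (cases z) auto
  then show thesis using that D(1) by blast
qed

definition main_terms :: "real \<Rightarrow> real \<Rightarrow> real \<Rightarrow> real" where
  "main_terms t p q = c_coeff p q * t powr ((1 - p - q) / 2)
     - (c_coeff (p - 1) q + c_coeff p (q - 1)) * t powr ((2 - p - q) / 2)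
     + c_coeff (p - 1) (q - 1) * t powr ((3 - p - q) / 2)"

text \<open>Expanding (1 - r)(1 - s) gives four power moments with signs +, -, -, +, each known
  exactly. The most demanding at infinity has exponents p - 1 and q - 1, and their sum exceeds 1
  because p + q > 3.\<close>

lemma quadrant_term_integral:
  assumes t: "0 < t" and pq: "p < 2" "q < 2" "3 < p + q"
  shows "has_bochner_integral lborel2 (quadrant_term t p q) (main_terms t p q)"
proof -
  define H where "H a b z = indicat_real ({0<..} \<times> {0<..}) z * (half_line_kernel t (fst z) (snd z) * fst z powr (- a) * snd z powr (- b))" for a b and z :: "real \<times> real"
  have m: "has_bochner_integral lborel2 (H a b) (c_coeff a b * t powr ((1 - a - b) / 2))"
    if "a < 2" "b < 2" "1 < a + b" "a + b < 4" "a + b \<noteq> 2" for a b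
    unfolding H_def[abs_def] using half_line_moment[OF t that] .
  have "has_bochner_integral lborel2 (\<lambda>z. H p q z - (H (p - 1) q z + H p (q - 1) z) + H (p - 1) (q - 1) z)
    (c_coeff p q * t powr ((1 - p - q) / 2) - (c_coeff (p - 1) q * t powr ((1 - (p - 1) - q) / 2) + c_coeff p (q - 1) * t powr ((1 - p - (q - 1)) / 2))
      + c_coeff (p - 1) (q - 1) * t powr ((1 - (p - 1) - (q - 1)) / 2))"
    using pq by (intro has_bochner_integral_add has_bochner_integral_diff m) auto
  moreover have "H p q z - (H (p - 1) q z + H p (q - 1) z) + H (p - 1) (q - 1) z = quadrant_term t p q z" for z
  proof (cases "0 < fst z \<and> 0 < snd z")
    case True
    obtain r s where z: "z = (r, s)" by force
    have e: "x powr (- (c - 1)) = x * x powr (- c)" if "0 < x" for x c :: real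
    proof -
      have "x powr (- (c - 1)) = x powr 1 * x powr (- c)" unfolding powr_add[symmetric] by simp
      then show ?thesis using that by simp
    qed
    show ?thesis using True unfolding z
      by (simp add: H_def quadrant_term_def profile_def e del: minus_diff_eq) (simp add: algebra_simps)
  next
    case False
    then show ?thesis by (cases z) (auto simp: H_def quadrant_term_def indicator_def)
  qed
  ultimately show ?thesis by (simp add: main_terms_def algebra_simps)
qed

lemma square_term_integral:
  assumes t: "0 < t" "t \<le> 1" and pq: "p < 2" "q < 2"
  shows "has_bochner_integral lborel2 (square_term t p q) (interval_content t p q)"
proof -
  obtain C where C: "C \<ge> 0" "\<And>r s. 0 \<le> r \<Longrightarrow> r \<le> 1 \<Longrightarrow> 0 \<le> s \<Longrightarrow> s \<le> 1 \<Longrightarrow> \<bar>interval_kernel t r s\<bar> \<le> C * (r * s)"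
    using interval_kernel_bound[OF t] by metis
  have m: "square_term t p q \<in> borel_measurable lborel2"
    unfolding square_term_def split_beta prod.collapse by measurable
  have i: "integrable lborel2 (square_term t p q)"
  proof (rule Bochner_Integration.integrable_bound)
    show "integrable lborel2 (\<lambda>z. C * (decay_weight p (fst z) * decay_weight q (snd z)))"
      using decay_weight_integrable2[OF pq] by (rule integrable_mult_right)
    show "AE z in lborel2. norm (square_term t p q z) \<le> norm (C * (decay_weight p (fst z) * decay_weight q (snd z)))"
    proof (rule AE_I2)
      fix z :: "real \<times> real"
      obtain r s where z: "z = (r, s)" by force
      have "norm (square_term t p q z) \<le> C * (decay_weight p (fst z) * decay_weight q (snd z))"
      proof (cases "r \<in> {0<..<1} \<and> s \<in> {0<..<1}")
        case True
        have e: "x powr (1 - c) = x * x powr (- c)" if "0 < x" for x c :: real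
        proof -
          have "x powr (1 - c) = x powr 1 * x powr (- c)" unfolding powr_add[symmetric] by simp
          then show ?thesis using that by simp
        qed
        have f: "\<bar>profile c x\<bar> \<le> x powr (- c)" if "x \<in> {0<..<1}" for x c :: real
          using that by (simp add: profile_def abs_mult mult_left_le_one_le)
        have "\<bar>interval_kernel t r s * profile p r * profile q s\<bar> \<le> C * (r * s) * r powr (- p) * s powr (- q)"
          unfolding abs_mult using C True by (intro mult_mono f) auto
        also have "\<dots> = C * (decay_weight p r * decay_weight q s)"
          using True by (simp add: decay_weight_def e)
        finally show ?thesis using True by (simp add: z square_term_def)
      next
        case False
        then have "square_term t p q z = 0" by (auto simp: z square_term_def)
        then show ?thesis using C decay_weight_nonneg by simp
      qed
      then show "norm (square_term t p q z) \<le> norm (C * (decay_weight p (fst z) * decay_weight q (snd z)))"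
        by (rule order_trans) simp
    qed
  qed (rule m)
  have "(LINT z|lborel2. square_term t p q z) = (LINT r|lborel. LINT s|lborel. square_term t p q (r, s))"
    by (rule lborel_pair.integral_fst'[OF i, symmetric])
  also have "\<dots> = interval_content t p q"
    unfolding interval_content_def set_lebesgue_integral_def
  proof (rule Bochner_Integration.integral_cong[OF refl])
    fix r :: real
    have "(LINT s|lborel. square_term t p q (r, s)) = (LINT s|lborel. (indicat_real {0<..<1} r * profile p r) * (indicat_real {0<..<1} s *\<^sub>R (interval_kernel t r s * profile q s)))"
      by (rule Bochner_Integration.integral_cong) (auto simp: square_term_def indicator_def)
    then show "(LINT s|lborel. square_term t p q (r, s)) = indicat_real {0<..<1} r *\<^sub>R (profile p r * (LINT s|lborel. indicat_real {0<..<1} s *\<^sub>R (interval_kernel t r s * profile q s)))"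
      by simp
  qed
  finally show ?thesis using i by (simp add: has_bochner_integral_iff)
qed

lemma corner_diagonal_measurable:
  "corner_term t p q \<in> borel_measurable lborel2" "diagonal_term t p q \<in> borel_measurable lborel2"
  unfolding corner_term_def diagonal_term_def split_beta prod.collapse gauss1_def by measurable

text \<open>Integrability of the layer terms is not estimated directly: they equal the pointwise
  remainder minus the square term plus the quadrant term, and these three are integrable.\<close>

lemma interval_content_remainder:
  assumes pq: "p < 2" "q < 2" "3 < p + q"
  obtains C where "C \<ge> 0"
    "\<And>t. 0 < t \<Longrightarrow> t \<le> 1 \<Longrightarrow> integrable lborel2 (\<lambda>z. corner_term t p q z + diagonal_term t p q z)"
    "\<And>t. 0 < t \<Longrightarrow> t \<le> 1 \<Longrightarrow>
      \<bar>interval_content t p q - main_terms t p q + (LINT z|lborel2. corner_term t p q z + diagonal_term t p q z)\<bar> \<le> C * t ^ N"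
proof -
  have pq1: "1 < p" "1 < q" using pq by auto
  obtain C where C: "C \<ge> 0" "\<And>t z. 0 < t \<Longrightarrow> t \<le> 1 \<Longrightarrow>
    \<bar>square_term t p q z - quadrant_term t p q z + (corner_term t p q z + diagonal_term t p q z)\<bar> \<le> C * t ^ N * error_weight p q z"
    using pointwise_remainder[OF pq1, of N] by metis
  have iE: "integrable lborel2 (error_weight p q)"
    unfolding error_weight_def[abs_def]
    using decay_weight_integrable2[OF pq(1,2)] strip_weight_integrable2[OF pq(3)] by auto
  define I where "I = (LINT z|lborel2. error_weight p q z)"
  have I0: "0 \<le> I" unfolding I_def
    by (intro integral_nonneg_AE AE_I2) (simp add: error_weight_def decay_weight_nonneg strip_weight_nonneg)
  have *: "integrable lborel2 (\<lambda>z. corner_term t p q z + diagonal_term t p q z) \<and>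
      \<bar>interval_content t p q - main_terms t p q + (LINT z|lborel2. corner_term t p q z + diagonal_term t p q z)\<bar> \<le> C * I * t ^ N"
    if t: "0 < t" "t \<le> 1" for t
  proof -
    define e where "e z = square_term t p q z - quadrant_term t p q z + (corner_term t p q z + diagonal_term t p q z)" for z
    note sq = square_term_integral[OF t pq(1,2)] and qd = quadrant_term_integral[OF t(1) pq]
    have em: "e \<in> borel_measurable lborel2"
      unfolding e_def using sq qd corner_diagonal_measurable by (auto simp: has_bochner_integral_iff)
    have iB: "integrable lborel2 (\<lambda>z. C * t ^ N * error_weight p q z)" using iE by simp
    have ie: "integrable lborel2 e"
      by (rule Bochner_Integration.integrable_bound[OF iB em]) (use C(2)[OF t] in \<open>auto simp: e_def intro!: AE_I2 order_trans[OF _ abs_ge_self]\<close>)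
    have eq: "corner_term t p q z + diagonal_term t p q z = e z - square_term t p q z + quadrant_term t p q z" for z
      by (simp add: e_def)
    have i: "integrable lborel2 (\<lambda>z. corner_term t p q z + diagonal_term t p q z)"
      unfolding eq using ie sq qd by (auto simp: has_bochner_integral_iff)
    have "interval_content t p q - main_terms t p q + (LINT z|lborel2. corner_term t p q z + diagonal_term t p q z) = (LINT z|lborel2. e z)"
      unfolding eq using ie sq qd by (simp add: has_bochner_integral_iff)
    also have "\<bar>\<dots>\<bar> \<le> (LINT z|lborel2. C * t ^ N * error_weight p q z)"
      by (rule order_trans[OF integral_abs_bound integral_mono[OF integrable_abs[OF ie] iB]]) (use C(2)[OF t] in \<open>simp add: e_def\<close>)
    also have "\<dots> = C * I * t ^ N" by (simp add: I_def)
    finally show ?thesis using i by simp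
  qed
  then show thesis using that[of "C * I"] C(1) I0 by simp
qed

section \<open>The boundary layer as a Gaussian average\<close>

text \<open>For each fixed first coordinate the map is a translation or a reflection, so invariance
  follows by integrating over the second coordinate first.\<close>

lemma shear_distr:
  fixes a b c :: real
  assumes c: "\<bar>c\<bar> = 1"
  shows "distr lborel2 lborel2 (\<lambda>z. (fst z, a * fst z + b + c * snd z)) = lborel2"
proof (rule measure_eqI)
  have m: "(\<lambda>z. (fst z, a * fst z + b + c * snd z)) \<in> lborel2 \<rightarrow>\<^sub>M lborel2" by measurable
  fix A assume "A \<in> sets (distr lborel2 lborel2 (\<lambda>z. (fst z, a * fst z + b + c * snd z)))"
  then have A: "A \<in> sets lborel2" by simp
  have ind: "(\<lambda>z. indicator A z :: ennreal) \<in> borel_measurable lborel2" using A by simp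
  have "emeasure (distr lborel2 lborel2 (\<lambda>z. (fst z, a * fst z + b + c * snd z))) A =
    (\<integral>\<^sup>+ z. indicator A z \<partial>distr lborel2 lborel2 (\<lambda>z. (fst z, a * fst z + b + c * snd z)))"
    using A by simp
  also have "\<dots> = (\<integral>\<^sup>+ z. indicator A (fst z, a * fst z + b + c * snd z) \<partial>lborel2)"
    by (rule nn_integral_distr[OF m]) (use ind in simp)
  also have "\<dots> = (\<integral>\<^sup>+ r. (\<integral>\<^sup>+ z. indicator A (fst (r, z), a * fst (r, z) + b + c * snd (r, z)) \<partial>lborel) \<partial>lborel)"
    by (rule lborel.nn_integral_fst[symmetric]) (rule measurable_compose[OF m ind])
  also have "\<dots> = (\<integral>\<^sup>+ r. (\<integral>\<^sup>+ s. indicator A (r, s) \<partial>lborel) \<partial>lborel)"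
  proof (rule nn_integral_cong)
    fix r :: real
    have sec: "(\<lambda>s. indicator A (r, s) :: ennreal) \<in> borel_measurable borel"
      using measurable_compose[OF measurable_Pair1'[of r lborel lborel] ind] by simp
    have "(\<integral>\<^sup>+ s. indicator A (r, s) \<partial>lborel) = ennreal \<bar>c\<bar> * (\<integral>\<^sup>+ z. indicator A (r, (a * r + b) + c * z) \<partial>lborel)"
      by (rule nn_integral_real_affine[OF sec]) (use c in auto)
    then show "(\<integral>\<^sup>+ z. indicator A (fst (r, z), a * fst (r, z) + b + c * snd (r, z)) \<partial>lborel) = (\<integral>\<^sup>+ s. indicator A (r, s) \<partial>lborel)"
      using c by simp
  qed
  also have "\<dots> = (\<integral>\<^sup>+ z. indicator A z \<partial>lborel2)"
    by (rule lborel.nn_integral_fst[OF ind])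
  finally show "emeasure (distr lborel2 lborel2 (\<lambda>z. (fst z, a * fst z + b + c * snd z))) A = emeasure lborel2 A"
    using A by simp
qed simp

text \<open>The new coordinate z is the distance on which the Gaussian depends; it factors out, and
  only the integral of the profiles along the line of constant z remains.\<close>

lemma shear_integral:
  fixes F :: "real \<times> real \<Rightarrow> real"
  assumes F: "integrable lborel2 F" and c: "\<bar>c\<bar> = 1"
    and eq: "\<And>r z. F (r, a * r + b + c * z) = indicator Z z * (G z * H r z)"
  shows "has_bochner_integral lborel (\<lambda>z. indicator Z z * (G z * (LINT r|lborel. H r z))) (LINT w|lborel2. F w)"
proof -
  have m: "(\<lambda>z. (fst z, a * fst z + b + c * snd z)) \<in> lborel2 \<rightarrow>\<^sub>M lborel2" by measurable
  have Fm: "F \<in> borel_measurable lborel2" using F by auto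
  have "integrable (distr lborel2 lborel2 (\<lambda>z. (fst z, a * fst z + b + c * snd z))) F"
    unfolding shear_distr[OF c] by (rule F)
  then have i: "integrable lborel2 (\<lambda>(r, z). indicator Z z * (G z * H r z))"
    by (subst (asm) integrable_distr_eq[OF m Fm]) (simp add: split_beta' eq)
  have I: "(LINT w|lborel2. F w) = (LINT w|lborel2. (\<lambda>(r, z). indicator Z z * (G z * H r z)) w)"
  proof -
    have "(LINT w|lborel2. F w) = (LINT w|distr lborel2 lborel2 (\<lambda>z. (fst z, a * fst z + b + c * snd z)). F w)"
      unfolding shear_distr[OF c] ..
    also have "\<dots> = (LINT w|lborel2. F (fst w, a * fst w + b + c * snd w))"
      by (rule integral_distr[OF m Fm])
    finally show ?thesis by (simp add: split_beta' eq)
  qed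
  have "integrable lborel (\<lambda>z. LINT r|lborel. indicator Z z * (G z * H r z))"
    by (rule lborel_pair.integrable_snd[OF i])
  moreover have "(LINT z|lborel. LINT r|lborel. indicator Z z * (G z * H r z)) = (LINT w|lborel2. F w)"
    unfolding I by (rule lborel_pair.integral_snd[OF i])
  ultimately show ?thesis by (simp add: has_bochner_integral_iff)
qed

text \<open>The profiles integrated along the segment r + s = 2 - z of the corner;
  \<open>corr_profile\<close> is the analogue for the part r \<ge> 1 of the line r - s = z.\<close>

definition conv_profile :: "real \<Rightarrow> real \<Rightarrow> real \<Rightarrow> real" where
  "conv_profile p q z = (LINT r|lborel. indicator {1 - z<..<1} r * (profile p r * profile q (2 - r - z)))"

definition corr_profile :: "real \<Rightarrow> real \<Rightarrow> real \<Rightarrow> real" where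
  "corr_profile p q z = (LINT r|lborel. indicator {1..} r * (profile p r * profile q (r - z)))"

text \<open>One side of the diagonal strip; the other is obtained by exchanging the profiles and the
  coordinates. The set Z of values r - s is a parameter so that the diagonal itself is counted on
  one side only.\<close>

definition diagonal_half :: "real set \<Rightarrow> real \<Rightarrow> real \<Rightarrow> real \<Rightarrow> real \<times> real \<Rightarrow> real" where
  "diagonal_half Z t p q z = (case z of (r, s) \<Rightarrow>
     indicator {z. 1 \<le> fst z \<and> fst z - snd z \<in> Z} (r, s) * (gauss1 t (r - s) * profile p r * profile q s))"

lemma has_bochner_integral_remove_0:
  fixes f :: "real \<Rightarrow> real"
  assumes "has_bochner_integral lborel (\<lambda>z. indicator {0..<a} z * f z) I"
  shows "has_bochner_integral lborel (\<lambda>z. indicator {0<..<a} z * f z) I"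
proof -
  have e: "indicator {0<..<a} z * f z = indicator (- {0}) z * (indicator {0..<a} z * f z)" for z
    by (auto simp: indicator_def)
  have i: "integrable lborel (\<lambda>z. indicator {0<..<a} z * f z)"
    unfolding e using assms integrable_mult_indicator[of "- {0}" lborel "\<lambda>z. indicator {0..<a} z * f z"]
    by (simp add: has_bochner_integral_iff)
  have "AE z in lborel. indicator {0..<a} z * f z = indicator {0<..<a} z * f z"
    by (rule AE_mp[OF AE_lborel_singleton[of 0]]) (auto simp: indicator_def)
  then have "(LINT z|lborel. indicator {0..<a} z * f z) = (LINT z|lborel. indicator {0<..<a} z * f z)"
    using assms i by (intro integral_cong_AE) (auto simp: has_bochner_integral_iff)
  then show ?thesis using assms i by (simp add: has_bochner_integral_iff)
qed

text \<open>The corner and the two sides of the diagonal are disjoint, so each inherits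
  integrability from the sum by restriction and can be sheared onto its own distance z.\<close>

lemma boundary_layer_integral:
  assumes i: "integrable lborel2 (\<lambda>z. corner_term t p q z + diagonal_term t p q z)"
  shows "has_bochner_integral lborel (\<lambda>z. indicator {0<..<1 / 2} z * (gauss1 t z * (conv_profile p q z + corr_profile p q z + corr_profile q p z)))
    (LINT z|lborel2. corner_term t p q z + diagonal_term t p q z)"
proof -
  define T :: "(real \<times> real) set" where "T = {z. 0 < fst z \<and> fst z < 1 \<and> 0 < snd z \<and> snd z < 1 \<and> 3 / 2 < fst z + snd z}"
  define D1 :: "(real \<times> real) set" where "D1 = {z. 1 \<le> fst z \<and> fst z - snd z \<in> {0..<1 / 2}}"
  define D2 :: "(real \<times> real) set" where "D2 = {z. 1 \<le> snd z \<and> snd z - fst z \<in> {0<..<1 / 2}}"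
  have s2: "sets lborel2 = sets (borel :: (real \<times> real) measure)"
    by (simp add: borel_prod[symmetric] cong: sets_pair_measure_cong)
  have cl: "{z. f z \<le> g z} \<in> sets lborel2" if "continuous_on UNIV f" "continuous_on UNIV g" for f g :: "real \<times> real \<Rightarrow> real"
    unfolding s2 by (intro borel_closed closed_Collect_le that)
  have op: "{z. f z < g z} \<in> sets lborel2" if "continuous_on UNIV f" "continuous_on UNIV g" for f g :: "real \<times> real \<Rightarrow> real"
    unfolding s2 by (intro borel_open open_Collect_less that)
  have sets: "T \<in> sets lborel2" "D1 \<in> sets lborel2" "D2 \<in> sets lborel2"
    unfolding T_def D1_def D2_def greaterThanLessThan_iff atLeastLessThan_iff Collect_conj_eq
    by (intro sets.Int cl op continuous_intros)+
  define h where "h z = corner_term t p q z + diagonal_term t p q z" for z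
  have ih: "integrable lborel2 h" using i by (simp add: h_def[abs_def])
  have restrict: "integrable lborel2 (\<lambda>z. indicator A z *\<^sub>R h z)" if "A \<in> sets lborel2" for A
    using ih that by (rule integrable_mult_indicator[rotated])
  have eT: "indicator T z *\<^sub>R h z = corner_term t p q z" for z
    by (cases z) (auto simp: h_def T_def corner_term_def diagonal_term_def indicator_def)
  have e1: "indicator D1 z *\<^sub>R h z = diagonal_half {0..<1 / 2} t p q z" for z
    by (cases z) (auto simp: h_def D1_def corner_term_def diagonal_term_def diagonal_half_def indicator_def)
  have e2: "indicator D2 z *\<^sub>R h z = diagonal_half {0<..<1 / 2} t q p (snd z, fst z)" for z
  proof -
    obtain r s where z: "z = (r, s)" by force
    have "gauss1 t (s - r) = gauss1 t (r - s)" using gauss1_minus[of t "r - s"] by simp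
    then show ?thesis
      unfolding z by (auto simp: h_def D2_def corner_term_def diagonal_term_def diagonal_half_def indicator_def)
  qed
  have sum: "h z = corner_term t p q z + (diagonal_half {0..<1 / 2} t p q z + diagonal_half {0<..<1 / 2} t q p (snd z, fst z))" for z
  proof -
    have "h z = indicator T z *\<^sub>R h z + (indicator D1 z *\<^sub>R h z + indicator D2 z *\<^sub>R h z)"
      by (cases z) (auto simp: h_def T_def D1_def D2_def corner_term_def diagonal_term_def indicator_def abs_less_iff)
    then show ?thesis unfolding eT e1 e2 .
  qed
  note iT = restrict[OF sets(1), unfolded eT] and i1 = restrict[OF sets(2), unfolded e1] and i2 = restrict[OF sets(3), unfolded e2]
  have i2': "integrable lborel2 (diagonal_half {0<..<1 / 2} t q p)"
    using lborel_pair.integrable_product_swap[OF i2] by (simp add: split_beta')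
  have I2: "(LINT z|lborel2. diagonal_half {0<..<1 / 2} t q p (snd z, fst z)) = (LINT z|lborel2. diagonal_half {0<..<1 / 2} t q p z)"
    using lborel_pair.integral_product_swap[of "diagonal_half {0<..<1 / 2} t q p"] i2' by (simp add: split_beta')
  have cT: "corner_term t p q (r, - 1 * r + 2 + - 1 * z) = indicator {0<..<1 / 2} z * (gauss1 t z * (indicator {1 - z<..<1} r * (profile p r * profile q (2 - r - z))))" for r z
  proof -
    have "2 - r - (- 1 * r + 2 + - 1 * z) = z" by simp
    moreover have "- 1 * r + 2 + - 1 * z = 2 - r - z" by simp
    moreover have "indicat_real {z. 0 < fst z \<and> fst z < 1 \<and> 0 < snd z \<and> snd z < 1 \<and> 3 / 2 < fst z + snd z} (r, 2 - r - z) = indicator {0<..<1 / 2} z * indicator {1 - z<..<1} r"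
      by (auto simp: indicator_def)
    ultimately show ?thesis unfolding corner_term_def prod.case by (simp only: mult_ac)
  qed
  have cD: "diagonal_half Z t p' q' (r, 1 * r + 0 + - 1 * z) = indicator Z z * (gauss1 t z * (indicator {1..} r * (profile p' r * profile q' (r - z))))" for r z Z p' q'
    by (auto simp: diagonal_half_def indicator_def)
  have hT: "has_bochner_integral lborel (\<lambda>z. indicator {0<..<1 / 2} z * (gauss1 t z * conv_profile p q z)) (LINT z|lborel2. corner_term t p q z)"
    unfolding conv_profile_def by (rule shear_integral[OF iT _ cT]) simp
  have h1: "has_bochner_integral lborel (\<lambda>z. indicator {0<..<1 / 2} z * (gauss1 t z * corr_profile p q z)) (LINT z|lborel2. diagonal_half {0..<1 / 2} t p q z)"
    unfolding corr_profile_def by (rule has_bochner_integral_remove_0, rule shear_integral[OF i1 _ cD]) simp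
  have h2: "has_bochner_integral lborel (\<lambda>z. indicator {0<..<1 / 2} z * (gauss1 t z * corr_profile q p z)) (LINT z|lborel2. diagonal_half {0<..<1 / 2} t q p z)"
    unfolding corr_profile_def by (rule shear_integral[OF i2' _ cD]) simp
  have "(LINT z|lborel2. h z) = (LINT z|lborel2. corner_term t p q z) + ((LINT z|lborel2. diagonal_half {0..<1 / 2} t p q z) + (LINT z|lborel2. diagonal_half {0<..<1 / 2} t q p z))"
    unfolding sum using iT i1 i2 I2 by simp
  moreover have "indicator {0<..<1 / 2} z * (gauss1 t z * (conv_profile p q z + corr_profile p q z + corr_profile q p z)) =
     indicator {0<..<1 / 2} z * (gauss1 t z * conv_profile p q z) + (indicator {0<..<1 / 2} z * (gauss1 t z * corr_profile p q z) + indicator {0<..<1 / 2} z * (gauss1 t z * corr_profile q p z))" for z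
    by (simp add: algebra_simps)
  ultimately show ?thesis
    using has_bochner_integral_add[OF hT has_bochner_integral_add[OF h1 h2]] by (simp add: h_def)
qed

section \<open>Taylor expansion of the layer profiles\<close>

text \<open>For z \<le> 1/2 every tail term is at most (2 z)^N times the corresponding term of the
  majorant series at 1/2. The majorant E is separate from c so that coefficients depending on a
  parameter share one constant.\<close>

lemma power_series_remainder:
  fixes c E :: "nat \<Rightarrow> real"
  assumes cE: "\<And>n. \<bar>c n\<bar> \<le> E n" and E: "summable (\<lambda>n. E n * (1 / 2) ^ n)" and z: "0 \<le> z" "z \<le> 1 / 2"
  shows "\<bar>(\<Sum>n. c n * z ^ n) - (\<Sum>n<N. c n * z ^ n)\<bar> \<le> 2 ^ N * (\<Sum>n. E n * (1 / 2) ^ n) * z ^ N"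
proof -
  have E0: "0 \<le> E n" for n using cE[of n] by linarith
  have le: "\<bar>c n * z ^ n\<bar> \<le> E n * (1 / 2) ^ n" for n
    unfolding abs_mult using cE z E0 by (intro mult_mono) (auto simp: power_abs intro!: power_mono)
  have s: "summable (\<lambda>n. c n * z ^ n)"
    by (rule summable_comparison_test'[OF E]) (use le in auto)
  have sE: "summable (\<lambda>n. E (n + N) * (1 / 2) ^ (n + N))"
    using summable_ignore_initial_segment[OF E] .
  have tail: "\<bar>c (n + N) * z ^ (n + N)\<bar> \<le> 2 ^ N * z ^ N * (E (n + N) * (1 / 2) ^ (n + N))" for n
  proof -
    have "\<bar>c (n + N) * z ^ (n + N)\<bar> = \<bar>c (n + N)\<bar> * z ^ n * z ^ N"
      using z by (simp add: abs_mult power_add)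
    also have "\<dots> \<le> E (n + N) * (1 / 2) ^ n * z ^ N"
      using cE E0 z by (intro mult_right_mono mult_mono power_mono) auto
    also have "\<dots> = 2 ^ N * z ^ N * (E (n + N) * (1 / 2) ^ (n + N))"
      by (simp add: power_add power_divide)
    finally show ?thesis .
  qed
  have "(\<Sum>n. c n * z ^ n) - (\<Sum>n<N. c n * z ^ n) = (\<Sum>n. c (n + N) * z ^ (n + N))"
    using suminf_split_initial_segment[OF s, of N] by simp
  also have "\<bar>\<dots>\<bar> \<le> (\<Sum>n. 2 ^ N * z ^ N * (E (n + N) * (1 / 2) ^ (n + N)))"
  proof -
    have sa: "summable (\<lambda>n. \<bar>c (n + N) * z ^ (n + N)\<bar>)"
      by (rule summable_comparison_test'[OF summable_mult[OF sE, of "2 ^ N * z ^ N"]]) (use tail in auto)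
    have "\<bar>\<Sum>n. c (n + N) * z ^ (n + N)\<bar> \<le> (\<Sum>n. \<bar>c (n + N) * z ^ (n + N)\<bar>)"
      by (rule summable_rabs[OF sa])
    also have "\<dots> \<le> (\<Sum>n. 2 ^ N * z ^ N * (E (n + N) * (1 / 2) ^ (n + N)))"
      by (rule suminf_le[OF tail sa summable_mult[OF sE]])
    finally show ?thesis .
  qed
  also have "\<dots> = 2 ^ N * z ^ N * (\<Sum>n. E (n + N) * (1 / 2) ^ (n + N))"
    by (rule suminf_mult[OF sE])
  also have "\<dots> \<le> 2 ^ N * z ^ N * (\<Sum>n. E n * (1 / 2) ^ n)"
  proof (rule mult_left_mono)
    show "(\<Sum>n. E (n + N) * (1 / 2) ^ (n + N)) \<le> (\<Sum>n. E n * (1 / 2) ^ n)"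
      using suminf_split_initial_segment[OF E, of N] sum_nonneg[of "{..<N}" "\<lambda>n. E n * (1 / 2) ^ n"] E0 by simp
  qed (use z in simp)
  finally show ?thesis by (simp add: mult_ac)
qed

lemma gbinomial_abs_summable:
  fixes a x :: real
  assumes "\<bar>x\<bar> < 1"
  shows "summable (\<lambda>n. \<bar>a gchoose n\<bar> * \<bar>x\<bar> ^ n)"
proof -
  obtain y where y: "\<bar>x\<bar> < y" "y < 1" using assms dense by blast
  have "summable (\<lambda>n. (a gchoose n) * y ^ n)"
    using gen_binomial_real[of y a] y by (auto intro: sums_summable)
  then have "summable (\<lambda>n. norm ((a gchoose n) * x ^ n))"
    using y by (intro powser_insidea[of _ y]) auto
  then show ?thesis by (simp add: abs_mult power_abs)
qed

lemma binomial_remainder: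
  fixes a :: real
  obtains C where "C \<ge> 0" "\<And>w. 0 \<le> w \<Longrightarrow> w \<le> 1 / 2 \<Longrightarrow> \<bar>(1 - w) powr a - (\<Sum>n<N. (a gchoose n) * (- 1) ^ n * w ^ n)\<bar> \<le> C * w ^ N"
proof -
  define C where "C = 2 ^ N * (\<Sum>n. \<bar>a gchoose n\<bar> * (1 / 2) ^ n)"
  have s: "summable (\<lambda>n. \<bar>a gchoose n\<bar> * (1 / 2) ^ n)"
    using gbinomial_abs_summable[of "1 / 2" a] by simp
  have "\<bar>(1 - w) powr a - (\<Sum>n<N. (a gchoose n) * (- 1) ^ n * w ^ n)\<bar> \<le> C * w ^ N" if w: "0 \<le> w" "w \<le> 1 / 2" for w
  proof -
    have "(\<lambda>n. (a gchoose n) * (- w) ^ n) sums (1 + - w) powr a"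
      by (rule gen_binomial_real) (use w in auto)
    then have "(\<Sum>n. (a gchoose n) * (- 1) ^ n * w ^ n) = (1 - w) powr a"
      by (auto simp: sums_iff power_minus[of w] mult.assoc)
    then show ?thesis
      using power_series_remainder[of "\<lambda>n. (a gchoose n) * (- 1) ^ n" "\<lambda>n. \<bar>a gchoose n\<bar>", OF _ s w, of N]
      by (simp add: abs_mult power_abs C_def)
  qed
  moreover have "0 \<le> C" unfolding C_def by (intro mult_nonneg_nonneg suminf_nonneg s) auto
  ultimately show thesis using that by blast
qed

lemma powr_to_inf_integral:
  fixes e :: real
  assumes "e < - 1"
  shows "has_bochner_integral lborel (\<lambda>r. indicator {1..} r * r powr e) (- 1 / (e + 1))"
proof -
  have "((\<lambda>x. x powr e) has_integral - (1 powr (e + 1)) / (e + 1)) {1..}"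
    using has_integral_powr_to_inf[of e 1] assms by simp
  then have I: "(\<integral>\<^sup>+ x. ennreal (indicator {1..} x * x powr e) \<partial>lborel) = ennreal (- 1 / (e + 1))"
    using nn_integral_has_integral_lebesgue[of "{1..}" "\<lambda>x. x powr e"] by simp
  show ?thesis
    by (rule has_bochner_integral_nn_integral[OF _ _ _ I]) (use assms in \<open>auto simp: divide_nonpos_neg\<close>)
qed

lemma profile_moment:
  assumes "2 < p + e"
  shows "has_bochner_integral lborel (\<lambda>r. indicator {1..} r * (profile p r * r powr (- e))) (1 / (p + e - 1) - 1 / (p + e - 2))"
proof -
  have "has_bochner_integral lborel (\<lambda>r. indicator {1..} r * r powr (- p - e) - indicator {1..} r * r powr (1 - p - e))
     (- 1 / ((- p - e) + 1) - - 1 / ((1 - p - e) + 1))"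
    using assms by (intro has_bochner_integral_diff powr_to_inf_integral) auto
  moreover have "indicator {1..} r * r powr (- p - e) - indicator {1..} r * r powr (1 - p - e) = indicator {1..} r * (profile p r * r powr (- e))" for r :: real
  proof (cases "1 \<le> r")
    case True
    have "r powr (- p - e) = r powr (- p) * r powr (- e)" unfolding powr_add[symmetric] by simp
    moreover have "r powr (1 - p - e) = r powr 1 * r powr (- p) * r powr (- e)" unfolding powr_add[symmetric] by simp
    ultimately show ?thesis using True by (simp add: profile_def algebra_simps)
  qed simp
  moreover have "- 1 / ((- p - e) + 1) - - 1 / ((1 - p - e) + 1) = 1 / (p + e - 1) - 1 / (p + e - 2)"
    using assms by (simp add: divide_simps) (simp add: algebra_simps)
  ultimately show ?thesis by simp
qed

text \<open>With r - z = r (1 - z / r), the two powers in the shifted profile are expanded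
  binomially and each power of r is integrated by \<open>profile_moment\<close>.\<close>

definition corr_coeff :: "real \<Rightarrow> real \<Rightarrow> nat \<Rightarrow> real" where
  "corr_coeff p q j = (- 1) ^ j *
     (((- q) gchoose j) * (1 / (p + q + real j - 1) - 1 / (p + q + real j - 2))
      - ((1 - q) gchoose j) * (1 / (p + q + real j - 2) - 1 / (p + q + real j - 3)))"

text \<open>The ratio z / r is at most 1/2 for all r \<ge> 1, so one binomial remainder is uniform
  in r. It is integrated against r powr (2 - p - q), again by p + q > 3.\<close>

lemma corr_profile_expansion:
  assumes pq: "p < 2" "q < 2" "3 < p + q"
  obtains C where "C \<ge> 0" "\<And>z. 0 < z \<Longrightarrow> z < 1 / 2 \<Longrightarrow> \<bar>corr_profile p q z - (\<Sum>j<N. corr_coeff p q j * z ^ j)\<bar> \<le> C * z ^ N"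
proof -
  obtain C1 where C1: "C1 \<ge> 0" "\<And>w. 0 \<le> w \<Longrightarrow> w \<le> 1 / 2 \<Longrightarrow> \<bar>(1 - w) powr (- q) - (\<Sum>n<N. ((- q) gchoose n) * (- 1) ^ n * w ^ n)\<bar> \<le> C1 * w ^ N"
    using binomial_remainder[where N=N and a="- q"] by metis
  obtain C2 where C2: "C2 \<ge> 0" "\<And>w. 0 \<le> w \<Longrightarrow> w \<le> 1 / 2 \<Longrightarrow> \<bar>(1 - w) powr (1 - q) - (\<Sum>n<N. ((1 - q) gchoose n) * (- 1) ^ n * w ^ n)\<bar> \<le> C2 * w ^ N"
    using binomial_remainder[where N=N and a="1 - q"] by metis
  define g where "g j r = indicator {1..} r * (profile p r * r powr (- (q + real j)))" for j :: nat and r :: real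
  define g' where "g' j r = indicator {1..} r * (profile p r * r powr (- (q + real j - 1)))" for j :: nat and r :: real
  have gI: "has_bochner_integral lborel (g j) (1 / (p + q + real j - 1) - 1 / (p + q + real j - 2))" for j
    using profile_moment[of p "q + real j"] pq unfolding g_def[abs_def] by (simp add: add.assoc)
  have g'I: "has_bochner_integral lborel (g' j) (1 / (p + q + real j - 2) - 1 / (p + q + real j - 3))" for j
    using profile_moment[of p "q + real j - 1"] pq unfolding g'_def[abs_def] by (simp add: algebra_simps)
  define S where "S z r = (\<Sum>j<N. z ^ j * ((- 1) ^ j * (((- q) gchoose j) * g j r - ((1 - q) gchoose j) * g' j r)))" for z r
  have SI: "has_bochner_integral lborel (S z) (\<Sum>j<N. z ^ j * corr_coeff p q j)" for z
    unfolding S_def corr_coeff_def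
    by (intro has_bochner_integral_sum has_bochner_integral_mult_right has_bochner_integral_diff gI g'I)
  define w where "w r = indicator {1..} r * r powr (2 - (p + q))" for r :: real
  have wI: "has_bochner_integral lborel w (- 1 / ((2 - (p + q)) + 1))"
    unfolding w_def[abs_def] using pq by (intro powr_to_inf_integral) auto
  define I where "I = - 1 / ((2 - (p + q)) + 1)"
  have I0: "0 \<le> I" using pq by (simp add: I_def divide_nonpos_neg)
  have "\<bar>corr_profile p q z - (\<Sum>j<N. corr_coeff p q j * z ^ j)\<bar> \<le> ((C1 + C2) * I) * z ^ N" if z: "0 < z" "z < 1 / 2" for z
  proof -
    define F where "F r = indicator {1..} r * (profile p r * profile q (r - z))" for r
    have Fm: "F \<in> borel_measurable lborel" unfolding F_def by measurable
    have pt: "\<bar>F r - S z r\<bar> \<le> (C1 + C2) * z ^ N * w r" for r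
    proof (cases "1 \<le> r")
      case False
      then show ?thesis by (simp add: F_def S_def g_def g'_def w_def)
    next
      case True
      define v where "v = z / r"
      have r: "0 < r" using True by simp
      have v: "0 \<le> v" "v \<le> 1 / 2"
      proof -
        have "z \<le> 1 / 2 * r" using z True by simp
        then show "v \<le> 1 / 2" using r by (simp add: v_def divide_le_eq)
      qed (use z True in \<open>simp add: v_def\<close>)
      have rz: "r - z = r * (1 - v)" using r by (simp add: v_def right_diff_distrib)
      have rzp: "(r - z) powr e = r powr e * (1 - v) powr e" for e unfolding rz by (rule powr_mult)
      have rp: "r powr (- (e + real j)) * z ^ j = r powr (- e) * v ^ j" for e j
      proof -
        have "r powr (- (e + real j)) = r powr (- e) * r powr (- real j)" unfolding powr_add[symmetric] by simp
        also have "r powr (- real j) = 1 / r ^ j" using r by (simp add: powr_minus_divide powr_realpow)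
        finally show ?thesis by (simp add: v_def power_divide)
      qed
      define B where "B = (1 - v) powr (- q) - (\<Sum>n<N. ((- q) gchoose n) * (- 1) ^ n * v ^ n)"
      define B' where "B' = (1 - v) powr (1 - q) - (\<Sum>n<N. ((1 - q) gchoose n) * (- 1) ^ n * v ^ n)"
      have "profile q (r - z) = (r - z) powr (- q) - (r - z) * (r - z) powr (- q)"
        by (simp add: profile_def left_diff_distrib)
      also have "(r - z) * (r - z) powr (- q) = (r - z) powr (1 - q)"
      proof -
        have "(r - z) powr (1 - q) = (r - z) powr 1 * (r - z) powr (- q)" unfolding powr_add[symmetric] by simp
        then show ?thesis using z True by simp
      qed
      finally have F: "F r = profile p r * (r powr (- q) * (1 - v) powr (- q) - r powr (1 - q) * (1 - v) powr (1 - q))"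
        unfolding rzp using True by (simp add: F_def)
      have S: "S z r = profile p r * (r powr (- q) * (\<Sum>n<N. ((- q) gchoose n) * (- 1) ^ n * v ^ n) - r powr (1 - q) * (\<Sum>n<N. ((1 - q) gchoose n) * (- 1) ^ n * v ^ n))"
      proof -
        have "z ^ j * ((- 1) ^ j * (((- q) gchoose j) * g j r - ((1 - q) gchoose j) * g' j r)) =
          profile p r * (r powr (- q) * (((- q) gchoose j) * (- 1) ^ j * v ^ j) - r powr (1 - q) * (((1 - q) gchoose j) * (- 1) ^ j * v ^ j))" for j
        proof -
          have "g j r * z ^ j = profile p r * (r powr (- q) * v ^ j)" using rp[of q j] True by (simp add: g_def mult.assoc)
          moreover have "g' j r * z ^ j = profile p r * (r powr (1 - q) * v ^ j)"
            using rp[of "q - 1" j] True by (simp add: g'_def mult.assoc algebra_simps)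
          moreover have "z ^ j * ((- 1) ^ j * (((- q) gchoose j) * g j r - ((1 - q) gchoose j) * g' j r)) =
            (- 1) ^ j * (((- q) gchoose j) * (g j r * z ^ j) - ((1 - q) gchoose j) * (g' j r * z ^ j))" by (simp add: algebra_simps)
          ultimately show ?thesis by (simp add: algebra_simps)
        qed
        then show ?thesis unfolding S_def by (simp add: sum_distrib_left sum_subtractf right_diff_distrib)
      qed
      have "F r - S z r = profile p r * (r powr (- q) * B - r powr (1 - q) * B')"
        unfolding F S B_def B'_def by (simp add: algebra_simps)
      also have "\<bar>\<dots>\<bar> \<le> r powr (1 - p) * (r powr (1 - q) * (C1 * v ^ N) + r powr (1 - q) * (C2 * v ^ N))"
        unfolding abs_mult
      proof (rule mult_mono)
        have e: "r powr (1 - p) = r * r powr (- p)"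
        proof -
          have "r powr (1 - p) = r powr 1 * r powr (- p)" unfolding powr_add[symmetric] by simp
          then show ?thesis using r by simp
        qed
        show "\<bar>profile p r\<bar> \<le> r powr (1 - p)"
          unfolding e profile_def abs_mult using True by (intro mult_mono) auto
        have "\<bar>r powr (- q) * B\<bar> \<le> r powr (1 - q) * (C1 * v ^ N)"
          unfolding abs_mult B_def using C1 v True by (intro mult_mono C1(2)) (auto intro: powr_mono)
        moreover have "\<bar>r powr (1 - q) * B'\<bar> \<le> r powr (1 - q) * (C2 * v ^ N)"
          unfolding abs_mult B'_def using C2 v by (intro mult_mono C2(2)) auto
        ultimately show "\<bar>r powr (- q) * B - r powr (1 - q) * B'\<bar> \<le> r powr (1 - q) * (C1 * v ^ N) + r powr (1 - q) * (C2 * v ^ N)"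
          by linarith
      qed auto
      also have "\<dots> = (C1 + C2) * v ^ N * (r powr (1 - p) * r powr (1 - q))" by (simp add: algebra_simps)
      also have "r powr (1 - p) * r powr (1 - q) = w r"
      proof -
        have "1 - p + (1 - q) = 2 - (p + q)" by simp
        then show ?thesis unfolding powr_add[symmetric] using True by (simp only: w_def) simp
      qed
      also have "(C1 + C2) * v ^ N * w r \<le> (C1 + C2) * z ^ N * w r"
      proof -
        have "v \<le> z" using True z mult_left_mono[of 1 r z] by (simp add: v_def divide_le_eq)
        then show ?thesis using C1 C2 v z by (intro mult_right_mono mult_left_mono power_mono) (auto simp: w_def)
      qed
      finally show ?thesis .
    qed
    have iB: "integrable lborel (\<lambda>r. (C1 + C2) * z ^ N * w r)" using wI by (simp add: has_bochner_integral_iff)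
    have iD: "integrable lborel (\<lambda>r. F r - S z r)"
    proof (rule Bochner_Integration.integrable_bound[OF iB])
      show "(\<lambda>r. F r - S z r) \<in> borel_measurable lborel"
        using SI[of z] Fm by (intro borel_measurable_diff) (auto simp: has_bochner_integral_iff)
    qed (use pt in \<open>auto intro!: AE_I2 order_trans[OF _ abs_ge_self]\<close>)
    have iF: "integrable lborel F"
      using Bochner_Integration.integrable_add[OF iD, of "S z"] SI by (simp add: has_bochner_integral_iff)
    have "corr_profile p q z - (\<Sum>j<N. corr_coeff p q j * z ^ j) = (LINT r|lborel. F r - S z r)"
      using iF SI[of z] by (simp add: corr_profile_def F_def[symmetric] has_bochner_integral_iff mult.commute)
    also have "\<bar>\<dots>\<bar> \<le> (LINT r|lborel. (C1 + C2) * z ^ N * w r)"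
      by (rule order_trans[OF integral_abs_bound integral_mono[OF integrable_abs[OF iD] iB pt]])
    also have "\<dots> = ((C1 + C2) * I) * z ^ N" using wI by (simp add: has_bochner_integral_iff I_def)
    finally show ?thesis .
  qed
  then show thesis using that[of "(C1 + C2) * I"] C1(1) C2(1) I0 by simp
qed

text \<open>Coefficient of z^n in the product of (1 - z v) powr (-p) and (1 - z (1 - v)) powr
  (-q).\<close>

definition conv_poly :: "real \<Rightarrow> real \<Rightarrow> nat \<Rightarrow> real \<Rightarrow> real" where
  "conv_poly p q n v = (\<Sum>i\<le>n. (((- p) gchoose i) * (- v) ^ i) * (((- q) gchoose (n - i)) * (- (1 - v)) ^ (n - i)))"

text \<open>Substituting r = 1 - z v produces z^3, one factor each from 1 - r, 1 - s and dr; hence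
  the shift by three and the zeros below it.\<close>

definition conv_coeff :: "real \<Rightarrow> real \<Rightarrow> nat \<Rightarrow> real" where
  "conv_coeff p q j = (if j < 3 then 0 else LINT v:{0<..<1}|lborel. v * (1 - v) * conv_poly p q (j - 3) v)"

text \<open>The Cauchy product of the two binomial series has a majorant independent of v in [0,1],
  so the expansion can be integrated over v.\<close>

lemma conv_profile_expansion:
  obtains C where "C \<ge> 0" "\<And>z. 0 < z \<Longrightarrow> z < 1 / 2 \<Longrightarrow> \<bar>conv_profile p q z - (\<Sum>j<N. conv_coeff p q j * z ^ j)\<bar> \<le> C * z ^ N"
proof -
  define E where "E n = (\<Sum>i\<le>n. \<bar>(- p) gchoose i\<bar> * \<bar>(- q) gchoose (n - i)\<bar>)" for n
  have sp: "summable (\<lambda>n. \<bar>a gchoose n\<bar> * (1 / 2) ^ n)" for a :: real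
    using gbinomial_abs_summable[of "1 / 2" a] by simp
  have "summable (\<lambda>n. \<Sum>i\<le>n. (\<bar>(- p) gchoose i\<bar> * (1 / 2) ^ i) * (\<bar>(- q) gchoose (n - i)\<bar> * (1 / 2) ^ (n - i)))"
    using sp by (intro summable_Cauchy_product) auto
  moreover have "(\<Sum>i\<le>n. (\<bar>(- p) gchoose i\<bar> * (1 / 2) ^ i) * (\<bar>(- q) gchoose (n - i)\<bar> * (1 / 2) ^ (n - i))) = E n * (1 / 2) ^ n" for n
    unfolding E_def sum_distrib_right
  proof (rule sum.cong[OF refl])
    fix i assume "i \<in> {..n}"
    then have "(1 / 2 :: real) ^ n = (1 / 2) ^ i * (1 / 2) ^ (n - i)" by (simp add: power_add[symmetric])
    then show "(\<bar>(- p) gchoose i\<bar> * (1 / 2) ^ i) * (\<bar>(- q) gchoose (n - i)\<bar> * (1 / 2) ^ (n - i)) = \<bar>(- p) gchoose i\<bar> * \<bar>(- q) gchoose (n - i)\<bar> * (1 / 2) ^ n"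
      by simp
  qed
  ultimately have sE: "summable (\<lambda>n. E n * (1 / 2) ^ n)" by simp
  have E0: "0 \<le> E n" for n unfolding E_def by (intro sum_nonneg) auto
  have cE: "\<bar>conv_poly p q n v\<bar> \<le> E n" if v: "v \<in> {0..1}" for n v
  proof -
    have "\<bar>conv_poly p q n v\<bar> \<le> (\<Sum>i\<le>n. \<bar>(((- p) gchoose i) * (- v) ^ i) * (((- q) gchoose (n - i)) * (- (1 - v)) ^ (n - i))\<bar>)"
      unfolding conv_poly_def by (rule sum_abs)
    also have "\<dots> \<le> E n"
      unfolding E_def
    proof (rule sum_mono)
      fix i
      have "\<bar>v\<bar> ^ i \<le> 1" "\<bar>1 - v\<bar> ^ (n - i) \<le> 1" using v by (auto intro!: power_le_one)
      then have "(\<bar>(- p) gchoose i\<bar> * \<bar>v\<bar> ^ i) * (\<bar>(- q) gchoose (n - i)\<bar> * \<bar>1 - v\<bar> ^ (n - i)) \<le> (\<bar>(- p) gchoose i\<bar> * 1) * (\<bar>(- q) gchoose (n - i)\<bar> * 1)"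
        by (intro mult_mono mult_left_mono) auto
      then show "\<bar>(((- p) gchoose i) * (- v) ^ i) * (((- q) gchoose (n - i)) * (- (1 - v)) ^ (n - i))\<bar> \<le> \<bar>(- p) gchoose i\<bar> * \<bar>(- q) gchoose (n - i)\<bar>"
        by (simp add: abs_mult power_abs abs_minus_commute)
    qed
    finally show ?thesis .
  qed
  \<comment> \<open>Truncated subtraction: for N < 3 no term is taken off, and z^3 \<le> z^N closes
    the estimate.\<close>
  define M where "M = N - 3"
  define C where "C = 2 ^ M * (\<Sum>n. E n * (1 / 2) ^ n)"
  have C0: "0 \<le> C" unfolding C_def using E0 by (intro mult_nonneg_nonneg suminf_nonneg sE) auto
  define Pr where "Pr z v = (1 - z * v) powr (- p) * (1 - z * (1 - v)) powr (- q)" for z v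
  have rem: "\<bar>Pr z v - (\<Sum>n<M. conv_poly p q n v * z ^ n)\<bar> \<le> C * z ^ M" if z: "0 < z" "z < 1 / 2" and v: "v \<in> {0..1}" for z v
  proof -
    have X: "\<bar>z * v\<bar> < 1" "\<bar>z * (1 - v)\<bar> < 1"
      using z v mult_mono[of z "1/2" v 1] mult_mono[of z "1/2" "1 - v" 1] by (auto simp: abs_mult)
    have s1: "(\<lambda>n. ((- p) gchoose n) * (- (z * v)) ^ n) sums (1 - z * v) powr (- p)"
      using gen_binomial_real[of "- (z * v)" "- p"] X by simp
    have s2: "(\<lambda>n. ((- q) gchoose n) * (- (z * (1 - v))) ^ n) sums (1 - z * (1 - v)) powr (- q)"
      using gen_binomial_real[of "- (z * (1 - v))" "- q"] X by simp
    have a1: "summable (\<lambda>n. norm (((- p) gchoose n) * (- (z * v)) ^ n))"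
      using gbinomial_abs_summable[OF X(1), of "- p"] by (simp add: abs_mult power_abs power_mult_distrib)
    have a2: "summable (\<lambda>n. norm (((- q) gchoose n) * (- (z * (1 - v))) ^ n))"
      using gbinomial_abs_summable[OF X(2), of "- q"] by (simp only: real_norm_def abs_mult power_abs abs_minus_cancel)
    have "(\<lambda>n. \<Sum>i\<le>n. (((- p) gchoose i) * (- (z * v)) ^ i) * (((- q) gchoose (n - i)) * (- (z * (1 - v))) ^ (n - i))) sums
       ((\<Sum>n. ((- p) gchoose n) * (- (z * v)) ^ n) * (\<Sum>n. ((- q) gchoose n) * (- (z * (1 - v))) ^ n))"
      by (rule Cauchy_product_sums[OF a1 a2])
    moreover have "(\<Sum>i\<le>n. (((- p) gchoose i) * (- (z * v)) ^ i) * (((- q) gchoose (n - i)) * (- (z * (1 - v))) ^ (n - i))) = conv_poly p q n v * z ^ n" for n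
      unfolding conv_poly_def sum_distrib_right
    proof (rule sum.cong[OF refl])
      fix i assume "i \<in> {..n}"
      then have zn: "z ^ n = z ^ i * z ^ (n - i)" by (simp add: power_add[symmetric])
      have hp: "(- (z * w)) ^ k = (- w) ^ k * z ^ k" for w k by (simp add: power_mult_distrib[symmetric] mult.commute)
      show "(((- p) gchoose i) * (- (z * v)) ^ i) * (((- q) gchoose (n - i)) * (- (z * (1 - v))) ^ (n - i)) =
        (((- p) gchoose i) * (- v) ^ i) * (((- q) gchoose (n - i)) * (- (1 - v)) ^ (n - i)) * z ^ n"
        unfolding zn hp by (simp only: mult_ac)
    qed
    ultimately have "(\<Sum>n. conv_poly p q n v * z ^ n) = Pr z v"
      using s1 s2 by (simp add: sums_iff Pr_def)
    then show ?thesis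
      using power_series_remainder[of "\<lambda>n. conv_poly p q n v" E, OF cE[OF v] sE, of z M] z by (simp add: C_def)
  qed
  define d where "d n = (LINT v:{0<..<1}|lborel. v * (1 - v) * conv_poly p q n v)" for n
  have dI: "integrable lborel (\<lambda>v. indicator {0<..<1} v * (v * (1 - v) * conv_poly p q n v))" for n
  proof -
    have "set_integrable lborel {0..1} (\<lambda>v. v * (1 - v) * conv_poly p q n v)"
      unfolding set_integrable_def conv_poly_def
      by (rule borel_integrable_compact) (auto intro!: continuous_intros)
    then have "set_integrable lborel {0<..<1} (\<lambda>v. v * (1 - v) * conv_poly p q n v)"
      by (rule set_integrable_subset) auto
    then show ?thesis by (simp add: set_integrable_def)
  qed
  have re: "(\<Sum>j<N. conv_coeff p q j * z ^ j) = z ^ 3 * (\<Sum>n<M. d n * z ^ n)" for z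
    unfolding M_def
  proof (induction N)
    case (Suc N)
    show ?case
    proof (cases "N < 3")
      case True
      then show ?thesis using Suc by (simp add: conv_coeff_def)
    next
      case False
      then obtain k where k: "N = k + 3" by (metis add.commute le_Suc_ex not_less)
      have c: "conv_coeff p q (k + 3) = d k" by (simp add: conv_coeff_def d_def)
      have IH: "(\<Sum>j<k + 3. conv_coeff p q j * z ^ j) = z ^ 3 * (\<Sum>n<k. d n * z ^ n)"
        using Suc unfolding k by simp
      have S: "Suc (k + 3) - 3 = Suc k" by simp
      show ?thesis
        unfolding k S sum.lessThan_Suc IH c by (simp add: power_add distrib_left mult_ac)
    qed
  qed simp
  have "\<bar>conv_profile p q z - (\<Sum>j<N. conv_coeff p q j * z ^ j)\<bar> \<le> C * z ^ N" if z: "0 < z" "z < 1 / 2" for z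
  proof -
    define F where "F v = indicator {0<..<1} v * (v * (1 - v) * Pr z v)" for v
    have cp: "conv_profile p q z = z ^ 3 * (LINT v|lborel. F v)"
    proof -
      have "conv_profile p q z = \<bar>- z\<bar> *\<^sub>R (LINT v|lborel. indicator {1 - z<..<1} (1 + (- z) * v) * (profile p (1 + (- z) * v) * profile q (2 - (1 + (- z) * v) - z)))"
        unfolding conv_profile_def by (rule lborel_integral_real_affine) (use z in auto)
      also have "(LINT v|lborel. indicator {1 - z<..<1} (1 + (- z) * v) * (profile p (1 + (- z) * v) * profile q (2 - (1 + (- z) * v) - z))) = (LINT v|lborel. z\<^sup>2 * F v)"
      proof (rule Bochner_Integration.integral_cong[OF refl])
        fix v :: real
        have "indicat_real {1 - z<..<1} (1 + (- z) * v) = indicator {0<..<1} v"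
          using z by (auto simp: indicator_def zero_less_mult_iff)
        moreover have "profile p (1 + (- z) * v) = z * v * (1 - z * v) powr (- p)" by (simp add: profile_def)
        moreover have "2 - (1 + (- z) * v) - z = 1 - z * (1 - v)" by (simp add: algebra_simps)
        moreover have "profile q (1 - z * (1 - v)) = z * (1 - v) * (1 - z * (1 - v)) powr (- q)" by (simp add: profile_def)
        ultimately show "indicator {1 - z<..<1} (1 + (- z) * v) * (profile p (1 + (- z) * v) * profile q (2 - (1 + (- z) * v) - z)) = z\<^sup>2 * F v"
          by (simp only: F_def Pr_def power2_eq_square mult_ac)
      qed
      finally show ?thesis using z by (simp add: power2_eq_square power3_eq_cube)
    qed
    define S where "S v = (\<Sum>n<M. z ^ n * (indicator {0<..<1} v * (v * (1 - v) * conv_poly p q n v)))" for v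
    have SI: "has_bochner_integral lborel S (\<Sum>n<M. z ^ n * d n)"
      unfolding S_def using dI
      by (intro has_bochner_integral_sum has_bochner_integral_mult_right) (simp add: has_bochner_integral_iff d_def set_lebesgue_integral_def)
    have Fm: "F \<in> borel_measurable lborel" unfolding F_def Pr_def by measurable
    have pt: "\<bar>F v - S v\<bar> \<le> C * z ^ M * indicator {0..1} v" for v
    proof (cases "v \<in> {0<..<1}")
      case True
      have "F v - S v = v * (1 - v) * (Pr z v - (\<Sum>n<M. conv_poly p q n v * z ^ n))"
        using True by (simp add: F_def S_def right_diff_distrib sum_distrib_left mult_ac)
      also have "\<bar>\<dots>\<bar> \<le> 1 * (C * z ^ M)"
        unfolding abs_mult[of "v * (1 - v)"]
      proof (rule mult_mono)
        show "\<bar>v * (1 - v)\<bar> \<le> 1" using True mult_mono[of v 1 "1 - v" 1] by (simp add: abs_mult)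
        show "\<bar>Pr z v - (\<Sum>n<M. conv_poly p q n v * z ^ n)\<bar> \<le> C * z ^ M" using True by (intro rem z) auto
      qed auto
      finally show ?thesis using True by simp
    next
      case False
      then show ?thesis using C0 z by (simp add: F_def S_def)
    qed
    have iB: "integrable lborel (\<lambda>v :: real. C * z ^ M * indicator {0..1} v)"
      by (intro integrable_mult_right integrable_real_indicator) (auto simp: emeasure_lborel_Icc_eq)
    have iD: "integrable lborel (\<lambda>v. F v - S v)"
    proof (rule Bochner_Integration.integrable_bound[OF iB])
      show "(\<lambda>v. F v - S v) \<in> borel_measurable lborel"
        using SI Fm by (intro borel_measurable_diff) (auto simp: has_bochner_integral_iff)
    qed (use pt in \<open>auto intro!: AE_I2 order_trans[OF _ abs_ge_self]\<close>)
    have iF: "integrable lborel F"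
      using Bochner_Integration.integrable_add[OF iD, of S] SI by (simp add: has_bochner_integral_iff)
    have "conv_profile p q z - (\<Sum>j<N. conv_coeff p q j * z ^ j) = z ^ 3 * (LINT v|lborel. F v - S v)"
      unfolding cp re using iF SI by (simp add: has_bochner_integral_iff right_diff_distrib mult.commute)
    also have "\<bar>\<dots>\<bar> \<le> z ^ 3 * (C * z ^ M)"
    proof -
      have "\<bar>LINT v|lborel. F v - S v\<bar> \<le> (LINT v::real|lborel. C * z ^ M * indicator {0..1} v)"
        by (rule order_trans[OF integral_abs_bound integral_mono[OF integrable_abs[OF iD] iB pt]])
      also have "\<dots> = C * z ^ M" by simp
      finally show ?thesis using z by (simp add: abs_mult mult_left_mono)
    qed
    also have "\<dots> = C * z ^ (3 + M)" by (simp add: power_add)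
    also have "\<dots> \<le> C * z ^ N"
      using z C0 by (intro mult_left_mono power_decreasing) (auto simp: M_def)
    finally show ?thesis .
  qed
  then show thesis using that C0 by blast
qed

section \<open>Watson's lemma\<close>

text \<open>The moment of order j of \<open>gauss1\<close> over the positive half line at t = 1; odd
  orders occur as well.\<close>

definition gauss_moment :: "nat \<Rightarrow> real" where
  "gauss_moment j = 2 ^ j * Gamma ((real j + 1) / 2) / (2 * sqrt pi)"

lemma gauss_moment_integral:
  assumes t: "0 < t"
  shows "has_bochner_integral lborel (\<lambda>z. indicator {0<..} z * (gauss1 t z * z ^ j)) (gauss_moment j * t powr (real j / 2))"
proof -
  define P where "P = (real j + 1) / 2"
  have P: "0 < P" by (simp add: P_def)
  define k where "k = 1 / (2 * sqrt (4 * pi * t))"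
  have k: "0 \<le> k" using t by (simp add: k_def)
  define f where "f x = ennreal (k * (x powr (P - 1) * exp (- (1 / (4 * t)) * x)))" for x
  have fm: "f \<in> borel_measurable borel" unfolding f_def by measurable
  have "(\<integral>\<^sup>+ z. ennreal (indicator {0<..} z * (gauss1 t z * z ^ j)) \<partial>lborel) = (\<integral>\<^sup>+ s. ennreal (2 * s) * indicator {0<..} s * f (s\<^sup>2) \<partial>lborel)"
  proof (rule nn_integral_cong)
    fix s :: real
    show "ennreal (indicator {0<..} s * (gauss1 t s * s ^ j)) = ennreal (2 * s) * indicator {0<..} s * f (s\<^sup>2)"
    proof (cases "0 < s")
      case True
      have "s\<^sup>2 powr (P - 1) = s powr (2 * (P - 1))" using True powr_powr[of s 2 "P - 1"] by simp
      then have "s * s\<^sup>2 powr (P - 1) = s powr 1 * s powr (2 * (P - 1))" using True by simp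
      also have "\<dots> = s powr real j" unfolding powr_add[symmetric] by (simp add: P_def field_simps)
      also have "\<dots> = s ^ j" using True by (simp add: powr_realpow)
      finally have e: "s * s\<^sup>2 powr (P - 1) = s ^ j" .
      have g: "gauss1 t s = 2 * k * exp (- (1 / (4 * t)) * s\<^sup>2)" by (simp add: gauss1_def k_def)
      have "gauss1 t s * s ^ j = 2 * s * (k * (s\<^sup>2 powr (P - 1) * exp (- (1 / (4 * t)) * s\<^sup>2)))"
        unfolding g e[symmetric] by simp
      then show ?thesis using True by (simp add: f_def ennreal_mult'[symmetric])
    qed simp
  qed
  also have "\<dots> = (\<integral>\<^sup>+ x. indicator {0<..} x * f x \<partial>lborel)" by (rule nn_integral_square_subst[OF fm])
  also have "\<dots> = (\<integral>\<^sup>+ x. ennreal k * ennreal (indicator {0<..} x * (x powr (P - 1) * exp (- (1 / (4 * t)) * x))) \<partial>lborel)"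
    using k by (intro nn_integral_cong) (auto simp: f_def ennreal_mult' indicator_def)
  also have "\<dots> = ennreal k * ennreal (Gamma P * (1 / (4 * t)) powr (- P))"
    by (subst nn_integral_cmult) (use t nn_integral_gamma_scale[OF _ P, of "1 / (4 * t)"] in auto)
  also have "\<dots> = ennreal (k * (Gamma P * (1 / (4 * t)) powr (- P)))" using k by (simp add: ennreal_mult')
  also have "k * (Gamma P * (1 / (4 * t)) powr (- P)) = gauss_moment j * t powr (real j / 2)"
  proof -
    have "(1 / (4 * t)) powr (- P) = (4 * t) powr P" using t by (simp add: powr_minus powr_divide)
    also have "\<dots> = (4 * t) powr (1 / 2) * (4 * t) powr (real j / 2)"
      unfolding powr_add[symmetric] by (simp add: P_def add_divide_distrib add.commute)
    also have "(4 * t) powr (real j / 2) = 4 powr (real j / 2) * t powr (real j / 2)" by (rule powr_mult)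
    also have "4 powr (real j / 2) = 2 ^ j"
      using powr_powr[of 2 2 "real j / 2"] by (simp add: powr_realpow)
    finally have a: "(1 / (4 * t)) powr (- P) = sqrt (4 * t) * (2 ^ j * t powr (real j / 2))"
      using t by (simp add: powr_half_sqrt)
    have "sqrt (4 * pi * t) = sqrt pi * sqrt (4 * t)" by (simp only: real_sqrt_mult[symmetric] mult_ac)
    then have kk: "k * sqrt (4 * t) = 1 / (2 * sqrt pi)" using t by (simp add: k_def)
    have "k * (Gamma P * (1 / (4 * t)) powr (- P)) = (k * sqrt (4 * t)) * Gamma P * 2 ^ j * t powr (real j / 2)"
      unfolding a by simp
    then show ?thesis unfolding kk by (simp add: gauss_moment_def P_def)
  qed
  finally have I: "(\<integral>\<^sup>+ z. ennreal (indicator {0<..} z * (gauss1 t z * z ^ j)) \<partial>lborel) = ennreal (gauss_moment j * t powr (real j / 2))" .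
  show ?thesis
  proof (rule has_bochner_integral_nn_integral[OF _ _ _ I])
    show "AE z in lborel. 0 \<le> indicator {0<..} z * (gauss1 t z * z ^ j)"
      using t by (intro AE_I2) (auto simp: indicator_def)
    show "0 \<le> gauss_moment j * t powr (real j / 2)"
      unfolding gauss_moment_def by (intro mult_nonneg_nonneg divide_nonneg_nonneg Gamma_real_nonneg) auto
  qed measurable
qed

text \<open>The expansion is available only on (0, 1/2), whereas the moments extend over the whole
  half line. Beyond 1/2 the inequality 1 \<le> (2 z)^N moves each Taylor term to the moment of order
  j + N, which is O(t powr (N / 2)) for t \<le> 1.\<close>

lemma watson:
  fixes \<Psi> :: "real \<Rightarrow> real" and \<psi> :: "nat \<Rightarrow> real"
  assumes C: "C \<ge> 0" and \<Psi>: "\<And>z. 0 < z \<Longrightarrow> z < 1 / 2 \<Longrightarrow> \<bar>\<Psi> z - (\<Sum>j<N. \<psi> j * z ^ j)\<bar> \<le> C * z ^ N"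
  obtains D where "D \<ge> 0"
    "\<And>t I. 0 < t \<Longrightarrow> t \<le> 1 \<Longrightarrow> has_bochner_integral lborel (\<lambda>z. indicator {0<..<1 / 2} z * (gauss1 t z * \<Psi> z)) I \<Longrightarrow>
      \<bar>I - (\<Sum>j<N. \<psi> j * (gauss_moment j * t powr (real j / 2)))\<bar> \<le> D * t powr (real N / 2)"
proof -
  have gm0: "0 \<le> gauss_moment j" for j
    unfolding gauss_moment_def by (intro mult_nonneg_nonneg divide_nonneg_nonneg Gamma_real_nonneg) auto
  define D where "D = C * gauss_moment N + (\<Sum>j<N. \<bar>\<psi> j\<bar> * 2 ^ N * gauss_moment (j + N))"
  have D0: "0 \<le> D" unfolding D_def using C gm0 by (intro add_nonneg_nonneg mult_nonneg_nonneg sum_nonneg) auto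
  have "\<bar>I - (\<Sum>j<N. \<psi> j * (gauss_moment j * t powr (real j / 2)))\<bar> \<le> D * t powr (real N / 2)"
    if t: "0 < t" "t \<le> 1" and I: "has_bochner_integral lborel (\<lambda>z. indicator {0<..<1 / 2} z * (gauss1 t z * \<Psi> z)) I" for t I
  proof -
    define m where "m j z = indicator {0<..} z * (gauss1 t z * z ^ j)" for j z
    have mI: "has_bochner_integral lborel (m j) (gauss_moment j * t powr (real j / 2))" for j
      unfolding m_def[abs_def] by (rule gauss_moment_integral[OF t(1)])
    define F where "F z = indicator {0<..<1 / 2} z * (gauss1 t z * \<Psi> z) - (\<Sum>j<N. \<psi> j * m j z)" for z
    have FI: "has_bochner_integral lborel F (I - (\<Sum>j<N. \<psi> j * (gauss_moment j * t powr (real j / 2))))"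
      unfolding F_def by (intro has_bochner_integral_diff I has_bochner_integral_sum has_bochner_integral_mult_right mI)
    define W where "W z = C * m N z + (\<Sum>j<N. \<bar>\<psi> j\<bar> * 2 ^ N * m (j + N) z)" for z
    have WI: "has_bochner_integral lborel W (C * (gauss_moment N * t powr (real N / 2)) + (\<Sum>j<N. \<bar>\<psi> j\<bar> * 2 ^ N * (gauss_moment (j + N) * t powr (real (j + N) / 2))))"
      unfolding W_def by (intro has_bochner_integral_add has_bochner_integral_sum has_bochner_integral_mult_right mI)
    have m0: "0 \<le> m j z" for j z using t by (auto simp: m_def indicator_def)
    have pt: "\<bar>F z\<bar> \<le> W z" for z
    proof -
      consider "z \<le> 0" | "0 < z" "z < 1 / 2" | "1 / 2 \<le> z" by linarith
      then show ?thesis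
      proof cases
        case 1
        then show ?thesis by (simp add: F_def W_def m_def)
      next
        case 2
        have "F z = gauss1 t z * (\<Psi> z - (\<Sum>j<N. \<psi> j * z ^ j))"
          using 2 by (simp add: F_def m_def right_diff_distrib sum_distrib_left mult_ac)
        then have "\<bar>F z\<bar> \<le> gauss1 t z * (C * z ^ N)"
          using \<Psi>[OF 2] t by (simp add: abs_mult mult_left_mono)
        also have "\<dots> = C * m N z" using 2 by (simp add: m_def)
        also have "\<dots> \<le> W z" unfolding W_def using m0 by (simp add: sum_nonneg)
        finally show ?thesis .
      next
        case 3
        have "\<bar>F z\<bar> \<le> (\<Sum>j<N. \<bar>\<psi> j * m j z\<bar>)" using 3 by (simp add: F_def)
        also have "\<dots> \<le> (\<Sum>j<N. \<bar>\<psi> j\<bar> * 2 ^ N * m (j + N) z)"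
        proof (rule sum_mono)
          fix j
          have "1 \<le> (2 * z) ^ N" using 3 by (intro one_le_power) auto
          then have "m j z * 1 \<le> m j z * (2 * z) ^ N" using m0 by (intro mult_left_mono) auto
          also have "m j z * (2 * z) ^ N = 2 ^ N * m (j + N) z" by (simp add: m_def power_add power_mult_distrib)
          finally show "\<bar>\<psi> j * m j z\<bar> \<le> \<bar>\<psi> j\<bar> * 2 ^ N * m (j + N) z"
            using m0 by (simp add: abs_mult mult.assoc mult_left_mono)
        qed
        also have "\<dots> \<le> W z" unfolding W_def using m0 C by simp
        finally show ?thesis .
      qed
    qed
    have "\<bar>I - (\<Sum>j<N. \<psi> j * (gauss_moment j * t powr (real j / 2)))\<bar> = \<bar>LINT z|lborel. F z\<bar>"
      using FI by (simp add: has_bochner_integral_iff)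
    also have "\<dots> \<le> (LINT z|lborel. W z)"
      using FI WI by (intro order_trans[OF integral_abs_bound integral_mono[OF integrable_abs _ pt]]) (auto simp: has_bochner_integral_iff)
    also have "\<dots> = C * (gauss_moment N * t powr (real N / 2)) + (\<Sum>j<N. \<bar>\<psi> j\<bar> * 2 ^ N * (gauss_moment (j + N) * t powr (real (j + N) / 2)))"
      using WI by (simp add: has_bochner_integral_iff)
    also have "\<dots> \<le> C * (gauss_moment N * t powr (real N / 2)) + (\<Sum>j<N. \<bar>\<psi> j\<bar> * 2 ^ N * (gauss_moment (j + N) * t powr (real N / 2)))"
      using t gm0 by (intro add_left_mono sum_mono mult_left_mono powr_mono') auto
    also have "\<dots> = D * t powr (real N / 2)" by (simp only: D_def distrib_right sum_distrib_right mult.assoc)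
    finally show ?thesis .
  qed
  then show thesis using that D0 by blast
qed

section \<open>Coefficients and conclusion\<close>

definition layer_coeff :: "real \<Rightarrow> real \<Rightarrow> nat \<Rightarrow> real" where
  "layer_coeff p q j = conv_coeff p q j + corr_coeff p q j + corr_coeff q p j"

lemma interval_content_expansion:
  assumes pq: "p < 2" "q < 2" "3 < p + q"
  obtains C where "C \<ge> 0" "\<And>t. 0 < t \<Longrightarrow> t \<le> 1 \<Longrightarrow>
    \<bar>interval_content t p q - main_terms t p q + (\<Sum>j<N. layer_coeff p q j * (gauss_moment j * t powr (real j / 2)))\<bar> \<le> C * t powr (real N / 2)"
proof -
  obtain C1 where C1: "C1 \<ge> 0"
    "\<And>t. 0 < t \<Longrightarrow> t \<le> 1 \<Longrightarrow> integrable lborel2 (\<lambda>z. corner_term t p q z + diagonal_term t p q z)"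
    "\<And>t. 0 < t \<Longrightarrow> t \<le> 1 \<Longrightarrow>
      \<bar>interval_content t p q - main_terms t p q + (LINT z|lborel2. corner_term t p q z + diagonal_term t p q z)\<bar> \<le> C1 * t ^ N"
    by (rule interval_content_remainder[OF pq, of N]) (rule that; assumption)
  have pq': "3 < q + p" using pq(3) by simp
  obtain E1 where E1: "E1 \<ge> 0" "\<And>z. 0 < z \<Longrightarrow> z < 1 / 2 \<Longrightarrow> \<bar>conv_profile p q z - (\<Sum>j<N. conv_coeff p q j * z ^ j)\<bar> \<le> E1 * z ^ N"
    by (rule conv_profile_expansion[where N=N and p=p and q=q]) (rule that; assumption)
  obtain E2 where E2: "E2 \<ge> 0" "\<And>z. 0 < z \<Longrightarrow> z < 1 / 2 \<Longrightarrow> \<bar>corr_profile p q z - (\<Sum>j<N. corr_coeff p q j * z ^ j)\<bar> \<le> E2 * z ^ N"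
    by (rule corr_profile_expansion[OF pq, where N=N]) (rule that; assumption)
  obtain E3 where E3: "E3 \<ge> 0" "\<And>z. 0 < z \<Longrightarrow> z < 1 / 2 \<Longrightarrow> \<bar>corr_profile q p z - (\<Sum>j<N. corr_coeff q p j * z ^ j)\<bar> \<le> E3 * z ^ N"
    by (rule corr_profile_expansion[OF pq(2,1) pq', where N=N]) (rule that; assumption)
  define \<Psi> where "\<Psi> z = conv_profile p q z + corr_profile p q z + corr_profile q p z" for z
  have \<Psi>: "\<bar>\<Psi> z - (\<Sum>j<N. layer_coeff p q j * z ^ j)\<bar> \<le> (E1 + E2 + E3) * z ^ N" if "0 < z" "z < 1 / 2" for z
  proof -
    have "(\<Sum>j<N. layer_coeff p q j * z ^ j) = (\<Sum>j<N. conv_coeff p q j * z ^ j) + (\<Sum>j<N. corr_coeff p q j * z ^ j) + (\<Sum>j<N. corr_coeff q p j * z ^ j)"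
      by (simp add: layer_coeff_def distrib_right sum.distrib)
    moreover have "(E1 + E2 + E3) * z ^ N = E1 * z ^ N + E2 * z ^ N + E3 * z ^ N" by (simp add: distrib_right)
    ultimately show ?thesis
      using E1(2)[OF that] E2(2)[OF that] E3(2)[OF that] unfolding \<Psi>_def by linarith
  qed
  have E0: "0 \<le> E1 + E2 + E3" using E1 E2 E3 by simp
  obtain D where D: "D \<ge> 0"
    "\<And>t I. 0 < t \<Longrightarrow> t \<le> 1 \<Longrightarrow> has_bochner_integral lborel (\<lambda>z. indicator {0<..<1 / 2} z * (gauss1 t z * \<Psi> z)) I \<Longrightarrow>
      \<bar>I - (\<Sum>j<N. layer_coeff p q j * (gauss_moment j * t powr (real j / 2)))\<bar> \<le> D * t powr (real N / 2)"
    by (rule watson[OF E0 \<Psi>]) (assumption | rule that)+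
  have "\<bar>interval_content t p q - main_terms t p q + (\<Sum>j<N. layer_coeff p q j * (gauss_moment j * t powr (real j / 2)))\<bar> \<le> (C1 + D) * t powr (real N / 2)"
    if t: "0 < t" "t \<le> 1" for t
  proof -
    have I: "has_bochner_integral lborel (\<lambda>z. indicator {0<..<1 / 2} z * (gauss1 t z * \<Psi> z)) (LINT z|lborel2. corner_term t p q z + diagonal_term t p q z)"
      unfolding \<Psi>_def by (rule boundary_layer_integral[OF C1(2)[OF t]])
    have "t ^ N = t powr real N" using t by (simp add: powr_realpow)
    also have "\<dots> \<le> t powr (real N / 2)" using t by (intro powr_mono') auto
    finally have "C1 * t ^ N \<le> C1 * t powr (real N / 2)" using C1(1) by (rule mult_left_mono)
    then show ?thesis using D(2)[OF t I] C1(3)[OF t] unfolding distrib_right by linarith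
  qed
  then show thesis using that[of "C1 + D"] C1(1) D(1) by simp
qed

text \<open>Up to order 3 these are the orders that meet a Taylor coefficient not identically
  zero.\<close>

lemma gauss_moment_values: "gauss_moment 0 = 1 / 2" "gauss_moment 2 = 1"
proof -
  show "gauss_moment 0 = 1 / 2" by (simp add: gauss_moment_def Gamma_one_half_real)
  have "Gamma (1 / 2 + 1 :: real) = 1 / 2 * Gamma (1 / 2)"
  proof (rule Gamma_plus1)
    show "(1 / 2 :: real) \<notin> \<int>\<^sub>\<le>\<^sub>0" by (auto elim!: nonpos_Ints_cases')
  qed
  then show "gauss_moment 2 = 1" by (simp add: gauss_moment_def Gamma_one_half_real)
qed

lemma conv_coeff_values: "conv_coeff p q 0 = 0" "conv_coeff p q 1 = 0" "conv_coeff p q 2 = 0" "conv_coeff p q 3 = 1 / 6"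
proof -
  have "(LINT v:{0<..<1}|lborel. v * (1 - v)) = (LBINT v=0..1. v * (1 - v))"
    by (subst interval_integral_Ioo) auto
  also have "\<dots> = (1\<^sup>2 / 2 - 1 ^ 3 / 3) - (0\<^sup>2 / 2 - 0 ^ 3 / 3 :: real)"
    unfolding zero_ereal_def one_ereal_def
    by (rule interval_integral_FTC_finite[where F="\<lambda>v. v\<^sup>2 / 2 - v ^ 3 / 3"])
       (auto intro!: continuous_intros derivative_eq_intros simp: has_real_derivative_iff_has_vector_derivative[symmetric] power2_eq_square algebra_simps)
  finally show "conv_coeff p q 3 = 1 / 6" by (simp add: conv_coeff_def conv_poly_def)
qed (simp_all add: conv_coeff_def)

lemma gchoose_values:
  fixes a :: real
  shows "a gchoose 0 = 1" "a gchoose 1 = a" "a gchoose 2 = a * (a - 1) / 2" "a gchoose 3 = a * (a - 1) * (a - 2) / 6"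
  by (simp_all add: gbinomial_prod_rev eval_nat_numeral)

text \<open>Rational identities in p and s = p + q. At order 1 the two sides of the diagonal cancel
  each other; at order 3 together they cancel the 1/6 of the corner.\<close>

lemma layer_coeff_values:
  assumes "3 < p + q"
  shows "layer_coeff p q 0 = 4 / ((p + q - 1) * (p + q - 2) * (p + q - 3))"
    and "layer_coeff p q 1 = 0"
    and "layer_coeff p q 2 = - 2 * p * q / ((p + q + 1) * (p + q) * (p + q - 1))"
    and "layer_coeff p q 3 = 0"
proof -
  define s where "s = p + q"
  have q: "q = s - p" by (simp add: s_def)
  have s: "s - 3 \<noteq> 0" "s - 2 \<noteq> 0" "s - 1 \<noteq> 0" "s \<noteq> 0" "s + 1 \<noteq> 0" "s + 2 \<noteq> 0" using assms by (auto simp: s_def)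
  have e: "p + q = s" "q + p = s" by (auto simp: s_def)
  show "layer_coeff p q 0 = 4 / ((p + q - 1) * (p + q - 2) * (p + q - 3))"
    unfolding layer_coeff_def corr_coeff_def conv_coeff_values gchoose_values e
    using s by (simp add: divide_simps)
  have e1: "s + real 1 - 1 = s" "s + real 1 - 2 = s - 1" "s + real 1 - 3 = s - 2" by auto
  show "layer_coeff p q 1 = 0"
    unfolding layer_coeff_def corr_coeff_def conv_coeff_values gchoose_values e e1 q
    using s by (simp add: divide_simps) (simp add: algebra_simps)
  have e2: "s + real 2 - 1 = s + 1" "s + real 2 - 2 = s" "s + real 2 - 3 = s - 1" by auto
  show "layer_coeff p q 2 = - 2 * p * q / ((p + q + 1) * (p + q) * (p + q - 1))"
    unfolding layer_coeff_def corr_coeff_def conv_coeff_values gchoose_values e e2 q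
    using s by (simp add: divide_simps) (simp add: algebra_simps power2_eq_square)
  have e3: "s + real 3 - 1 = s + 2" "s + real 3 - 2 = s + 1" "s + real 3 - 3 = s" by auto
  show "layer_coeff p q 3 = 0"
    unfolding layer_coeff_def corr_coeff_def conv_coeff_values gchoose_values e e3 q
    using s by (simp add: divide_simps) (simp add: algebra_simps power2_eq_square)
qed

lemma c_coeff_commute: "c_coeff p q = c_coeff q p"
proof -
  have "- p - q = - q - p" "2 - p - q = 2 - q - p" "p + q = q + p" by auto
  then show ?thesis unfolding c_coeff_def by (simp only: add.commute)
qed

lemma scaled_powr:
  fixes a t :: real
  assumes "0 < a" "0 < t"
  shows "a powr c * (t / a\<^sup>2) powr e = a powr (c - 2 * e) * t powr e"
proof -
  have "(a\<^sup>2) powr e = a powr (2 * e)" using assms powr_powr[of a 2 e] by simp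
  then show ?thesis using assms by (simp add: powr_divide powr_diff)
qed

text \<open>The coefficients can be chosen before a, the kernel and J because scaling reduces every
  ball to the same interval, with all dependence on a in explicit powers.\<close>

theorem theorem7:
  fixes \<alpha> \<beta> :: real
  assumes "\<alpha> < 2" and "\<beta> < 2" and "\<alpha> + \<beta> > 3"
  shows "\<exists>b :: nat \<Rightarrow> real.
    b 0 = - (8 * pi) / ((\<alpha> + \<beta> - 1) * (\<alpha> + \<beta> - 2) * (\<alpha> + \<beta> - 3)) \<and>
    b 1 = 0 \<and>
    b 2 = 8 * pi * \<alpha> * \<beta> / ((\<alpha> + \<beta> + 1) * (\<alpha> + \<beta>) * (\<alpha> + \<beta> - 1)) \<and>
    b 3 = 0 \<and>
    (\<forall>a>0. \<forall>p :: real^3 \<Rightarrow> real^3 \<Rightarrow> real \<Rightarrow> real.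
      dirichlet_heat_kernel (ball 0 a) p \<longrightarrow>
      (\<forall>J :: nat.
        (\<lambda>t. heat_content (ball 0 a) p (boundary_power a \<alpha>) (boundary_power a \<beta>) t
           - (4 * pi * c_coeff \<alpha> \<beta> * a\<^sup>2 * t powr ((1 - \<alpha> - \<beta>) / 2)
              - 4 * pi * (c_coeff (\<alpha> - 1) \<beta> + c_coeff \<alpha> (\<beta> - 1)) * a * t powr ((2 - \<alpha> - \<beta>) / 2)
              + 4 * pi * c_coeff (\<alpha> - 1) (\<beta> - 1) * t powr ((3 - \<alpha> - \<beta>) / 2)
              + (\<Sum>j=0..J. b j * a powr (3 - real j - \<alpha> - \<beta>) * t powr (real j / 2))))
        \<in> O[at_right 0](\<lambda>t. t powr ((real J + 1) / 2))))"
proof -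
  have s: "3 < \<beta> + \<alpha>" using assms by simp
  \<comment> \<open>The layer enters the interval content with a minus sign, and 4 pi is the
    prefactor in the reduction to the interval.\<close>
  define b where "b j = - (4 * pi) * (layer_coeff \<beta> \<alpha> j * gauss_moment j)" for j
  have b0: "b 0 = - (8 * pi) / ((\<alpha> + \<beta> - 1) * (\<alpha> + \<beta> - 2) * (\<alpha> + \<beta> - 3))"
    unfolding b_def layer_coeff_values[OF s] gauss_moment_values by (simp add: add.commute)
  have b2: "b 2 = 8 * pi * \<alpha> * \<beta> / ((\<alpha> + \<beta> + 1) * (\<alpha> + \<beta>) * (\<alpha> + \<beta> - 1))"
    unfolding b_def layer_coeff_values[OF s] gauss_moment_values by (simp add: add.commute mult_ac)
  have b13: "b 1 = 0" "b 3 = 0"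
    unfolding b_def layer_coeff_values[OF s] by simp_all
  have asym: "(\<lambda>t. heat_content (ball 0 a) p (boundary_power a \<alpha>) (boundary_power a \<beta>) t
           - (4 * pi * c_coeff \<alpha> \<beta> * a\<^sup>2 * t powr ((1 - \<alpha> - \<beta>) / 2)
              - 4 * pi * (c_coeff (\<alpha> - 1) \<beta> + c_coeff \<alpha> (\<beta> - 1)) * a * t powr ((2 - \<alpha> - \<beta>) / 2)
              + 4 * pi * c_coeff (\<alpha> - 1) (\<beta> - 1) * t powr ((3 - \<alpha> - \<beta>) / 2)
              + (\<Sum>j=0..J. b j * a powr (3 - real j - \<alpha> - \<beta>) * t powr (real j / 2))))
        \<in> O[at_right 0](\<lambda>t. t powr ((real J + 1) / 2))"
    if a: "0 < a" and p: "dirichlet_heat_kernel (ball 0 a) p" for a :: real and p :: "real^3 \<Rightarrow> real^3 \<Rightarrow> real \<Rightarrow> real" and J :: nat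
  proof -
    \<comment> \<open>The sum up to J has \<open>Suc J\<close> terms, whence the exponent (J + 1) /
      2 of the remainder.\<close>
    obtain C where C: "C \<ge> 0" "\<And>t. 0 < t \<Longrightarrow> t \<le> 1 \<Longrightarrow>
      \<bar>interval_content t \<beta> \<alpha> - main_terms t \<beta> \<alpha> + (\<Sum>j<Suc J. layer_coeff \<beta> \<alpha> j * (gauss_moment j * t powr (real j / 2)))\<bar> \<le> C * t powr (real (Suc J) / 2)"
      using interval_content_expansion[OF assms(2,1) s, where N="Suc J"] by blast
    define K where "K = 4 * pi * a powr (3 - \<alpha> - \<beta>)"
    have K: "0 \<le> K" by (simp add: K_def)
    show ?thesis
    proof (rule bigoI)
      \<comment> \<open>Time t on the ball is t / a^2 on the interval, where the expansion is
        available up to time 1.\<close>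
      have "\<forall>\<^sub>F t in at_right 0. t \<in> {0<..<a\<^sup>2}" using a by (intro eventually_at_right_real) simp
      then show "\<forall>\<^sub>F t in at_right 0. norm (heat_content (ball 0 a) p (boundary_power a \<alpha>) (boundary_power a \<beta>) t
           - (4 * pi * c_coeff \<alpha> \<beta> * a\<^sup>2 * t powr ((1 - \<alpha> - \<beta>) / 2)
              - 4 * pi * (c_coeff (\<alpha> - 1) \<beta> + c_coeff \<alpha> (\<beta> - 1)) * a * t powr ((2 - \<alpha> - \<beta>) / 2)
              + 4 * pi * c_coeff (\<alpha> - 1) (\<beta> - 1) * t powr ((3 - \<alpha> - \<beta>) / 2)
              + (\<Sum>j=0..J. b j * a powr (3 - real j - \<alpha> - \<beta>) * t powr (real j / 2))))
         \<le> (4 * pi * C * a powr (2 - \<alpha> - \<beta> - real J)) * norm (t powr ((real J + 1) / 2))"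
      proof eventually_elim
        case (elim t)
        define \<tau> where "\<tau> = t / a\<^sup>2"
        have t: "0 < t" "t \<le> a\<^sup>2" using elim by auto
        have \<tau>: "0 < \<tau>" "\<tau> \<le> 1" using t a by (auto simp: \<tau>_def)
        have hc: "heat_content (ball 0 a) p (boundary_power a \<alpha>) (boundary_power a \<beta>) t = K * interval_content \<tau> \<beta> \<alpha>"
          unfolding K_def \<tau>_def by (rule heat_content_eq_interval_content[OF p a t assms(1)])
        have sc: "K * \<tau> powr e = 4 * pi * (a powr (3 - \<alpha> - \<beta> - 2 * e) * t powr e)" for e
          unfolding K_def \<tau>_def using scaled_powr[OF a t(1), of "3 - \<alpha> - \<beta>" e] by simp
        have sc1: "K * \<tau> powr ((1 - \<beta> - \<alpha>) / 2) = 4 * pi * (a\<^sup>2 * t powr ((1 - \<alpha> - \<beta>) / 2))"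
        proof -
          have e: "3 - \<alpha> - \<beta> - 2 * ((1 - \<beta> - \<alpha>) / 2) = 2" and c: "1 - \<beta> - \<alpha> = 1 - \<alpha> - \<beta>" by (simp_all add: field_simps)
          then show ?thesis using sc[of "(1 - \<beta> - \<alpha>) / 2", unfolded e, unfolded c] a unfolding c by simp
        qed
        have sc2: "K * \<tau> powr ((2 - \<beta> - \<alpha>) / 2) = 4 * pi * (a * t powr ((2 - \<alpha> - \<beta>) / 2))"
        proof -
          have e: "3 - \<alpha> - \<beta> - 2 * ((2 - \<beta> - \<alpha>) / 2) = 1" and c: "2 - \<beta> - \<alpha> = 2 - \<alpha> - \<beta>" by (simp_all add: field_simps)
          then show ?thesis using sc[of "(2 - \<beta> - \<alpha>) / 2", unfolded e, unfolded c] a unfolding c by simp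
        qed
        have sc3: "K * \<tau> powr ((3 - \<beta> - \<alpha>) / 2) = 4 * pi * t powr ((3 - \<alpha> - \<beta>) / 2)"
        proof -
          have e: "3 - \<alpha> - \<beta> - 2 * ((3 - \<beta> - \<alpha>) / 2) = 0" and c: "3 - \<beta> - \<alpha> = 3 - \<alpha> - \<beta>" by (simp_all add: field_simps)
          then show ?thesis using sc[of "(3 - \<beta> - \<alpha>) / 2", unfolded e, unfolded c] a unfolding c by simp
        qed
        have "K * main_terms \<tau> \<beta> \<alpha> = c_coeff \<beta> \<alpha> * (K * \<tau> powr ((1 - \<beta> - \<alpha>) / 2))
            - (c_coeff (\<beta> - 1) \<alpha> + c_coeff \<beta> (\<alpha> - 1)) * (K * \<tau> powr ((2 - \<beta> - \<alpha>) / 2))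
            + c_coeff (\<beta> - 1) (\<alpha> - 1) * (K * \<tau> powr ((3 - \<beta> - \<alpha>) / 2))"
          by (simp add: main_terms_def algebra_simps)
        also have "\<dots> = 4 * pi * c_coeff \<alpha> \<beta> * a\<^sup>2 * t powr ((1 - \<alpha> - \<beta>) / 2)
              - 4 * pi * (c_coeff (\<alpha> - 1) \<beta> + c_coeff \<alpha> (\<beta> - 1)) * a * t powr ((2 - \<alpha> - \<beta>) / 2)
              + 4 * pi * c_coeff (\<alpha> - 1) (\<beta> - 1) * t powr ((3 - \<alpha> - \<beta>) / 2)"
          unfolding sc1 sc2 sc3 c_coeff_commute[of \<beta>] c_coeff_commute[of "\<beta> - 1"] by (simp add: algebra_simps)
        finally have main: "K * main_terms \<tau> \<beta> \<alpha> = \<dots>" .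
        have lay: "(\<Sum>j=0..J. b j * a powr (3 - real j - \<alpha> - \<beta>) * t powr (real j / 2)) =
           - (K * (\<Sum>j<Suc J. layer_coeff \<beta> \<alpha> j * (gauss_moment j * \<tau> powr (real j / 2))))"
        proof -
          have "b j * a powr (3 - real j - \<alpha> - \<beta>) * t powr (real j / 2) = - (K * (layer_coeff \<beta> \<alpha> j * (gauss_moment j * \<tau> powr (real j / 2))))" for j
          proof -
            have e: "3 - \<alpha> - \<beta> - 2 * (real j / 2) = 3 - real j - \<alpha> - \<beta>" by simp
            have k: "K * \<tau> powr (real j / 2) = 4 * pi * (a powr (3 - real j - \<alpha> - \<beta>) * t powr (real j / 2))"
              using sc[of "real j / 2", unfolded e] .
            have "b j * a powr (3 - real j - \<alpha> - \<beta>) * t powr (real j / 2) = - (layer_coeff \<beta> \<alpha> j * gauss_moment j * (K * \<tau> powr (real j / 2)))"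
              unfolding k by (simp add: b_def)
            then show ?thesis by (simp add: mult_ac)
          qed
          then show ?thesis by (simp add: sum_distrib_left sum_negf atLeast0AtMost lessThan_Suc_atMost)
        qed
        have "heat_content (ball 0 a) p (boundary_power a \<alpha>) (boundary_power a \<beta>) t
           - (4 * pi * c_coeff \<alpha> \<beta> * a\<^sup>2 * t powr ((1 - \<alpha> - \<beta>) / 2)
              - 4 * pi * (c_coeff (\<alpha> - 1) \<beta> + c_coeff \<alpha> (\<beta> - 1)) * a * t powr ((2 - \<alpha> - \<beta>) / 2)
              + 4 * pi * c_coeff (\<alpha> - 1) (\<beta> - 1) * t powr ((3 - \<alpha> - \<beta>) / 2)
              + (\<Sum>j=0..J. b j * a powr (3 - real j - \<alpha> - \<beta>) * t powr (real j / 2)))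
          = K * (interval_content \<tau> \<beta> \<alpha> - main_terms \<tau> \<beta> \<alpha> + (\<Sum>j<Suc J. layer_coeff \<beta> \<alpha> j * (gauss_moment j * \<tau> powr (real j / 2))))"
          unfolding hc main[symmetric] lay by (simp only: right_diff_distrib distrib_left)
        also have "norm \<dots> \<le> K * (C * \<tau> powr (real (Suc J) / 2))"
          unfolding norm_mult using C(2)[OF \<tau>] K by (auto intro: mult_left_mono)
        also have "\<dots> = C * (K * \<tau> powr (real (Suc J) / 2))" by simp
        also have "\<dots> = (4 * pi * C * a powr (2 - \<alpha> - \<beta> - real J)) * norm (t powr ((real J + 1) / 2))"
        proof -
          have "3 - \<alpha> - \<beta> - 2 * (real (Suc J) / 2) = 2 - \<alpha> - \<beta> - real J" by (simp add: field_simps)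
          moreover have "real (Suc J) / 2 = (real J + 1) / 2" by simp
          ultimately show ?thesis unfolding sc by (simp only: real_norm_def powr_ge_zero abs_of_nonneg mult_ac)
        qed
        finally show ?case .
      qed
    qed
  qed
  show ?thesis
    by (rule exI[of _ b]) (use b0 b2 b13 asym in blast)
qed


end
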